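(* If $k\geq 3$ is an odd integer and $h>1$, then \[R_k(h)\ll (\log h)^{O_k(1)} h^{\frac{k-1}{2}}.\]
   Context: For a tuple $\mathcal D=(d_1,\ldots,d_k)$ of distinct integers and a prime $p$, let $\nu_p(\mathcal D)$ be the number of residue classes modulo $p$ occupied by $d_1,\ldots,d_k$, and define the singular series \[\mathfrak{S}(\mathcal D)=\prod_{p}\left(1-\frac1p\right)^{-k}\left(1-\frac{\nu_p(\mathcal D)}{p}\right)\] (product over all primes), with $\mathfrak S(\emptyset)=1$. For $X\subseteq\{1,\ldots,k\}$ let $\mathcal D_X$ denote the tuple consisting of those $d_i$ with $i\in X$. Define the refined singular series \[\mathfrak{S}_0(\mathcal D)=\sum_{X\subseteq\{1,\ldots,k\}}(-1)^{k-|X|}\mathfrak S(\mathcal D_X),\] and \[R_k(h)=\sum_{\substack{1\leq d_1,\ldots,d_k\leq h\\ d_1,\ldots,d_k \text{ distinct}}}\mathfrak S_0(d_1,\ldots,d_k).\] The notation $f\ll g$ means $|f|\le Cg$ for a constant $C$; $O_k(1)$ denotes a quantity bounded in terms of $k$ only. *)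

theory Defs
  imports "HOL-Analysis.Analysis" "HOL-Computational_Algebra.Primes"
begin

text \<open>
  A tuple of \<open>k\<close> distinct integers is a list \<open>D\<close> with \<open>distinct D\<close> and \<open>length D = k\<close>.
  Positions are counted from \<open>0\<close>, so index sets are subsets of \<open>{..<k}\<close>, and the subtuple
  indexed by \<open>X\<close> is \<open>nths D X\<close>.
\<close>

definition residue_count :: "nat \<Rightarrow> int list \<Rightarrow> nat" where
  "residue_count p D = card ((\<lambda>d. d mod int p) ` set D)"

text \<open>
  The product over primes is an infinite product over the naturals with factor \<open>1\<close> at
  non-primes. For distinct entries all but finitely many factors are
  \<open>1 + O(1 / p\<^sup>2)\<close>, so it converges; \<open>has_prod\<close> admits finitely many zero factors, giving the
  value \<open>0\<close> when the entries cover all residue classes modulo some prime.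
\<close>

definition singular_series :: "int list \<Rightarrow> real" where
  "singular_series D =
     (\<Prod>p. if prime p
           then (1 - 1 / real p) powi (- int (length D)) * (1 - real (residue_count p D) / real p)
           else 1)"

lemma singular_series_Nil [simp]: "singular_series [] = 1"
proof -
  have "(\<lambda>p::nat. if prime p
           then (1 - 1 / real p) powi (- int (length ([]::int list)))
                  * (1 - real (residue_count p []) / real p)
           else 1) = (\<lambda>_. 1)"
    by (auto simp: residue_count_def)
  then show ?thesis
    unfolding singular_series_def by simp
qed

definition refined_singular_series :: "int list \<Rightarrow> real" where
  "refined_singular_series D =
     (\<Sum>X\<in>Pow {..<length D}. (-1) ^ (length D - card X) * singular_series (nths D X))"

definition distinct_tuples :: "nat \<Rightarrow> real \<Rightarrow> int list set" where
  "distinct_tuples k h =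
     {D. length D = k \<and> distinct D \<and> (\<forall>d\<in>set D. 1 \<le> d \<and> real_of_int d \<le> h)}"

lemma finite_distinct_tuples: "finite (distinct_tuples k h)"
proof (rule finite_subset)
  show "distinct_tuples k h \<subseteq> {D. set D \<subseteq> {1..\<lfloor>h\<rfloor>} \<and> length D = k}"
    by (auto simp: distinct_tuples_def le_floor_iff)
  show "finite {D. set D \<subseteq> {1..\<lfloor>h\<rfloor>} \<and> length D = k}"
    by (rule finite_lists_length_eq) simp
qed

definition R :: "nat \<Rightarrow> real \<Rightarrow> real" where
  "R k h = (\<Sum>D\<in>distinct_tuples k h. refined_singular_series D)"

end

theory Submission
  imports Defs "HOL-Number_Theory.Totient" "HOL-Computational_Algebra.Squarefree" "HOL-Library.Discrete_Functions" "HOL-Combinatorics.Multiset_Permutations"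
begin

text \<open>For a large \<open>y\<close> (a power of \<open>h\<close>) let \<open>q\<close> be the product of the primes up to \<open>y\<close> and \<open>P = q / \<phi>(q)\<close>, which
  is polylogarithmic. Up to a negligible error the refined singular series of \<open>d\<^sub>1, \<dots>, d\<^sub>k\<close> is the mean over \<open>n\<close>
  modulo \<open>q\<close> of \<open>\<Prod> X(n + d\<^sub>i)\<close>, where \<open>X(m)\<close> is \<open>P - 1\<close> or \<open>-1\<close> according to whether \<open>m\<close> is coprime to \<open>q\<close>. Hence
  \<open>R k h\<close> is \<open>k!\<close> times the mean of an elementary symmetric function of \<open>X(n + 1), \<dots>, X(n + H)\<close>. As \<open>X\<close>
  satisfies a quadratic equation, a Newton-type recursion reduces the claim to the bound \<open>H ^ (m div 2)\<close>,
  up to logarithms, for the \<open>m\<close>-th moments of \<open>S(n) = X(n + 1) + \<dots> + X(n + H)\<close>.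

  By Fourier expansion the \<open>m\<close>-th moment is at most a weighted sum over tuples of fractions \<open>b\<^sub>i / q\<close> with
  \<open>\<Sum> b\<^sub>i \<equiv> 0 (mod q)\<close>. The fundamental lemma of Montgomery and Vaughan bounds it by \<open>H powr (m / 2)\<close>. For odd
  \<open>m\<close> one has to save another \<open>sqrt H\<close>. Rankin's trick discards the tuples whose denominators have a
  large least common multiple, and pairs with \<open>b\<^sub>i + b\<^sub>l = 0\<close> are split off by induction on \<open>m\<close>. Suppose that
  no such pair exists and that \<open>\<bar>b\<^sub>i\<bar> \<le> \<delta>\<^sub>i q\<close>; then the denominators are at least \<open>1 / \<delta>\<^sub>i\<close>. A prime dividing one
  denominator divides another one, so in one of the \<open>m\<close> near-perfect matchings \<open>\<tau>\<close> of the index set the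
  denominators of matched fractions have a large common part. Apply the lemma of Montgomery and Vaughan
  to the sums \<open>b\<^sub>i + b\<^bsub>\<tau> i\<^esub>\<close>: the primes that divide only the two denominators of a pair cancel, and the number
  of representations of such a sum is small because the fractions are well spaced. The moments of the
  divisor function that arise are bounded by powers of the logarithm.\<close>

section \<open>Sums of products of periodic functions\<close>

text \<open>The lemma of Montgomery and Vaughan is an l2 estimate, which is why it loses
  \<open>sqrt H\<close> for odd \<open>m\<close>: on the box
  \<open>|b i| \<le> \<delta> i * q\<close> it bounds the sum of the reciprocal denominators by
  about the product of the \<open>sqrt (\<delta> i)\<close>, the weights are of size
  \<open>1 / \<delta> i\<close>, and the scales \<open>\<delta> i = 1 / H\<close> give
  \<open>H powr (m / 2)\<close>. The matching argument yields one more factor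
  \<open>sqrt \<delta>m\<close>, where \<open>\<delta>m\<close> is the largest scale. It cancels one
  of the factors \<open>1 / sqrt (\<delta> i)\<close> completely, and each of the remaining
  \<open>m - 1\<close> is at most \<open>sqrt H\<close>. The matching comes from averaging. For each
  \<open>i\<close> the common parts of \<open>b i\<close> with the other fractions have product at
  least the square of its denominator, hence at least \<open>(1 / \<delta>m)\<^sup>2\<close>. The
  \<open>m\<close> matchings distribute all these common parts among themselves, so in one of them
  the product is at least \<open>1 / \<delta>m\<close>. Rankin's trick gains \<open>sqrt H\<close>
  as soon as the least common multiple exceeds \<open>exp (ln y * ln H / 2)\<close>. The logarithm
  of this threshold is still a power of \<open>ln H\<close>, so divisor moments up to it cost only
  logarithms.\<close>

lemma squarefree_mult_imp_coprime:
  assumes "squarefree (a * b :: nat)"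
  shows "coprime a b"
proof -
  have "gcd a b ^ 2 dvd a * b" by (simp add: power2_eq_square mult_dvd_mono)
  then have "gcd a b dvd 1" using assms squarefreeD by blast
  then show ?thesis by (simp add: coprime_iff_gcd_eq_1)
qed

lemma periodic_mult:
  fixes g :: "nat \<Rightarrow> 'a"
  assumes "\<And>n. g (n + d) = g n"
  shows "g (n + d * t) = g n"
proof (induction t)
  case (Suc t)
  have "g (n + d * Suc t) = g ((n + d * t) + d)" by (simp add: algebra_simps)
  then show ?case using Suc assms by simp
qed simp

lemma periodic_dvd:
  fixes g :: "nat \<Rightarrow> 'a"
  assumes "\<And>n. g (n + d) = g n" "d dvd e"
  shows "g (n + e) = g n"
  using periodic_mult[of g d, OF assms(1)] assms(2) by (auto elim!: dvdE)

lemma periodic_mod: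
  fixes g :: "nat \<Rightarrow> 'a"
  assumes "\<And>n. g (n + d) = g n"
  shows "g (n mod d) = g n"
  using periodic_mult[of g d "n mod d" "n div d", OF assms] by (simp add: add.commute)

lemma sum_mult_group:
  fixes f :: "nat \<Rightarrow> 'a::comm_monoid_add"
  shows "(\<Sum>n<p*d. f n) = (\<Sum>n<d. \<Sum>j<p. f (n + j * d))"
proof -
  have "(\<Sum>n<p*d. f n) = (\<Sum>j<p. sum f {j*d..<j*d+d})" by (simp add: sum.nat_group)
  also have "\<dots> = (\<Sum>j<p. \<Sum>n<d. f (n + j*d))"
  proof (rule sum.cong[OF refl])
    fix j
    show "sum f {j*d..<j*d+d} = (\<Sum>n<d. f (n + j*d))"
      using sum.shift_bounds_nat_ivl[of f 0 "j*d" d] by (simp add: add.commute atLeast0LessThan)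
  qed
  finally show ?thesis by (subst sum.swap) 
qed

text \<open>Only \<open>j mod p\<close> matters for \<open>g (n + j * d')\<close>, and
  multiplication by \<open>t\<close> permutes the residues modulo \<open>p\<close>.\<close>

lemma sum_periodic_coprime_step:
  fixes g :: "nat \<Rightarrow> 'a::comm_monoid_add"
  assumes per: "\<And>n. g (n + p * d') = g n" and "coprime p t" "p > 0"
  shows "(\<Sum>j<p. g (n + j * (t * d'))) = (\<Sum>j<p. g (n + j * d'))"
proof -
  have bij: "bij_betw (\<lambda>j. (j * t) mod p) {..<p} {..<p}"
  proof -
    have "inj_on (\<lambda>j. (j * t) mod p) {..<p}"
    proof (rule inj_onI)
      fix i j assume "i \<in> {..<p}" "j \<in> {..<p}" "(i*t) mod p = (j*t) mod p"
      then have "[i*t = j*t] (mod p)" by (simp add: cong_def)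
      then have "[i = j] (mod p)" using assms(2) cong_mult_rcancel_nat[of t p i j] by (simp add: coprime_commute)
      then show "i = j" using \<open>i \<in> _\<close> \<open>j \<in> _\<close> by (simp add: cong_def)
    qed
    moreover have "(\<lambda>j. (j * t) mod p) ` {..<p} \<subseteq> {..<p}" using assms(3) by auto
    ultimately show ?thesis by (simp add: bij_betw_def endo_inj_surj)
  qed
  have "(\<Sum>j<p. g (n + j * d')) = (\<Sum>j<p. g (n + ((j*t) mod p) * d'))"
    by (rule sum.reindex_bij_betw[OF bij, symmetric])
  also have "\<dots> = (\<Sum>j<p. g (n + j * (t * d')))"
  proof (rule sum.cong[OF refl])
    fix j
    have "n + j * (t * d') = (n + ((j*t) mod p) * d') + (p*d') * ((j*t) div p)"
    proof -
      have "j*t*d' = ((j*t) mod p + p * ((j*t) div p)) * d'" by simp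
      then show ?thesis by (simp only: algebra_simps)
    qed
    then show "g (n + ((j*t) mod p) * d') = g (n + j * (t * d'))"
      using periodic_mult[of g "p*d'", OF per] by metis
  qed
  finally show ?thesis ..
qed

text \<open>Cauchy-Schwarz takes care of two factors; each further factor is bounded pointwise by
  its l2 norm. For a single factor the inequality fails, which is why every prime has to divide at
  least two of the periods below.\<close>

lemma sum_prod_le_prod_sqrt:
  fixes g :: "'s \<Rightarrow> 'j \<Rightarrow> real"
  assumes "finite S" "finite J" "card S \<ge> 2" "\<And>s j. s \<in> S \<Longrightarrow> j \<in> J \<Longrightarrow> g s j \<ge> 0"
  shows "(\<Sum>j\<in>J. \<Prod>s\<in>S. g s j) \<le> (\<Prod>s\<in>S. sqrt (\<Sum>j\<in>J. (g s j)\<^sup>2))"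
  using assms
proof (induction "card S" arbitrary: S rule: less_induct)
  case less
  obtain a where a: "a \<in> S" using less.prems(3) by fastforce
  define S' where "S' = S - {a}"
  have S: "S = insert a S'" "a \<notin> S'" "finite S'" using a less.prems by (auto simp: S'_def)
  have cS: "card S' = card S - 1" using a less.prems by (simp add: S'_def)
  show ?case
  proof (cases "card S = 2")
    case True
    then have "card S' = 1" using cS by simp
    then obtain b where b: "S' = {b}" by (auto simp: card_1_singleton_iff)
    have "(\<Sum>j\<in>J. \<Prod>s\<in>S. g s j) = (\<Sum>j\<in>J. g a j * g b j)" using S b by simp
    also have "\<dots> \<le> sqrt (\<Sum>j\<in>J. (g a j)\<^sup>2) * sqrt (\<Sum>j\<in>J. (g b j)\<^sup>2)"
      using real_le_rsqrt[OF Cauchy_Schwarz_ineq_sum[of "g a" "g b" J]] by (simp only: real_sqrt_mult)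
    finally show ?thesis using S b by simp
  next
    case False
    then have c2: "card S' \<ge> 2" using cS less.prems(3) by simp
    have IH: "(\<Sum>j\<in>J. \<Prod>s\<in>S'. g s j) \<le> (\<Prod>s\<in>S'. sqrt (\<Sum>j\<in>J. (g s j)\<^sup>2))"
      by (rule less.hyps) (use cS c2 less.prems in \<open>auto simp: S'_def\<close>)
    have "(\<Sum>j\<in>J. \<Prod>s\<in>S. g s j) = (\<Sum>j\<in>J. g a j * (\<Prod>s\<in>S'. g s j))" using S by simp
    also have "\<dots> \<le> (\<Sum>j\<in>J. sqrt (\<Sum>j\<in>J. (g a j)\<^sup>2) * (\<Prod>s\<in>S'. g s j))"
    proof (rule sum_mono, rule mult_right_mono)
      fix j assume j: "j \<in> J"
      have "(g a j)\<^sup>2 \<le> (\<Sum>j\<in>J. (g a j)\<^sup>2)" using j less.prems(2) by (intro member_le_sum) auto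
      then show "g a j \<le> sqrt (\<Sum>j\<in>J. (g a j)\<^sup>2)" by (simp add: real_le_rsqrt)
      show "0 \<le> (\<Prod>s\<in>S'. g s j)" using j less.prems(4) S by (intro prod_nonneg) auto
    qed
    also have "\<dots> = sqrt (\<Sum>j\<in>J. (g a j)\<^sup>2) * (\<Sum>j\<in>J. (\<Prod>s\<in>S'. g s j))" by (simp add: sum_distrib_left)
    also have "\<dots> \<le> sqrt (\<Sum>j\<in>J. (g a j)\<^sup>2) * (\<Prod>s\<in>S'. sqrt (\<Sum>j\<in>J. (g s j)\<^sup>2))"
      by (intro mult_left_mono IH) (simp add: sum_nonneg)
    finally show ?thesis using S by simp
  qed
qed

text \<open>A Loomis--Whitney type inequality, one prime (that is, one CRT coordinate) at a time.\<close>

lemma sum_prod_periodic_le: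
  fixes g :: "'s \<Rightarrow> nat \<Rightarrow> real"
  assumes "finite S" "squarefree D" "D > 0"
    and "\<And>s. s \<in> S \<Longrightarrow> d s dvd D"
    and "\<And>s n. s \<in> S \<Longrightarrow> g s (n + d s) = g s n"
    and "\<And>s n. s \<in> S \<Longrightarrow> g s n \<ge> 0"
    and "\<And>p. prime p \<Longrightarrow> p dvd D \<Longrightarrow> card {s\<in>S. p dvd d s} \<ge> 2"
  shows "(\<Sum>n<D. \<Prod>s\<in>S. g s n) \<le> (\<Prod>s\<in>S. sqrt (\<Sum>n<d s. (g s n)\<^sup>2))"
  using assms(2-)
proof (induction D arbitrary: d g rule: less_induct)
  case (less D)
  show ?case
  proof (cases "D = 1")
    case True
    have "(\<Prod>s\<in>S. g s 0) = (\<Prod>s\<in>S. sqrt (\<Sum>n<d s. (g s n)\<^sup>2))"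
    proof (rule prod.cong[OF refl])
      fix s assume s: "s \<in> S"
      then have "d s = 1" using less.prems(3) True by auto
      then show "g s 0 = sqrt (\<Sum>n<d s. (g s n)\<^sup>2)" using less.prems(5)[OF s] by simp
    qed
    then show ?thesis using True by simp
  next
    case False
    then obtain p where p: "prime p" "p dvd D" using prime_factor_nat by blast
    define D' where "D' = D div p"
    have D: "D = p * D'" using p by (simp add: D'_def)
    have p0: "p > 0" using p prime_gt_0_nat by blast
    have cop: "coprime p D'" using less.prems(1) D squarefree_mult_imp_coprime by blast
    have D'0: "D' > 0" using less.prems(2) D by simp
    have D'less: "D' < D" using D D'0 prime_gt_1_nat[OF p(1)] by simp
    define T where "T = {s\<in>S. p dvd d s}"
    define d' where "d' s = (if s \<in> T then d s div p else d s)" for s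
    \<comment> \<open>The coordinate modulo \<open>p\<close> is integrated out: a factor that
      depends on it is replaced by its l2 norm in this coordinate, so the total sum of squares of
      each factor is unchanged.\<close>
    define g' where "g' s n = (if s \<in> T then sqrt (\<Sum>j<p. (g s (n + j * D'))\<^sup>2) else g s n)" for s n
    have dT: "d s = p * d' s" if "s \<in> T" for s using that by (auto simp: T_def d'_def)
    have d'dvd: "d' s dvd D'" if "s \<in> S" for s
    proof (cases "s \<in> T")
      case True
      then show ?thesis using dT[OF True] less.prems(3)[OF that] D p0 by simp
    next
      case False
      then have "coprime (d s) p" using that p(1) by (simp add: T_def prime_imp_coprime_nat coprime_commute)
      then show ?thesis using less.prems(3)[OF that] False D by (simp add: d'_def coprime_dvd_mult_right_iff)
    qed
    \<comment> \<open>The step \<open>D'\<close> in \<open>g'\<close> is common to all factors,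
      while the period of a single factor suggests the step \<open>d' s\<close>. The two differ by a
      factor coprime to \<open>p\<close>, so they visit the same values.\<close>
    have shift: "(\<Sum>j<p. (g s (n + j * D'))\<^sup>2) = (\<Sum>j<p. (g s (n + j * d' s))\<^sup>2)" if s: "s \<in> T" for s n
    proof -
      have sS: "s \<in> S" using s by (simp add: T_def)
      obtain t where t: "D' = t * d' s" using d'dvd[OF sS] by (metis dvdE mult.commute)
      have "coprime p t" using cop t by simp
      have per: "(g s (n + p * d' s))\<^sup>2 = (g s n)\<^sup>2" for n using less.prems(4)[OF sS] dT[OF s] by simp
      show ?thesis using sum_periodic_coprime_step[of "\<lambda>n. (g s n)\<^sup>2", OF per \<open>coprime p t\<close> p0] t by simp
    qed
    have per': "g' s (n + d' s) = g' s n" if s: "s \<in> S" for s n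
    proof (cases "s \<in> T")
      case True
      let ?f = "\<lambda>j. (g s (n + j * d' s))\<^sup>2"
      have "(\<Sum>j<p. (g s (n + d' s + j * d' s))\<^sup>2) = (\<Sum>j<p. ?f (Suc j))" by (simp add: algebra_simps)
      also have "\<dots> + ?f 0 = (\<Sum>j<Suc p. ?f j)" by (subst sum.lessThan_Suc_shift) simp
      also have "\<dots> = (\<Sum>j<p. ?f j) + ?f p" by simp
      also have "?f p = ?f 0" using less.prems(4)[OF s] dT[OF True] by simp
      finally have "(\<Sum>j<p. (g s (n + d' s + j * d' s))\<^sup>2) = (\<Sum>j<p. ?f j)" by simp
      then show ?thesis using True by (simp add: g'_def shift)
    next
      case False
      then show ?thesis using less.prems(4)[OF s] by (simp add: g'_def d'_def)
    qed
    have nn: "g' s n \<ge> 0" if "s \<in> S" for s n using less.prems(5)[OF that] by (simp add: g'_def sum_nonneg)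
    have cov: "card {s\<in>S. r dvd d' s} \<ge> 2" if r: "prime r" "r dvd D'" for r
    proof -
      have "r \<noteq> p" using r cop p(1) by (metis coprime_absorb_left not_prime_unit)
      then have "r dvd d s \<longleftrightarrow> r dvd d' s" if "s \<in> S" for s
      proof (cases "s \<in> T")
        case True
        have "coprime r p" using \<open>r \<noteq> p\<close> r p(1) by (simp add: primes_coprime)
        then show ?thesis using dT[OF True] by (simp add: coprime_dvd_mult_right_iff)
      qed (simp add: d'_def)
      then have "{s\<in>S. r dvd d' s} = {s\<in>S. r dvd d s}" by auto
      then show ?thesis using less.prems(6)[of r] r D by simp
    qed
    have sq': "squarefree D'" using less.prems(1) D by (metis squarefree_mono dvd_triv_right)
    have IH: "(\<Sum>n<D'. \<Prod>s\<in>S. g' s n) \<le> (\<Prod>s\<in>S. sqrt (\<Sum>n<d' s. (g' s n)\<^sup>2))"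
      by (rule less.IH[OF D'less sq' D'0]) (use d'dvd per' nn cov in auto)
    have finT: "finite T" "T \<subseteq> S" using assms(1) by (auto simp: T_def)
    have split: "(\<Prod>s\<in>S. f s) = (\<Prod>s\<in>S - T. f s) * (\<Prod>s\<in>T. f s)" for f :: "'s \<Rightarrow> real"
      using prod.subset_diff[OF finT(2) assms(1)] .
    have "(\<Sum>n<D. \<Prod>s\<in>S. g s n) = (\<Sum>n<D'. \<Sum>j<p. \<Prod>s\<in>S. g s (n + j * D'))"
      using sum_mult_group[of "\<lambda>n. \<Prod>s\<in>S. g s n" p D'] D by simp
    also have "\<dots> \<le> (\<Sum>n<D'. \<Prod>s\<in>S. g' s n)"
    proof (rule sum_mono)
      fix n
      \<comment> \<open>Factors outside \<open>T\<close> have a period dividing \<open>D'\<close>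
        and come out of the sum over \<open>j\<close>; by the covering hypothesis at least two
        factors stay inside.\<close>
      have "(\<Sum>j<p. \<Prod>s\<in>S. g s (n + j * D')) = (\<Sum>j<p. (\<Prod>s\<in>S - T. g s n) * (\<Prod>s\<in>T. g s (n + j * D')))"
      proof (rule sum.cong[OF refl])
        fix j
        have "g s (n + j * D') = g s n" if "s \<in> S - T" for s
          using that d'dvd[of s] less.prems(4)[of s] periodic_dvd[of "g s" "d s" "j * D'" n] by (simp add: d'_def)
        then show "(\<Prod>s\<in>S. g s (n + j * D')) = (\<Prod>s\<in>S - T. g s n) * (\<Prod>s\<in>T. g s (n + j * D'))"
          by (subst split) simp
      qed
      also have "\<dots> = (\<Prod>s\<in>S - T. g s n) * (\<Sum>j<p. (\<Prod>s\<in>T. g s (n + j * D')))" by (simp add: sum_distrib_left)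
      also have "\<dots> \<le> (\<Prod>s\<in>S - T. g s n) * (\<Prod>s\<in>T. sqrt (\<Sum>j<p. (g s (n + j * D'))\<^sup>2))"
        using finT less.prems(5) less.prems(6)[OF p] 
        by (intro mult_left_mono sum_prod_le_prod_sqrt prod_nonneg) (auto simp: T_def)
      also have "\<dots> = (\<Prod>s\<in>S. g' s n)" by (subst split) (simp add: g'_def)
      finally show "(\<Sum>j<p. \<Prod>s\<in>S. g s (n + j * D')) \<le> (\<Prod>s\<in>S. g' s n)" .
    qed
    also note IH
    also have "(\<Prod>s\<in>S. sqrt (\<Sum>n<d' s. (g' s n)\<^sup>2)) = (\<Prod>s\<in>S. sqrt (\<Sum>n<d s. (g s n)\<^sup>2))"
    proof (rule prod.cong[OF refl])
      fix s assume s: "s \<in> S"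
      show "sqrt (\<Sum>n<d' s. (g' s n)\<^sup>2) = sqrt (\<Sum>n<d s. (g s n)\<^sup>2)"
      proof (cases "s \<in> T")
        case True
        have "(\<Sum>n<d' s. (g' s n)\<^sup>2) = (\<Sum>n<d' s. \<Sum>j<p. (g s (n + j * d' s))\<^sup>2)"
          using True by (simp add: g'_def shift sum_nonneg)
        also have "\<dots> = (\<Sum>n<d s. (g s n)\<^sup>2)" using sum_mult_group[of "\<lambda>n. (g s n)\<^sup>2" p "d' s"] dT[OF True] by simp
        finally show ?thesis by simp
      qed (simp add: d'_def g'_def)
    qed
    finally show ?thesis .
  qed
qed

section \<open>The fundamental lemma of Montgomery and Vaughan\<close>

definition ee :: "real \<Rightarrow> complex" where "ee x = cis (2 * pi * x)"

lemma ee_add: "ee (x + y) = ee x * ee y" by (simp add: ee_def cis_mult algebra_simps)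
lemma ee_0 [simp]: "ee 0 = 1" by (simp add: ee_def)
lemma ee_minus: "ee (- x) = cnj (ee x)" by (simp add: ee_def cis_cnj)
lemma norm_ee [simp]: "cmod (ee x) = 1" by (simp add: ee_def)
lemma ee_of_nat_mult: "ee (real n * x) = ee x ^ n"
  by (simp add: ee_def Complex.DeMoivre mult_ac)

lemma ee_eq_1_iff: "ee x = 1 \<longleftrightarrow> x \<in> \<int>"
proof
  assume "ee x = 1"
  then have "cos (2 * pi * x) = 1" by (simp add: ee_def complex_eq_iff)
  then obtain n :: int where "2 * pi * x = real_of_int n * 2 * pi" by (auto simp: cos_one_2pi_int)
  then have "x = real_of_int n" by simp
  then show "x \<in> \<int>" by simp
next
  assume "x \<in> \<int>"
  then obtain n :: int where "x = of_int n" by (elim Ints_cases)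
  then show "ee x = 1" by (simp add: ee_def complex_eq_iff mult.commute[of _ "real_of_int n"])
      (metis cos_int_2pin sin_int_2pin mult.commute mult.left_commute)
qed

lemma ee_of_int [simp]: "ee (of_int n) = 1" by (simp add: ee_eq_1_iff)

lemma of_int_div_in_Ints_iff:
  assumes "q > 0"
  shows "real_of_int b / real q \<in> \<int> \<longleftrightarrow> int q dvd b"
proof
  assume "real_of_int b / real q \<in> \<int>"
  then obtain n where "real_of_int b / real q = of_int n" by (elim Ints_cases)
  then have "real_of_int b = of_int (n * int q)" using assms by (simp add: field_simps)
  then have "b = n * int q" by linarith
  then show "int q dvd b" by simp
next
  assume "int q dvd b"
  then obtain n where "b = int q * n" by blast
  then show "real_of_int b / real q \<in> \<int>" using assms by simp
qed

lemma sum_ee: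
  assumes "q > 0"
  shows "(\<Sum>n<q. ee (real n * (of_int b / real q))) = (if int q dvd b then of_nat q else 0)"
proof (cases "int q dvd b")
  case True
  then have "ee (of_int b / real q) = 1" using assms by (simp add: ee_eq_1_iff of_int_div_in_Ints_iff)
  then show ?thesis using True by (simp add: ee_of_nat_mult del: times_divide_eq_right)
next
  case False
  let ?w = "ee (of_int b / real q)"
  have w: "?w \<noteq> 1" using assms False by (simp add: ee_eq_1_iff of_int_div_in_Ints_iff)
  have "?w ^ q = 1" using ee_of_nat_mult[of q "of_int b / real q"] assms by simp
  then show ?thesis using False w by (simp add: ee_of_nat_mult sum_gp_strict del: times_divide_eq_right)
qed

lemma sum_periodic:
  fixes f :: "nat \<Rightarrow> real"
  assumes "\<And>n. f (n + D) = f n" "D dvd q" "D > 0"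
  shows "(\<Sum>n<q. f n) = real (q div D) * (\<Sum>n<D. f n)"
proof -
  obtain p where q: "q = p * D" using assms(2) by (metis dvdE mult.commute)
  have "(\<Sum>n<q. f n) = (\<Sum>n<D. \<Sum>j<p. f (n + j * D))" by (simp add: q sum_mult_group)
  also have "\<dots> = (\<Sum>n<D. \<Sum>j<p. f n)"
    using periodic_mult[of f D, OF assms(1)] by (intro sum.cong refl) (simp add: mult.commute)
  finally show ?thesis using q assms(3) by (simp add: sum_distrib_left)
qed

lemma parseval:
  fixes G :: "int \<Rightarrow> complex"
  assumes "q > 0" "finite X" "inj_on (\<lambda>b. b mod int q) X"
  shows "(\<Sum>n<q. (cmod (\<Sum>b\<in>X. G b * ee (real n * (of_int b / real q))))\<^sup>2) = real q * (\<Sum>b\<in>X. (cmod (G b))\<^sup>2)"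
proof -
  let ?e = "\<lambda>n b. ee (real n * (of_int b / real q))"
  have "complex_of_real (\<Sum>n<q. (cmod (\<Sum>b\<in>X. G b * ?e n b))\<^sup>2)
      = (\<Sum>n<q. (\<Sum>b\<in>X. G b * ?e n b) * cnj (\<Sum>b\<in>X. G b * ?e n b))"
    by (simp only: of_real_sum complex_norm_square)
  also have "\<dots> = (\<Sum>n<q. \<Sum>b\<in>X. \<Sum>c\<in>X. G b * cnj (G c) * ?e n (b - c))"
    by (auto simp: sum_product ee_add[symmetric] ee_minus[symmetric] diff_divide_distrib algebra_simps intro!: sum.cong)
  also have "\<dots> = (\<Sum>b\<in>X. \<Sum>c\<in>X. \<Sum>n<q. G b * cnj (G c) * ?e n (b - c))"
    by (subst sum.swap, rule sum.cong[OF refl], subst sum.swap) simp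
  also have "\<dots> = (\<Sum>b\<in>X. \<Sum>c\<in>X. if c = b then G b * cnj (G c) * of_nat q else 0)"
  proof (intro sum.cong refl)
    fix b c assume bc: "b \<in> X" "c \<in> X"
    have "int q dvd b - c \<longleftrightarrow> c = b"
      using assms(3) bc by (auto simp: mod_eq_dvd_iff[symmetric] dest: inj_onD)
    then show "(\<Sum>n<q. G b * cnj (G c) * ?e n (b - c)) = (if c = b then G b * cnj (G c) * of_nat q else 0)"
      using sum_ee[OF assms(1), of "b - c"] by (simp add: sum_distrib_left[symmetric])
  qed
  also have "\<dots> = (\<Sum>b\<in>X. G b * cnj (G b) * of_nat q)" using assms(2) by (simp add: sum.delta')
  also have "\<dots> = complex_of_real (real q * (\<Sum>b\<in>X. (cmod (G b))\<^sup>2))"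
    by (simp add: sum_distrib_left complex_norm_square mult_ac del: of_real_power)
  finally show ?thesis by (simp only: of_real_eq_iff)
qed

lemma indicator_dvd_sum:
  assumes "q > 0" "finite S"
  shows "(\<Sum>n<q. \<Prod>s\<in>S. ee (real n * (of_int (b s) / real q))) = (if int q dvd (\<Sum>s\<in>S. b s) then of_nat q else 0)"
proof -
  have "(\<Prod>s\<in>S. ee (real n * (of_int (b s) / real q))) = ee (real n * (of_int (\<Sum>s\<in>S. b s) / real q))" for n
    using assms(2) by (induction S) (auto simp: ee_add[symmetric] add_divide_distrib algebra_simps)
  then show ?thesis by (simp only: sum_ee[OF assms(1)])
qed

text \<open>An element \<open>b \<in> X s\<close> stands for the fraction \<open>b / q\<close>; \<open>D\<close> is a common multiple of the denominators.\<close>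

lemma montgomery_vaughan:
  fixes q :: nat and G :: "'s \<Rightarrow> int \<Rightarrow> real"
  assumes q: "q > 0" "D dvd q" and D: "squarefree D" and S: "finite S"
    and dD: "\<And>s. s \<in> S \<Longrightarrow> d s dvd D"
    and den: "\<And>s b. s \<in> S \<Longrightarrow> b \<in> X s \<Longrightarrow> int q dvd b * int (d s)"
    and fin: "\<And>s. s \<in> S \<Longrightarrow> finite (X s)"
    and inj: "\<And>s. s \<in> S \<Longrightarrow> inj_on (\<lambda>b. b mod int q) (X s)"
    and nn: "\<And>s b. s \<in> S \<Longrightarrow> b \<in> X s \<Longrightarrow> G s b \<ge> 0"
    and cov: "\<And>p. prime p \<Longrightarrow> p dvd D \<Longrightarrow> card {s\<in>S. p dvd d s} \<ge> 2"
  shows "(\<Sum>b\<in>{b\<in>PiE S X. int q dvd (\<Sum>s\<in>S. b s)}. \<Prod>s\<in>S. G s (b s))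
       \<le> (1 / real D) * (\<Prod>s\<in>S. sqrt (real (d s) * (\<Sum>b\<in>X s. (G s b)\<^sup>2)))"
proof -
  have D0: "D > 0" using q by (auto intro: Nat.gr0I)
  let ?e = "\<lambda>n b. ee (real n * (of_int b / real q))"
  define g where "g s n = cmod (\<Sum>b\<in>X s. of_real (G s b) * ?e n b)" for s n
  have gnn: "g s n \<ge> 0" for s n by (simp add: g_def)
  define L where "L = (\<Sum>b\<in>{b\<in>PiE S X. int q dvd (\<Sum>s\<in>S. b s)}. \<Prod>s\<in>S. G s (b s))"
  have finP: "finite (PiE S X)" using S fin by (intro finite_PiE) auto
  have per: "g s (n + d s) = g s n" if s: "s \<in> S" for s n
  proof -
    have "?e (n + d s) b = ?e n b" if b: "b \<in> X s" for b
    proof -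
      have "real_of_int (b * int (d s)) / real q \<in> \<int>"
        using den[OF s b] q by (simp add: of_int_div_in_Ints_iff del: of_int_mult)
      then have "ee (real_of_int (b * int (d s)) / real q) = 1" by (simp add: ee_eq_1_iff)
      then show ?thesis
        using ee_add[of "real n * (of_int b / real q)" "real_of_int (b * int (d s)) / real q"]
        by (simp add: algebra_simps)
    qed
    then show ?thesis by (simp add: g_def)
  qed
  \<comment> \<open>Additive characters detect the divisibility condition and turn the sum over
    tuples into a sum over \<open>n\<close> of products of trigonometric polynomials, one for each
    \<open>s\<close>.\<close>
  have "of_nat q * complex_of_real L = (\<Sum>b\<in>PiE S X. complex_of_real (\<Prod>s\<in>S. G s (b s)) * (if int q dvd (\<Sum>s\<in>S. b s) then of_nat q else 0))"
    unfolding L_def sum.inter_filter[OF finP] by (auto simp: sum_distrib_left intro!: sum.cong)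
  also have "\<dots> = (\<Sum>b\<in>PiE S X. \<Sum>n<q. \<Prod>s\<in>S. of_real (G s (b s)) * ?e n (b s))"
    by (subst indicator_dvd_sum[OF q(1) S, symmetric]) (simp add: sum_distrib_left prod.distrib)
  also have "\<dots> = (\<Sum>n<q. \<Sum>b\<in>PiE S X. \<Prod>s\<in>S. of_real (G s (b s)) * ?e n (b s))" by (rule sum.swap)
  also have "\<dots> = (\<Sum>n<q. \<Prod>s\<in>S. \<Sum>b\<in>X s. of_real (G s b) * ?e n b)"
    using S fin by (intro sum.cong refl) (subst prod_sum_PiE, auto)
  finally have eq: "of_nat q * complex_of_real L = (\<Sum>n<q. \<Prod>s\<in>S. \<Sum>b\<in>X s. of_real (G s b) * ?e n b)" .
  have L0: "L \<ge> 0" unfolding L_def by (intro sum_nonneg prod_nonneg) (auto intro!: nn)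
  have "real q * L = cmod (of_nat q * complex_of_real L)" using L0 by (simp add: norm_mult)
  also have "\<dots> \<le> (\<Sum>n<q. \<Prod>s\<in>S. g s n)"
    unfolding eq g_def by (rule order_trans[OF norm_sum]) (simp add: prod_norm)
  also have "\<dots> = real (q div D) * (\<Sum>n<D. \<Prod>s\<in>S. g s n)"
  proof (rule sum_periodic)
    show "(\<Prod>s\<in>S. g s (n + D)) = (\<Prod>s\<in>S. g s n)" for n
      by (intro prod.cong refl) (use periodic_dvd[of "g s" "d s" D n for s, OF per] dD in blast)
  qed (use q D0 in auto)
  also have "\<dots> \<le> real (q div D) * (\<Prod>s\<in>S. sqrt (\<Sum>n<d s. (g s n)\<^sup>2))"
    by (intro mult_left_mono sum_prod_periodic_le S D D0) (auto simp: per dD cov gnn)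
  also have "(\<Prod>s\<in>S. sqrt (\<Sum>n<d s. (g s n)\<^sup>2)) = (\<Prod>s\<in>S. sqrt (real (d s) * (\<Sum>b\<in>X s. (G s b)\<^sup>2)))"
  proof (rule prod.cong[OF refl])
    fix s assume s: "s \<in> S"
    have ds: "d s dvd q" "d s > 0" using dD[OF s] q by (auto intro: Nat.gr0I dvd_trans)
    \<comment> \<open>Parseval holds over the full period \<open>q\<close>; dividing by the number
      \<open>q div d s\<close> of shorter periods leaves the factor \<open>d s\<close>.\<close>
    have "real (q div d s) * (\<Sum>n<d s. (g s n)\<^sup>2) = (\<Sum>n<q. (g s n)\<^sup>2)"
      by (rule sum_periodic[symmetric]) (use per[OF s] ds in auto)
    also have "\<dots> = real q * (\<Sum>b\<in>X s. (G s b)\<^sup>2)"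
      using parseval[OF q(1) fin[OF s] inj[OF s], of "\<lambda>b. of_real (G s b)"] by (simp add: g_def)
    also have "real q = real (q div d s) * real (d s)" using ds by (simp flip: of_nat_mult)
    finally have "(\<Sum>n<d s. (g s n)\<^sup>2) = real (d s) * (\<Sum>b\<in>X s. (G s b)\<^sup>2)"
      using ds q by (auto simp: mult.assoc div_greater_zero_iff dvd_imp_le)
    then show "sqrt (\<Sum>n<d s. (g s n)\<^sup>2) = sqrt (real (d s) * (\<Sum>b\<in>X s. (G s b)\<^sup>2))" by simp
  qed
  finally have "real q * L \<le> real (q div D) * (\<Prod>s\<in>S. sqrt (real (d s) * (\<Sum>b\<in>X s. (G s b)\<^sup>2)))" .
  moreover have "real (q div D) = real q / real D" using q by (simp add: real_of_nat_div)
  ultimately have "real q * L \<le> real q * ((1 / real D) * (\<Prod>s\<in>S. sqrt (real (d s) * (\<Sum>b\<in>X s. (G s b)\<^sup>2))))"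
    by (simp add: field_simps)
  then have "L \<le> (1 / real D) * (\<Prod>s\<in>S. sqrt (real (d s) * (\<Sum>b\<in>X s. (G s b)\<^sup>2)))"
    using q(1) by (simp only: mult_le_cancel_left_pos of_nat_0_less_iff)
  then show ?thesis by (simp only: L_def)
qed

section \<open>Reduced denominators and Ramanujan sums\<close>

text \<open>Representatives between \<open>-q/2\<close> (excluded) and \<open>q/2\<close>, so that
  \<open>|b| / q\<close> is the distance from \<open>b / q\<close> to the nearest integer.\<close>

definition sym_residues :: "nat \<Rightarrow> int set" where "sym_residues q = {b. - int q < 2 * b \<and> 2 * b \<le> int q}"
definition nz_residues :: "nat \<Rightarrow> int set" where "nz_residues q = sym_residues q - {0}"
text \<open>In lowest terms \<open>b / q\<close> is \<open>num q b / den q b\<close>; in particular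
  \<open>den q 0 = 1\<close> for \<open>q > 0\<close>.\<close>

definition den :: "nat \<Rightarrow> int \<Rightarrow> nat" where "den q b = q div gcd (nat \<bar>b\<bar>) q"
definition num :: "nat \<Rightarrow> int \<Rightarrow> int" where "num q b = b div int (gcd (nat \<bar>b\<bar>) q)"

lemma finite_sym_residues [simp]: "finite (sym_residues q)"
  by (rule finite_subset[of _ "{- int q..int q}"]) (auto simp: sym_residues_def)

lemma finite_nz_residues [simp]: "finite (nz_residues q)" by (simp add: nz_residues_def)

lemma inj_on_sym_residues: "inj_on (\<lambda>b. b mod int q) (sym_residues q)"
proof (rule inj_onI)
  fix a b assume ab: "a \<in> sym_residues q" "b \<in> sym_residues q" "a mod int q = b mod int q"
  then have "int q dvd a - b" by (simp add: mod_eq_dvd_iff)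
  moreover have "\<bar>a - b\<bar> < int q" using ab by (auto simp: sym_residues_def)
  ultimately show "a = b" using zdvd_imp_le[of "int q" "\<bar>a - b\<bar>"] by (cases "a = b") auto
qed

lemma inj_on_nz_residues: "inj_on (\<lambda>b. b mod int q) (nz_residues q)"
  using inj_on_sym_residues by (rule inj_on_subset) (auto simp: nz_residues_def)

lemma bij_betw_sym_residues:
  assumes q: "q > 0"
  shows "bij_betw (\<lambda>b. nat (b mod int q)) (sym_residues q) {..<q}"
  unfolding bij_betw_def
proof (rule conjI)
  show "inj_on (\<lambda>b. nat (b mod int q)) (sym_residues q)"
    using inj_on_sym_residues[of q] q by (auto simp: inj_on_def nat_eq_iff)
  show "(\<lambda>b. nat (b mod int q)) ` sym_residues q = {..<q}"
  proof safe
    fix b show "nat (b mod int q) < q" using q by (simp add: nat_less_iff)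
  next
    fix n assume n: "n < q"
    show "n \<in> (\<lambda>b. nat (b mod int q)) ` sym_residues q"
    proof (cases "2 * n \<le> q")
      case True
      then show ?thesis using n by (intro image_eqI[of _ _ "int n"]) (auto simp: sym_residues_def)
    next
      case False
      have "(int n - int q) mod int q = int n mod int q" by simp
      then show ?thesis using n False by (intro image_eqI[of _ _ "int n - int q"]) (auto simp: sym_residues_def)
    qed
  qed
qed

lemma ex_sym_residues_cong:
  assumes "q > 0"
  obtains b where "b \<in> sym_residues q" "int q dvd b - t"
proof -
  have "nat (t mod int q) \<in> {..<q}" using assms by (simp add: nat_less_iff)
  then obtain b where b: "b \<in> sym_residues q" "nat (t mod int q) = nat (b mod int q)"
    using bij_betw_sym_residues[OF assms] by (auto simp: bij_betw_def)
  then have "b mod int q = t mod int q" using assms by (simp add: nat_eq_iff)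
  then show ?thesis using that b by (simp add: mod_eq_dvd_iff)
qed

lemma den_num:
  assumes "q > 0"
  shows "int q * num q b = b * int (den q b)" "coprime (num q b) (int (den q b))" "den q b dvd q" "den q b > 0"
proof -
  define g where "g = gcd (nat \<bar>b\<bar>) q"
  have "int g dvd int (nat \<bar>b\<bar>)" unfolding int_dvd_int_iff g_def by (rule gcd_dvd1)
  then have "int g dvd b" by simp
  moreover have "g > 0" using assms by (simp only: g_def gcd_pos_nat) simp
  moreover have "g dvd q" unfolding g_def by (rule gcd_dvd2)
  ultimately have g: "g > 0" "g dvd q" "int g dvd b" by blast+
  have q: "q = den q b * g" using g by (simp add: den_def g_def)
  have b: "b = num q b * int g" using g by (simp add: num_def g_def)
  show "int q * num q b = b * int (den q b)" by (subst (1) q, subst (3) b) simp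
  show "den q b dvd q" using q by (metis dvd_triv_left)
  then show "den q b > 0" using assms by (auto intro: Nat.gr0I)
  have "gcd b (int q) = int g" by (simp add: g_def)
  then have "num q b = b div gcd b (int q)" "int (den q b) = int q div gcd b (int q)"
    by (simp_all only: num_def den_def g_def of_nat_div)
  then show "coprime (num q b) (int (den q b))" using div_gcd_coprime[of b "int q"] assms by simp
qed

text \<open>\<open>den q b\<close> is the additive order of \<open>b\<close> modulo
  \<open>q\<close>. From this characterisation the rules for sums and for congruent arguments follow
  at once.\<close>

lemma dvd_mult_iff_den:
  assumes "q > 0"
  shows "int q dvd b * int n \<longleftrightarrow> den q b dvd n"
proof -
  have "int q dvd b * int n \<longleftrightarrow> int q * int (den q b) dvd b * int n * int (den q b)"
    using den_num(4)[OF assms, of b] by simp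
  also have "b * int n * int (den q b) = int q * (num q b * int n)"
    using den_num(1)[OF assms, of b] by (simp add: mult_ac)
  also have "int q * int (den q b) dvd int q * (num q b * int n) \<longleftrightarrow> int (den q b) dvd num q b * int n"
    using assms by simp
  also have "\<dots> \<longleftrightarrow> int (den q b) dvd int n"
    using den_num(2)[OF assms, of b] by (simp add: coprime_dvd_mult_right_iff coprime_commute)
  finally show ?thesis by simp
qed

lemma den_eq_1_iff: "q > 0 \<Longrightarrow> den q b = 1 \<longleftrightarrow> int q dvd b"
  using dvd_mult_iff_den[of q b 1] by simp

lemma nz_residues_not_dvd: "b \<in> nz_residues q \<Longrightarrow> \<not> int q dvd b"
  using zdvd_imp_le[of "int q" "\<bar>b\<bar>"] by (auto simp: nz_residues_def sym_residues_def)

lemma den_add_dvd: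
  assumes "q > 0" "den q a dvd n" "den q b dvd n" shows "den q (a + b) dvd n"
  using assms by (simp add: dvd_mult_iff_den[symmetric] distrib_right)

lemma den_cong: "int q dvd a - b \<Longrightarrow> q > 0 \<Longrightarrow> den q a = den q b"
proof -
  assume q: "q > 0" and "int q dvd a - b"
  then have "int q dvd a * int n \<longleftrightarrow> int q dvd b * int n" for n
    using dvd_mult2[of "int q" "a - b" "int n"] by (metis (no_types) left_diff_distrib dvd_diff_commute dvd_diffD dvd_diffD1 diff_add_cancel dvd_add_right_iff)
  then have "den q a dvd n \<longleftrightarrow> den q b dvd n" for n using dvd_mult_iff_den[OF q] by simp
  then show ?thesis by (metis dvd_antisym dvd_refl)
qed

lemma gcd_mult_coprime:
  fixes x a c :: nat
  assumes "coprime a c"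
  shows "gcd x (a * c) = gcd x a * gcd x c"
proof (rule dvd_antisym)
  obtain g1 g2 where g: "gcd x (a * c) = g1 * g2" "g1 dvd a" "g2 dvd c"
    using division_decomp[of "gcd x (a * c)" a c] by auto
  have "g1 dvd x" "g2 dvd x" using g(1) by (metis dvd_mult_left dvd_mult_right gcd_dvd1)+
  then show "gcd x (a * c) dvd gcd x a * gcd x c" using g by (simp add: mult_dvd_mono)
  have "coprime (gcd x a) (gcd x c)" using assms by (meson coprime_divisors gcd_dvd2)
  then have "gcd x a * gcd x c dvd x" by (intro divides_mult) auto
  then show "gcd x a * gcd x c dvd gcd x (a * c)" by (simp add: mult_dvd_mono)
qed

lemma den_mult_coprime:
  assumes "coprime a c" "a > 0" "c > 0"
  shows "den (a * c) b = den a b * den c b"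
proof -
  have "gcd (nat \<bar>b\<bar>) (a * c) = gcd (nat \<bar>b\<bar>) a * gcd (nat \<bar>b\<bar>) c"
    by (rule gcd_mult_coprime[OF assms(1)])
  then show ?thesis unfolding den_def by (simp only: div_mult_div_if_dvd gcd_dvd2)
qed

text \<open>Chinese remainder theorem: \<open>F\<close> sums over the multiples of \<open>c\<close>,
  it has period \<open>c\<close>, and multiplication by \<open>a\<close> permutes the residues
  modulo \<open>c\<close>.\<close>

lemma sum_coprime_periodic:
  fixes f :: "nat \<Rightarrow> 'a::comm_monoid_add"
  assumes "coprime a c" "a > 0" "c > 0" "\<And>n. f (n + a * c) = f n"
  shows "(\<Sum>l<a*c. f l) = (\<Sum>u<a. \<Sum>v<c. f (u * c + v * a))"
proof -
  define F where "F n = (\<Sum>j<a. f (n + j * c))" for n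
  have per: "F (n + c) = F n" for n
  proof -
    show ?thesis
    proof -
      have "(\<Sum>j<a. f (n + c + j * c)) = (\<Sum>j<a. f (n + (j + 1) * c))" by (simp add: algebra_simps)
      also have "\<dots> = (\<Sum>j<a. f (n + ((j + 1) mod a) * c))"
      proof (rule sum.cong[OF refl])
        fix j assume "j \<in> {..<a}"
        then show "f (n + (j + 1) * c) = f (n + ((j + 1) mod a) * c)"
          using assms(4)[of n] by (cases "j + 1 = a") auto
      qed
      also have "\<dots> = (\<Sum>j<a. f (n + j * c))"
      proof (rule sum.reindex_bij_betw[where g = "\<lambda>j. f (n + j * c)"])
        have "inj_on (\<lambda>j. (j + 1) mod a) {..<a}"
          by (rule inj_onI) (metis lessThan_iff mod_Suc_eq_mod_add3 mod_less Suc_eq_plus1 mod_Suc nat.inject nat.distinct(1))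
        moreover from this have "(\<lambda>j. (j + 1) mod a) ` {..<a} = {..<a}"
          by (intro endo_inj_surj) (use assms(2) in auto)
        ultimately show "bij_betw (\<lambda>j. (j + 1) mod a) {..<a} {..<a}" by (simp add: bij_betw_def)
      qed
      finally show ?thesis by (simp add: F_def)
    qed
  qed
  have "(\<Sum>l<a*c. f l) = (\<Sum>n<c. F n)" by (simp add: sum_mult_group F_def)
  also have "\<dots> = (\<Sum>v<c. F (v * a))"
    using sum_periodic_coprime_step[of F c 1 a 0] per assms by (simp add: coprime_commute)
  finally show ?thesis by (simp add: F_def add.commute sum.swap[of _ "{..<a}"])
qed

definition ramanujan_sum :: "nat \<Rightarrow> int \<Rightarrow> complex" where
  "ramanujan_sum q b = (\<Sum>l<q. if coprime l q then ee (real l * (of_int b / real q)) else 0)"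

lemma ee_nat_shift: "q > 0 \<Longrightarrow> ee (real (l + q * t) * (of_int b / real q)) = ee (real l * (of_int b / real q))"
proof -
  assume q: "q > 0"
  have "real (l + q * t) * (of_int b / real q) = real l * (of_int b / real q) + of_int (int t * b)"
    using q by (simp add: field_simps)
  then show ?thesis by (simp only: ee_add ee_of_int mult_1_right)
qed

lemma ramanujan_sum_mult:
  assumes "coprime a c" "a > 0" "c > 0"
  shows "ramanujan_sum (a * c) b = ramanujan_sum a b * ramanujan_sum c b"
proof -
  let ?f = "\<lambda>l. if coprime l (a*c) then ee (real l * (of_int b / real (a*c))) else 0"
  have "ramanujan_sum (a * c) b = (\<Sum>u<a. \<Sum>v<c. ?f (u * c + v * a))"
    unfolding ramanujan_sum_def
  proof (rule sum_coprime_periodic[OF assms])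
    show "?f (n + a * c) = ?f n" for n
      using ee_nat_shift[of "a*c" n 1 b] assms by (auto simp: coprime_iff_gcd_eq_1)
  qed
  also have "\<dots> = (\<Sum>u<a. \<Sum>v<c. (if coprime u a then ee (real u * (of_int b / real a)) else 0) *
                                (if coprime v c then ee (real v * (of_int b / real c)) else 0))"
  proof (intro sum.cong refl)
    fix u v
    have "coprime (u * c + v * a) (a * c) \<longleftrightarrow> coprime (u * c + v * a) a \<and> coprime (u * c + v * a) c" by simp
    also have "coprime (u * c + v * a) a \<longleftrightarrow> coprime (u * c) a"
      using gcd_add_mult[of a v "u * c"] by (simp only: coprime_iff_gcd_eq_1 gcd.commute[of _ a] add.commute)
    also have "coprime (u * c + v * a) c \<longleftrightarrow> coprime (v * a) c"
      using gcd_add_mult[of c u "v * a"] by (simp only: coprime_iff_gcd_eq_1 gcd.commute[of _ c])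
    finally have c: "coprime (u * c + v * a) (a * c) \<longleftrightarrow> coprime u a \<and> coprime v c"
      using assms(1) by (auto simp: coprime_commute)
    have "real (u * c + v * a) * (of_int b / real (a*c)) = real u * (of_int b / real a) + real v * (of_int b / real c)"
      using assms by (simp add: field_simps)
    then show "?f (u * c + v * a) = (if coprime u a then ee (real u * (of_int b / real a)) else 0) *
                                (if coprime v c then ee (real v * (of_int b / real c)) else 0)"
      using c by (simp only: ee_add) auto
  qed
  also have "\<dots> = ramanujan_sum a b * ramanujan_sum c b" by (simp only: ramanujan_sum_def sum_product)
  finally show ?thesis .
qed

text \<open>The sum is \<open>p - 1\<close> or \<open>-1\<close>, and \<open>den p b\<close> is
  \<open>1\<close> or \<open>p\<close> accordingly. In this product form the identity is
  multiplicative over coprime moduli.\<close>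

lemma ramanujan_sum_prime:
  assumes "prime p"
  shows "cmod (ramanujan_sum p b) * real (totient (den p b)) = real (totient p)"
proof -
  have p: "p > 0" "p > 1" using assms prime_gt_1_nat prime_gt_0_nat by auto
  have cop: "coprime l p \<longleftrightarrow> l \<noteq> 0" if "l < p" for l
    using that assms p prime_imp_coprime[of p l] dvd_imp_le[of p l]
    by (cases "l = 0") (auto simp: coprime_commute)
  have "ramanujan_sum p b = (\<Sum>l<p. (ee (real l * (of_int b / real p)) - (if l = 0 then 1 else 0)))"
    unfolding ramanujan_sum_def by (intro sum.cong refl) (auto simp: cop)
  also have "\<dots> = (if int p dvd b then of_nat p else 0) - 1"
    using p by (simp add: sum_subtractf sum_ee del: times_divide_eq_right)
  finally have r: "ramanujan_sum p b = (if int p dvd b then of_nat p else 0) - 1" .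
  show ?thesis
  proof (cases "int p dvd b")
    case True
    then have "den p b = 1" using den_eq_1_iff p by blast
    moreover have "cmod (of_nat p - 1) = real p - 1"
      using p by (metis norm_of_nat of_nat_1 of_nat_diff less_imp_le_nat)
    ultimately show ?thesis using True r assms p by (simp add: totient_prime of_nat_diff)
  next
    case False
    have "den p b dvd p" "den p b \<noteq> 1" using den_num(3)[of p b] den_eq_1_iff[of p b] p False by auto
    then have "den p b = p" using assms by (metis prime_nat_iff)
    then show ?thesis using False r by simp
  qed
qed

lemma ramanujan_sum_norm:
  assumes "squarefree q" "q > 0"
  shows "cmod (ramanujan_sum q b) * real (totient (den q b)) = real (totient q)"
  using assms
proof (induction q rule: less_induct)
  case (less q)
  show ?case
  proof (cases "q = 1")
    case True
    have "den 1 b = 1" by (simp add: den_def)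
    then show ?thesis using True by (simp add: ramanujan_sum_def)
  next
    case False
    then obtain p where p: "prime p" "p dvd q" using prime_factor_nat by blast
    then obtain c where q: "q = p * c" by blast
    have c: "coprime p c" "c > 0" "p > 0" "c < q" "squarefree c" 
      using less.prems p q squarefree_mult_imp_coprime[of p c] prime_gt_1_nat[OF p(1)] squarefree_mono[of c q]
      by auto
    have "den p b dvd p" "den c b dvd c" using den_num(3) c by auto
    then have cd: "coprime (den p b) (den c b)" using c(1) by (meson coprime_divisors)
    have "cmod (ramanujan_sum q b) * real (totient (den q b))
        = (cmod (ramanujan_sum p b) * real (totient (den p b))) * (cmod (ramanujan_sum c b) * real (totient (den c b)))"
      using c cd by (simp add: q ramanujan_sum_mult den_mult_coprime norm_mult totient_mult_coprime)
    also have "\<dots> = real (totient p) * real (totient c)" using ramanujan_sum_prime[OF p(1)] less.IH[of c] c by simp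
    finally show ?thesis using c by (simp add: q totient_mult_coprime)
  qed
qed

section \<open>Moments of reduced residues in short intervals\<close>

text \<open>A crude Jordan inequality: \<open>y \<le> 2\<close> on the range, so the cubic term of
  the Taylor bound is at most \<open>4 * y / 6\<close>.\<close>

lemma abs_sin_ge: "\<bar>y\<bar> \<le> pi / 2 \<Longrightarrow> \<bar>y\<bar> / 3 \<le> \<bar>sin y\<bar>"
proof -
  have pos: "y / 3 \<le> sin y" if "0 \<le> y" "y \<le> pi / 2" for y :: real
  proof -
    have "y \<le> 2" using that pi_less_4 by linarith
    then have "y ^ 2 \<le> 4" using that power_mono[of y 2 2] by simp
    have "\<bar>sin y - y\<bar> \<le> \<bar>y\<bar> ^ 3 / 6"
      using Maclaurin_sin_bound[of y 3] by (simp add: numeral_eq_Suc sin_coeff_def)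
    moreover have "\<bar>y\<bar> ^ 3 = y ^ 3" using that(1) by simp
    ultimately have "y - y ^ 3 / 6 \<le> sin y" by linarith
    moreover have "y ^ 3 \<le> 4 * y" using \<open>y^2 \<le> 4\<close> that by (simp add: power3_eq_cube power2_eq_square mult_right_mono)
    ultimately show ?thesis using that by linarith
  qed
  assume "\<bar>y\<bar> \<le> pi / 2"
  then show ?thesis using pos[of y] pos[of "-y"] by (cases "y \<ge> 0") auto
qed

lemma cmod_ee_minus_1: "cmod (ee x - 1) = 2 * \<bar>sin (pi * x)\<bar>"
proof -
  have "(cmod (ee x - 1))\<^sup>2 = (cos (2*(pi*x)) - 1)\<^sup>2 + (sin (2*(pi*x)))\<^sup>2"
    by (simp add: ee_def cmod_power2 mult.assoc)
  also have "\<dots> = (2 * sin (pi*x))\<^sup>2"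
    unfolding cos_double_sin sin_double using sin_cos_squared_add[of "pi*x"] by algebra
  finally have "(cmod (ee x - 1))\<^sup>2 = (2 * \<bar>sin (pi*x)\<bar>)\<^sup>2" by (simp add: power_mult_distrib)
  then show ?thesis by (metis abs_ge_zero mult_nonneg_nonneg norm_ge_zero power2_eq_imp_eq zero_le_numeral)
qed

text \<open>The sine bound and \<open>pi > 3\<close> give
  \<open>cmod (ee x - 1) \<ge> 2 * |x|\<close>, while the numerator of the geometric sum is at most
  2.\<close>

lemma sum_ee_kernel:
  assumes "\<bar>x\<bar> \<le> 1 / 2" "x \<noteq> 0"
  shows "cmod (\<Sum>d=1..H. ee (real d * x)) \<le> 1 / \<bar>x\<bar>"
proof -
  have "\<bar>pi * x\<bar> / 3 \<le> \<bar>sin (pi * x)\<bar>" using assms by (intro abs_sin_ge) (simp add: abs_mult)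
  moreover have "\<bar>pi * x\<bar> \<ge> 3 * \<bar>x\<bar>" using pi_gt3 by (simp add: abs_mult mult_right_mono)
  ultimately have low: "cmod (ee x - 1) \<ge> 2 * \<bar>x\<bar>" unfolding cmod_ee_minus_1 by linarith
  then have ne: "ee x \<noteq> 1" using assms by auto
  have "(\<Sum>d=1..H. ee (real d * x)) = ee x * (\<Sum>d<H. ee x ^ d)"
    by (induction H) (simp_all add: ee_of_nat_mult distrib_left del: of_nat_Suc)
  also have "\<dots> = ee x * ((ee x ^ H - 1) / (ee x - 1))"
    using ne by (simp add: sum_gp_strict divide_simps) (simp add: algebra_simps)
  finally have "cmod (\<Sum>d=1..H. ee (real d * x)) = cmod (ee x ^ H - 1) / cmod (ee x - 1)"
    by (simp add: norm_mult norm_divide)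
  also have "\<dots> \<le> 2 / (2 * \<bar>x\<bar>)"
  proof (rule frac_le)
    show "cmod (ee x ^ H - 1) \<le> 2" using norm_triangle_ineq4[of "ee x ^ H" 1] by (simp add: norm_power)
  qed (use low assms in auto)
  finally show ?thesis by simp
qed

text \<open>The Fourier coefficients of \<open>centred q\<close> have modulus at most \<open>1 / totient (den q b)\<close>, and the Dirichlet
  kernel of an interval of length \<open>H\<close> is at most \<open>min H (q / \<bar>b\<bar>)\<close>.\<close>

definition weight :: "nat \<Rightarrow> nat \<Rightarrow> int \<Rightarrow> real" where
  "weight q H b = min (real H) (real q / \<bar>real_of_int b\<bar>) / real (totient (den q b))"

text \<open>The frequency 0 is left out because \<open>centred q\<close> has mean zero. The tuples
  are extensional, hence determined by their values on \<open>I\<close>.\<close>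

definition zero_sums :: "nat \<Rightarrow> nat set \<Rightarrow> (nat \<Rightarrow> int) set" where
  "zero_sums q I = {b \<in> PiE I (\<lambda>_. nz_residues q). int q dvd (\<Sum>i\<in>I. b i)}"

definition centred :: "nat \<Rightarrow> nat \<Rightarrow> real" where
  "centred q m = real q / real (totient q) * (if coprime m q then 1 else 0) - 1"

definition window_sum :: "nat \<Rightarrow> nat \<Rightarrow> nat \<Rightarrow> real" where
  "window_sum q H n = (\<Sum>d=1..H. centred q (n + d))"

lemma sum_sym_residues_char:
  assumes "q > 0"
  shows "(\<Sum>b\<in>sym_residues q. ee (of_int t * (of_int b / real q))) = (if int q dvd t then of_nat q else 0)"
proof -
  have "(\<Sum>b\<in>sym_residues q. ee (of_int t * (of_int b / real q))) = (\<Sum>b\<in>sym_residues q. ee (real (nat (b mod int q)) * (of_int t / real q)))"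
  proof (rule sum.cong[OF refl])
    fix b
    have "real_of_int b = of_int (b mod int q) + of_int (int q * (b div int q))"
      by (metis mod_mult_div_eq of_int_add)
    then have "of_int t * (of_int b / real q) = real (nat (b mod int q)) * (of_int t / real q) + of_int (t * (b div int q))"
      using assms by (simp add: field_simps)
    then show "ee (of_int t * (of_int b / real q)) = ee (real (nat (b mod int q)) * (of_int t / real q))"
      by (simp only: ee_add ee_of_int mult_1_right)
  qed
  also have "\<dots> = (\<Sum>n<q. ee (real n * (of_int t / real q)))"
    by (rule sum.reindex_bij_betw[OF bij_betw_sym_residues[OF assms], of "\<lambda>n. ee (real n * (of_int t / real q))"])
  finally show ?thesis using sum_ee[OF assms] by simp
qed

lemma fourier_inversion:
  fixes u :: "nat \<Rightarrow> complex"
  assumes "q > 0" "\<And>n. u (n + q) = u n"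
  shows "u m = (\<Sum>b\<in>sym_residues q. ((1 / of_nat q) * (\<Sum>l<q. u l * ee (- (real l * (of_int b / real q))))) * ee (real m * (of_int b / real q)))"
proof -
  have "(\<Sum>b\<in>sym_residues q. ((1 / of_nat q) * (\<Sum>l<q. u l * ee (- (real l * (of_int b / real q))))) * ee (real m * (of_int b / real q)))
     = (\<Sum>b\<in>sym_residues q. \<Sum>l<q. (u l / of_nat q) * ee (of_int (int m - int l) * (of_int b / real q)))"
    by (intro sum.cong refl) (auto simp: sum_distrib_left sum_distrib_right ee_add[symmetric] algebra_simps diff_divide_distrib intro!: sum.cong)
  also have "\<dots> = (\<Sum>l<q. (u l / of_nat q) * (\<Sum>b\<in>sym_residues q. ee (of_int (int m - int l) * (of_int b / real q))))"
    by (subst sum.swap) (simp add: sum_distrib_left)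
  also have "\<dots> = (\<Sum>l<q. if l = m mod q then u l else 0)"
  proof (intro sum.cong refl)
    fix l assume l: "l \<in> {..<q}"
    have "int q dvd int m - int l \<longleftrightarrow> l = m mod q"
      using l by (simp add: mod_eq_dvd_iff[symmetric] flip: of_nat_mod) auto
    then show "(u l / of_nat q) * (\<Sum>b\<in>sym_residues q. ee (of_int (int m - int l) * (of_int b / real q))) = (if l = m mod q then u l else 0)"
      using sum_sym_residues_char[OF assms(1), of "int m - int l"] assms(1) by simp
  qed
  also have "\<dots> = u (m mod q)" using assms(1) by (simp add: sum.delta')
  finally show ?thesis using periodic_mod[of u q m, OF assms(2)] by simp
qed

lemma totient_eq_sum: "q > 0 \<Longrightarrow> (\<Sum>l<q. if coprime l q then 1 else 0) = (of_nat (totient q) :: 'a::semiring_1)" 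
proof -
  assume q: "q > 0"
  show ?thesis
  \<comment> \<open>\<open>totatives 1\<close> is \<open>{1}\<close>, whereas the sum runs over
    \<open>{0}\<close>; for larger \<open>q\<close> the two index sets agree.\<close>
  proof (cases "q = 1")
    case False
    then have "{l\<in>{..<q}. coprime l q} = totatives q"
      using q by (auto simp: totatives_def coprime_iff_gcd_eq_1 intro!: Nat.gr0I le_neq_trans)
    then show ?thesis by (simp add: totient_def sum.If_cases Int_def)
  qed simp
qed

text \<open>The coefficient at \<open>b\<close> is the conjugate Ramanujan sum divided by
  \<open>totient q\<close>. At \<open>b = 0\<close> it equals 1 and is cancelled by the
  \<open>- 1\<close> in \<open>centred\<close>.\<close>

lemma centred_fourier:
  assumes q: "q > 0" "squarefree q"
  obtains c where "\<And>m. complex_of_real (centred q m) = (\<Sum>b\<in>nz_residues q. c b * ee (real m * (of_int b / real q)))"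
    "\<And>b. cmod (c b) = 1 / real (totient (den q b))"
proof -
  let ?P = "of_nat q / of_nat (totient q) :: complex"
  define c where "c b = (1 / of_nat q) * (\<Sum>l<q. (?P * (if coprime l q then 1 else 0)) * ee (- (real l * (of_int b / real q))))" for b
  have tq: "totient q > 0" using q by simp
  have cb: "c b = cnj (ramanujan_sum q b) / of_nat (totient q)" for b
    using q by (auto simp: c_def ramanujan_sum_def sum_distrib_left sum_divide_distrib ee_minus intro!: sum.cong)
  have "cmod (c b) = 1 / real (totient (den q b))" for b
  proof -
    have "den q b > 0" using den_num(4) q by blast
    then show ?thesis using ramanujan_sum_norm[OF q(2,1), of b] tq by (simp add: cb norm_divide field_simps)
  qed
  moreover have "complex_of_real (centred q m) = (\<Sum>b\<in>nz_residues q. c b * ee (real m * (of_int b / real q)))" for m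
  proof -
    have per: "?P * (if coprime (n + q) q then 1 else 0) = ?P * (if coprime n q then 1 else 0)" for n
      by (simp add: coprime_iff_gcd_eq_1)
    have c0: "c 0 = 1"
    proof -
      have "(\<Sum>l<q. if coprime l q then 1 else 0) = (of_nat (totient q) :: complex)"
        by (rule totient_eq_sum[OF q(1)])
      moreover have "c 0 = (1 / of_nat q) * (?P * (\<Sum>l<q. if coprime l q then 1 else 0))"
        unfolding sum_distrib_left c_def by simp
      ultimately show ?thesis using q tq by simp
    qed
    have "?P * (if coprime m q then 1 else 0) = (\<Sum>b\<in>sym_residues q. c b * ee (real m * (of_int b / real q)))"
      unfolding c_def by (rule fourier_inversion[of q "\<lambda>n. ?P * (if coprime n q then 1 else 0)" m, OF q(1) per])
    also have "sym_residues q = insert 0 (nz_residues q)" using q by (auto simp: nz_residues_def sym_residues_def)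
    finally have "?P * (if coprime m q then 1 else 0) = 1 + (\<Sum>b\<in>nz_residues q. c b * ee (real m * (of_int b / real q)))"
      using c0 sum.insert[of "nz_residues q" 0 "\<lambda>b. c b * ee (real m * (of_int b / real q))"]
      by (simp del: times_divide_eq_right add: nz_residues_def[THEN arg_cong[of _ _ "\<lambda>A. 0 \<in> A"]])
    moreover have "complex_of_real (centred q m) = ?P * (if coprime m q then 1 else 0) - 1" by (simp add: centred_def)
    ultimately show ?thesis by (simp only: add_diff_cancel_left')
  qed
  ultimately show ?thesis using that by blast
qed

text \<open>Taking absolute values here destroys all oscillation of the coefficients; whatever is
  saved afterwards comes from the arithmetic of fractions with integral sum.\<close>

lemma moment_le:
  assumes q: "q > 0" "squarefree q"
  shows "\<bar>(\<Sum>n<q. window_sum q H n ^ k) / real q\<bar> \<le> (\<Sum>b\<in>zero_sums q {..<k}. \<Prod>i<k. weight q H (b i))"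
proof -
  obtain c where c: "\<And>m. complex_of_real (centred q m) = (\<Sum>b\<in>nz_residues q. c b * ee (real m * (of_int b / real q)))"
    "\<And>b. cmod (c b) = 1 / real (totient (den q b))" using centred_fourier[OF q] by blast
  define K where "K b = c b * (\<Sum>d=1..H. ee (real d * (of_int b / real q)))" for b
  have S: "complex_of_real (window_sum q H n) = (\<Sum>b\<in>nz_residues q. K b * ee (real n * (of_int b / real q)))" for n
  proof -
    have "complex_of_real (window_sum q H n) = (\<Sum>d=1..H. \<Sum>b\<in>nz_residues q. c b * ee (real (n + d) * (of_int b / real q)))"
      by (simp add: window_sum_def c(1) del: of_nat_add)
    also have "\<dots> = (\<Sum>b\<in>nz_residues q. \<Sum>d=1..H. c b * ee (real (n + d) * (of_int b / real q)))" by (rule sum.swap)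
    also have "\<dots> = (\<Sum>b\<in>nz_residues q. K b * ee (real n * (of_int b / real q)))"
      by (intro sum.cong refl)
         (simp add: K_def sum_distrib_left sum_distrib_right ee_add distrib_right mult_ac del: times_divide_eq_right)
    finally show ?thesis .
  qed
  have Kb: "cmod (K b) \<le> weight q H b" if b: "b \<in> nz_residues q" for b
  proof -
    have "cmod (\<Sum>d=1..H. ee (real d * (of_int b / real q))) \<le> real H"
      using norm_sum[of "\<lambda>d. ee (real d * (of_int b / real q))" "{1..H}"] by (simp del: times_divide_eq_right)
    moreover have "cmod (\<Sum>d=1..H. ee (real d * (of_int b / real q))) \<le> 1 / \<bar>of_int b / real q\<bar>"
      by (rule sum_ee_kernel) (use b q in \<open>auto simp: nz_residues_def sym_residues_def abs_if field_simps\<close>)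
    ultimately have "cmod (\<Sum>d=1..H. ee (real d * (of_int b / real q))) \<le> min (real H) (real q / \<bar>real_of_int b\<bar>)" by simp
    then show ?thesis by (simp add: K_def weight_def norm_mult c(2) divide_right_mono)
  qed
  have finP: "finite (PiE {..<k} (\<lambda>_. nz_residues q))" by (intro finite_PiE) auto
  have "complex_of_real (\<Sum>n<q. window_sum q H n ^ k) = (\<Sum>n<q. \<Prod>i<k. \<Sum>b\<in>nz_residues q. K b * ee (real n * (of_int b / real q)))"
    by (simp add: S)
  also have "\<dots> = (\<Sum>n<q. \<Sum>b\<in>PiE {..<k} (\<lambda>_. nz_residues q). \<Prod>i<k. K (b i) * ee (real n * (of_int (b i) / real q)))"
    by (intro sum.cong refl) (subst prod_sum_PiE, auto)
  also have "\<dots> = (\<Sum>b\<in>PiE {..<k} (\<lambda>_. nz_residues q). \<Sum>n<q. (\<Prod>i<k. K (b i)) * (\<Prod>i<k. ee (real n * (of_int (b i) / real q))))"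
    by (subst sum.swap) (simp add: prod.distrib)
  also have "\<dots> = (\<Sum>b\<in>PiE {..<k} (\<lambda>_. nz_residues q). (\<Prod>i<k. K (b i)) * (if int q dvd (\<Sum>i<k. b i) then of_nat q else 0))"
    by (simp only: sum_distrib_left[symmetric] indicator_dvd_sum[OF q(1) finite_lessThan])
  also have "\<dots> = (\<Sum>b\<in>zero_sums q {..<k}. (\<Prod>i<k. K (b i)) * of_nat q)"
    unfolding zero_sums_def sum.inter_filter[OF finP] by (intro sum.cong refl) simp
  finally have eq: "complex_of_real ((\<Sum>n<q. window_sum q H n ^ k) / real q) = (\<Sum>b\<in>zero_sums q {..<k}. (\<Prod>i<k. K (b i)))"
    using q by (simp add: sum_distrib_right[symmetric])
  have "\<bar>(\<Sum>n<q. window_sum q H n ^ k) / real q\<bar> = cmod (complex_of_real ((\<Sum>n<q. window_sum q H n ^ k) / real q))"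
    by (simp only: norm_of_real)
  also have "\<dots> \<le> (\<Sum>b\<in>zero_sums q {..<k}. \<Prod>i<k. cmod (K (b i)))"
    unfolding eq by (rule order_trans[OF norm_sum]) (simp add: prod_norm)
  also have "\<dots> \<le> (\<Sum>b\<in>zero_sums q {..<k}. \<Prod>i<k. weight q H (b i))"
    by (intro sum_mono prod_mono) (auto simp: zero_sums_def intro!: Kb)
  finally show ?thesis .
qed

section \<open>Moments of the divisor function\<close>

text \<open>\<open>divs 0 = 0\<close>, because \<open>0\<close> has infinitely many divisors; hence
  the positivity hypotheses below.\<close>

definition divs :: "nat \<Rightarrow> nat" where "divs n = card {d. d dvd n}"

lemma finite_divs: "n > 0 \<Longrightarrow> finite {d. d dvd (n::nat)}"
  by (rule finite_subset[of _ "{..n}"]) (auto dest: dvd_imp_le)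

lemma divs_pos: "n > 0 \<Longrightarrow> divs n \<ge> 1"
proof -
  assume n: "n > 0"
  have "{1} \<subseteq> {d. d dvd n}" by simp
  from card_mono[OF finite_divs[OF n] this] show ?thesis by (simp add: divs_def)
qed

lemma divs_mono: "a dvd b \<Longrightarrow> b > 0 \<Longrightarrow> divs a \<le> divs b"
  unfolding divs_def by (intro card_mono finite_divs) (auto intro: dvd_trans)

lemma divs_mult_le:
  assumes "a > 0" "b > 0" shows "divs (a * b) \<le> divs a * divs b"
proof -
  have "{d. d dvd a * b} \<subseteq> (\<lambda>(x, y). x * y) ` ({d. d dvd a} \<times> {d. d dvd b})"
    using division_decomp[of _ a b] by fastforce
  then have "divs (a * b) \<le> card ((\<lambda>(x, y). x * y) ` ({d. d dvd a} \<times> {d. d dvd b}))"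
    unfolding divs_def using assms by (intro card_mono finite_imageI finite_cartesian_product finite_divs) auto
  also have "\<dots> \<le> card ({d. d dvd a} \<times> {d. d dvd b})"
    using assms by (intro card_image_le finite_cartesian_product finite_divs) auto
  finally show ?thesis by (simp add: card_cartesian_product divs_def)
qed

lemma sum_divisor_swap:
  fixes g :: "nat \<Rightarrow> nat \<Rightarrow> 'a::comm_monoid_add"
  shows "(\<Sum>n=1..N. \<Sum>d | d dvd n. g d (n div d)) = (\<Sum>d=1..N. \<Sum>e=1..N div d. g d e)"
proof -
  have "(\<Sum>n=1..N. \<Sum>d | d dvd n. g d (n div d)) = (\<Sum>(n,d)\<in>Sigma {1..N} (\<lambda>n. {d. d dvd n}). g d (n div d))"
    by (rule sum.Sigma) (auto intro: finite_divs)
  also have "\<dots> = (\<Sum>(d,e)\<in>Sigma {1..N} (\<lambda>d. {1..N div d}). g d e)"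
  proof (rule sum.reindex_bij_witness[where i = "\<lambda>(d,e). (d*e, d)" and j = "\<lambda>(n,d). (d, n div d)"])
    fix a assume "a \<in> Sigma {1..N} (\<lambda>n. {d. d dvd n})"
    then show "(case case a of (n, d) \<Rightarrow> (d, n div d) of (d, e) \<Rightarrow> (d * e, d)) = a"
      "(case a of (n, d) \<Rightarrow> (d, n div d)) \<in> Sigma {1..N} (\<lambda>d. {1..N div d})"
      "(case case a of (n, d) \<Rightarrow> (d, n div d) of (d, e) \<Rightarrow> g d e) = (case a of (n, d) \<Rightarrow> g d (n div d))"
      by (auto simp: div_le_mono dest: dvd_imp_le intro: Nat.gr0I) 
         (auto simp: Suc_le_eq div_greater_zero_iff dest: dvd_imp_le intro: Nat.gr0I)
  next
    fix b assume b: "b \<in> Sigma {1..N} (\<lambda>d. {1..N div d})"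
    then obtain d e where de: "b = (d, e)" "1 \<le> d" "1 \<le> e" "e \<le> N div d" by auto
    then have "d * e \<le> N" by (metis div_times_less_eq_dividend dual_order.trans mult.commute mult_le_mono1)
    then show "(case b of (d, e) \<Rightarrow> (d * e, d)) \<in> Sigma {1..N} (\<lambda>n. {d. d dvd n})" 
         "(case case b of (d, e) \<Rightarrow> (d * e, d) of (n, d) \<Rightarrow> (d, n div d)) = b" using de by auto
  qed
  also have "\<dots> = (\<Sum>d=1..N. \<Sum>e=1..N div d. g d e)" by (rule sum.Sigma[symmetric]) auto
  finally show ?thesis .
qed

text \<open>One factor \<open>divs n\<close> is a sum over the factorisations
  \<open>n = d * e\<close>, and the remaining power is submultiplicative. Raising the exponent by
  one thus squares the bound, whence the powers \<open>2 ^ m\<close> of the logarithm.\<close>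

lemma sum_divs_pow_Suc_le:
  fixes w :: "nat \<Rightarrow> real"
  assumes "\<And>d e. d \<ge> 1 \<Longrightarrow> e \<ge> 1 \<Longrightarrow> w (d * e) = w d * w e" "\<And>n. w n \<ge> 0"
  shows "(\<Sum>n=1..N. real (divs n) ^ Suc m * w n)
       \<le> (\<Sum>d=1..N. real (divs d) ^ m * w d * (\<Sum>e=1..N div d. real (divs e) ^ m * w e))"
proof -
  have "(\<Sum>n=1..N. real (divs n) ^ Suc m * w n) = (\<Sum>n=1..N. \<Sum>d | d dvd n. real (divs (d * (n div d))) ^ m * w (d * (n div d)))"
  proof (rule sum.cong[OF refl])
    fix n assume "n \<in> {1..N}"
    have "(\<Sum>d | d dvd n. real (divs (d * (n div d))) ^ m * w (d * (n div d))) = (\<Sum>d | d dvd n. real (divs n) ^ m * w n)"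
      by (rule sum.cong) auto
    then show "real (divs n) ^ Suc m * w n = (\<Sum>d | d dvd n. real (divs (d * (n div d))) ^ m * w (d * (n div d)))"
      by (simp add: divs_def[of n])
  qed
  also have "\<dots> = (\<Sum>d=1..N. \<Sum>e=1..N div d. real (divs (d * e)) ^ m * w (d * e))"
    by (rule sum_divisor_swap)
  also have "\<dots> \<le> (\<Sum>d=1..N. \<Sum>e=1..N div d. real (divs d * divs e) ^ m * (w d * w e))"
    using assms by (intro sum_mono mult_mono power_mono) (auto intro!: divs_mult_le simp flip: of_nat_mult)
  finally show ?thesis by (simp add: sum_distrib_left power_mult_distrib mult_ac)
qed

lemma harm_le_ln: "N > 0 \<Longrightarrow> harm N \<le> ln (real N) + 1"
proof (induction N rule: nat_induct_non_zero)
  case (Suc n)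
  have "ln (real n / real (Suc n)) \<le> real n / real (Suc n) - 1"
    using Suc.hyps by (intro ln_le_minus_one) auto
  also have "\<dots> = - (1 / real (Suc n))" by (simp add: field_simps)
  finally have "1 / real (Suc n) \<le> ln (real (Suc n)) - ln (real n)"
    using Suc.hyps by (simp add: ln_div)
  then show ?case using Suc.IH by (simp add: harm_Suc inverse_eq_divide)
qed (simp add: harm_def)

text \<open>With \<open>Suc N\<close> inside the logarithm the hypothesis entails
  \<open>L \<ge> 1\<close> for every \<open>N\<close>, including 0.\<close>

lemma sum_divs_pow_over_le:
  assumes "1 + ln (real (Suc N)) \<le> L"
  shows "(\<Sum>n=1..N. real (divs n) ^ m * (1 / real n)) \<le> L ^ (2 ^ m)"
proof (induction m)
  case 0
  have "(\<Sum>n=1..N. 1 / real n) = harm N" by (simp add: harm_def inverse_eq_divide)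
  also have "\<dots> \<le> 1 + ln (real (Suc N))"
  proof (cases "N = 0")
    case False
    then have "harm N \<le> ln (real N) + 1" using harm_le_ln[of N] by simp
    moreover have "ln (real N) \<le> ln (real (Suc N))" using False by (intro ln_mono) auto
    ultimately show ?thesis by linarith
  qed (simp add: harm_def)
  finally show ?case using assms by simp
next
  case (Suc m)
  let ?S = "\<Sum>n=1..N. real (divs n) ^ m * (1 / real n)"
  have "(\<Sum>n=1..N. real (divs n) ^ Suc m * (1 / real n)) \<le> 
     (\<Sum>d=1..N. real (divs d) ^ m * (1 / real d) * (\<Sum>e=1..N div d. real (divs e) ^ m * (1 / real e)))"
    by (rule sum_divs_pow_Suc_le) auto
  also have "\<dots> \<le> (\<Sum>d=1..N. real (divs d) ^ m * (1 / real d) * ?S)"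
    by (intro sum_mono mult_left_mono sum_mono2) (auto intro: order_trans[OF _ div_le_dividend])
  also have "\<dots> = ?S * ?S" by (simp add: sum_distrib_right)
  also have "\<dots> \<le> L ^ (2 ^ m) * L ^ (2 ^ m)" using Suc by (intro mult_mono) (auto intro!: sum_nonneg order_trans[OF _ Suc])
  finally show ?case by (simp add: power_add[symmetric] mult_2)
qed

lemma sum_divs_pow_le:
  assumes "1 + ln (real (Suc N)) \<le> L"
  shows "(\<Sum>n=1..N. real (divs n) ^ m) \<le> real N * L ^ (2 ^ m)"
  using assms
proof (induction m arbitrary: N)
  case 0
  have "ln (real (Suc N)) \<ge> 0" by simp
  then have "1 \<le> L" using 0 by linarith
  then show ?case using mult_left_mono[of 1 L "real N"] by simp
next
  case (Suc m)
  have L1: "L \<ge> 1" using Suc.prems ln_ge_zero[of "real (Suc N)"] by linarith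
  have "(\<Sum>n=1..N. real (divs n) ^ Suc m * 1) \<le> 
     (\<Sum>d=1..N. real (divs d) ^ m * 1 * (\<Sum>e=1..N div d. real (divs e) ^ m * 1))"
    by (rule sum_divs_pow_Suc_le) auto
  also have "\<dots> \<le> (\<Sum>d=1..N. real (divs d) ^ m * (real N / real d * L ^ (2 ^ m)))"
  proof (intro sum_mono)
    fix d assume d: "d \<in> {1..N}"
    have "ln (real (Suc (N div d))) \<le> ln (real (Suc N))" by (intro ln_mono) (auto simp: div_le_dividend)
    then have "(\<Sum>e=1..N div d. real (divs e) ^ m) \<le> real (N div d) * L ^ (2 ^ m)"
      using Suc.prems by (intro Suc.IH) linarith
    also have "\<dots> \<le> real N / real d * L ^ (2 ^ m)"
      using L1 by (intro mult_right_mono of_nat_div_le_of_nat) auto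
    finally show "real (divs d) ^ m * 1 * (\<Sum>e=1..N div d. real (divs e) ^ m * 1) \<le> real (divs d) ^ m * (real N / real d * L ^ (2 ^ m))"
      by (simp only: mult_1_right) (intro mult_left_mono, auto)
  qed
  also have "\<dots> = real N * L ^ (2 ^ m) * (\<Sum>d=1..N. real (divs d) ^ m * (1 / real d))"
    by (simp add: sum_distrib_left mult_ac)
  also have "\<dots> \<le> real N * L ^ (2 ^ m) * L ^ (2 ^ m)"
    using L1 by (intro mult_left_mono sum_divs_pow_over_le Suc.prems) auto
  finally show ?case by (simp add: power_add[symmetric] mult_2 mult_ac)
qed

definition nz_ints :: "real \<Rightarrow> int set" where "nz_ints U = {u. u \<noteq> 0 \<and> \<bar>real_of_int u\<bar> \<le> U}"

lemma finite_nz_ints [simp]: "finite (nz_ints U)"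
  by (rule finite_subset[of _ "{-\<lceil>U\<rceil>..\<lceil>U\<rceil>}"]) (auto simp: nz_ints_def, linarith+)

lemma sum_nz_ints_le:
  fixes f :: "nat \<Rightarrow> real"
  assumes "\<And>n. f n \<ge> 0"
  shows "(\<Sum>u\<in>nz_ints U. f (nat \<bar>u\<bar>)) \<le> 2 * (\<Sum>n=1..nat \<lfloor>U\<rfloor>. f n)"
proof -
  have fin: "finite ((\<lambda>n. int n) ` {1..nat \<lfloor>U\<rfloor>})" by simp
  have "nz_ints U \<subseteq> (\<lambda>n. int n) ` {1..nat \<lfloor>U\<rfloor>} \<union> (\<lambda>n. - int n) ` {1..nat \<lfloor>U\<rfloor>}"
  proof
    fix u assume u: "u \<in> nz_ints U"
    then have "\<bar>u\<bar> \<le> \<lfloor>U\<rfloor>" "u \<noteq> 0" by (auto simp: nz_ints_def le_floor_iff)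
    then have "nat \<bar>u\<bar> \<in> {1..nat \<lfloor>U\<rfloor>}" by auto
    moreover have "u = int (nat \<bar>u\<bar>) \<or> u = - int (nat \<bar>u\<bar>)" by auto
    ultimately show "u \<in> (\<lambda>n. int n) ` {1..nat \<lfloor>U\<rfloor>} \<union> (\<lambda>n. - int n) ` {1..nat \<lfloor>U\<rfloor>}" by blast
  qed
  then have "(\<Sum>u\<in>nz_ints U. f (nat \<bar>u\<bar>)) \<le> (\<Sum>u\<in>(\<lambda>n. int n) ` {1..nat \<lfloor>U\<rfloor>} \<union> (\<lambda>n. - int n) ` {1..nat \<lfloor>U\<rfloor>}. f (nat \<bar>u\<bar>))"
    by (intro sum_mono2) (auto simp: assms)
  also have "\<dots> \<le> (\<Sum>u\<in>(\<lambda>n. int n) ` {1..nat \<lfloor>U\<rfloor>}. f (nat \<bar>u\<bar>)) + (\<Sum>u\<in>(\<lambda>n. - int n) ` {1..nat \<lfloor>U\<rfloor>}. f (nat \<bar>u\<bar>))"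
    using sum_nonneg[of "(\<lambda>n. int n) ` {1..nat \<lfloor>U\<rfloor>} \<inter> (\<lambda>n. - int n) ` {1..nat \<lfloor>U\<rfloor>}" "\<lambda>u. f (nat \<bar>u\<bar>)"] assms
    by (subst sum_Un) auto
  also have "\<dots> = 2 * (\<Sum>n=1..nat \<lfloor>U\<rfloor>. f n)" by (simp add: sum.reindex inj_on_def)
  finally show ?thesis .
qed

lemma card_nz_ints_le:
  assumes "U \<ge> 0" shows "real (card (nz_ints U)) \<le> 2 * U"
proof -
  have "real (card (nz_ints U)) \<le> 2 * real_of_int \<lfloor>U\<rfloor>" using sum_nz_ints_le[of "\<lambda>_. 1" U] assms by simp
  also have "\<dots> \<le> 2 * U" by simp
  finally show ?thesis .
qed

lemma sum_nz_ints_divs_le: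
  assumes "1 + ln (2 + U) \<le> L" "U \<ge> 0"
  shows "(\<Sum>u\<in>nz_ints U. real (divs (nat \<bar>u\<bar>)) ^ m) \<le> 2 * U * L ^ (2 ^ m)"
proof -
  have fl: "real (nat \<lfloor>U\<rfloor>) \<le> U" using assms(2) by (rule of_nat_floor)
  have "ln (real (Suc (nat \<lfloor>U\<rfloor>))) \<le> ln (2 + U)"
    using fl assms(2) by (subst ln_le_cancel_iff) (simp_all del: of_nat_nat of_nat_int_floor)
  then have "(\<Sum>n=1..nat \<lfloor>U\<rfloor>. real (divs n) ^ m) \<le> real (nat \<lfloor>U\<rfloor>) * L ^ (2 ^ m)"
    using assms by (intro sum_divs_pow_le) linarith
  also have "\<dots> \<le> U * L ^ (2 ^ m)"
    using fl assms(1) ln_ge_zero[of "2 + U"] assms(2) by (intro mult_right_mono zero_le_power) linarith+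
  finally show ?thesis using sum_nz_ints_le[of "\<lambda>n. real (divs n) ^ m" U] by simp
qed

lemma prod3_power_le:
  fixes x y z :: real
  assumes "x \<ge> 0" "y \<ge> 0" "z \<ge> 0"
  shows "(x * y * z) ^ K \<le> x ^ (3*K) + y ^ (3*K) + z ^ (3*K)"
proof -
  define t where "t = max x (max y z)"
  have "x * y * z \<le> t * t * t" using assms by (intro mult_mono) (auto simp: t_def)
  then have "(x * y * z) ^ K \<le> (t * t * t) ^ K" using assms by (intro power_mono) auto
  also have "\<dots> = t ^ (3*K)" by (simp add: power_mult power3_eq_cube)
  also have "\<dots> \<le> x ^ (3*K) + y ^ (3*K) + z ^ (3*K)" using assms by (auto simp: t_def max_def)
  finally show ?thesis .
qed

lemma sum_shift_nz_ints_le: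
  assumes L: "1 + ln (2 + 2 * U) \<le> L" and "V \<le> U" "0 \<le> V"
  shows "(\<Sum>v\<in>nz_ints V. \<Sum>u\<in>{u\<in>nz_ints U. u + v \<noteq> 0}. real (divs (nat \<bar>u + v\<bar>)) ^ m) \<le> 8 * U * V * L ^ (2 ^ m)"
proof -
  have "(\<Sum>u\<in>{u\<in>nz_ints U. u + v \<noteq> 0}. real (divs (nat \<bar>u + v\<bar>)) ^ m) \<le> 2 * (2 * U) * L ^ (2 ^ m)" if v: "v \<in> nz_ints V" for v
  proof -
    have "(\<Sum>u\<in>{u\<in>nz_ints U. u + v \<noteq> 0}. real (divs (nat \<bar>u + v\<bar>)) ^ m)
        = (\<Sum>w\<in>(\<lambda>u. u + v) ` {u\<in>nz_ints U. u + v \<noteq> 0}. real (divs (nat \<bar>w\<bar>)) ^ m)"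
      by (subst sum.reindex) (auto simp: inj_on_def)
    also have "\<dots> \<le> (\<Sum>w\<in>nz_ints (2 * U). real (divs (nat \<bar>w\<bar>)) ^ m)"
      using v assms by (intro sum_mono2 finite_nz_ints) (auto simp: nz_ints_def)
    also have "\<dots> \<le> 2 * (2 * U) * L ^ (2 ^ m)" using assms by (intro sum_nz_ints_divs_le) auto
    finally show ?thesis .
  qed
  then have "(\<Sum>v\<in>nz_ints V. \<Sum>u\<in>{u\<in>nz_ints U. u + v \<noteq> 0}. real (divs (nat \<bar>u + v\<bar>)) ^ m) \<le> real (card (nz_ints V)) * (2 * (2 * U) * L ^ (2 ^ m))"
    by (intro sum_bounded_above)
  also have "\<dots> \<le> (2 * V) * (2 * (2 * U) * L ^ (2 ^ m))"
  proof (intro mult_right_mono card_nz_ints_le)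
    have "L \<ge> 0" using L ln_ge_zero[of "2 + 2 * U"] assms by linarith
    then show "0 \<le> 2 * (2 * U) * L ^ 2 ^ m" using assms by simp
  qed (use assms in auto)
  finally show ?thesis by (simp add: mult_ac)
qed

text \<open>Products of three divisor functions are separated by \<open>prod3_power_le\<close>. For
  \<open>u + v\<close> the variable with the shorter range is fixed first, so that
  \<open>u + v\<close> stays within twice the longer range.\<close>

lemma sum_triple_divs_le:
  assumes L: "1 + ln (2 + 2 * U) \<le> L" "1 + ln (2 + 2 * V) \<le> L" and "0 \<le> U" "0 \<le> V"
  shows "(\<Sum>(u,v)\<in>{(u,v). u \<in> nz_ints U \<and> v \<in> nz_ints V \<and> u + v \<noteq> 0}.
           (real (divs (nat \<bar>u\<bar>)) * real (divs (nat \<bar>v\<bar>)) * real (divs (nat \<bar>u + v\<bar>))) ^ K)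
       \<le> 16 * U * V * L ^ (2 ^ (3 * K))"
proof -
  let ?t = "\<lambda>u. real (divs (nat \<bar>u\<bar>)) ^ (3*K)" and ?M = "L ^ (2 ^ (3 * K))"
  define T where "T = {(u,v). u \<in> nz_ints U \<and> v \<in> nz_ints V \<and> u + v \<noteq> 0}"
  have T: "T \<subseteq> nz_ints U \<times> nz_ints V" by (auto simp: T_def)
  then have finT: "finite T" by (rule finite_subset) simp
  have LU: "1 + ln (2 + U) \<le> L" "1 + ln (2 + V) \<le> L" "L \<ge> 1"
  proof -
    have "ln (2+U) \<le> ln (2+2*U)" "ln (2+V) \<le> ln (2+2*V)" "0 \<le> ln (2+2*U)" using assms by auto
    then show "1 + ln (2 + U) \<le> L" "1 + ln (2 + V) \<le> L" "L \<ge> 1" using L by linarith+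
  qed
  have "(\<Sum>(u,v)\<in>T. (real (divs (nat \<bar>u\<bar>)) * real (divs (nat \<bar>v\<bar>)) * real (divs (nat \<bar>u + v\<bar>))) ^ K)
      \<le> (\<Sum>(u,v)\<in>T. ?t u + ?t v + ?t (u + v))"
    by (intro sum_mono) (auto intro!: prod3_power_le)
  also have "\<dots> = (\<Sum>(u,v)\<in>T. ?t u) + (\<Sum>(u,v)\<in>T. ?t v) + (\<Sum>(u,v)\<in>T. ?t (u + v))"
    by (simp add: sum.distrib case_prod_unfold)
  also have "(\<Sum>(u,v)\<in>T. ?t u) \<le> 4 * U * V * ?M"
  proof -
    have "(\<Sum>(u,v)\<in>T. ?t u) \<le> (\<Sum>(u,v)\<in>nz_ints U \<times> nz_ints V. ?t u)" using T by (intro sum_mono2) auto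
    also have "\<dots> = (\<Sum>u\<in>nz_ints U. ?t u) * real (card (nz_ints V))"
      by (simp add: sum.cartesian_product[symmetric] sum_distrib_left mult.commute)
    also have "\<dots> \<le> (2 * U * ?M) * (2 * V)"
      using assms LU by (intro mult_mono sum_nz_ints_divs_le card_nz_ints_le) auto
    finally show ?thesis by (simp add: mult_ac)
  qed
  also have "(\<Sum>(u,v)\<in>T. ?t v) \<le> 4 * U * V * ?M"
  proof -
    have "(\<Sum>(u,v)\<in>T. ?t v) \<le> (\<Sum>(u,v)\<in>nz_ints U \<times> nz_ints V. ?t v)" using T by (intro sum_mono2) auto
    also have "\<dots> = real (card (nz_ints U)) * (\<Sum>u\<in>nz_ints V. ?t u)"
      by (simp add: sum.cartesian_product[symmetric] sum_distrib_left)
    also have "\<dots> \<le> (2 * U) * (2 * V * ?M)"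
      using assms LU by (intro mult_mono sum_nz_ints_divs_le card_nz_ints_le) (auto intro: sum_nonneg)
    finally show ?thesis by (simp add: mult_ac)
  qed
  also have "(\<Sum>(u,v)\<in>T. ?t (u + v)) \<le> 8 * U * V * ?M"
  proof (cases "V \<le> U")
    case True
    have "(\<Sum>(u,v)\<in>T. ?t (u + v)) = (\<Sum>(v,u)\<in>Sigma (nz_ints V) (\<lambda>v. {u\<in>nz_ints U. u + v \<noteq> 0}). ?t (u + v))"
      by (rule sum.reindex_bij_witness[where i = "\<lambda>(v,u). (u,v)" and j = "\<lambda>(u,v). (v,u)"]) (auto simp: T_def)
    also have "\<dots> = (\<Sum>v\<in>nz_ints V. \<Sum>u\<in>{u\<in>nz_ints U. u + v \<noteq> 0}. ?t (u + v))"
      by (rule sum.Sigma[symmetric]) auto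
    also have "\<dots> \<le> 8 * U * V * ?M" using True assms by (intro sum_shift_nz_ints_le) auto
    finally show ?thesis .
  next
    case False
    have "(\<Sum>(u,v)\<in>T. ?t (u + v)) = (\<Sum>(v,u)\<in>Sigma (nz_ints U) (\<lambda>v. {u\<in>nz_ints V. u + v \<noteq> 0}). ?t (u + v))"
      by (rule sum.reindex_bij_witness[where i = "\<lambda>x. x" and j = "\<lambda>x. x"]) (auto simp: T_def add.commute)
    also have "\<dots> = (\<Sum>v\<in>nz_ints U. \<Sum>u\<in>{u\<in>nz_ints V. u + v \<noteq> 0}. ?t (u + v))"
      by (rule sum.Sigma[symmetric]) auto
    also have "\<dots> \<le> 8 * V * U * ?M" using False assms by (intro sum_shift_nz_ints_le) auto
    finally show ?thesis by (simp add: mult_ac)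
  qed
  finally show ?thesis unfolding T_def by (simp add: mult_ac)
qed

section \<open>Divisor sums over pairs of numerators\<close>

lemma sum_le_sum_inj:
  fixes f :: "'a \<Rightarrow> real" and g :: "'b \<Rightarrow> real"
  assumes "finite T" "inj_on j S" "j ` S \<subseteq> T" "\<And>s. s \<in> S \<Longrightarrow> f s \<le> g (j s)" "\<And>t. t \<in> T \<Longrightarrow> g t \<ge> 0"
  shows "sum f S \<le> sum g T"
proof -
  have "sum f S \<le> (\<Sum>s\<in>S. g (j s))" using assms(4) by (rule sum_mono)
  also have "\<dots> = sum g (j ` S)" using assms(2) by (simp add: sum.reindex)
  also have "\<dots> \<le> sum g T" using assms by (intro sum_mono2) auto
  finally show ?thesis .
qed

text \<open>A power mean inequality, by induction from Chebyshev's sum inequality, that is, from the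
  nonnegativity of the double sum of
  \<open>(x i - x j) * (x i ^ Suc m - x j ^ Suc m)\<close>.\<close>

lemma sum_power_le_card:
  fixes x :: "'a \<Rightarrow> real"
  assumes "\<And>i. i \<in> A \<Longrightarrow> x i \<ge> 0"
  shows "(\<Sum>i\<in>A. x i) ^ Suc m \<le> real (card A) ^ m * (\<Sum>i\<in>A. x i ^ Suc m)"
proof (induction m)
  case (Suc m)
  have "0 \<le> (\<Sum>i\<in>A. \<Sum>j\<in>A. (x i - x j) * (x i ^ Suc m - x j ^ Suc m))"
  proof (intro sum_nonneg)
    fix i j assume ij: "i \<in> A" "j \<in> A"
    show "0 \<le> (x i - x j) * (x i ^ Suc m - x j ^ Suc m)"
    proof (cases "x i \<le> x j")
      case True
      then have "x i ^ Suc m \<le> x j ^ Suc m" using assms ij by (intro power_mono) auto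
      then show ?thesis using True by (intro mult_nonpos_nonpos) auto
    next
      case False
      then have "x j ^ Suc m \<le> x i ^ Suc m" using assms ij by (intro power_mono) auto
      then show ?thesis using False by (intro mult_nonneg_nonneg) auto
    qed
  qed
  also have "\<dots> = (\<Sum>i\<in>A. \<Sum>j\<in>A. x i ^ Suc (Suc m)) - (\<Sum>i\<in>A. \<Sum>j\<in>A. x i ^ Suc m * x j)
      - ((\<Sum>i\<in>A. \<Sum>j\<in>A. x i * x j ^ Suc m) - (\<Sum>i\<in>A. \<Sum>j\<in>A. x j ^ Suc (Suc m)))"
    by (simp only: sum_subtractf[symmetric]) (intro sum.cong refl, simp add: algebra_simps)
  also have "\<dots> = 2 * (real (card A) * (\<Sum>i\<in>A. x i ^ Suc (Suc m)) - (\<Sum>i\<in>A. x i) * (\<Sum>i\<in>A. x i ^ Suc m))"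
  proof -
    have "(\<Sum>i\<in>A. \<Sum>j\<in>A. x i ^ Suc m * x j) = (\<Sum>i\<in>A. x i ^ Suc m) * (\<Sum>i\<in>A. x i)"
      "(\<Sum>i\<in>A. \<Sum>j\<in>A. x i * x j ^ Suc m) = (\<Sum>i\<in>A. x i) * (\<Sum>i\<in>A. x i ^ Suc m)"
      by (simp_all only: sum_product)
    moreover have "(\<Sum>i\<in>A. \<Sum>j\<in>A. x i ^ Suc (Suc m)) = real (card A) * (\<Sum>i\<in>A. x i ^ Suc (Suc m))"
      "(\<Sum>i\<in>A. \<Sum>j\<in>A. x j ^ Suc (Suc m)) = real (card A) * (\<Sum>i\<in>A. x i ^ Suc (Suc m))"
      by (simp_all only: sum_constant sum_distrib_left)
    moreover have "a - b - (c - d) = 2 * (P - Q)" if "b = Q" "c = Q" "a = P" "d = P" for a b c d P Q :: real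
      using that by simp
    ultimately show ?thesis by (simp only: mult.commute[of "\<Sum>i\<in>A. x i ^ Suc m"])
  qed
  finally have *: "(\<Sum>i\<in>A. x i) * (\<Sum>i\<in>A. x i ^ Suc m) \<le> real (card A) * (\<Sum>i\<in>A. x i ^ Suc (Suc m))" by simp
  have "(\<Sum>i\<in>A. x i) ^ Suc (Suc m) = (\<Sum>i\<in>A. x i) * (\<Sum>i\<in>A. x i) ^ Suc m" by simp
  also have "\<dots> \<le> (\<Sum>i\<in>A. x i) * (real (card A) ^ m * (\<Sum>i\<in>A. x i ^ Suc m))"
    by (intro mult_left_mono Suc sum_nonneg assms)
  also have "\<dots> = real (card A) ^ m * ((\<Sum>i\<in>A. x i) * (\<Sum>i\<in>A. x i ^ Suc m))" by simp
  also have "\<dots> \<le> real (card A) ^ m * (real (card A) * (\<Sum>i\<in>A. x i ^ Suc (Suc m)))"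
    by (intro mult_left_mono *) simp
  finally show ?case by (simp add: mult_ac)
qed simp

lemma finite_dvd_nat_abs: "u \<noteq> 0 \<Longrightarrow> finite {d. d dvd nat \<bar>u\<bar>}" "u \<noteq> 0 \<Longrightarrow> finite {d. int d dvd u}"
  using finite_divs[of "nat \<bar>u\<bar>"] by simp_all

text \<open>For fractions with numerators \<open>a1\<close>, \<open>a2\<close> and denominators
  \<open>w * h * y1\<close>, \<open>w * h * y2\<close>, the form \<open>a1 * y2 + a2 * y1\<close> is
  the numerator of their sum over the denominator \<open>w * h * y1 * y2\<close>. Its divisors will
  count the possible \<open>w\<close>.\<close>

definition nondeg_pairs :: "real \<Rightarrow> real \<Rightarrow> nat \<Rightarrow> nat \<Rightarrow> (int \<times> int) set" where
  "nondeg_pairs A1 A2 y1 y2 = {(a1,a2). a1 \<in> nz_ints A1 \<and> a2 \<in> nz_ints A2 \<and> a1 * int y2 + a2 * int y1 \<noteq> 0}"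

definition pair_divisor_sum :: "real \<Rightarrow> real \<Rightarrow> nat \<Rightarrow> nat \<Rightarrow> nat \<Rightarrow> real" where
  "pair_divisor_sum A1 A2 y1 y2 K = (\<Sum>(a1,a2)\<in>nondeg_pairs A1 A2 y1 y2. real (divs (nat \<bar>a1 * int y2 + a2 * int y1\<bar>)) ^ K)"

lemma nondeg_pairs_subset: "nondeg_pairs A1 A2 y1 y2 \<subseteq> nz_ints A1 \<times> nz_ints A2" by (auto simp: nondeg_pairs_def)
lemma finite_nondeg_pairs [simp]: "finite (nondeg_pairs A1 A2 y1 y2)" by (rule finite_subset[OF nondeg_pairs_subset]) simp
lemma pair_divisor_sum_nonneg: "pair_divisor_sum A1 A2 y1 y2 K \<ge> 0" by (auto simp: pair_divisor_sum_def intro!: sum_nonneg)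

lemma pair_divisor_sum_power_le:
  assumes "A1 \<ge> 0" "A2 \<ge> 0" 
  shows "pair_divisor_sum A1 A2 y1 y2 1 ^ Suc m \<le> (4 * A1 * A2) ^ m * pair_divisor_sum A1 A2 y1 y2 (Suc m)"
proof -
  have "real (card (nondeg_pairs A1 A2 y1 y2)) \<le> real (card (nz_ints A1 \<times> nz_ints A2))"
    by (intro of_nat_mono card_mono nondeg_pairs_subset) simp
  also have "\<dots> \<le> (2 * A1) * (2 * A2)" unfolding card_cartesian_product of_nat_mult
    using assms by (intro mult_mono card_nz_ints_le) auto
  finally have c: "real (card (nondeg_pairs A1 A2 y1 y2)) \<le> 4 * A1 * A2" by simp
  have "pair_divisor_sum A1 A2 y1 y2 1 ^ Suc m \<le> real (card (nondeg_pairs A1 A2 y1 y2)) ^ m * pair_divisor_sum A1 A2 y1 y2 (Suc m)"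
    unfolding pair_divisor_sum_def using sum_power_le_card[of "nondeg_pairs A1 A2 y1 y2" "\<lambda>(a1,a2). real (divs (nat \<bar>a1 * int y2 + a2 * int y1\<bar>))" m]
    by (simp add: case_prod_unfold)
  also have "\<dots> \<le> (4 * A1 * A2) ^ m * pair_divisor_sum A1 A2 y1 y2 (Suc m)"
    by (intro mult_right_mono power_mono c pair_divisor_sum_nonneg) auto
  finally show ?thesis .
qed

text \<open>Put \<open>u = a1 * y2\<close> and \<open>v = a2 * y1\<close>. Then \<open>y2\<close>
  divides \<open>u\<close> and \<open>y1\<close> divides \<open>v\<close>, so a pair
  \<open>(u, v)\<close> arises at most \<open>divs u * divs v\<close> times; these factors are
  absorbed by passing from \<open>K\<close> to \<open>Suc K\<close>.\<close>

lemma sum_box_divs_le: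
  fixes Q1 Q2 Y1 Y2 :: real and B1 B2 :: "nat set"
  assumes "0 \<le> Q1" "0 \<le> Q2" "0 \<le> Y1" "0 \<le> Y2" "finite B1" "finite B2"
    and B: "\<And>y. y \<in> B1 \<Longrightarrow> 1 \<le> y \<and> real y \<le> Y1" "\<And>y. y \<in> B2 \<Longrightarrow> 1 \<le> y \<and> real y \<le> Y2"
    and L: "1 + ln (2 + 2 * (Q1 * Y1 * Y2)) \<le> L" "1 + ln (2 + 2 * (Q2 * Y1 * Y2)) \<le> L"
  shows "(\<Sum>y1\<in>B1. \<Sum>y2\<in>B2. (real (divs y1) * real (divs y2)) ^ K * pair_divisor_sum (Q1 * real y1) (Q2 * real y2) y1 y2 K)
      \<le> 16 * (Q1 * Y1 * Y2) * (Q2 * Y1 * Y2) * L ^ (2 ^ (3 * Suc K))"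
proof -
  let ?U = "Q1 * Y1 * Y2" and ?V = "Q2 * Y1 * Y2"
  define T where "T = {(u,v). u \<in> nz_ints ?U \<and> v \<in> nz_ints ?V \<and> u + v \<noteq> 0}"
  define S where "S = Sigma (B1 \<times> B2) (\<lambda>(y1,y2). nondeg_pairs (Q1 * real y1) (Q2 * real y2) y1 y2)"
  let ?d = "\<lambda>u. real (divs (nat \<bar>u\<bar>))"
  define W where "W = Sigma T (\<lambda>(u,v). {d. d dvd nat \<bar>u\<bar>} \<times> {d. d dvd nat \<bar>v\<bar>})"
  have finT: "finite T" by (rule finite_subset[of _ "nz_ints ?U \<times> nz_ints ?V"]) (auto simp: T_def)
  have Tn0: "u \<noteq> 0" "v \<noteq> 0" if "(u,v) \<in> T" for u v using that by (auto simp: T_def nz_ints_def)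
  have finW: "finite W" unfolding W_def using finT Tn0 by (intro finite_SigmaI) (auto intro!: finite_cartesian_product finite_dvd_nat_abs)
  have "(\<Sum>y1\<in>B1. \<Sum>y2\<in>B2. (real (divs y1) * real (divs y2)) ^ K * pair_divisor_sum (Q1 * real y1) (Q2 * real y2) y1 y2 K)
      = (\<Sum>(y1,y2)\<in>B1 \<times> B2. \<Sum>(a1,a2)\<in>nondeg_pairs (Q1 * real y1) (Q2 * real y2) y1 y2.
           (real (divs y1) * real (divs y2) * ?d (a1 * int y2 + a2 * int y1)) ^ K)"
    unfolding pair_divisor_sum_def sum.cartesian_product by (simp add: sum_distrib_left case_prod_unfold power_mult_distrib)
  also have "\<dots> = (\<Sum>((y1,y2),(a1,a2))\<in>S. (real (divs y1) * real (divs y2) * ?d (a1 * int y2 + a2 * int y1)) ^ K)"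
    unfolding S_def case_prod_unfold by (subst sum.Sigma) (use assms in \<open>auto simp: case_prod_unfold\<close>)
  also have "\<dots> \<le> (\<Sum>((u,v),_)\<in>W. (?d u * ?d v * ?d (u + v)) ^ K)"
  proof (rule sum_le_sum_inj[where j = "\<lambda>((y1,y2),(a1,a2)). ((a1 * int y2, a2 * int y1), (y2, y1))", OF finW])
    have pos: "0 < y1" "0 < y2" if "((y1,y2),(a1,a2)) \<in> S" for y1 y2 a1 a2
      using that B by (auto simp: S_def Suc_le_eq)
    show "inj_on (\<lambda>((y1,y2),(a1,a2)). ((a1 * int y2, a2 * int y1), (y2, y1))) S"
    proof (rule inj_onI)
      fix s t assume st: "s \<in> S" "t \<in> S"
        "(\<lambda>((y1,y2),(a1,a2)). ((a1 * int y2, a2 * int y1), (y2, y1))) s = (\<lambda>((y1,y2),(a1,a2)). ((a1 * int y2, a2 * int y1), (y2, y1))) t"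
      obtain y1 y2 a1 a2 where s: "s = ((y1,y2),(a1,a2))" by (metis prod.exhaust)
      obtain z1 z2 b1 b2 where t: "t = ((z1,z2),(b1,b2))" by (metis prod.exhaust)
      from pos[of y1 y2 a1 a2] st show "s = t" by (auto simp: s t)
    qed
    show "(\<lambda>((y1,y2),(a1,a2)). ((a1 * int y2, a2 * int y1), (y2, y1))) ` S \<subseteq> W"
    proof clarify
      fix y1 y2 a1 a2 assume s: "((y1,y2),(a1,a2)) \<in> S"
      have y: "y1 \<in> B1" "y2 \<in> B2" "1 \<le> y1" "real y1 \<le> Y1" "1 \<le> y2" "real y2 \<le> Y2" using s B by (auto simp: S_def)
      have a: "a1 \<noteq> 0" "a2 \<noteq> 0" "\<bar>real_of_int a1\<bar> \<le> Q1 * real y1" "\<bar>real_of_int a2\<bar> \<le> Q2 * real y2" "a1 * int y2 + a2 * int y1 \<noteq> 0"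
        using s by (auto simp: S_def nondeg_pairs_def nz_ints_def)
      have "\<bar>real_of_int a1\<bar> * real y2 \<le> (Q1 * Y1) * Y2"
        using a y assms by (intro mult_mono order_trans[OF a(3)]) (auto intro: mult_left_mono)
      moreover have "\<bar>real_of_int a2\<bar> * real y1 \<le> (Q2 * Y2) * Y1"
        using a y assms by (intro mult_mono order_trans[OF a(4)]) (auto intro: mult_left_mono)
      ultimately have "(a1 * int y2, a2 * int y1) \<in> T"
        using a y by (auto simp: T_def nz_ints_def abs_mult mult_ac)
      then show "((a1 * int y2, a2 * int y1), (y2, y1)) \<in> W" by (auto simp: W_def nat_abs_mult_distrib)
    qed
  next
    fix s assume s: "s \<in> S"
    obtain y1 y2 a1 a2 where e: "s = ((y1,y2),(a1,a2))" by (metis prod.exhaust)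
    have y: "1 \<le> y1" "1 \<le> y2" "a1 \<noteq> 0" "a2 \<noteq> 0" using s e B by (auto simp: S_def nondeg_pairs_def nz_ints_def)
    have "divs y2 \<le> divs (nat \<bar>a1 * int y2\<bar>)" "divs y1 \<le> divs (nat \<bar>a2 * int y1\<bar>)"
      using y by (auto intro!: divs_mono simp: nat_abs_mult_distrib)
    then have "real (divs y1) * real (divs y2) \<le> ?d (a2 * int y1) * ?d (a1 * int y2)" by (intro mult_mono) auto
    then have "real (divs y1) * real (divs y2) * ?d (a1 * int y2 + a2 * int y1) \<le> ?d (a1 * int y2) * ?d (a2 * int y1) * ?d (a1 * int y2 + a2 * int y1)"
      by (intro mult_right_mono) (auto simp: mult_ac)
    then show "(\<lambda>((y1,y2),(a1,a2)). (real (divs y1) * real (divs y2) * ?d (a1 * int y2 + a2 * int y1)) ^ K) s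
       \<le> (\<lambda>((u,v),_). (?d u * ?d v * ?d (u + v)) ^ K) ((\<lambda>((y1,y2),(a1,a2)). ((a1 * int y2, a2 * int y1), (y2, y1))) s)"
      by (simp add: e power_mono)
  qed auto
  also have "\<dots> = (\<Sum>(u,v)\<in>T. \<Sum>_\<in>{d. d dvd nat \<bar>u\<bar>} \<times> {d. d dvd nat \<bar>v\<bar>}. (?d u * ?d v * ?d (u + v)) ^ K)"
    unfolding W_def case_prod_unfold by (subst sum.Sigma[OF finT]) (use Tn0 in \<open>auto intro!: finite_cartesian_product finite_dvd_nat_abs simp: case_prod_unfold\<close>)
  also have "\<dots> = (\<Sum>(u,v)\<in>T. ?d u * ?d v * (?d u * ?d v * ?d (u + v)) ^ K)"
    by (simp add: card_cartesian_product divs_def)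
  also have "\<dots> \<le> (\<Sum>(u,v)\<in>T. (?d u * ?d v * ?d (u + v)) ^ Suc K)"
  proof (intro sum_mono, clarify)
    fix u v assume "(u,v) \<in> T"
    then have "1 \<le> ?d (u + v)" using divs_pos[of "nat \<bar>u + v\<bar>"] by (auto simp: T_def)
    then have "?d u * ?d v * 1 \<le> ?d u * ?d v * ?d (u + v)" by (intro mult_left_mono) auto
    then have "?d u * ?d v * (?d u * ?d v * ?d (u + v)) ^ K \<le> ?d u * ?d v * ?d (u + v) * (?d u * ?d v * ?d (u + v)) ^ K"
      by (intro mult_right_mono) auto
    then show "?d u * ?d v * (?d u * ?d v * ?d (u + v)) ^ K \<le> (?d u * ?d v * ?d (u + v)) ^ Suc K" by simp
  qed
  also have "\<dots> \<le> 16 * ?U * ?V * L ^ (2 ^ (3 * Suc K))"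
    unfolding T_def using assms by (intro sum_triple_divs_le) auto
  finally show ?thesis by (simp add: mult_ac)
qed

text \<open>The factor 2 comes from \<open>ln 2 \<ge> 1 / 2\<close>.\<close>

lemma floor_log_le_ln: "n > 0 \<Longrightarrow> real (floor_log n) \<le> 2 * ln (real n)"
proof -
  assume n: "n > 0"
  have "ln (2 ^ floor_log n) \<le> ln (real n)"
    using floor_log_exp2_le[OF n] n by (subst ln_le_cancel_iff) (auto simp flip: of_nat_le_iff)
  then have "real (floor_log n) * ln 2 \<le> ln (real n)" by (simp add: ln_realpow)
  moreover have "real (floor_log n) * (1/2) \<le> real (floor_log n) * ln 2"
    using ln_le_minus_one[of "1/2::real"] by (intro mult_left_mono) (auto simp: ln_div)
  ultimately show ?thesis by linarith
qed

text \<open>On dyadic blocks of \<open>y1\<close> and \<open>y2\<close> the denominators are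
  constant up to bounded factors, and \<open>sum_box_divs_le\<close> applies with ranges
  \<open>2 * 2 ^ f\<close>. It gives \<open>256 = 16 * 4 * 4\<close> for each of the at most
  \<open>(2 * L) ^ 2\<close> pairs of blocks.\<close>

lemma sum_dyadic_divs_le:
  fixes Q1 Q2 :: real
  assumes Q: "0 < Q1" "0 < Q2" "Q1 \<le> 2 * real z ^ 2" "Q2 \<le> 2 * real z ^ 2" and z: "z > 0"
    and L: "1 + ln (2 + 16 * real z ^ 4) \<le> L"
  shows "(\<Sum>y1=1..z. \<Sum>y2=1..z. (real (divs y1) * real (divs y2)) ^ K / (real y1 * real y2) *
          (pair_divisor_sum (Q1 * real y1) (Q2 * real y2) y1 y2 K / ((Q1 * real y1) * (Q2 * real y2)))) \<le> 1024 * L ^ (2 ^ (3 * Suc K) + 2)"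
proof -
  let ?B = "\<lambda>f. {y\<in>{1..z}. floor_log y = f}"
  let ?g = "\<lambda>y1 y2. (real (divs y1) * real (divs y2)) ^ K / (real y1 * real y2) *
          (pair_divisor_sum (Q1 * real y1) (Q2 * real y2) y1 y2 K / ((Q1 * real y1) * (Q2 * real y2)))"
  let ?F = "{..floor_log z}"
  have z1: "real z \<ge> 1" using z by simp
  have cF: "real (card ?F) \<le> 2 * L"
  proof -
    have "ln (real z) \<le> ln (2 + 16 * real z ^ 4)"
    proof -
      have "real z ^ 1 \<le> real z ^ 4" using z1 by (intro power_increasing) auto
      then have "real z \<le> 2 + 16 * real z ^ 4" unfolding power_one_right using z1 by linarith
      then show ?thesis using z1 by (subst ln_le_cancel_iff) auto
    qed
    then show ?thesis using floor_log_le_ln[OF z] L by simp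
  qed
  then have L0: "L \<ge> 0" by (meson mult_nonneg_nonneg of_nat_0_le_iff order_trans zero_le_mult_iff zero_le_numeral not_numeral_le_zero linorder_not_le mult_le_0_iff)
  have "(\<Sum>y1=1..z. \<Sum>y2=1..z. ?g y1 y2) = (\<Sum>y1=1..z. \<Sum>f2\<in>?F. \<Sum>y2\<in>?B f2. ?g y1 y2)"
    by (intro sum.cong refl sum.group[symmetric]) (auto intro: floor_log_le_iff)
  also have "\<dots> = (\<Sum>f2\<in>?F. \<Sum>y1=1..z. \<Sum>y2\<in>?B f2. ?g y1 y2)" by (rule sum.swap)
  also have "\<dots> = (\<Sum>f2\<in>?F. \<Sum>f1\<in>?F. \<Sum>y1\<in>?B f1. \<Sum>y2\<in>?B f2. ?g y1 y2)"
    by (intro sum.cong refl sum.group[symmetric]) (auto intro: floor_log_le_iff)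
  also have "\<dots> \<le> (\<Sum>f2\<in>?F. \<Sum>f1\<in>?F. 256 * L ^ (2 ^ (3 * Suc K)))"
  proof (intro sum_mono)
    fix f1 f2 assume f: "f1 \<in> ?F" "f2 \<in> ?F"
    have up: "(2::real) ^ f \<le> real z" if "f \<in> ?F" for f
    proof -
      have "(2::nat) ^ f \<le> 2 ^ floor_log z" using that by (intro power_increasing) auto
      also have "\<dots> \<le> z" by (rule floor_log_exp2_le[OF z])
      finally show ?thesis by (simp flip: of_nat_le_iff)
    qed
    have By: "2 ^ f \<le> real y" "real y \<le> 2 * 2 ^ f" "1 \<le> y" if "y \<in> ?B f" for y f
    proof -
      show y1: "1 \<le> y" using that by simp
      have "real (2 ^ f) \<le> real y" using that floor_log_exp2_le[of y] y1 by (intro of_nat_mono) auto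
      then show "2 ^ f \<le> real y" by simp
      have "real y \<le> real (2 * 2 ^ f)" using that floor_log_exp2_ge[of y] by (intro of_nat_mono) auto
      then show "real y \<le> 2 * 2 ^ f" by simp
    qed
    define c where "c = (1::real) / (Q1 * Q2 * 4 ^ f1 * 4 ^ f2)"
    have c0: "c \<ge> 0" using Q by (simp add: c_def)
    have "(\<Sum>y1\<in>?B f1. \<Sum>y2\<in>?B f2. ?g y1 y2) \<le> (\<Sum>y1\<in>?B f1. \<Sum>y2\<in>?B f2. c * ((real (divs y1) * real (divs y2)) ^ K * pair_divisor_sum (Q1 * real y1) (Q2 * real y2) y1 y2 K))"
    proof (intro sum_mono)
      fix y1 y2 assume y: "y1 \<in> ?B f1" "y2 \<in> ?B f2"
      have "Q1 * Q2 * 4 ^ f1 * 4 ^ f2 = (2^f1 * 2^f2) * ((Q1 * 2^f1) * (Q2 * 2^f2))"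
      proof -
        have "(4::real) ^ f = 2^f * 2^f" for f by (simp flip: power_mult_distrib)
        then show ?thesis by (simp add: mult_ac)
      qed
      also have "\<dots> \<le> (real y1 * real y2) * ((Q1 * real y1) * (Q2 * real y2))"
        using By[OF y(1)] By[OF y(2)] Q by (intro mult_mono mult_left_mono) auto
      finally have "1 / ((real y1 * real y2) * ((Q1 * real y1) * (Q2 * real y2))) \<le> c"
        unfolding c_def using Q by (intro divide_left_mono) (use By[OF y(1)] By[OF y(2)] in auto)
      then have "1 / ((real y1 * real y2) * ((Q1 * real y1) * (Q2 * real y2))) * ((real (divs y1) * real (divs y2)) ^ K * pair_divisor_sum (Q1 * real y1) (Q2 * real y2) y1 y2 K)
          \<le> c * ((real (divs y1) * real (divs y2)) ^ K * pair_divisor_sum (Q1 * real y1) (Q2 * real y2) y1 y2 K)"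
        by (intro mult_right_mono mult_nonneg_nonneg pair_divisor_sum_nonneg) auto
      then show "?g y1 y2 \<le> c * ((real (divs y1) * real (divs y2)) ^ K * pair_divisor_sum (Q1 * real y1) (Q2 * real y2) y1 y2 K)"
        by (simp add: mult_ac)
    qed
    also have "\<dots> = c * (\<Sum>y1\<in>?B f1. \<Sum>y2\<in>?B f2. (real (divs y1) * real (divs y2)) ^ K * pair_divisor_sum (Q1 * real y1) (Q2 * real y2) y1 y2 K)"
      by (simp add: sum_distrib_left)
    also have "\<dots> \<le> c * (16 * (Q1 * (2 * 2^f1) * (2 * 2^f2)) * (Q2 * (2 * 2^f1) * (2 * 2^f2)) * L ^ (2 ^ (3 * Suc K)))"
    proof (intro mult_left_mono c0 sum_box_divs_le)
      have bd: "1 + ln (2 + 2 * (Q * (2 * 2^f1) * (2 * 2^f2))) \<le> L" if "0 < Q" "Q \<le> 2 * real z ^ 2" for Q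
      proof -
        have "Q * 2^f1 * 2^f2 \<le> (2 * real z ^ 2) * real z * real z"
          using that up[OF f(1)] up[OF f(2)] by (intro mult_mono) auto
        then have "2 + 2 * (Q * (2 * 2^f1) * (2 * 2^f2)) \<le> 2 + 16 * real z ^ 4" by (simp add: power2_eq_square power4_eq_xxxx)
        then have "ln (2 + 2 * (Q * (2 * 2^f1) * (2 * 2^f2))) \<le> ln (2 + 16 * real z ^ 4)"
          using that by (subst ln_le_cancel_iff) (auto intro!: add_pos_nonneg)
        then show ?thesis using L by linarith
      qed
      show "1 + ln (2 + 2 * (Q1 * (2 * 2^f1) * (2 * 2^f2))) \<le> L" using Q by (intro bd)
      show "1 + ln (2 + 2 * (Q2 * (2 * 2^f1) * (2 * 2^f2))) \<le> L" using Q by (intro bd)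
    qed (use Q By in auto)
    also have "\<dots> = 256 * L ^ (2 ^ (3 * Suc K))"
    proof -
      have "(4::real) ^ f = 2^f * 2^f" for f by (simp flip: power_mult_distrib)
      then show ?thesis using Q by (simp add: c_def field_simps)
    qed
    finally show "(\<Sum>y1\<in>?B f1. \<Sum>y2\<in>?B f2. ?g y1 y2) \<le> 256 * L ^ (2 ^ (3 * Suc K))" .
  qed
  also have "\<dots> = real (card ?F) * real (card ?F) * (256 * L ^ (2 ^ (3 * Suc K)))" by simp
  also have "\<dots> \<le> (2 * L) * (2 * L) * (256 * L ^ (2 ^ (3 * Suc K)))"
    using L0 by (intro mult_right_mono mult_mono cF) auto
  also have "\<dots> = 1024 * L ^ (2 ^ (3 * Suc K) + 2)" by (simp add: power_add power2_eq_square)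
  finally show ?thesis .
qed

text \<open>Each coordinate other than \<open>i\<close> and \<open>j\<close> is free and contributes
  a factor \<open>card X\<close>.\<close>

lemma sum_PiE_two_le:
  fixes E :: "'b \<Rightarrow> 'b \<Rightarrow> real"
  assumes "finite I" "i \<in> I" "j \<in> I" "i \<noteq> j" "finite X" "\<And>a b. E a b \<ge> 0"
  shows "(\<Sum>c\<in>PiE I (\<lambda>_. X). E (c i) (c j)) \<le> real (card X) ^ (card I - 2) * (\<Sum>a\<in>X. \<Sum>b\<in>X. E a b)"
proof -
  let ?P = "PiE I (\<lambda>_. X)"
  have finP: "finite ?P" using assms by (intro finite_PiE) auto
  have "(\<Sum>c\<in>?P. E (c i) (c j)) = (\<Sum>x\<in>X \<times> X. \<Sum>c | c \<in> ?P \<and> (c i, c j) = x. E (c i) (c j))"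
    using assms finP by (intro sum.group[symmetric]) (auto simp: PiE_mem)
  also have "\<dots> = (\<Sum>x\<in>X \<times> X. real (card {c \<in> ?P. (c i, c j) = x}) * E (fst x) (snd x))"
  proof (rule sum.cong[OF refl])
    fix x assume "x \<in> X \<times> X"
    have "(\<Sum>c | c \<in> ?P \<and> (c i, c j) = x. E (c i) (c j)) = (\<Sum>c | c \<in> ?P \<and> (c i, c j) = x. E (fst x) (snd x))"
      by (rule sum.cong) auto
    then show "(\<Sum>c | c \<in> ?P \<and> (c i, c j) = x. E (c i) (c j)) = real (card {c \<in> ?P. (c i, c j) = x}) * E (fst x) (snd x)"
      by simp
  qed
  also have "\<dots> \<le> (\<Sum>x\<in>X \<times> X. real (card X) ^ (card I - 2) * E (fst x) (snd x))"
  proof (intro sum_mono mult_right_mono assms)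
    fix x
    have "card {c \<in> ?P. (c i, c j) = x} \<le> card (PiE (I - {i,j}) (\<lambda>_. X))"
    proof (rule card_inj_on_le[where f = "\<lambda>c. restrict c (I - {i,j})"])
      show "inj_on (\<lambda>c. restrict c (I - {i,j})) {c \<in> ?P. (c i, c j) = x}"
      proof (rule inj_onI, clarify)
        fix c d assume cd: "c \<in> ?P" "d \<in> ?P" "d i = c i" "d j = c j" "restrict c (I - {i,j}) = restrict d (I - {i,j})"
        show "c = d"
        proof (rule PiE_ext[OF cd(1,2)])
          fix l assume "l \<in> I"
          then show "c l = d l" using cd(3,4) fun_cong[OF cd(5), of l] by (cases "l = i \<or> l = j") auto
        qed
      qed
      show "(\<lambda>c. restrict c (I - {i,j})) ` {c \<in> ?P. (c i, c j) = x} \<subseteq> PiE (I - {i,j}) (\<lambda>_. X)"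
        by (rule image_subsetI) (simp only: restrict_PiE_iff, auto)
      show "finite (PiE (I - {i,j}) (\<lambda>_. X))" using assms by (intro finite_PiE) auto
    qed
    also have "\<dots> = card X ^ (card I - 2)"
    proof -
      have "card (I - {i,j}) = card I - card {i,j}" using assms by (intro card_Diff_subset) auto
      also have "card {i,j} = 2" using assms(4) by simp
      finally show ?thesis using assms(1) by (simp add: card_PiE)
    qed
    finally have "real (card {c \<in> ?P. (c i, c j) = x}) \<le> real (card X ^ (card I - 2))" by (rule of_nat_mono)
    then show "real (card {c \<in> ?P. (c i, c j) = x}) \<le> real (card X) ^ (card I - 2)" by simp
  qed
  also have "\<dots> = real (card X) ^ (card I - 2) * (\<Sum>a\<in>X. \<Sum>b\<in>X. E a b)"
    by (simp add: sum_distrib_left sum.cartesian_product case_prod_unfold)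
  finally show ?thesis .
qed

text \<open>Write \<open>h = gcd a b\<close>, \<open>a = h * y1\<close>, \<open>b = h * y2\<close>.
  Then \<open>lcm a b = h * y1 * y2\<close> divides \<open>D\<close>, say with quotient
  \<open>t\<close>, and by submultiplicativity the weight of \<open>D\<close> splits over
  \<open>t\<close>, \<open>h\<close>, \<open>y1\<close>, \<open>y2\<close>.\<close>

lemma sum_common_multiples_le:
  fixes E' :: "nat \<Rightarrow> nat \<Rightarrow> nat \<Rightarrow> real"
  assumes "\<And>h a b. E' h a b \<ge> 0"
  shows "(\<Sum>D=1..z. (1 / real D) * (real (divs D) ^ m * (\<Sum>a | a dvd D. \<Sum>b | b dvd D. E' (gcd a b) (a div gcd a b) (b div gcd a b))))
    \<le> (\<Sum>t=1..z. real (divs t) ^ m * (1 / real t)) * (\<Sum>h=1..z. real (divs h) ^ m * (1 / real h) * 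
        (\<Sum>y1=1..z. \<Sum>y2=1..z. (real (divs y1) * real (divs y2)) ^ m / (real y1 * real y2) * E' h y1 y2))"
proof -
  define S where "S = Sigma {1..z} (\<lambda>D. {a. a dvd D} \<times> {b. b dvd D})"
  define T where "T = {1..z} \<times> {1..z} \<times> {1..z} \<times> {1..z}"
  let ?w = "\<lambda>n. real (divs n) ^ m * (1 / real n)"
  have "(\<Sum>D=1..z. (1 / real D) * (real (divs D) ^ m * (\<Sum>a | a dvd D. \<Sum>b | b dvd D. E' (gcd a b) (a div gcd a b) (b div gcd a b))))
     = (\<Sum>(D,a,b)\<in>S. ?w D * E' (gcd a b) (a div gcd a b) (b div gcd a b))"
    unfolding S_def by (subst sum.Sigma[symmetric]) 
      (auto simp: sum.cartesian_product sum_distrib_left finite_divs case_prod_unfold mult_ac intro!: sum.cong)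
  also have "\<dots> \<le> (\<Sum>(t,h,y1,y2)\<in>T. ?w t * (?w h * (?w y1 * ?w y2 * E' h y1 y2)))"
  proof (rule sum_le_sum_inj[where j = "\<lambda>(D,a,b). (D div (gcd a b * (a div gcd a b) * (b div gcd a b)), gcd a b, a div gcd a b, b div gcd a b)"])
    show "finite T" by (simp add: T_def)
    have key: "\<exists>t h y1 y2. s = (t * (h * y1 * y2), h * y1, h * y2) \<and> h = gcd a b \<and> y1 = a div gcd a b \<and> y2 = b div gcd a b
        \<and> D div (h * y1 * y2) = t \<and> 0 < t \<and> 0 < h \<and> 0 < y1 \<and> 0 < y2 \<and> t * (h * y1 * y2) \<le> z"
      if s: "s \<in> S" "s = (D,a,b)" for s D a b
    proof -
      define h where "h = gcd a b" 
      define y1 where "y1 = a div h" define y2 where "y2 = b div h"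
      have D: "1 \<le> D" "D \<le> z" "a dvd D" "b dvd D" using s by (auto simp: S_def)
      have pos: "0 < a" "0 < b" using D by (auto intro: Nat.gr0I)
      then have h: "h > 0" "a = h * y1" "b = h * y2" by (auto simp: h_def y1_def y2_def)
      have "lcm a b = h * y1 * y2"
      proof -
        have "h * lcm a b = a * b" unfolding h_def by simp
        then have "h * lcm a b = h * (h * y1 * y2)" using h by simp
        then show ?thesis using h(1) by simp
      qed
      then have "h * y1 * y2 dvd D" using D by (metis lcm_least)
      then obtain t where t: "D = t * (h * y1 * y2)" by (metis dvdE mult.commute)
      have "0 < t" "0 < y1" "0 < y2" using t D(1) pos h by (auto intro!: Nat.gr0I)
      moreover have "s = (t * (h * y1 * y2), h * y1, h * y2)" using s(2) t h(2,3) by simp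
      moreover have "D div (h * y1 * y2) = t" using t h(1) \<open>0 < y1\<close> \<open>0 < y2\<close> by simp
      moreover have "t * (h * y1 * y2) \<le> z" using D(2) t by simp
      ultimately show ?thesis using h(1) h_def y1_def[unfolded h_def] y2_def[unfolded h_def] by blast
    qed
    have le: "t \<le> t * (h * y1 * y2) \<and> h \<le> t * (h * y1 * y2) \<and> y1 \<le> t * (h * y1 * y2) \<and> y2 \<le> t * (h * y1 * y2)"
      if "0 < t" "0 < h" "0 < y1" "0 < y2" for t h y1 y2 :: nat
      using that by (auto intro!: dvd_imp_le)
    show "inj_on (\<lambda>(D,a,b). (D div (gcd a b * (a div gcd a b) * (b div gcd a b)), gcd a b, a div gcd a b, b div gcd a b)) S"
    proof (rule inj_onI)
      fix s s' assume ss: "s \<in> S" "s' \<in> S" 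
        "(\<lambda>(D,a,b). (D div (gcd a b * (a div gcd a b) * (b div gcd a b)), gcd a b, a div gcd a b, b div gcd a b)) s =
         (\<lambda>(D,a,b). (D div (gcd a b * (a div gcd a b) * (b div gcd a b)), gcd a b, a div gcd a b, b div gcd a b)) s'"
      obtain D a b where s: "s = (D,a,b)" by (metis prod.exhaust)
      obtain D' a' b' where s': "s' = (D',a',b')" by (metis prod.exhaust)
      from key[OF ss(1) s] key[OF ss(2) s'] ss(3) show "s = s'" unfolding s s' by (auto simp only: prod.inject prod.case)
    qed
    show "(\<lambda>(D,a,b). (D div (gcd a b * (a div gcd a b) * (b div gcd a b)), gcd a b, a div gcd a b, b div gcd a b)) ` S \<subseteq> T"
    proof (rule image_subsetI)
      fix s assume "s \<in> S"
      moreover obtain D a b where s: "s = (D,a,b)" by (metis prod.exhaust)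
      ultimately obtain t h y1 y2 where e: "s = (t * (h * y1 * y2), h * y1, h * y2)" "h = gcd a b" "y1 = a div gcd a b" "y2 = b div gcd a b"
        "D div (h * y1 * y2) = t" "0 < t" "0 < h" "0 < y1" "0 < y2" "t * (h * y1 * y2) \<le> z" using key by blast
      have "t \<le> t * (h * y1 * y2)" "h \<le> t * (h * y1 * y2)" "y1 \<le> t * (h * y1 * y2)" "y2 \<le> t * (h * y1 * y2)"
        using le e(6-9) by blast+
      then have "t \<le> z" "h \<le> z" "y1 \<le> z" "y2 \<le> z" using e(10) by (blast intro: le_trans)+
      then have "(t, h, y1, y2) \<in> T" using e(6-9) by (simp add: T_def)
      then show "(case s of (D,a,b) \<Rightarrow> (D div (gcd a b * (a div gcd a b) * (b div gcd a b)), gcd a b, a div gcd a b, b div gcd a b)) \<in> T"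
        using e(2-5) by (simp add: s)
    qed
    fix s assume sS: "s \<in> S"
    moreover obtain D a b where s: "s = (D,a,b)" by (metis prod.exhaust)
    ultimately obtain t h y1 y2 where e: "s = (t * (h * y1 * y2), h * y1, h * y2)" "h = gcd a b" "y1 = a div gcd a b" "y2 = b div gcd a b"
        "D div (h * y1 * y2) = t" "0 < t" "0 < h" "0 < y1" "0 < y2" "t * (h * y1 * y2) \<le> z" using key by blast
    have "divs D \<le> divs t * (divs h * divs y1 * divs y2)"
    proof -
      have "divs (t * (h * y1 * y2)) \<le> divs t * divs (h * y1 * y2)" using e(6-9) by (intro divs_mult_le) auto
      also have "\<dots> \<le> divs t * (divs (h * y1) * divs y2)" using e(6-9) by (intro mult_left_mono divs_mult_le) auto
      also have "\<dots> \<le> divs t * (divs h * divs y1 * divs y2)" using e(6-9) by (intro mult_left_mono mult_right_mono divs_mult_le) auto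
      finally show ?thesis using e(1) s by simp
    qed
    then have "real (divs D) \<le> real (divs t) * (real (divs h) * real (divs y1) * real (divs y2))"
      by (simp only: of_nat_mult[symmetric] of_nat_mono)
    then have "real (divs D) ^ m \<le> (real (divs t) * (real (divs h) * real (divs y1) * real (divs y2))) ^ m"
      by (intro power_mono) auto
    then have "real (divs D) ^ m * (1 / real D) \<le> (real (divs t) * (real (divs h) * real (divs y1) * real (divs y2))) ^ m * (1 / real (t * (h * y1 * y2)))"
      using e(1) s by (simp add: divide_right_mono)
    also have "\<dots> = ?w t * (?w h * (?w y1 * ?w y2))" by (simp add: power_mult_distrib)
    finally have "?w D * E' h y1 y2 \<le> ?w t * (?w h * (?w y1 * ?w y2)) * E' h y1 y2" by (intro mult_right_mono assms)
    then show "(case s of (D,a,b) \<Rightarrow> ?w D * E' (gcd a b) (a div gcd a b) (b div gcd a b)) \<le> 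
      (case (case s of (D,a,b) \<Rightarrow> (D div (gcd a b * (a div gcd a b) * (b div gcd a b)), gcd a b, a div gcd a b, b div gcd a b)) of
        (t,h,y1,y2) \<Rightarrow> ?w t * (?w h * (?w y1 * ?w y2 * E' h y1 y2)))"
      unfolding s prod.case e(2)[symmetric] e(3)[unfolded e(2)[symmetric], symmetric] e(4)[unfolded e(2)[symmetric], symmetric] e(5)
      by (simp only: mult_ac)
  qed (auto intro!: mult_nonneg_nonneg divide_nonneg_nonneg assms)
  also have "\<dots> = (\<Sum>t=1..z. ?w t * (\<Sum>h=1..z. ?w h * (\<Sum>y1=1..z. \<Sum>y2=1..z. ?w y1 * ?w y2 * E' h y1 y2)))"
    unfolding T_def by (simp add: sum.cartesian_product[symmetric] sum_distrib_left mult_ac)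
  also have "\<dots> = (\<Sum>t=1..z. ?w t) * (\<Sum>h=1..z. ?w h * (\<Sum>y1=1..z. \<Sum>y2=1..z. ?w y1 * ?w y2 * E' h y1 y2))"
    by (simp only: sum_distrib_right)
  finally show ?thesis by (simp add: power_mult_distrib)
qed

text \<open>The bound of \<open>card_fracpairs_le\<close> relative to the size of the box of
  numerators: a fraction with denominator \<open>w * o1\<close>, where \<open>w < 2 ^ Suc e\<close>,
  and of size at most \<open>\<delta>1\<close> has numerator at most
  \<open>2 ^ Suc e * \<delta>1 * o1\<close>.\<close>

definition scaled_divisor_sum :: "nat \<Rightarrow> real \<Rightarrow> real \<Rightarrow> nat \<Rightarrow> nat \<Rightarrow> real" where
  "scaled_divisor_sum e \<delta>1 \<delta>2 o1 o2 = pair_divisor_sum (2 ^ Suc e * \<delta>1 * real o1) (2 ^ Suc e * \<delta>2 * real o2) (o1 div gcd o1 o2) (o2 div gcd o1 o2) 1 /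
     ((2 ^ Suc e * \<delta>1 * real o1) * (2 ^ Suc e * \<delta>2 * real o2))"

text \<open>All entries of a tuple with least common multiple \<open>D\<close> divide
  \<open>D\<close>, so at most \<open>divs D ^ (card I - 2)\<close> such tuples have prescribed
  entries at \<open>i\<close> and \<open>j\<close>. What remains is a sum over \<open>D\<close> and
  two of its divisors.\<close>

lemma sum_scaled_divisor_sum_le:
  assumes I: "finite I" "i \<in> I" "j \<in> I" "i \<noteq> j" "card I \<le> K + 2" and K: "K \<ge> 1"
    and d: "0 < \<delta>1" "\<delta>1 \<le> 1" "0 < \<delta>2" "\<delta>2 \<le> 1" and z: "z > 0" "2 ^ e \<le> real z"
    and L: "1 + ln (2 + 16 * real z ^ 4) \<le> L"
  shows "(\<Sum>c\<in>{c\<in>PiE I (\<lambda>_. {1..z}). Lcm (c ` I) \<le> z}. (1 / real (Lcm (c ` I))) * scaled_divisor_sum e \<delta>1 \<delta>2 (c i) (c j) ^ K)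
     \<le> 4 ^ K * 1024 * L ^ (2 ^ (3 * Suc K) + 2 + 2 ^ K + 2 ^ K)"
proof -
  let ?O = "{c\<in>PiE I (\<lambda>_. {1..z}). Lcm (c ` I) \<le> z}"
  define m where "m = card I - 2"
  have mK: "m \<le> K" using I by (simp add: m_def)
  obtain K' where K': "K = Suc K'" using K by (cases K) auto
  define Q where "Q \<delta> h = 2 ^ Suc e * \<delta> * real h" for \<delta> and h :: nat
  define E' where "E' h y1 y2 = (pair_divisor_sum (Q \<delta>1 h * real y1) (Q \<delta>2 h * real y2) y1 y2 1 / ((Q \<delta>1 h * real y1) * (Q \<delta>2 h * real y2))) ^ K" for h y1 y2
  have E0: "E' h y1 y2 \<ge> 0" for h y1 y2
    using d by (auto simp: E'_def Q_def intro!: pair_divisor_sum_nonneg zero_le_power divide_nonneg_nonneg)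
  have z1: "real z \<ge> 1" using z by simp
  have L': "1 + ln (real (Suc z)) \<le> L"
  proof -
    have "real z ^ 1 \<le> real z ^ 4" using z1 by (intro power_increasing) auto
    then have "real (Suc z) \<le> 2 + 16 * real z ^ 4" unfolding power_one_right of_nat_Suc using z1 by linarith
    then have "ln (real (Suc z)) \<le> ln (2 + 16 * real z ^ 4)" using z1 by (subst ln_le_cancel_iff) (auto intro!: add_pos_nonneg)
    then show ?thesis using L by linarith
  qed
  then have L1: "L \<ge> 1" using ln_ge_zero[of "real (Suc z)"] by linarith
  have Opos: "c l \<in> {1..z}" if "c \<in> ?O" "l \<in> I" for c l using that by (auto simp: PiE_iff)
  have LcmO: "Lcm (c ` I) \<in> {1..z}" if "c \<in> ?O" for c
  proof -
    have "0 \<notin> c ` I" using Opos[OF that] by force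
    then have "Lcm (c ` I) \<noteq> 0" using I by (simp add: Lcm_0_iff)
    then show ?thesis using that by auto
  qed
  have tbE: "scaled_divisor_sum e \<delta>1 \<delta>2 a b ^ K = E' (gcd a b) (a div gcd a b) (b div gcd a b)" if "a > 0" for a b
  proof -
    have "real (gcd a b) * real (a div gcd a b) = real a" "real (gcd a b) * real (b div gcd a b) = real b"
      by (simp_all flip: of_nat_mult)
    then have "Q \<delta>1 (gcd a b) * real (a div gcd a b) = 2 ^ Suc e * \<delta>1 * real a" "Q \<delta>2 (gcd a b) * real (b div gcd a b) = 2 ^ Suc e * \<delta>2 * real b"
      by (simp_all add: Q_def mult.assoc)
    then show ?thesis by (simp add: scaled_divisor_sum_def E'_def)
  qed
  let ?E = "\<lambda>a b. E' (gcd a b) (a div gcd a b) (b div gcd a b)"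
  have "(\<Sum>c\<in>?O. (1 / real (Lcm (c ` I))) * scaled_divisor_sum e \<delta>1 \<delta>2 (c i) (c j) ^ K) = (\<Sum>c\<in>?O. (1 / real (Lcm (c ` I))) * ?E (c i) (c j))"
  proof (rule sum.cong[OF refl])
    fix c assume "c \<in> ?O"
    then have "c i > 0" using Opos[of c i] I by auto
    then show "(1 / real (Lcm (c ` I))) * scaled_divisor_sum e \<delta>1 \<delta>2 (c i) (c j) ^ K = (1 / real (Lcm (c ` I))) * ?E (c i) (c j)" by (simp add: tbE)
  qed
  also have "\<dots> = (\<Sum>D=1..z. \<Sum>c | c \<in> ?O \<and> Lcm (c ` I) = D. (1 / real (Lcm (c ` I))) * ?E (c i) (c j))"
    using LcmO I by (intro sum.group[symmetric] finite_subset[of ?O "PiE I (\<lambda>_. {1..z})"] finite_PiE) auto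
  also have "\<dots> \<le> (\<Sum>D=1..z. (1 / real D) * (real (divs D) ^ m * (\<Sum>a | a dvd D. \<Sum>b | b dvd D. ?E a b)))"
  proof (rule sum_mono)
    fix D assume D: "D \<in> {1..z}"
    then have fd: "finite {a. a dvd D}" by (intro finite_divs) auto
    have "(\<Sum>c | c \<in> ?O \<and> Lcm (c ` I) = D. (1 / real (Lcm (c ` I))) * ?E (c i) (c j)) = (\<Sum>c | c \<in> ?O \<and> Lcm (c ` I) = D. (1 / real D) * ?E (c i) (c j))"
      by (rule sum.cong) auto
    also have "\<dots> \<le> (\<Sum>c\<in>PiE I (\<lambda>_. {a. a dvd D}). (1 / real D) * ?E (c i) (c j))"
    proof (rule sum_mono2)
      show "finite (PiE I (\<lambda>_. {a. a dvd D}))" using I fd by (intro finite_PiE) auto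
      show "{c \<in> ?O. Lcm (c ` I) = D} \<subseteq> PiE I (\<lambda>_. {a. a dvd D})"
      proof
        fix c assume c: "c \<in> {c \<in> ?O. Lcm (c ` I) = D}"
        then have "c \<in> extensional I" by (simp add: PiE_iff)
        moreover have "c l dvd D" if "l \<in> I" for l using c that dvd_Lcm[of "c l" "c ` I"] by blast
        ultimately show "c \<in> PiE I (\<lambda>_. {a. a dvd D})" by (simp add: PiE_iff)
      qed
    qed (use E0 in \<open>simp add: divide_nonneg_nonneg\<close>)
    also have "\<dots> = (1 / real D) * (\<Sum>c\<in>PiE I (\<lambda>_. {a. a dvd D}). ?E (c i) (c j))" by (simp only: sum_distrib_left)
    also have "\<dots> \<le> (1 / real D) * (real (divs D) ^ m * (\<Sum>a | a dvd D. \<Sum>b | b dvd D. ?E a b))"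
      unfolding m_def divs_def by (intro mult_left_mono sum_PiE_two_le I fd E0) auto
    finally show "(\<Sum>c | c \<in> ?O \<and> Lcm (c ` I) = D. (1 / real (Lcm (c ` I))) * ?E (c i) (c j)) \<le> (1 / real D) * (real (divs D) ^ m * (\<Sum>a | a dvd D. \<Sum>b | b dvd D. ?E a b))" .
  qed
  also have "\<dots> \<le> (\<Sum>t=1..z. real (divs t) ^ m * (1 / real t)) * (\<Sum>h=1..z. real (divs h) ^ m * (1 / real h) * 
        (\<Sum>y1=1..z. \<Sum>y2=1..z. (real (divs y1) * real (divs y2)) ^ m / (real y1 * real y2) * E' h y1 y2))"
    by (rule sum_common_multiples_le[OF E0])
  also have "\<dots> \<le> L ^ (2 ^ m) * (\<Sum>h=1..z. real (divs h) ^ m * (1 / real h) * (4 ^ K * (1024 * L ^ (2 ^ (3 * Suc K) + 2))))"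
  proof (intro mult_mono sum_mono mult_left_mono)
    show "(\<Sum>t=1..z. real (divs t) ^ m * (1 / real t)) \<le> L ^ (2 ^ m)" by (rule sum_divs_pow_over_le[OF L'])
    fix h assume h: "h \<in> {1..z}"
    have Q0: "0 < Q \<delta>1 h" "0 < Q \<delta>2 h" using d h by (auto simp: Q_def)
    have Qle: "Q \<delta> h \<le> 2 * real z ^ 2" if "0 < \<delta>" "\<delta> \<le> 1" for \<delta>
    proof -
      have "2 ^ e * \<delta> * real h \<le> real z * 1 * real z" using that z h by (intro mult_mono) auto
      then show ?thesis by (simp add: Q_def power2_eq_square)
    qed
    have "(\<Sum>y1=1..z. \<Sum>y2=1..z. (real (divs y1) * real (divs y2)) ^ m / (real y1 * real y2) * E' h y1 y2)
       \<le> (\<Sum>y1=1..z. \<Sum>y2=1..z. 4 ^ K * ((real (divs y1) * real (divs y2)) ^ K / (real y1 * real y2) *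
          (pair_divisor_sum (Q \<delta>1 h * real y1) (Q \<delta>2 h * real y2) y1 y2 K / ((Q \<delta>1 h * real y1) * (Q \<delta>2 h * real y2)))))"
    proof (intro sum_mono)
      fix y1 y2 assume y: "y1 \<in> {1..z}" "y2 \<in> {1..z}"
      let ?A1 = "Q \<delta>1 h * real y1" and ?A2 = "Q \<delta>2 h * real y2"
      have A: "?A1 > 0" "?A2 > 0" using Q0 y by auto
      have "E' h y1 y2 = pair_divisor_sum ?A1 ?A2 y1 y2 1 ^ K / ((?A1 * ?A2) ^ K' * (?A1 * ?A2))"
        unfolding E'_def power_divide K' by simp
      \<comment> \<open>The power mean inequality replaces the \<open>K\<close>-th power of a
        divisor sum by a sum of \<open>K\<close>-th powers; of the normalisation
        \<open>(?A1 * ?A2) ^ K\<close> one factor survives.\<close>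
      also have "\<dots> \<le> ((4 * ?A1 * ?A2) ^ K' * pair_divisor_sum ?A1 ?A2 y1 y2 K) / ((?A1 * ?A2) ^ K' * (?A1 * ?A2))"
        unfolding K' using A by (intro divide_right_mono pair_divisor_sum_power_le) auto
      also have "(4 * ?A1 * ?A2) ^ K' = 4 ^ K' * (?A1 * ?A2) ^ K'" by (simp add: power_mult_distrib mult.assoc)
      also have "(4 ^ K' * (?A1 * ?A2) ^ K' * pair_divisor_sum ?A1 ?A2 y1 y2 K) / ((?A1 * ?A2) ^ K' * (?A1 * ?A2)) = 4 ^ K' * (pair_divisor_sum ?A1 ?A2 y1 y2 K / (?A1 * ?A2))"
        using A by simp
      also have "\<dots> \<le> 4 ^ K * (pair_divisor_sum ?A1 ?A2 y1 y2 K / (?A1 * ?A2))"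
        using A pair_divisor_sum_nonneg by (intro mult_right_mono divide_nonneg_nonneg) (auto simp: K')
      finally have 1: "E' h y1 y2 \<le> 4 ^ K * (pair_divisor_sum ?A1 ?A2 y1 y2 K / (?A1 * ?A2))" .
      have "1 \<le> divs y1 * divs y2" using divs_pos[of y1] divs_pos[of y2] y by (simp add: Suc_le_eq)
      then have "real 1 \<le> real (divs y1 * divs y2)" by (rule of_nat_mono)
      then have "1 \<le> real (divs y1) * real (divs y2)" by simp
      then have "(real (divs y1) * real (divs y2)) ^ m \<le> (real (divs y1) * real (divs y2)) ^ K"
        using mK by (intro power_increasing) auto
      then have 2: "(real (divs y1) * real (divs y2)) ^ m / (real y1 * real y2) \<le> (real (divs y1) * real (divs y2)) ^ K / (real y1 * real y2)"
        by (intro divide_right_mono) auto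
      have "(real (divs y1) * real (divs y2)) ^ m / (real y1 * real y2) * E' h y1 y2 \<le> (real (divs y1) * real (divs y2)) ^ K / (real y1 * real y2) * (4 ^ K * (pair_divisor_sum ?A1 ?A2 y1 y2 K / (?A1 * ?A2)))"
        by (intro mult_mono 1 2 E0) auto
      then show "(real (divs y1) * real (divs y2)) ^ m / (real y1 * real y2) * E' h y1 y2 \<le> 4 ^ K * ((real (divs y1) * real (divs y2)) ^ K / (real y1 * real y2) *
          (pair_divisor_sum ?A1 ?A2 y1 y2 K / (?A1 * ?A2)))" by (simp only: mult_ac)
    qed
    also have "\<dots> = 4 ^ K * (\<Sum>y1=1..z. \<Sum>y2=1..z. (real (divs y1) * real (divs y2)) ^ K / (real y1 * real y2) *
          (pair_divisor_sum (Q \<delta>1 h * real y1) (Q \<delta>2 h * real y2) y1 y2 K / ((Q \<delta>1 h * real y1) * (Q \<delta>2 h * real y2))))"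
      by (simp only: sum_distrib_left)
    also have "\<dots> \<le> 4 ^ K * (1024 * L ^ (2 ^ (3 * Suc K) + 2))"
      by (intro mult_left_mono sum_dyadic_divs_le Q0 Qle d z L) auto
    finally show "(\<Sum>y1=1..z. \<Sum>y2=1..z. (real (divs y1) * real (divs y2)) ^ m / (real y1 * real y2) * E' h y1 y2) \<le> 4 ^ K * (1024 * L ^ (2 ^ (3 * Suc K) + 2))" .
  qed (use L1 E0 in \<open>auto intro!: sum_nonneg mult_nonneg_nonneg divide_nonneg_nonneg\<close>)
  also have "\<dots> = L ^ (2 ^ m) * ((\<Sum>h=1..z. real (divs h) ^ m * (1 / real h)) * (4 ^ K * (1024 * L ^ (2 ^ (3 * Suc K) + 2))))"
    by (simp only: sum_distrib_right)
  also have "\<dots> \<le> L ^ (2 ^ K) * (L ^ (2 ^ K) * (4 ^ K * (1024 * L ^ (2 ^ (3 * Suc K) + 2))))"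
  proof -
    have a: "L ^ (2 ^ m) \<le> L ^ (2 ^ K)" using L1 mK by (intro power_increasing) auto
    have b: "(\<Sum>h=1..z. real (divs h) ^ m * (1 / real h)) \<le> L ^ (2 ^ K)"
      using sum_divs_pow_over_le[OF L'] a by (rule order_trans)
    show ?thesis using L1 by (intro mult_mono a b mult_right_mono) (auto intro!: sum_nonneg mult_nonneg_nonneg)
  qed
  also have "\<dots> = 4 ^ K * 1024 * L ^ (2 ^ (3 * Suc K) + 2 + 2 ^ K + 2 ^ K)" by (simp only: power_add mult_ac)
  finally show ?thesis .
qed

section \<open>Pairs of fractions with a common factor in the denominators\<close>

text \<open>Division by \<open>s\<close> and rounding down is injective on points at distance at
  least \<open>s\<close>.\<close>

lemma card_spaced_le:
  fixes B :: "real set"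
  assumes "finite B" "s > 0" "M \<ge> 0" "\<And>b. b \<in> B \<Longrightarrow> \<bar>b\<bar> \<le> M" "\<And>b c. b \<in> B \<Longrightarrow> c \<in> B \<Longrightarrow> b \<noteq> c \<Longrightarrow> \<bar>b - c\<bar> \<ge> s"
  shows "real (card B) \<le> 1 + 2 * M / s"
proof -
  let ?f = "\<lambda>b. \<lfloor>(b + M) / s\<rfloor>"
  have inj: "inj_on ?f B"
  proof (rule inj_onI)
    fix b c assume bc: "b \<in> B" "c \<in> B" "?f b = ?f c"
    have "\<bar>(b + M) / s - (c + M) / s\<bar> < 1" using bc(3) by linarith
    moreover have "(b + M) / s - (c + M) / s = (b - c) / s" by (simp add: diff_divide_distrib[symmetric])
    ultimately have "\<bar>(b - c) / s\<bar> < 1" by simp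
    then have "\<bar>b - c\<bar> < s" using assms(2) by (simp add: abs_divide pos_divide_less_eq)
    then show "b = c" using assms(5)[OF bc(1,2)] by fastforce
  qed
  have "?f ` B \<subseteq> {0..\<lfloor>2 * M / s\<rfloor>}"
  proof (rule image_subsetI)
    fix b assume "b \<in> B"
    then have "0 \<le> b + M" "b + M \<le> 2 * M" using assms(4)[of b] by linarith+
    then have "0 \<le> (b + M) / s" "(b + M) / s \<le> 2 * M / s" using assms(2) by (auto intro: divide_right_mono)
    then show "?f b \<in> {0..\<lfloor>2 * M / s\<rfloor>}" by (auto intro: floor_mono)
  qed
  then have "card B \<le> card {0..\<lfloor>2 * M / s\<rfloor>}" using card_inj_on_le[OF inj] by blast
  also have "\<dots> = nat (\<lfloor>2 * M / s\<rfloor> + 1)" by simp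
  finally have "real (card B) \<le> real (nat (\<lfloor>2 * M / s\<rfloor> + 1))" by (rule of_nat_mono)
  also have "\<dots> = real_of_int \<lfloor>2 * M / s\<rfloor> + 1"
  proof -
    have "0 \<le> \<lfloor>2 * M / s\<rfloor>" using assms by simp
    then show ?thesis by simp
  qed
  also have "\<dots> \<le> 1 + 2 * M / s" by simp
  finally show ?thesis .
qed

text \<open>In the application \<open>w\<close> is the part of the two denominators that is shared
  with no other denominator, known up to a factor 2, and \<open>o1\<close>, \<open>o2\<close> are
  the cofactors. The last condition records that \<open>w\<close> cancels in the sum of the two
  fractions.\<close>

definition fracpairs :: "nat \<Rightarrow> nat \<Rightarrow> nat \<Rightarrow> nat \<Rightarrow> real \<Rightarrow> real \<Rightarrow> (int \<times> int) set" where
  "fracpairs q o1 o2 e \<delta>1 \<delta>2 = {(b1,b2). b1 \<in> nz_residues q \<and> b2 \<in> nz_residues q \<and> \<bar>real_of_int b1\<bar> \<le> \<delta>1 * real q \<and> \<bar>real_of_int b2\<bar> \<le> \<delta>2 * real q \<and>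
     b1 + b2 \<noteq> 0 \<and> (\<exists>w. 2 ^ e \<le> w \<and> w < 2 ^ Suc e \<and> den q b1 = w * o1 \<and> den q b2 = w * o2) \<and> den q (b1 + b2) dvd lcm o1 o2}"

lemma finite_fracpairs [simp]: "finite (fracpairs q o1 o2 e \<delta>1 \<delta>2)"
  by (rule finite_subset[of _ "nz_residues q \<times> nz_residues q"]) (auto simp: fracpairs_def)

text \<open>A pair is determined by its two numerators and \<open>w\<close>. As \<open>w\<close>
  cancels in the sum of the two fractions, it divides the numerator of this sum, so the choices of
  \<open>w\<close> are counted by a divisor function.\<close>

lemma card_fracpairs_le:
  assumes q: "q > 0" and o: "o1 > 0" "o2 > 0" and d: "\<delta>1 \<ge> 0" "\<delta>2 \<ge> 0"
  shows "real (card (fracpairs q o1 o2 e \<delta>1 \<delta>2)) \<le>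
    pair_divisor_sum (2 ^ Suc e * \<delta>1 * real o1) (2 ^ Suc e * \<delta>2 * real o2) (o1 div gcd o1 o2) (o2 div gcd o1 o2) 1"
proof -
  define h where "h = gcd o1 o2"
  define y1 where "y1 = o1 div h"
  define y2 where "y2 = o2 div h"
  let ?A1 = "2 ^ Suc e * \<delta>1 * real o1" and ?A2 = "2 ^ Suc e * \<delta>2 * real o2"
  have h: "h > 0" "o1 = h * y1" "o2 = h * y2" using o by (auto simp: h_def y1_def y2_def)
  have lcm_den: "lcm o1 o2 = h * y1 * y2"
  proof -
    have "h * lcm o1 o2 = o1 * o2" unfolding h_def by simp
    then have "h * lcm o1 o2 = h * (h * y1 * y2)" using h by simp
    then show ?thesis using h(1) by simp
  qed
  define S where "S = Sigma (nondeg_pairs ?A1 ?A2 y1 y2) (\<lambda>(a1,a2). {w. w dvd nat \<bar>a1 * int y2 + a2 * int y1\<bar>})"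
  have n0: "a1 * int y2 + a2 * int y1 \<noteq> 0" if "(a1,a2) \<in> nondeg_pairs ?A1 ?A2 y1 y2" for a1 a2 using that by (auto simp: nondeg_pairs_def)
  have fin: "finite {w. w dvd nat \<bar>a1 * int y2 + a2 * int y1\<bar>}" if "(a1,a2) \<in> nondeg_pairs ?A1 ?A2 y1 y2" for a1 a2
    using n0[OF that] by (rule finite_dvd_nat_abs)
  have finS: "finite S" unfolding S_def using fin by (intro finite_SigmaI) auto
  define j where "j x = ((num q (fst x), num q (snd x)), den q (fst x) div o1)" for x
  have key: "den q b1 = w * o1 \<and> den q b2 = w * o2 \<and> ((num q b1, num q b2), w) \<in> S \<and> j (b1,b2) = ((num q b1, num q b2), w)"
    if b: "(b1,b2) \<in> fracpairs q o1 o2 e \<delta>1 \<delta>2" and w: "2 ^ e \<le> w" "w < 2 ^ Suc e" "den q b1 = w * o1" "den q b2 = w * o2" for b1 b2 w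
  proof -
    have nd: "real q * real_of_int (num q b) = real_of_int b * real (den q b)" for b
      using den_num(1)[OF q, of b] by (metis of_int_mult of_int_of_nat_eq)
    have bd: "\<bar>real_of_int (num q b)\<bar> \<le> 2 ^ Suc e * \<delta> * real u" if "\<bar>real_of_int b\<bar> \<le> \<delta> * real q" "den q b = w * u" "\<delta> \<ge> 0" for b \<delta> u
    proof -
      have "real q * \<bar>real_of_int (num q b)\<bar> = \<bar>real_of_int b\<bar> * real (den q b)" using nd[of b] by (metis abs_mult abs_of_nat)
      also have "\<dots> \<le> (\<delta> * real q) * (2 ^ Suc e * real u)"
      proof (intro mult_mono that)
        have "real w \<le> real (2 ^ Suc e)" using w(2) by (intro of_nat_mono) simp
        then show "real (den q b) \<le> 2 ^ Suc e * real u" unfolding that(2) of_nat_mult by (intro mult_right_mono) auto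
      qed (use that in auto)
      also have "\<dots> = real q * (2 ^ Suc e * \<delta> * real u)" by simp
      finally show ?thesis using q by (simp only: mult_le_cancel_left_pos of_nat_0_less_iff)
    qed
    have nz: "num q b \<noteq> 0" if "b \<in> nz_residues q" for b
    proof
      assume "num q b = 0"
      then have "b * int (den q b) = 0" using den_num(1)[OF q, of b] by simp
      then show False using den_num(4)[OF q, of b] that by (auto simp: nz_residues_def)
    qed
    have eq: "int q * (num q b1 * int y2 + num q b2 * int y1) = (b1 + b2) * int (lcm o1 o2) * int w"
    proof -
      have "int q * (num q b1 * int y2 + num q b2 * int y1) = (b1 * int (den q b1)) * int y2 + (b2 * int (den q b2)) * int y1"
        unfolding den_num(1)[OF q, symmetric] by (simp add: algebra_simps)
      also have "\<dots> = (b1 + b2) * int (lcm o1 o2) * int w" unfolding w(3,4) lcm_den by (subst h(2), subst h(3)) (simp add: algebra_simps)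
      finally show ?thesis .
    qed
    have w0: "w > 0" using w(1) by (auto intro: Nat.gr0I)
    have "int q dvd (b1 + b2) * int (lcm o1 o2)" using b by (simp add: fracpairs_def dvd_mult_iff_den[OF q])
    then obtain s where "(b1 + b2) * int (lcm o1 o2) = int q * s" by blast
    then have "int q * (num q b1 * int y2 + num q b2 * int y1) = int q * (s * int w)" using eq by simp
    then have Dw: "num q b1 * int y2 + num q b2 * int y1 = s * int w" using q by simp
    have "(b1 + b2) * int (lcm o1 o2) * int w \<noteq> 0" using b w0 o by (auto simp: fracpairs_def lcm_eq_0_iff)
    then have D0: "num q b1 * int y2 + num q b2 * int y1 \<noteq> 0" using eq by auto
    have "int w dvd num q b1 * int y2 + num q b2 * int y1" using Dw by simp
    then have "((num q b1, num q b2), w) \<in> S"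
      using b D0 nz bd[OF _ w(3) d(1)] bd[OF _ w(4) d(2)] by (auto simp: S_def nondeg_pairs_def nz_ints_def fracpairs_def)
    then show ?thesis using w o by (simp add: j_def)
  qed
  have ex: "\<exists>w. den q b1 = w * o1 \<and> den q b2 = w * o2 \<and> ((num q b1, num q b2), w) \<in> S \<and> j (b1,b2) = ((num q b1, num q b2), w)"
    if "(b1,b2) \<in> fracpairs q o1 o2 e \<delta>1 \<delta>2" for b1 b2
    using key[OF that] that unfolding fracpairs_def by blast
  have "card (fracpairs q o1 o2 e \<delta>1 \<delta>2) \<le> card S"
  proof (rule card_inj_on_le[OF _ _ finS])
    show "j ` fracpairs q o1 o2 e \<delta>1 \<delta>2 \<subseteq> S" using ex by fastforce
    show "inj_on j (fracpairs q o1 o2 e \<delta>1 \<delta>2)"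
    proof (rule inj_onI)
      fix x x' assume x: "x \<in> fracpairs q o1 o2 e \<delta>1 \<delta>2" "x' \<in> fracpairs q o1 o2 e \<delta>1 \<delta>2" "j x = j x'"
      obtain b1 b2 b1' b2' where e: "x = (b1,b2)" "x' = (b1',b2')" by (metis prod.exhaust)
      obtain w where w: "den q b1 = w * o1" "den q b2 = w * o2" "j (b1,b2) = ((num q b1, num q b2), w)" using ex x(1) e by blast
      obtain w' where w': "den q b1' = w' * o1" "den q b2' = w' * o2" "j (b1',b2') = ((num q b1', num q b2'), w')" using ex x(2) e by blast
      have eqs: "num q b1 = num q b1'" "num q b2 = num q b2'" "den q b1 = den q b1'" "den q b2 = den q b2'"
      proof -
        have "num q b1 = num q b1' \<and> num q b2 = num q b2' \<and> w = w'" using w(3) w'(3) x(3) unfolding e by simp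
        then show "num q b1 = num q b1'" "num q b2 = num q b2'" "den q b1 = den q b1'" "den q b2 = den q b2'"
          using w(1,2) w'(1,2) by simp_all
      qed
      have "b = b'" if "num q b = num q b'" "den q b = den q b'" for b b'
      proof -
        have "b * int (den q b') = b' * int (den q b')"
          using den_num(1)[OF q, of b, unfolded that] den_num(1)[OF q, of b'] by (rule trans[OF sym])
        moreover have "int (den q b') \<noteq> 0" using den_num(4)[OF q, of b'] by simp
        ultimately show ?thesis by simp
      qed
      then show "x = x'" using eqs e by blast
    qed
  qed
  also have "card S = (\<Sum>x\<in>nondeg_pairs ?A1 ?A2 y1 y2. card (case x of (a1,a2) \<Rightarrow> {w. w dvd nat \<bar>a1 * int y2 + a2 * int y1\<bar>}))"
    unfolding S_def using fin by (intro card_SigmaI) auto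
  finally have "real (card (fracpairs q o1 o2 e \<delta>1 \<delta>2)) \<le> real (\<Sum>x\<in>nondeg_pairs ?A1 ?A2 y1 y2. card (case x of (a1,a2) \<Rightarrow> {w. w dvd nat \<bar>a1 * int y2 + a2 * int y1\<bar>}))"
    by (rule of_nat_mono)
  also have "\<dots> = pair_divisor_sum ?A1 ?A2 y1 y2 1" by (simp add: pair_divisor_sum_def divs_def case_prod_unfold)
  finally show ?thesis by (simp add: y1_def y2_def h_def)
qed

definition fibre :: "nat \<Rightarrow> nat \<Rightarrow> nat \<Rightarrow> nat \<Rightarrow> real \<Rightarrow> real \<Rightarrow> int \<Rightarrow> (int \<times> int) set" where
  "fibre q o1 o2 e \<delta>1 \<delta>2 t = {(b1,b2)\<in>fracpairs q o1 o2 e \<delta>1 \<delta>2. int q dvd b1 + b2 - t}"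

lemma finite_fibre [simp]: "finite (fibre q o1 o2 e \<delta>1 \<delta>2 t)"
  by (rule finite_subset[OF _ finite_fracpairs]) (auto simp: fibre_def)

text \<open>Two first components in the same fibre differ by a fraction whose denominator divides
  both \<open>w w' o1\<close> and \<open>w w' o2\<close>, hence \<open>w w' gcd o1 o2\<close>: they are well spaced.\<close>

lemma card_fibre_le:
  assumes q: "q > 0" and o: "o1 > 0" "o2 > 0" and d: "\<delta>1 \<ge> 0"
  shows "real (card (fibre q o1 o2 e \<delta>1 \<delta>2 t)) \<le> 1 + 8 * \<delta>1 * real (gcd o1 o2) * 4 ^ e"
proof -
  let ?F = "fibre q o1 o2 e \<delta>1 \<delta>2 t"
  define h where "h = gcd o1 o2"
  have h: "h > 0" using o by (simp add: h_def)
  \<comment> \<open>Two factors \<open>w\<close>, \<open>v\<close> below \<open>2 ^ Suc e\<close>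
    have product at most \<open>4 * 4 ^ e\<close>, so fractions whose difference has a denominator
    dividing \<open>w * v * h\<close> are at least \<open>1 / (4 * 4 ^ e * h)\<close> apart.\<close>
  let ?s = "real q / (4 * 4 ^ e * real h)"
  have s: "?s > 0" using q h by simp
  have spaced: "\<bar>real_of_int b1 - real_of_int c1\<bar> \<ge> ?s \<and> b1 \<noteq> c1" if T: "(b1,b2) \<in> ?F" "(c1,c2) \<in> ?F" "(b1,b2) \<noteq> (c1,c2)" for b1 b2 c1 c2
  proof -
    have b: "b1 \<in> nz_residues q" "b2 \<in> nz_residues q" "c1 \<in> nz_residues q" "c2 \<in> nz_residues q" "int q dvd b1 + b2 - t" "int q dvd c1 + c2 - t"
      using T by (auto simp: fibre_def fracpairs_def)
    obtain w where w: "w < 2 ^ Suc e" "den q b1 = w * o1" "den q b2 = w * o2" "2 ^ e \<le> w" using T(1) by (auto simp: fibre_def fracpairs_def)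
    obtain v where v: "v < 2 ^ Suc e" "den q c1 = v * o1" "den q c2 = v * o2" "2 ^ e \<le> v" using T(2) by (auto simp: fibre_def fracpairs_def)
    have wv0: "w > 0" "v > 0" using w(4) v(4) by (auto intro: Nat.gr0I)
    have "int q dvd (b1 + b2 - t) - (c1 + c2 - t)" using b(5,6) by (rule dvd_diff)
    then have cong: "int q dvd (b1 - c1) - (c2 - b2)" by (simp add: algebra_simps)
    have ne: "b1 \<noteq> c1"
    proof
      assume "b1 = c1"
      then have "b2 mod int q = c2 mod int q" using cong by (simp add: mod_eq_dvd_iff dvd_diff_commute)
      then have "b2 = c2" using inj_on_nz_residues[of q] b by (auto dest: inj_onD)
      then show False using \<open>b1 = c1\<close> T by simp
    qed
    have neg: "den q (- x) = den q x" for x by (simp add: den_def)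
    have "den q (b1 - c1) dvd w * v * o1"
      using den_add_dvd[OF q, of b1 "w * v * o1" "- c1"] w v by (simp add: neg)
    moreover have "den q (c2 - b2) dvd w * v * o2"
      using den_add_dvd[OF q, of c2 "w * v * o2" "- b2"] w v by (simp add: neg)
    moreover have "den q (b1 - c1) = den q (c2 - b2)" using cong q by (rule den_cong)
    ultimately have "den q (b1 - c1) dvd gcd (w * v * o1) (w * v * o2)" by simp
    also have "\<dots> = w * v * h" by (simp add: h_def gcd_mult_distrib_nat)
    finally have "int q dvd (b1 - c1) * int (w * v * h)" by (simp only: dvd_mult_iff_den[OF q])
    then have "int q dvd \<bar>(b1 - c1) * int (w * v * h)\<bar>" by (simp only: dvd_abs_iff)
    moreover have "\<bar>(b1 - c1) * int (w * v * h)\<bar> > 0" using ne wv0 h by simp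
    ultimately have "int q \<le> \<bar>(b1 - c1) * int (w * v * h)\<bar>" by (rule zdvd_imp_le)
    then have "real_of_int (int q) \<le> real_of_int \<bar>(b1 - c1) * int (w * v * h)\<bar>" by (simp only: of_int_le_iff)
    then have "real q \<le> \<bar>real_of_int b1 - real_of_int c1\<bar> * (real w * real v * real h)" by (simp add: abs_mult)
    also have "\<dots> \<le> \<bar>real_of_int b1 - real_of_int c1\<bar> * (2 ^ Suc e * 2 ^ Suc e * real h)"
    proof -
      have "real w \<le> real (2 ^ Suc e)" "real v \<le> real (2 ^ Suc e)" using w v by (auto intro!: of_nat_mono simp del: power_Suc)
      then show ?thesis by (intro mult_left_mono mult_right_mono mult_mono) auto
    qed
    also have "2 ^ Suc e * 2 ^ Suc e = (4 * 4 ^ e :: real)" by (simp flip: power_mult_distrib)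
    finally show ?thesis using ne h by (simp add: field_simps)
  qed
  have inj: "inj_on (\<lambda>x. real_of_int (fst x)) ?F"
  proof (rule inj_onI)
    fix x y assume xy: "x \<in> ?F" "y \<in> ?F" "real_of_int (fst x) = real_of_int (fst y)"
    show "x = y"
    proof (rule ccontr)
      assume "x \<noteq> y"
      then have "fst x \<noteq> fst y" using spaced[of "fst x" "snd x" "fst y" "snd y"] xy(1,2) by simp
      then show False using xy(3) by simp
    qed
  qed
  have "real (card ((\<lambda>x. real_of_int (fst x)) ` ?F)) \<le> 1 + 2 * (\<delta>1 * real q) / ?s"
  proof (rule card_spaced_le[OF _ s])
    show "\<bar>b - c\<bar> \<ge> ?s" if "b \<in> (\<lambda>x. real_of_int (fst x)) ` ?F" "c \<in> (\<lambda>x. real_of_int (fst x)) ` ?F" "b \<noteq> c" for b c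
      using that spaced by auto
    show "finite ((\<lambda>x. real_of_int (fst x)) ` ?F)" by simp
  qed (use d in \<open>auto simp: fibre_def fracpairs_def\<close>)
  also have "2 * (\<delta>1 * real q) / ?s = 8 * \<delta>1 * real h * 4 ^ e" using q h by simp
  finally show ?thesis using inj by (simp add: card_image h_def)
qed

text \<open>The second moment of the fibre sizes is at most their maximum times their sum, and the
  fibres over distinct residues are disjoint.\<close>

lemma sum_card_fibre_sq_le:
  assumes q: "q > 0" and o: "o1 > 0" "o2 > 0" and d: "\<delta>1 \<ge> 0" "\<delta>2 \<ge> 0"
  shows "(\<Sum>t\<in>sym_residues q. (real (card (fibre q o1 o2 e \<delta>1 \<delta>2 t)))\<^sup>2) \<le> (1 + 8 * \<delta>1 * real (gcd o1 o2) * 4 ^ e) *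
    pair_divisor_sum (2 ^ Suc e * \<delta>1 * real o1) (2 ^ Suc e * \<delta>2 * real o2) (o1 div gcd o1 o2) (o2 div gcd o1 o2) 1"
proof -
  let ?F = "fibre q o1 o2 e \<delta>1 \<delta>2" and ?k = "1 + 8 * \<delta>1 * real (gcd o1 o2) * 4 ^ e"
  have disj: "disjoint_family_on ?F (sym_residues q)"
    unfolding disjoint_family_on_def
  proof (intro ballI impI)
    fix s t assume st: "s \<in> sym_residues q" "t \<in> sym_residues q" "s \<noteq> t"
    show "?F s \<inter> ?F t = {}"
    proof (rule ccontr)
      assume "?F s \<inter> ?F t \<noteq> {}"
      then obtain b1 b2 where "int q dvd b1 + b2 - t" "int q dvd b1 + b2 - s" by (auto simp: fibre_def)
      then have "int q dvd (b1 + b2 - t) - (b1 + b2 - s)" by (rule dvd_diff)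
      then have "s mod int q = t mod int q" by (simp add: mod_eq_dvd_iff)
      then show False using inj_on_sym_residues[of q] st by (auto dest: inj_onD)
    qed
  qed
  have "(\<Sum>t\<in>sym_residues q. (real (card (?F t)))\<^sup>2) \<le> (\<Sum>t\<in>sym_residues q. ?k * real (card (?F t)))"
    unfolding power2_eq_square by (intro sum_mono mult_right_mono card_fibre_le assms) auto
  also have "\<dots> = ?k * real (\<Sum>t\<in>sym_residues q. card (?F t))" by (simp add: sum_distrib_left)
  also have "(\<Sum>t\<in>sym_residues q. card (?F t)) = card (\<Union>t\<in>sym_residues q. ?F t)"
    using disj by (intro card_UN_disjoint'[symmetric]) auto
  also have "?k * real (card (\<Union>t\<in>sym_residues q. ?F t)) \<le> ?k * real (card (fracpairs q o1 o2 e \<delta>1 \<delta>2))"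
    using d by (intro mult_left_mono of_nat_mono card_mono) (auto simp: fibre_def)
  also have "\<dots> \<le> ?k * pair_divisor_sum (2 ^ Suc e * \<delta>1 * real o1) (2 ^ Suc e * \<delta>2 * real o2) (o1 div gcd o1 o2) (o2 div gcd o1 o2) 1"
    using d by (intro mult_left_mono card_fracpairs_le assms) auto
  finally show ?thesis .
qed

section \<open>Tuples of fractions and matchings\<close>

text \<open>The primes shared by exactly these two denominators. For \<open>i = l\<close> these
  would be primes dividing one denominator only, which do not occur when the fractions have an
  integral sum.\<close>

definition private_part :: "nat \<Rightarrow> nat set \<Rightarrow> (nat \<Rightarrow> int) \<Rightarrow> nat \<Rightarrow> nat \<Rightarrow> nat" where
  "private_part q I b i l = \<Prod>{p \<in> prime_factors (den q (b i)). p dvd den q (b l) \<and> (\<forall>j\<in>I - {i,l}. \<not> p dvd den q (b j))}"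

lemma zero_sumsD: "b \<in> zero_sums q I \<Longrightarrow> i \<in> I \<Longrightarrow> b i \<in> nz_residues q" "b \<in> zero_sums q I \<Longrightarrow> int q dvd (\<Sum>i\<in>I. b i)"
  by (auto simp: zero_sums_def)

lemma finite_zero_sums: "finite I \<Longrightarrow> finite (zero_sums q I)"
  unfolding zero_sums_def by (rule finite_subset[of _ "PiE I (\<lambda>_. nz_residues q)"]) (auto intro: finite_PiE)

lemma den_sum_dvd:
  assumes "q > 0" "finite A" "\<And>i. i \<in> A \<Longrightarrow> den q (b i) dvd n"
  shows "den q (\<Sum>i\<in>A. b i) dvd n"
  using assms(2,3)
proof (induction A)
  case empty
  then show ?case using den_eq_1_iff[OF assms(1), of 0] by simp
next
  case (insert x A)
  then show ?case by (simp add: den_add_dvd[OF assms(1)])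
qed

lemma den_uminus: "den q (- x) = den q x" by (simp add: den_def)

text \<open>Modulo \<open>q\<close> the partial sum over \<open>A\<close> is minus the one over the
  complement. For a one-element \<open>A\<close> this shows that no prime divides a single
  denominator only.\<close>

lemma den_complement:
  assumes q: "q > 0" and I: "finite I" "A \<subseteq> I" and s: "int q dvd (\<Sum>i\<in>I. b i)"
  shows "den q (\<Sum>i\<in>A. b i) dvd (\<Prod>i\<in>I - A. den q (b i))"
proof -
  have "(\<Sum>i\<in>I. b i) = (\<Sum>i\<in>I - A. b i) + (\<Sum>i\<in>A. b i)" using I(2,1) by (rule sum.subset_diff)
  then have "int q dvd (\<Sum>i\<in>A. b i) - (- (\<Sum>i\<in>I - A. b i))" using s by (simp add: add.commute)
  then have "den q (\<Sum>i\<in>A. b i) = den q (\<Sum>i\<in>I - A. b i)" using den_cong[OF _ q] den_uminus by metis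
  moreover have "den q (\<Sum>i\<in>I - A. b i) dvd (\<Prod>i\<in>I - A. den q (b i))"
    by (rule den_sum_dvd[OF q]) (use I in \<open>auto intro: dvd_prodI\<close>)
  ultimately show ?thesis by simp
qed

lemma prime_dvd_den_other:
  assumes q: "q > 0" and I: "finite I" "i \<in> I" and s: "int q dvd (\<Sum>i\<in>I. b i)" and p: "prime p" "p dvd den q (b i)"
  shows "\<exists>j\<in>I - {i}. p dvd den q (b j)"
proof -
  have "p dvd (\<Prod>j\<in>I - {i}. den q (b j))"
    using den_complement[OF q I(1), of "{i}" b] I s p by (auto intro: dvd_trans)
  then show ?thesis using p(1) I by (auto simp: prime_dvd_prod_iff)
qed

text \<open>A near-perfect matching, encoded as an involution whose only fixed point is the
  unmatched index \<open>v\<close>.\<close>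

locale matching =
  fixes q :: nat and I :: "nat set" and v :: nat and \<tau> :: "nat \<Rightarrow> nat"
  assumes q: "q > 0" "squarefree q" and I: "finite I" "v \<in> I"
    and tau: "\<And>i. i \<in> I \<Longrightarrow> \<tau> i \<in> I" "\<And>i. i \<in> I \<Longrightarrow> \<tau> (\<tau> i) = i" "\<And>i. i \<in> I \<Longrightarrow> \<tau> i = i \<longleftrightarrow> i = v"
begin

definition reps :: "nat set" where "reps = {i\<in>I. i < \<tau> i}"
text \<open>Each denominator is \<open>pair_part\<close> times \<open>cofactor\<close>. The first
  factor is the same for both members of a pair, and it is 1 for the unmatched index.\<close>

definition pair_part :: "(nat \<Rightarrow> int) \<Rightarrow> nat \<Rightarrow> nat" where "pair_part b i = private_part q I b i (\<tau> i)"
definition cofactor :: "(nat \<Rightarrow> int) \<Rightarrow> nat \<Rightarrow> nat" where "cofactor b i = den q (b i) div pair_part b i"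

lemma reps_subset: "reps \<subseteq> I" and finite_reps: "finite reps" and v_notin_reps: "v \<notin> reps"
  using I tau(3)[of v] by (auto simp: reps_def)

lemma I_split: "I = insert v (reps \<union> \<tau> ` reps)" "reps \<inter> \<tau> ` reps = {}" "v \<notin> reps \<union> \<tau> ` reps" "inj_on \<tau> reps"
proof -
  show "I = insert v (reps \<union> \<tau> ` reps)"
  proof
    show "I \<subseteq> insert v (reps \<union> \<tau> ` reps)"
    proof
      fix i assume i: "i \<in> I"
      consider "i = v" | "i < \<tau> i" | "\<tau> i < i" using tau(3)[OF i] by linarith
      then show "i \<in> insert v (reps \<union> \<tau> ` reps)"
      proof cases
        case 3
        then have "\<tau> i \<in> reps" using i tau by (simp add: reps_def)
        then show ?thesis using tau(2)[OF i] by (metis UnCI image_eqI insertCI)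
      qed (use i in \<open>auto simp: reps_def\<close>)
    qed
  qed (use I tau reps_subset in auto)
  show "reps \<inter> \<tau> ` reps = {}" using tau(2) by (fastforce simp: reps_def)
  show "inj_on \<tau> reps" using tau(2) reps_subset by (metis inj_onI subsetD)
  show "v \<notin> reps \<union> \<tau> ` reps"
  proof
    assume "v \<in> reps \<union> \<tau> ` reps"
    then obtain i where "i \<in> reps" "\<tau> i = v" using v_notin_reps by auto
    then show False using tau(2,3) I reps_subset by (metis v_notin_reps subsetD)
  qed
qed

lemma prod_split:
  fixes f :: "nat \<Rightarrow> 'a::comm_monoid_mult"
  shows "(\<Prod>i\<in>I. f i) = f v * (\<Prod>s\<in>reps. f s * f (\<tau> s))"
proof -
  have "(\<Prod>i\<in>I. f i) = f v * (\<Prod>i\<in>reps \<union> \<tau> ` reps. f i)"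
    using arg_cong[OF I_split(1), of "prod f"] I_split(3) finite_reps by simp
  also have "(\<Prod>i\<in>reps \<union> \<tau> ` reps. f i) = (\<Prod>i\<in>reps. f i) * (\<Prod>i\<in>\<tau> ` reps. f i)"
    using finite_reps I_split(2) by (intro prod.union_disjoint) auto
  also have "(\<Prod>i\<in>\<tau> ` reps. f i) = (\<Prod>i\<in>reps. f (\<tau> i))" by (simp add: prod.reindex[OF I_split(4)])
  finally show ?thesis by (simp add: prod.distrib)
qed

lemma sum_split:
  fixes f :: "nat \<Rightarrow> 'a::comm_monoid_add"
  shows "(\<Sum>i\<in>I. f i) = f v + (\<Sum>s\<in>reps. f s + f (\<tau> s))"
proof -
  have "(\<Sum>i\<in>I. f i) = f v + (\<Sum>i\<in>reps \<union> \<tau> ` reps. f i)"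
    using arg_cong[OF I_split(1), of "sum f"] I_split(3) finite_reps by simp
  also have "(\<Sum>i\<in>reps \<union> \<tau> ` reps. f i) = (\<Sum>i\<in>reps. f i) + (\<Sum>i\<in>\<tau> ` reps. f i)"
    using finite_reps I_split(2) by (intro sum.union_disjoint) auto
  also have "(\<Sum>i\<in>\<tau> ` reps. f i) = (\<Sum>i\<in>reps. f (\<tau> i))" by (simp add: sum.reindex[OF I_split(4)])
  finally show ?thesis by (simp add: sum.distrib)
qed

lemma card_I: "card I = 1 + 2 * card reps"
  using sum_split[of "\<lambda>_. 1::nat"] by simp

context
  fixes b assumes b: "b \<in> zero_sums q I"
begin

lemma den_pos: "den q (b i) > 0" and den_dvd_q: "den q (b i) dvd q"
  using den_num[OF q(1)] by auto

lemma sqfree_den: "squarefree (den q (b i))"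
  using den_dvd_q q(2) by (rule squarefree_mono)

lemma pair_part_sym: "i \<in> I \<Longrightarrow> pair_part b (\<tau> i) = pair_part b i"
  unfolding pair_part_def private_part_def using tau(2)[of i] den_pos
  by (intro arg_cong[of _ _ Prod]) (auto simp: insert_commute prime_factors_dvd)

lemma pair_part_prime_iff:
  assumes "i \<in> I" "prime p"
  shows "p dvd pair_part b i \<longleftrightarrow> p dvd den q (b i) \<and> p dvd den q (b (\<tau> i)) \<and> (\<forall>j\<in>I - {i,\<tau> i}. \<not> p dvd den q (b j))"
proof -
  let ?P = "{p \<in> prime_factors (den q (b i)). p dvd den q (b (\<tau> i)) \<and> (\<forall>j\<in>I - {i,\<tau> i}. \<not> p dvd den q (b j))}"
  have "p dvd pair_part b i \<longleftrightarrow> (\<exists>r\<in>?P. p dvd r)"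
    unfolding pair_part_def private_part_def by (subst prime_dvd_prod_iff) (use assms in auto)
  also have "\<dots> \<longleftrightarrow> p \<in> ?P"
  proof
    assume "\<exists>r\<in>?P. p dvd r"
    then obtain r where r: "r \<in> ?P" "p dvd r" by blast
    then have "p = r" using assms(2) by (intro primes_dvd_imp_eq) (auto dest: in_prime_factors_imp_prime)
    then show "p \<in> ?P" using r by simp
  qed auto
  finally show ?thesis using den_pos assms(2) by (auto simp: prime_factors_dvd)
qed

lemma pair_part_dvd: "pair_part b i dvd den q (b i)"
proof -
  have "pair_part b i dvd \<Prod>(prime_factors (den q (b i)))"
    unfolding pair_part_def private_part_def by (intro prod_dvd_prod_subset) auto
  also have "\<Prod>(prime_factors (den q (b i))) dvd den q (b i)"
  proof -
    have "\<Prod>(prime_factors (den q (b i))) dvd (\<Prod>p\<in>prime_factors (den q (b i)). p ^ multiplicity p (den q (b i)))"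
      by (intro prod_dvd_prod dvd_power) (auto simp: prime_factors_multiplicity)
    also have "\<dots> = den q (b i)" using prod_prime_factors[of "den q (b i)"] den_pos[of i] by simp
    finally show ?thesis .
  qed
  finally show ?thesis .
qed

lemma pair_part_pos: "pair_part b i > 0" using pair_part_dvd den_pos by (metis dvd_0_left gr0I less_numeral_extra(3))

lemma den_eq: "den q (b i) = pair_part b i * cofactor b i" using pair_part_dvd[of i] by (simp add: cofactor_def)

lemma cofactor_pos: "cofactor b i > 0" using den_eq[of i] den_pos[of i] by (auto intro: Nat.gr0I)

lemma cofactor_dvd_den: "cofactor b i dvd den q (b i)" by (metis den_eq dvd_triv_right)

lemma pair_part_v: "pair_part b v = 1"
proof (rule ccontr)
  assume "pair_part b v \<noteq> 1"
  then obtain p where p: "prime p" "p dvd pair_part b v" using prime_factor_nat by blast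
  then have "p dvd den q (b v)" "\<forall>j\<in>I - {v}. \<not> p dvd den q (b j)"
    using pair_part_prime_iff[OF I(2) p(1)] tau(3)[OF I(2)] by auto
  then show False using prime_dvd_den_other[OF q(1) I zero_sumsD(2)[OF b] p(1)] by blast
qed

text \<open>The sum of the pair is minus the sum of all other fractions, so its denominator divides
  the product of their denominators, and none of these contains a prime of
  \<open>pair_part\<close>.\<close>

lemma den_pair_dvd:
  assumes i: "i \<in> I" "i \<noteq> v"
  shows "den q (b i + b (\<tau> i)) dvd lcm (cofactor b i) (cofactor b (\<tau> i))"
proof -
  let ?d = "den q (b i + b (\<tau> i))"
  have ne: "i \<noteq> \<tau> i" using tau(3)[OF i(1)] i(2) by metis
  have 1: "?d dvd pair_part b i * lcm (cofactor b i) (cofactor b (\<tau> i))"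
    by (rule den_add_dvd[OF q(1)]) (simp_all add: den_eq pair_part_sym[OF i(1)])
  have 2: "?d dvd (\<Prod>j\<in>I - {i, \<tau> i}. den q (b j))"
    using den_complement[OF q(1) I(1), of "{i, \<tau> i}" b] zero_sumsD(2)[OF b] i tau ne by simp
  have "coprime ?d (pair_part b i)"
  proof (rule ccontr)
    assume "\<not> coprime ?d (pair_part b i)"
    then have "gcd ?d (pair_part b i) \<noteq> 1" by (simp add: coprime_iff_gcd_eq_1)
    then obtain p where "prime p" "p dvd gcd ?d (pair_part b i)" using prime_factor_nat by blast
    then have p: "prime p" "p dvd ?d" "p dvd pair_part b i" by auto
    then have "p dvd (\<Prod>j\<in>I - {i, \<tau> i}. den q (b j))" using 2 by (blast intro: dvd_trans)
    then obtain j where "j \<in> I - {i, \<tau> i}" "p dvd den q (b j)" using p(1) I by (auto simp: prime_dvd_prod_iff)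
    then show False using pair_part_prime_iff[OF i(1) p(1)] p(3) by blast
  qed
  then show ?thesis using 1 by (simp add: coprime_dvd_mult_right_iff)
qed

text \<open>Needed as the covering hypothesis of \<open>montgomery_vaughan\<close> for the pair
  sums. A prime of a cofactor is not in \<open>pair_part\<close>, since denominators are squarefree,
  so it divides a denominator outside the pair; there it lies in the cofactor because it also
  divides \<open>den q (b i)\<close>.\<close>

lemma cofactor_cover:
  assumes p: "prime p" "p dvd Lcm (cofactor b ` I)"
  shows "\<exists>i\<in>I. \<exists>j\<in>I - {i, \<tau> i}. p dvd cofactor b i \<and> p dvd cofactor b j"
proof -
  have "\<exists>i\<in>I. p dvd cofactor b i"
  proof (rule ccontr)
    assume n: "\<not> (\<exists>i\<in>I. p dvd cofactor b i)"
    have "Lcm (cofactor b ` I) dvd (\<Prod>i\<in>I. cofactor b i)" using I by (auto intro!: Lcm_least dvd_prodI)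
    then show False using p n I by (auto simp: prime_dvd_prod_iff dest: dvd_trans)
  qed
  then obtain i where i: "i \<in> I" "p dvd cofactor b i" by blast
  have not_ws: "\<not> p dvd pair_part b l" if "p dvd cofactor b l" for l
  proof
    assume "p dvd pair_part b l"
    then have "p ^ 2 dvd den q (b l)" unfolding den_eq power2_eq_square using that by (rule mult_dvd_mono)
    then have "p dvd 1" using sqfree_den squarefreeD by blast
    then show False using p(1) by simp
  qed
  have pi: "p dvd den q (b i)" using i cofactor_dvd_den dvd_trans by blast
  have "\<exists>j\<in>I - {i, \<tau> i}. p dvd den q (b j)"
  proof (rule ccontr)
    assume n: "\<not> (\<exists>j\<in>I - {i, \<tau> i}. p dvd den q (b j))"
    obtain j where "j \<in> I - {i}" "p dvd den q (b j)"
      using prime_dvd_den_other[OF q(1) I(1) i(1) zero_sumsD(2)[OF b] p(1) pi] by blast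
    then have "p dvd den q (b (\<tau> i))" using n by auto
    then have "p dvd pair_part b i" using pair_part_prime_iff[OF i(1) p(1)] pi n by blast
    then show False using not_ws i(2) by blast
  qed
  then obtain j where j: "j \<in> I - {i, \<tau> i}" "p dvd den q (b j)" by blast
  have "\<not> p dvd pair_part b j"
  proof
    assume "p dvd pair_part b j"
    moreover have "i \<in> I - {j, \<tau> j}" using i j tau(2)[of j] tau(2)[of i] by auto
    ultimately show False using pair_part_prime_iff[of j p] j p(1) pi by blast
  qed
  then have "p dvd cofactor b j" using j(2) p(1) unfolding den_eq by (auto simp: prime_dvd_mult_iff)
  then show ?thesis using i j by blast
qed

end
end

context matching
begin

definition box_sums :: "(nat \<Rightarrow> real) \<Rightarrow> (nat \<Rightarrow> int) set" where
  "box_sums \<delta> = {b \<in> zero_sums q I. (\<forall>i\<in>I. \<bar>real_of_int (b i)\<bar> \<le> \<delta> i * real q) \<and> (\<forall>i\<in>I. \<forall>j\<in>I. i \<noteq> j \<longrightarrow> b i + b j \<noteq> 0)}"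

text \<open>The cofactors are fixed exactly, the pair parts only up to a factor 2: their primes drop
  out of the pair sums, and only their size enters.\<close>

definition cell :: "(nat \<Rightarrow> real) \<Rightarrow> (nat \<Rightarrow> nat) \<Rightarrow> (nat \<Rightarrow> nat) \<Rightarrow> (nat \<Rightarrow> int) set" where
  "cell \<delta> c e = {b \<in> box_sums \<delta>. (\<forall>i\<in>I. cofactor b i = c i) \<and> (\<forall>s\<in>reps. 2 ^ e s \<le> pair_part b s \<and> pair_part b s < 2 ^ Suc (e s))}"

lemma finite_box_sums: "finite (box_sums \<delta>)" unfolding box_sums_def using finite_zero_sums[OF I(1), of q] by simp
lemma finite_cell: "finite (cell \<delta> c e)" unfolding cell_def using finite_box_sums by simp

text \<open>\<open>kappa\<close> and \<open>cell_divisor_sum\<close> are the two factors of the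
  bound in \<open>sum_card_fibre_sq_le\<close>, taken for the pair of \<open>s\<close>.\<close>

abbreviation kappa :: "(nat \<Rightarrow> real) \<Rightarrow> (nat \<Rightarrow> nat) \<Rightarrow> (nat \<Rightarrow> nat) \<Rightarrow> nat \<Rightarrow> real" where
  "kappa \<delta> c e s \<equiv> 1 + 8 * \<delta> s * real (gcd (c s) (c (\<tau> s))) * 4 ^ e s"

abbreviation cell_divisor_sum :: "(nat \<Rightarrow> real) \<Rightarrow> (nat \<Rightarrow> nat) \<Rightarrow> (nat \<Rightarrow> nat) \<Rightarrow> nat \<Rightarrow> real" where
  "cell_divisor_sum \<delta> c e s \<equiv> pair_divisor_sum (2 ^ Suc (e s) * \<delta> s * real (c s)) (2 ^ Suc (e s) * \<delta> (\<tau> s) * real (c (\<tau> s)))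
     (c s div gcd (c s) (c (\<tau> s))) (c (\<tau> s) div gcd (c s) (c (\<tau> s))) 1"

lemma card_den_eq_le:
  assumes "\<delta> \<ge> 0" "m > 0"
  shows "real (card {t \<in> nz_residues q. den q t = m \<and> \<bar>real_of_int t\<bar> \<le> \<delta> * real q}) \<le> 2 * \<delta> * real m"
proof -
  let ?A = "{t \<in> nz_residues q. den q t = m \<and> \<bar>real_of_int t\<bar> \<le> \<delta> * real q}"
  have "card ?A \<le> card (nz_ints (\<delta> * real m))"
  proof (rule card_inj_on_le[where f = "num q"])
    show "inj_on (num q) ?A"
    proof (rule inj_onI)
      fix s t assume st: "s \<in> ?A" "t \<in> ?A" "num q s = num q t"
      have "int q * num q s = s * int m" using den_num(1)[OF q(1), of s] st(1) by simp
      moreover have "int q * num q t = t * int m" using den_num(1)[OF q(1), of t] st(2) by simp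
      ultimately have "s * int m = t * int m" using st(3) by metis
      then show "s = t" using assms by auto
    qed
    show "num q ` ?A \<subseteq> nz_ints (\<delta> * real m)"
    proof (rule image_subsetI)
      fix t assume t: "t \<in> ?A"
      have e: "int q * num q t = t * int m" using den_num(1)[OF q(1), of t] t by simp
      then have "num q t \<noteq> 0" using t assms by (auto simp: nz_residues_def)
      have "real_of_int (int q * num q t) = real_of_int (t * int m)" using e by simp
      then have "real q * \<bar>real_of_int (num q t)\<bar> = \<bar>real_of_int t\<bar> * real m" by (metis abs_mult abs_of_nat of_int_mult of_int_of_nat_eq)
      also have "\<dots> \<le> (\<delta> * real q) * real m" using t by (intro mult_right_mono) auto
      also have "\<dots> = real q * (\<delta> * real m)" by simp
      finally have "\<bar>real_of_int (num q t)\<bar> \<le> \<delta> * real m" using q by (simp only: mult_le_cancel_left_pos of_nat_0_less_iff)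
      then show "num q t \<in> nz_ints (\<delta> * real m)" using \<open>num q t \<noteq> 0\<close> by (simp add: nz_ints_def)
    qed
  qed simp
  then have "real (card ?A) \<le> real (card (nz_ints (\<delta> * real m)))" by (rule of_nat_mono)
  also have "\<dots> \<le> 2 * (\<delta> * real m)" using assms by (intro card_nz_ints_le) auto
  finally show ?thesis by simp
qed

text \<open>A tuple is sent to its unmatched fraction together with its pair sums. The image is
  again a zero sum, with denominators dividing \<open>c v\<close> and the \<open>lcm\<close> of the
  two cofactors of a pair, and the tuples over a given image are counted by products of fibres.
  These fibre sizes serve as the weights \<open>G\<close> in
  \<open>montgomery_vaughan\<close>.\<close>

lemma card_cell_le:
  assumes d: "\<And>i. i \<in> I \<Longrightarrow> \<delta> i \<ge> 0" and ne: "cell \<delta> c e \<noteq> {}"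
  shows "real (card (cell \<delta> c e)) \<le> (1 / real (Lcm (c ` I))) * (sqrt (real (c v) * (2 * \<delta> v * real (c v))) *
    (\<Prod>s\<in>reps. sqrt (real (lcm (c s) (c (\<tau> s))) * (kappa \<delta> c e s * cell_divisor_sum \<delta> c e s))))"
proof -
  obtain b0 where b0: "b0 \<in> cell \<delta> c e" using ne by blast
  have z0: "b0 \<in> zero_sums q I" using b0 by (simp add: cell_def box_sums_def)
  have c: "c i = cofactor b0 i" if "i \<in> I" for i using b0 that by (simp add: cell_def)
  have cpos: "c i > 0" if "i \<in> I" for i using c[OF that] cofactor_pos[OF z0] by simp
  have cdvd: "c i dvd q" if "i \<in> I" for i
    using c[OF that] cofactor_dvd_den[OF z0, of i] den_dvd_q[OF z0, of i] by (metis dvd_trans)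
  define D where "D = Lcm (c ` I)"
  have Dq: "D dvd q" unfolding D_def using cdvd by (intro Lcm_least) auto
  have RpI: "s \<in> I" "\<tau> s \<in> I" "s \<noteq> v" if "s \<in> reps" for s using that reps_subset tau v_notin_reps by auto
  define S where "S = insert v reps"
  have finS: "finite S" by (simp add: S_def finite_reps)
  define d where "d s = (if s = v then c v else lcm (c s) (c (\<tau> s)))" for s
  \<comment> \<open>A pair sum is nonzero as an integer but may vanish modulo \<open>q\<close>,
    namely when both terms are \<open>q/2\<close>; hence \<open>sym_residues\<close> and not
    \<open>nz_residues\<close>.\<close>
  define X where "X s = {t \<in> sym_residues q. den q t dvd d s}" for s
  define G where "G s t = (if s = v then (if t \<in> nz_residues q \<and> den q t = c v \<and> \<bar>real_of_int t\<bar> \<le> \<delta> v * real q then 1 else 0)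
     else real (card (fibre q (c s) (c (\<tau> s)) (e s) (\<delta> s) (\<delta> (\<tau> s)) t)))" for s t
  \<comment> \<open>A pair sum may leave the symmetric range and has to be reduced modulo
    \<open>q\<close>.\<close>
  define rp where "rp x = (SOME t. t \<in> sym_residues q \<and> int q dvd t - x)" for x
  have rp: "rp x \<in> sym_residues q" "int q dvd rp x - x" for x
    using someI_ex[of "\<lambda>t. t \<in> sym_residues q \<and> int q dvd t - x"] ex_sym_residues_cong[OF q(1), of x] unfolding rp_def by blast+
  define \<Phi> where "\<Phi> b = restrict (\<lambda>s. if s = v then b v else rp (b s + b (\<tau> s))) S" for b
  define Y where "Y = {t \<in> PiE S X. int q dvd (\<Sum>s\<in>S. t s)}"
  have finY: "finite Y" unfolding Y_def using finS by (intro finite_subset[OF _ finite_PiE[of S X]]) (auto simp: X_def)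
  have dv: "d s dvd D" if "s \<in> S" for s
    using that RpI I by (auto simp: d_def D_def S_def intro!: lcm_least dvd_Lcm)
  have GnI: "G s t \<ge> 0" for s t by (simp add: G_def)
  have Phi: "\<Phi> b \<in> Y" if b: "b \<in> cell \<delta> c e" for b
  proof -
    have z: "b \<in> zero_sums q I" using b by (simp add: cell_def box_sums_def)
    have cb: "cofactor b i = c i" if "i \<in> I" for i using b that by (simp add: cell_def)
    have "\<Phi> b s \<in> X s" if s: "s \<in> S" for s
    proof (cases "s = v")
      case True
      have "den q (b v) = c v" using den_eq[OF z, of v] pair_part_v[OF z] cb[OF I(2)] by simp
      then show ?thesis using True s zero_sumsD(1)[OF z I(2)] by (simp add: \<Phi>_def X_def d_def nz_residues_def)
    next
      case False
      then have sR: "s \<in> reps" using s by (simp add: S_def)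
      have "den q (rp (b s + b (\<tau> s))) = den q (b s + b (\<tau> s))" using rp(2) q(1) by (rule den_cong)
      also have "\<dots> dvd lcm (c s) (c (\<tau> s))" using den_pair_dvd[OF z, of s] RpI[OF sR] cb by simp
      finally show ?thesis using False s rp(1) by (simp add: \<Phi>_def X_def d_def)
    qed
    moreover have "int q dvd (\<Sum>s\<in>S. \<Phi> b s)"
    proof -
      have "(\<Sum>s\<in>S. \<Phi> b s) = b v + (\<Sum>s\<in>reps. rp (b s + b (\<tau> s)))"
        using v_notin_reps finite_reps RpI by (auto simp: S_def \<Phi>_def intro!: sum.cong)
      also have "\<dots> = (\<Sum>i\<in>I. b i) + (\<Sum>s\<in>reps. rp (b s + b (\<tau> s)) - (b s + b (\<tau> s)))"
        unfolding sum_split[of b] sum_subtractf by simp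
      finally show ?thesis using zero_sumsD(2)[OF z] rp(2) by (simp add: dvd_sum)
    qed
    ultimately show ?thesis by (auto simp: Y_def \<Phi>_def)
  qed
  have fib: "real (card {b \<in> cell \<delta> c e. \<Phi> b = t}) \<le> (\<Prod>s\<in>S. G s (t s))" for t
  proof (cases "{b \<in> cell \<delta> c e. \<Phi> b = t} = {}")
    case True
    then show ?thesis using GnI by (simp only: card.empty of_nat_0) (intro prod_nonneg, auto)
  next
    case False
    let ?F = "\<lambda>s. fibre q (c s) (c (\<tau> s)) (e s) (\<delta> s) (\<delta> (\<tau> s)) (t s)"
    obtain b1 where b1: "b1 \<in> cell \<delta> c e" "\<Phi> b1 = t" using False by blast
    have z1: "b1 \<in> zero_sums q I" using b1 by (simp add: cell_def box_sums_def)
    have "t v = b1 v" using b1(2) by (auto simp: \<Phi>_def S_def)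
    moreover have "den q (b1 v) = c v" using den_eq[OF z1, of v] pair_part_v[OF z1] b1(1) I(2) by (simp add: cell_def)
    ultimately have Gv: "G v (t v) = 1" using zero_sumsD(1)[OF z1 I(2)] b1(1) I(2) by (simp add: G_def cell_def box_sums_def)
    have "card {b \<in> cell \<delta> c e. \<Phi> b = t} \<le> card (PiE reps ?F)"
    proof (rule card_inj_on_le[where f = "\<lambda>b. restrict (\<lambda>s. (b s, b (\<tau> s))) reps"])
      show "inj_on (\<lambda>b. restrict (\<lambda>s. (b s, b (\<tau> s))) reps) {b \<in> cell \<delta> c e. \<Phi> b = t}"
      proof (rule inj_onI)
        fix b b' assume bb: "b \<in> {b \<in> cell \<delta> c e. \<Phi> b = t}" "b' \<in> {b \<in> cell \<delta> c e. \<Phi> b = t}"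
          and r: "restrict (\<lambda>s. (b s, b (\<tau> s))) reps = restrict (\<lambda>s. (b' s, b' (\<tau> s))) reps"
        have P: "b \<in> PiE I (\<lambda>_. nz_residues q)" "b' \<in> PiE I (\<lambda>_. nz_residues q)" using bb by (auto simp: cell_def box_sums_def zero_sums_def)
        have RR: "b s = b' s \<and> b (\<tau> s) = b' (\<tau> s)" if "s \<in> reps" for s using fun_cong[OF r, of s] that by simp
        have vv: "b v = b' v"
        proof -
          have "\<Phi> b v = \<Phi> b' v" using bb by simp
          then show ?thesis by (simp add: \<Phi>_def S_def)
        qed
        show "b = b'"
        proof (rule PiE_ext[OF P])
          fix i assume "i \<in> I"
          then consider "i = v" | "i \<in> reps" | s where "s \<in> reps" "i = \<tau> s" using I_split(1) by blast
          then show "b i = b' i" using RR vv by cases auto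
        qed
      qed
      show "(\<lambda>b. restrict (\<lambda>s. (b s, b (\<tau> s))) reps) ` {b \<in> cell \<delta> c e. \<Phi> b = t} \<subseteq> PiE reps ?F"
      proof (rule image_subsetI)
        fix b assume b: "b \<in> {b \<in> cell \<delta> c e. \<Phi> b = t}"
        then have bT: "b \<in> box_sums \<delta>" and z: "b \<in> zero_sums q I" by (auto simp: cell_def box_sums_def)
        have "(b s, b (\<tau> s)) \<in> ?F s" if s: "s \<in> reps" for s
        proof -
          note sI = RpI[OF s]
          have cb: "cofactor b s = c s" "cofactor b (\<tau> s) = c (\<tau> s)" using b sI by (auto simp: cell_def)
          have w: "2 ^ e s \<le> pair_part b s" "pair_part b s < 2 ^ Suc (e s)" using b s by (auto simp: cell_def)
          have "den q (b s) = pair_part b s * c s" using den_eq[OF z, of s] cb by simp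
          moreover have "den q (b (\<tau> s)) = pair_part b s * c (\<tau> s)" using den_eq[OF z, of "\<tau> s"] cb pair_part_sym[OF z sI(1)] by simp
          moreover have "b s + b (\<tau> s) \<noteq> 0" using bT sI tau(3)[OF sI(1)] by (auto simp: box_sums_def)
          moreover have "den q (b s + b (\<tau> s)) dvd lcm (c s) (c (\<tau> s))" using den_pair_dvd[OF z sI(1,3)] cb by simp
          moreover have "int q dvd b s + b (\<tau> s) - t s"
          proof -
            have "t s = rp (b s + b (\<tau> s))" using b s sI(3) by (auto simp: \<Phi>_def S_def)
            then show ?thesis using rp(2)[of "b s + b (\<tau> s)"] by (simp add: dvd_diff_commute)
          qed
          ultimately show ?thesis using w bT sI zero_sumsD(1)[OF z] unfolding fibre_def fracpairs_def box_sums_def by blast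
        qed
        then show "restrict (\<lambda>s. (b s, b (\<tau> s))) reps \<in> PiE reps ?F" by (simp only: restrict_PiE_iff) blast
      qed
      show "finite (PiE reps ?F)" using finite_reps by (intro finite_PiE) auto
    qed
    also have "\<dots> = (\<Prod>s\<in>reps. card (?F s))" using finite_reps by (rule card_PiE)
    finally have "real (card {b \<in> cell \<delta> c e. \<Phi> b = t}) \<le> real (\<Prod>s\<in>reps. card (?F s))" by (rule of_nat_mono)
    also have "\<dots> = (\<Prod>s\<in>reps. G s (t s))" unfolding of_nat_prod using RpI by (intro prod.cong refl) (auto simp: G_def)
    also have "\<dots> = (\<Prod>s\<in>S. G s (t s))" using Gv v_notin_reps finite_reps by (simp add: S_def)
    finally show ?thesis .
  qed
  have "real (card (cell \<delta> c e)) = (\<Sum>b\<in>cell \<delta> c e. 1)" by simp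
  also have "\<dots> = (\<Sum>t\<in>Y. \<Sum>b | b \<in> cell \<delta> c e \<and> \<Phi> b = t. 1)"
    using Phi finite_cell finY by (intro sum.group[symmetric]) auto
  also have "\<dots> \<le> (\<Sum>t\<in>Y. \<Prod>s\<in>S. G s (t s))" using fib by (intro sum_mono) simp
  also have "\<dots> \<le> (1 / real D) * (\<Prod>s\<in>S. sqrt (real (d s) * (\<Sum>t\<in>X s. (G s t)\<^sup>2)))"
    unfolding Y_def
  proof (rule montgomery_vaughan)
    show "squarefree D" using Dq q(2) by (rule squarefree_mono)
    show "int q dvd t * int (d s)" if "s \<in> S" "t \<in> X s" for s t using that by (simp add: X_def dvd_mult_iff_den[OF q(1)])
    show "inj_on (\<lambda>b. b mod int q) (X s)" for s using inj_on_sym_residues by (rule inj_on_subset) (auto simp: X_def)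
    fix p :: nat assume p: "prime p" "p dvd D"
    have "Lcm (c ` I) = Lcm (cofactor b0 ` I)" using c by (intro arg_cong[of _ _ Lcm] image_cong) auto
    then obtain i j where ij: "i \<in> I" "j \<in> I" "j \<noteq> i" "j \<noteq> \<tau> i" "p dvd c i" "p dvd c j"
      using cofactor_cover[OF z0 p(1)] p(2) c unfolding D_def by fastforce
    \<comment> \<open>The element of \<open>S\<close> that stands for the pair of \<open>l\<close>,
      or for \<open>v\<close> itself; indices from different pairs go to different elements.\<close>
    define g where "g l = (if l = v then v else if l \<in> reps then l else \<tau> l)" for l
    have g: "g l \<in> S \<and> p dvd d (g l) \<and> (l = g l \<or> l = \<tau> (g l))" if l: "l \<in> I" "p dvd c l" for l
    proof -
      consider "l = v" | "l \<noteq> v" "l \<in> reps" | s where "l \<noteq> v" "l \<notin> reps" "s \<in> reps" "l = \<tau> s" using l I_split(1) by blast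
      then show ?thesis
      proof cases
        case 3
        then have "\<tau> l = s" using tau(2) RpI by simp
        then show ?thesis using 3 l RpI(3)[of s] by (auto simp: g_def S_def d_def intro: dvd_lcmI2)
      qed (use l in \<open>auto simp: g_def S_def d_def intro: dvd_lcmI1\<close>)
    qed
    have "g i \<noteq> g j"
    proof
      assume e: "g i = g j"
      have gS: "g i \<in> I" using g[OF ij(1,5)] RpI I(2) by (auto simp: S_def)
      from g[OF ij(1,5)] g[OF ij(2,6)] ij(3,4) e tau(2)[OF gS] show False by metis
    qed
    moreover have "{g i, g j} \<subseteq> {s \<in> S. p dvd d s}" using g ij by blast
    ultimately show "card {s \<in> S. p dvd d s} \<ge> 2"
      using card_mono[of "{s \<in> S. p dvd d s}" "{g i, g j}"] finS by simp
  qed (use q Dq finS dv GnI in \<open>auto simp: X_def\<close>)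
  also have "(\<Prod>s\<in>S. sqrt (real (d s) * (\<Sum>t\<in>X s. (G s t)\<^sup>2))) \<le> 
     sqrt (real (c v) * (2 * \<delta> v * real (c v))) * (\<Prod>s\<in>reps. sqrt (real (lcm (c s) (c (\<tau> s))) * (kappa \<delta> c e s * cell_divisor_sum \<delta> c e s)))"
  proof -
    have "(\<Prod>s\<in>S. sqrt (real (d s) * (\<Sum>t\<in>X s. (G s t)\<^sup>2))) = sqrt (real (c v) * (\<Sum>t\<in>X v. (G v t)\<^sup>2)) * (\<Prod>s\<in>reps. sqrt (real (d s) * (\<Sum>t\<in>X s. (G s t)\<^sup>2)))"
      using v_notin_reps finite_reps by (simp add: S_def d_def)
    also have "\<dots> \<le> sqrt (real (c v) * (2 * \<delta> v * real (c v))) * (\<Prod>s\<in>reps. sqrt (real (lcm (c s) (c (\<tau> s))) * (kappa \<delta> c e s * cell_divisor_sum \<delta> c e s)))"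
    proof -
      have "(\<Sum>t\<in>X v. (G v t)\<^sup>2) = (\<Sum>t\<in>X v. if t \<in> nz_residues q \<and> den q t = c v \<and> \<bar>real_of_int t\<bar> \<le> \<delta> v * real q then 1 else 0)"
        by (intro sum.cong refl) (simp add: G_def)
      also have "\<dots> = real (card {t \<in> X v. t \<in> nz_residues q \<and> den q t = c v \<and> \<bar>real_of_int t\<bar> \<le> \<delta> v * real q})"
        by (subst sum.inter_filter[symmetric]) (auto simp: X_def)
      also have "\<dots> \<le> real (card {t \<in> nz_residues q. den q t = c v \<and> \<bar>real_of_int t\<bar> \<le> \<delta> v * real q})"
        by (intro of_nat_mono card_mono) auto
      also have "\<dots> \<le> 2 * \<delta> v * real (c v)" using card_den_eq_le[OF d[OF I(2)] cpos[OF I(2)]] .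
      finally have hv: "sqrt (real (c v) * (\<Sum>t\<in>X v. (G v t)\<^sup>2)) \<le> sqrt (real (c v) * (2 * \<delta> v * real (c v)))"
        by (intro real_sqrt_le_mono mult_left_mono) auto
      have hs: "sqrt (real (d s) * (\<Sum>t\<in>X s. (G s t)\<^sup>2)) \<le> sqrt (real (lcm (c s) (c (\<tau> s))) * (kappa \<delta> c e s * cell_divisor_sum \<delta> c e s))"
        if s: "s \<in> reps" for s
      proof -
        note sI = RpI[OF s]
        have "(\<Sum>t\<in>X s. (G s t)\<^sup>2) = (\<Sum>t\<in>X s. (real (card (fibre q (c s) (c (\<tau> s)) (e s) (\<delta> s) (\<delta> (\<tau> s)) t)))\<^sup>2)"
          using sI by (simp add: G_def)
        also have "\<dots> \<le> (\<Sum>t\<in>sym_residues q. (real (card (fibre q (c s) (c (\<tau> s)) (e s) (\<delta> s) (\<delta> (\<tau> s)) t)))\<^sup>2)"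
          by (intro sum_mono2) (auto simp: X_def)
        also have "\<dots> \<le> kappa \<delta> c e s * cell_divisor_sum \<delta> c e s"
          using q sI cpos d by (intro sum_card_fibre_sq_le) auto
        finally have "real (d s) * (\<Sum>t\<in>X s. (G s t)\<^sup>2) \<le> real (lcm (c s) (c (\<tau> s))) * (kappa \<delta> c e s * cell_divisor_sum \<delta> c e s)"
          using sI by (simp add: d_def mult_left_mono)
        then show ?thesis by (rule real_sqrt_le_mono)
      qed
      show ?thesis
        using hv hs d[OF I(2)] by (intro mult_mono prod_mono prod_nonneg) (auto simp: sum_nonneg)
    qed
    finally show ?thesis .
  qed
  finally show ?thesis by (simp add: D_def mult_left_mono divide_right_mono)
qed

end

section \<open>Summation over the cells of a matching\<close>

lemma sum_inv_Lcm_le: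
  assumes I: "finite I" and L: "1 + ln (real (Suc z)) \<le> L"
  shows "(\<Sum>c\<in>{c\<in>PiE I (\<lambda>_. {1..z}). Lcm (c ` I) \<le> z}. 1 / real (Lcm (c ` I))) \<le> L ^ (2 ^ card I)"
proof -
  let ?O = "{c\<in>PiE I (\<lambda>_. {1..z}). Lcm (c ` I) \<le> z}"
  have LcmO: "Lcm (c ` I) \<in> {1..z}" if c: "c \<in> ?O" for c
  proof -
    have "0 \<notin> c ` I" using c by (auto simp: PiE_iff)
    then have "Lcm (c ` I) \<noteq> 0" using I by (simp add: Lcm_0_iff)
    then show ?thesis using c by auto
  qed
  have "(\<Sum>c\<in>?O. 1 / real (Lcm (c ` I))) = (\<Sum>D=1..z. \<Sum>c | c \<in> ?O \<and> Lcm (c ` I) = D. 1 / real (Lcm (c ` I)))"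
    using LcmO I by (intro sum.group[symmetric] finite_subset[of ?O "PiE I (\<lambda>_. {1..z})"] finite_PiE) auto
  also have "\<dots> \<le> (\<Sum>D=1..z. real (divs D) ^ card I * (1 / real D))"
  proof (rule sum_mono)
    fix D assume D: "D \<in> {1..z}"
    then have fd: "finite {a. a dvd D}" by (intro finite_divs) auto
    have "(\<Sum>c | c \<in> ?O \<and> Lcm (c ` I) = D. 1 / real (Lcm (c ` I))) = (\<Sum>c | c \<in> ?O \<and> Lcm (c ` I) = D. 1 / real D)"
      by (rule sum.cong) auto
    also have "\<dots> = real (card {c \<in> ?O. Lcm (c ` I) = D}) * (1 / real D)" by simp
    also have "\<dots> \<le> real (card (PiE I (\<lambda>_. {a. a dvd D}))) * (1 / real D)"
    proof (intro mult_right_mono of_nat_mono card_mono)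
      show "finite (PiE I (\<lambda>_. {a. a dvd D}))" using I fd by (intro finite_PiE) auto
      show "{c \<in> ?O. Lcm (c ` I) = D} \<subseteq> PiE I (\<lambda>_. {a. a dvd D})"
      proof
        fix c assume c: "c \<in> {c \<in> ?O. Lcm (c ` I) = D}"
        then have "c \<in> extensional I" by (simp add: PiE_iff)
        moreover have "c l dvd D" if "l \<in> I" for l using c that dvd_Lcm[of "c l" "c ` I"] by blast
        ultimately show "c \<in> PiE I (\<lambda>_. {a. a dvd D})" by (simp add: PiE_iff)
      qed
    qed simp
    also have "real (card (PiE I (\<lambda>_. {a. a dvd D}))) = real (divs D) ^ card I"
      using I by (simp add: card_PiE divs_def)
    finally show "(\<Sum>c | c \<in> ?O \<and> Lcm (c ` I) = D. 1 / real (Lcm (c ` I))) \<le> real (divs D) ^ card I * (1 / real D)" .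
  qed
  also have "\<dots> \<le> L ^ (2 ^ card I)" by (rule sum_divs_pow_over_le[OF L])
  finally show ?thesis .
qed

text \<open>If some \<open>t a \<le> \<delta>\<close>, this factor is at most
  \<open>2 * \<delta>\<close> and all others are at most 2. Otherwise each factor is at most
  \<open>2 * t s\<close>, and the hypothesis on the product applies.\<close>

lemma prod_add_le:
  fixes t :: "'a \<Rightarrow> real"
  assumes A: "finite A" "A \<noteq> {}" and t: "\<And>s. s \<in> A \<Longrightarrow> 0 \<le> t s \<and> t s \<le> 1" and d: "0 < \<delta>" "\<delta> \<le> 1"
    and p: "(\<Prod>s\<in>A. t s) \<le> 4 ^ card A * \<delta>"
  shows "(\<Prod>s\<in>A. t s + \<delta>) \<le> 8 ^ card A * \<delta>"
proof (cases "\<exists>a\<in>A. t a \<le> \<delta>")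
  case True
  then obtain a where a: "a \<in> A" "t a \<le> \<delta>" by blast
  have "(\<Prod>s\<in>A. t s + \<delta>) = (t a + \<delta>) * (\<Prod>s\<in>A - {a}. t s + \<delta>)" using A(1) a(1) by (rule prod.remove)
  also have "\<dots> \<le> (2 * \<delta>) * (\<Prod>s\<in>A - {a}. 2)"
    using a t d by (intro mult_mono prod_mono prod_nonneg) (auto intro: order_trans[OF add_mono[of _ 1 _ 1]] add_nonneg_nonneg)
  also have "\<dots> = 2 ^ card A * \<delta>"
  proof -
    have "card A = Suc (card (A - {a}))" using A a by (metis card.remove)
    then show ?thesis by simp
  qed
  also have "\<dots> \<le> 8 ^ card A * \<delta>" using d by (intro mult_right_mono power_mono) auto
  finally show ?thesis .
next
  case False
  then have "(\<Prod>s\<in>A. t s + \<delta>) \<le> (\<Prod>s\<in>A. 2 * t s)" using d t by (intro prod_mono) force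
  also have "\<dots> = 2 ^ card A * (\<Prod>s\<in>A. t s)" by (simp add: prod.distrib)
  also have "\<dots> \<le> 2 ^ card A * (4 ^ card A * \<delta>)" by (intro mult_left_mono p) auto
  also have "\<dots> = 8 ^ card A * \<delta>" by (simp add: mult.assoc[symmetric] power_mult_distrib[symmetric])
  finally show ?thesis .
qed

text \<open>With \<open>M\<close> the maximum of 1 and all \<open>x s\<close>, each square root is
  at most \<open>M\<close>. The right-hand side is additive in \<open>s\<close>, so that every pair
  can be averaged by itself.\<close>

lemma prod_sqrt_le_sum:
  fixes x :: "'a \<Rightarrow> real"
  assumes A: "finite A" "card A \<le> K" and x: "\<And>s. s \<in> A \<Longrightarrow> x s \<ge> 0"
  shows "(\<Prod>s\<in>A. sqrt (x s)) \<le> 1 + (\<Sum>s\<in>A. x s ^ K)"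
proof -
  define M where "M = Max (insert 1 (x ` A))"
  have M: "M \<ge> 1" "x s \<le> M" if "s \<in> A" for s using A that by (auto simp: M_def)
  have M1: "M \<ge> 1" using A by (simp add: M_def)
  have "(\<Prod>s\<in>A. sqrt (x s)) \<le> (\<Prod>s\<in>A. M)"
  proof (intro prod_mono conjI)
    fix s assume s: "s \<in> A"
    show "0 \<le> sqrt (x s)" using x[OF s] by simp
    have "sqrt (x s) \<le> sqrt (M ^ 2)"
    proof (rule real_sqrt_le_mono)
      have "M * 1 \<le> M * M" using M1 by (intro mult_left_mono) auto
      then show "x s \<le> M ^ 2" using M(2)[OF s] by (simp add: power2_eq_square)
    qed
    then show "sqrt (x s) \<le> M" using M1 by simp
  qed
  also have "\<dots> = M ^ card A" by simp
  also have "\<dots> \<le> M ^ K" using M1 A by (intro power_increasing) auto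
  also have "\<dots> \<le> 1 + (\<Sum>s\<in>A. x s ^ K)"
  proof -
    have "M \<in> insert 1 (x ` A)" unfolding M_def using A by (intro Max_in) auto
    then consider "M = 1" | s where "s \<in> A" "M = x s" by auto
    then show ?thesis
    proof cases
      case 1
      then show ?thesis using x by (simp add: sum_nonneg)
    next
      case 2
      have "x s ^ K \<le> (\<Sum>s\<in>A. x s ^ K)" using 2 A x by (intro member_le_sum) auto
      then show ?thesis using 2 by simp
    qed
  qed
  finally show ?thesis .
qed

lemma real_sqrt_prod: "sqrt (\<Prod>s\<in>A. f s) = (\<Prod>s\<in>A. sqrt (f s))"
  by (induction A rule: infinite_finite_induct) (auto simp: real_sqrt_mult)

text \<open>Under the square root, \<open>l * h = c1 * c2\<close> leaves \<open>4 * \<delta>1 *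
  \<delta>2 * t * (1 / (4 ^ e * h) + 8 * \<delta>1)\<close>. The bracket is small for a large common
  part: \<open>4 ^ e * h\<close> is about the square of the shared factor times the gcd of the
  cofactors.\<close>

lemma pair_factor_le:
  fixes c1 c2 h l :: nat
  assumes c: "c1 > 0" "c2 > 0" and h: "h = gcd c1 c2" and l: "l = lcm c1 c2" and d: "0 < \<delta>1" "0 < \<delta>2" "\<delta>1 \<le> \<delta>"
    and V: "V = t * ((2 ^ Suc e * \<delta>1 * real c1) * (2 ^ Suc e * \<delta>2 * real c2))" "t \<ge> 0"
  shows "1 / real c1 * (1 / real c2) * (1 / 4 ^ e) * sqrt (real l * ((1 + 8 * \<delta>1 * real h * 4 ^ e) * V))
    \<le> 6 * (sqrt \<delta>1 * sqrt \<delta>2) * sqrt (1 / (4 ^ e * real h) + \<delta>) * sqrt t"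
proof -
  have h0: "h > 0" using c h by simp
  have "l * h = c1 * c2" unfolding h l by simp
  then have lh: "real l * real h = real c1 * real c2" by (metis of_nat_mult)
  define B where "B = real c1 * real c2 * 4 ^ e"
  have B0: "B > 0" using c by (simp add: B_def)
  have p4: "(2::real) ^ e * 2 ^ e = 4 ^ e" by (simp flip: power_mult_distrib)
  have "1 / real c1 * (1 / real c2) * (1 / 4 ^ e) * sqrt (real l * ((1 + 8 * \<delta>1 * real h * 4 ^ e) * V))
     = sqrt ((1 / B) ^ 2) * sqrt (real l * ((1 + 8 * \<delta>1 * real h * 4 ^ e) * V))"
    using B0 by (simp add: B_def)
  also have "\<dots> = sqrt ((1 / B) ^ 2 * (real l * ((1 + 8 * \<delta>1 * real h * 4 ^ e) * V)))" by (simp only: real_sqrt_mult)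
  also have "(1 / B) ^ 2 * (real l * ((1 + 8 * \<delta>1 * real h * 4 ^ e) * V)) = 4 * \<delta>1 * \<delta>2 * t * (1 / (4 ^ e * real h) + 8 * \<delta>1)"
  proof -
    have l_eq: "real l = real c1 * real c2 / real h" using lh h0 by (simp add: field_simps)
    show ?thesis unfolding V B_def l_eq p4[symmetric] power_Suc using c h0
      by (simp add: field_simps power2_eq_square)
  qed
  also have "sqrt (4 * \<delta>1 * \<delta>2 * t * (1 / (4 ^ e * real h) + 8 * \<delta>1)) \<le> sqrt (36 * (\<delta>1 * \<delta>2) * (1 / (4 ^ e * real h) + \<delta>) * t)"
  proof (rule real_sqrt_le_mono)
    have "1 / (4 ^ e * real h) + 8 * \<delta>1 \<le> 9 * (1 / (4 ^ e * real h) + \<delta>)"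
    proof -
      have gen: "X + 8 * \<delta>1 \<le> 9 * (X + \<delta>)" if "X \<ge> 0" for X :: real 
      proof -
        have "8 * \<delta>1 \<le> 9 * \<delta>" using d by linarith
        moreover have "X \<le> 9 * X" using that by simp
        ultimately show ?thesis unfolding distrib_left by (rule add_mono[rotated])
      qed
      show ?thesis by (rule gen) simp
    qed
    then have "(4 * \<delta>1 * \<delta>2 * t) * (1 / (4 ^ e * real h) + 8 * \<delta>1) \<le> (4 * \<delta>1 * \<delta>2 * t) * (9 * (1 / (4 ^ e * real h) + \<delta>))"
      using d V(2) by (intro mult_left_mono) auto
    then show "4 * \<delta>1 * \<delta>2 * t * (1 / (4 ^ e * real h) + 8 * \<delta>1) \<le> 36 * (\<delta>1 * \<delta>2) * (1 / (4 ^ e * real h) + \<delta>) * t"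
      by (simp add: mult_ac)
  qed
  also have "\<dots> = 6 * (sqrt \<delta>1 * sqrt \<delta>2) * sqrt (1 / (4 ^ e * real h) + \<delta>) * sqrt t"
    by (simp add: real_sqrt_mult)
  finally show ?thesis .
qed

context matching
begin

text \<open>The pairs contribute the factors \<open>sqrt (1 / (4 ^ e * h) + \<delta>m)\<close>. By
  the lower bound on the common parts their product is of order at most
  \<open>sqrt \<delta>m\<close>, however the common parts are distributed over the pairs. The square
  roots of \<open>scaled_divisor_sum\<close> are polylogarithmic on average over the
  cofactors.\<close>

lemma class_bound:
  assumes m: "reps \<noteq> {}" "card I \<le> K + 2" "card reps \<le> K"
    and d: "\<And>i. i \<in> I \<Longrightarrow> 0 < \<delta> i" "\<And>i. i \<in> I \<Longrightarrow> \<delta> i \<le> \<delta>m" "\<delta>m \<le> 1"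
    and z: "z > 0" and L: "1 + ln (2 + 16 * real z ^ 4) \<le> L"
    and T: "T \<subseteq> box_sums \<delta>" "\<And>b. b \<in> T \<Longrightarrow> Lcm ((\<lambda>i. den q (b i)) ` I) \<le> z"
      "\<And>b. b \<in> T \<Longrightarrow> 1 / \<delta>m \<le> real (\<Prod>s\<in>reps. pair_part b s * gcd (den q (b s)) (den q (b (\<tau> s))))"
  shows "(\<Sum>b\<in>T. \<Prod>i\<in>I. 1 / real (den q (b i))) \<le>
     2 * 6 ^ card reps * 8 ^ card reps * (2 * L) ^ card reps *
       (L ^ (2 ^ card I) + real (card reps) * (4 ^ K * 1024 * L ^ (2 ^ (3 * Suc K) + 2 + 2 ^ K + 2 ^ K))) *
       (\<Prod>i\<in>I. sqrt (\<delta> i)) * sqrt \<delta>m"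
proof -
  let ?m = "card reps"
  define Cs where "Cs = {c\<in>PiE I (\<lambda>_. {1..z}). Lcm (c ` I) \<le> z}"
  define E where "E = PiE reps (\<lambda>_. {..floor_log z})"
  \<comment> \<open>The label of the cell that contains \<open>b\<close>.\<close>
  define \<kappa> where "\<kappa> b = (restrict (cofactor b) I, restrict (\<lambda>s. floor_log (pair_part b s)) reps)" for b
  have finCs: "finite Cs" unfolding Cs_def using I by (intro finite_subset[OF _ finite_PiE[of I "\<lambda>_. {1..z}"]]) auto
  have finE: "finite E" unfolding E_def using finite_reps by (intro finite_PiE) auto
  have finT: "finite T" using T(1) finite_box_sums by (rule finite_subset)
  have zT: "b \<in> zero_sums q I" if "b \<in> T" for b using T(1) that by (auto simp: box_sums_def)
  have RpI: "s \<in> I" "\<tau> s \<in> I" "s \<noteq> v" if "s \<in> reps" for s using that reps_subset tau v_notin_reps by auto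
  have d0: "\<delta>m > 0" using d(1)[OF I(2)] d(2)[OF I(2)] by linarith
  have z1: "real z \<ge> 1" using z by simp
  have L': "1 + ln (real (Suc z)) \<le> L"
  proof -
    have "real z ^ 1 \<le> real z ^ 4" using z1 by (intro power_increasing) auto
    then have "real (Suc z) \<le> 2 + 16 * real z ^ 4" unfolding power_one_right of_nat_Suc using z1 by linarith
    then have "ln (real (Suc z)) \<le> ln (2 + 16 * real z ^ 4)" using z1 by (subst ln_le_cancel_iff) (auto intro!: add_pos_nonneg)
    then show ?thesis using L by linarith
  qed
  then have L1: "L \<ge> 1" using ln_ge_zero[of "real (Suc z)"] by linarith
  have cF: "real (card {..floor_log z}) \<le> 2 * L"
  proof -
    have "ln (real z) \<le> ln (real (Suc z))" using z by (subst ln_le_cancel_iff) auto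
    then show ?thesis using floor_log_le_ln[OF z] L' by simp
  qed
  have cE: "real (card E) \<le> (2 * L) ^ ?m"
    unfolding E_def using finite_reps cF by (simp only: card_PiE prod_constant of_nat_power) (intro power_mono, auto)
  have LcmD: "Lcm ((\<lambda>i. den q (b i)) ` I) > 0" if "b \<in> T" for b
    using I den_pos[OF zT[OF that]] by (auto intro!: Nat.gr0I simp: Lcm_0_iff) (metis less_numeral_extra(3))
  have denz: "den q (b i) \<le> z" if "b \<in> T" "i \<in> I" for b i
    using dvd_imp_le[OF _ LcmD[OF that(1)], of "den q (b i)"] T(2)[OF that(1)] that(2) by (meson dvd_Lcm image_eqI le_trans)
  have \<kappa>: "\<kappa> b \<in> Cs \<times> E" if b: "b \<in> T" for b
  proof -
    have "cofactor b i \<in> {1..z}" if "i \<in> I" for i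
      using cofactor_pos[OF zT[OF b], of i] dvd_imp_le[OF cofactor_dvd_den[OF zT[OF b], of i] den_pos[OF zT[OF b]]] denz[OF b that] by auto
    moreover have "Lcm (cofactor b ` I) \<le> z"
    proof -
      have "Lcm (cofactor b ` I) dvd Lcm ((\<lambda>i. den q (b i)) ` I)"
        using cofactor_dvd_den[OF zT[OF b]] by (auto intro!: Lcm_least intro: dvd_trans[OF _ dvd_Lcm])
      then show ?thesis using dvd_imp_le[OF _ LcmD[OF b]] T(2)[OF b] by (meson le_trans)
    qed
    moreover have "restrict (cofactor b) I ` I = cofactor b ` I" by auto
    moreover have "floor_log (pair_part b s) \<le> floor_log z" if "s \<in> reps" for s
      using dvd_imp_le[OF pair_part_dvd[OF zT[OF b], of s] den_pos[OF zT[OF b]]] denz[OF b RpI(1)[OF that]] by (intro floor_log_le_iff) auto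
    ultimately show ?thesis by (auto simp: \<kappa>_def Cs_def E_def)
  qed
  have cellT: "b \<in> cell \<delta> c e" if "b \<in> T" "\<kappa> b = (c, e)" for b c e
  proof -
    have c: "c = restrict (cofactor b) I" "e = restrict (\<lambda>s. floor_log (pair_part b s)) reps" using that(2) by (auto simp: \<kappa>_def)
    have "2 ^ floor_log (pair_part b s) \<le> pair_part b s" "pair_part b s < 2 ^ Suc (floor_log (pair_part b s))" for s
      using pair_part_pos[OF zT[OF that(1)], of s] floor_log_exp2_le[of "pair_part b s"] floor_log_exp2_gt[of "pair_part b s"] by auto
    then show ?thesis using that(1) T(1) by (auto simp: cell_def c)
  qed
  let ?t = "\<lambda>c e s. scaled_divisor_sum (e s) (\<delta> s) (\<delta> (\<tau> s)) (c s) (c (\<tau> s))"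
  let ?C = "2 * 6 ^ ?m * (\<Prod>i\<in>I. sqrt (\<delta> i)) * sqrt (8 ^ ?m * \<delta>m)"
  have tb0: "?t c e s \<ge> 0" if "s \<in> reps" for c e s
    unfolding scaled_divisor_sum_def using d(1)[OF RpI(1)[OF that]] d(1)[OF RpI(2)[OF that]] by (intro divide_nonneg_nonneg pair_divisor_sum_nonneg mult_nonneg_nonneg) auto
  have C0: "?C \<ge> 0" using d d0 by (intro mult_nonneg_nonneg prod_nonneg) (auto intro: less_imp_le)
  have main: "(\<Sum>b | b \<in> T \<and> \<kappa> b = (c, e). \<Prod>i\<in>I. 1 / real (den q (b i))) \<le> ?C * ((1 / real (Lcm (c ` I))) * (1 + (\<Sum>s\<in>reps. ?t c e s ^ K)))"
    if ce: "(c, e) \<in> Cs \<times> E" for c e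
  proof (cases "{b. b \<in> T \<and> \<kappa> b = (c, e)} = {}")
    case True
    have "0 \<le> ?C * ((1 / real (Lcm (c ` I))) * (1 + (\<Sum>s\<in>reps. ?t c e s ^ K)))"
    proof (rule mult_nonneg_nonneg[OF C0])
      show "0 \<le> (1 / real (Lcm (c ` I))) * (1 + (\<Sum>s\<in>reps. ?t c e s ^ K))"
        using tb0 by (intro mult_nonneg_nonneg add_nonneg_nonneg sum_nonneg) auto
    qed
    then show ?thesis unfolding True by simp
  next
    case False
    then obtain b0 where b0: "b0 \<in> T" "\<kappa> b0 = (c, e)" by blast
    have ne: "cell \<delta> c e \<noteq> {}" using cellT[OF b0] by blast
    have cpos: "c i > 0" if "i \<in> I" for i using ce that by (auto simp: Cs_def PiE_iff Suc_le_eq)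
    \<comment> \<open>An upper bound for the summand on the whole cell: the pair parts are replaced
      by their lower bounds \<open>2 ^ e s\<close>.\<close>
    let ?g = "1 / real (c v) * (\<Prod>s\<in>reps. 1 / real (c s) * (1 / real (c (\<tau> s))) * (1 / 4 ^ e s))"
    have g0: "?g \<ge> 0" by (intro mult_nonneg_nonneg prod_nonneg) auto
    have fb: "(\<Prod>i\<in>I. 1 / real (den q (b i))) \<le> ?g" if b: "b \<in> T" "\<kappa> b = (c, e)" for b
    proof -
      have bc: "b \<in> cell \<delta> c e" and zb: "b \<in> zero_sums q I" using cellT[OF b] zT[OF b(1)] by auto
      have "den q (b v) = c v" using den_eq[OF zb, of v] pair_part_v[OF zb] bc I(2) by (simp add: cell_def)
      moreover have "1 / real (den q (b s)) * (1 / real (den q (b (\<tau> s)))) \<le> 1 / real (c s) * (1 / real (c (\<tau> s))) * (1 / 4 ^ e s)"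
        if s: "s \<in> reps" for s
      proof -
        note sI = RpI[OF s]
        have e: "den q (b s) = pair_part b s * c s" "den q (b (\<tau> s)) = pair_part b s * c (\<tau> s)"
          using den_eq[OF zb] pair_part_sym[OF zb sI(1)] bc sI by (auto simp: cell_def)
        have "2 ^ e s \<le> pair_part b s" using bc s by (simp add: cell_def)
        then have "real (2 ^ e s) \<le> real (pair_part b s)" by (rule of_nat_mono)
        then have w: "2 ^ e s \<le> real (pair_part b s)" by simp
        have "(4::real) ^ e s = 2 ^ e s * 2 ^ e s" by (simp flip: power_mult_distrib)
        also have "\<dots> \<le> real (pair_part b s) * real (pair_part b s)" using w by (intro mult_mono) auto
        finally have "1 / (real (pair_part b s) * real (pair_part b s)) \<le> 1 / 4 ^ e s"
          using pair_part_pos[OF zb, of s] by (intro divide_left_mono) auto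
        then have "1 / real (c s) * (1 / real (c (\<tau> s))) * (1 / (real (pair_part b s) * real (pair_part b s))) \<le> 1 / real (c s) * (1 / real (c (\<tau> s))) * (1 / 4 ^ e s)"
          by (intro mult_left_mono) auto
        then show ?thesis unfolding e by (simp add: mult_ac)
      qed
      ultimately show ?thesis unfolding prod_split[of "\<lambda>i. 1 / real (den q (b i))"]
        by (intro mult_mono prod_mono prod_nonneg) auto
    qed
    have "(\<Sum>b | b \<in> T \<and> \<kappa> b = (c, e). \<Prod>i\<in>I. 1 / real (den q (b i))) \<le> (\<Sum>b | b \<in> T \<and> \<kappa> b = (c, e). ?g)"
      using fb by (intro sum_mono) auto
    also have "\<dots> = real (card {b. b \<in> T \<and> \<kappa> b = (c, e)}) * ?g" by simp
    also have "\<dots> \<le> real (card (cell \<delta> c e)) * ?g"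
      using cellT finite_cell g0 by (intro mult_right_mono of_nat_mono card_mono) auto
    also have "\<dots> \<le> ((1 / real (Lcm (c ` I))) * (sqrt (real (c v) * (2 * \<delta> v * real (c v))) *
       (\<Prod>s\<in>reps. sqrt (real (lcm (c s) (c (\<tau> s))) * (kappa \<delta> c e s * cell_divisor_sum \<delta> c e s))))) * ?g"
      using d ne by (intro mult_right_mono card_cell_le g0) (auto intro: less_imp_le)
    also have "\<dots> = (1 / real (Lcm (c ` I))) * ((1 / real (c v) * sqrt (real (c v) * (2 * \<delta> v * real (c v)))) *
       (\<Prod>s\<in>reps. 1 / real (c s) * (1 / real (c (\<tau> s))) * (1 / 4 ^ e s) * sqrt (real (lcm (c s) (c (\<tau> s))) * (kappa \<delta> c e s * cell_divisor_sum \<delta> c e s))))"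
      by (simp only: prod.distrib mult_ac)
    also have "\<dots> \<le> (1 / real (Lcm (c ` I))) * ((2 * sqrt (\<delta> v)) *
       (\<Prod>s\<in>reps. 6 * (sqrt (\<delta> s) * sqrt (\<delta> (\<tau> s))) * sqrt (1 / (4 ^ e s * real (gcd (c s) (c (\<tau> s)))) + \<delta>m) * sqrt (?t c e s)))"
    proof -
      have "1 / real (c v) * sqrt (real (c v) * (2 * \<delta> v * real (c v))) = sqrt (2 * \<delta> v)"
      proof -
        have "real (c v) * (2 * \<delta> v * real (c v)) = real (c v) ^ 2 * (2 * \<delta> v)" by (simp add: power2_eq_square)
        then have "sqrt (real (c v) * (2 * \<delta> v * real (c v))) = real (c v) * sqrt (2 * \<delta> v)"
          by (simp only: real_sqrt_mult[of "real (c v) ^ 2"] real_sqrt_abs abs_of_nat)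
        then show ?thesis using cpos[OF I(2)] by simp
      qed
      also have "\<dots> \<le> sqrt (4 * \<delta> v)" using d(1)[OF I(2)] by (intro real_sqrt_le_mono) auto
      also have "\<dots> = 2 * sqrt (\<delta> v)" by (simp add: real_sqrt_mult)
      finally have hv: "1 / real (c v) * sqrt (real (c v) * (2 * \<delta> v * real (c v))) \<le> 2 * sqrt (\<delta> v)" .
      have hs: "0 \<le> 1 / real (c s) * (1 / real (c (\<tau> s))) * (1 / 4 ^ e s) * sqrt (real (lcm (c s) (c (\<tau> s))) * (kappa \<delta> c e s * cell_divisor_sum \<delta> c e s)) \<and>
        1 / real (c s) * (1 / real (c (\<tau> s))) * (1 / 4 ^ e s) * sqrt (real (lcm (c s) (c (\<tau> s))) * (kappa \<delta> c e s * cell_divisor_sum \<delta> c e s))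
        \<le> 6 * (sqrt (\<delta> s) * sqrt (\<delta> (\<tau> s))) * sqrt (1 / (4 ^ e s * real (gcd (c s) (c (\<tau> s)))) + \<delta>m) * sqrt (?t c e s)"
        if s: "s \<in> reps" for s
      proof
        note sI = RpI[OF s]
        show "1 / real (c s) * (1 / real (c (\<tau> s))) * (1 / 4 ^ e s) * sqrt (real (lcm (c s) (c (\<tau> s))) * (kappa \<delta> c e s * cell_divisor_sum \<delta> c e s))
          \<le> 6 * (sqrt (\<delta> s) * sqrt (\<delta> (\<tau> s))) * sqrt (1 / (4 ^ e s * real (gcd (c s) (c (\<tau> s)))) + \<delta>m) * sqrt (?t c e s)"
        proof (rule pair_factor_le[OF _ _ refl refl])
          have "0 < (2 ^ Suc (e s) * \<delta> s * real (c s)) * (2 ^ Suc (e s) * \<delta> (\<tau> s) * real (c (\<tau> s)))"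
            using cpos sI d(1) by (intro mult_pos_pos) auto
          then show "cell_divisor_sum \<delta> c e s = ?t c e s * ((2 ^ Suc (e s) * \<delta> s * real (c s)) * (2 ^ Suc (e s) * \<delta> (\<tau> s) * real (c (\<tau> s))))"
          proof -
            assume P: "0 < (2 ^ Suc (e s) * \<delta> s * real (c s)) * (2 ^ Suc (e s) * \<delta> (\<tau> s) * real (c (\<tau> s)))"
            have gen: "x = x / P * P" if "0 < P" for x P :: real using that by simp
            show ?thesis unfolding scaled_divisor_sum_def by (rule gen[OF P])
          qed
        qed (use cpos sI d tb0[OF s] in auto)
        have "kappa \<delta> c e s \<ge> 0" using d(1)[OF sI(1)] by simp
        then show "0 \<le> 1 / real (c s) * (1 / real (c (\<tau> s))) * (1 / 4 ^ e s) * sqrt (real (lcm (c s) (c (\<tau> s))) * (kappa \<delta> c e s * cell_divisor_sum \<delta> c e s))"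
          using pair_divisor_sum_nonneg by (intro mult_nonneg_nonneg real_sqrt_ge_zero) auto
      qed
      have "(\<Prod>s\<in>reps. 1 / real (c s) * (1 / real (c (\<tau> s))) * (1 / 4 ^ e s) * sqrt (real (lcm (c s) (c (\<tau> s))) * (kappa \<delta> c e s * cell_divisor_sum \<delta> c e s)))
        \<le> (\<Prod>s\<in>reps. 6 * (sqrt (\<delta> s) * sqrt (\<delta> (\<tau> s))) * sqrt (1 / (4 ^ e s * real (gcd (c s) (c (\<tau> s)))) + \<delta>m) * sqrt (?t c e s))"
        using hs by (rule prod_mono)
      moreover have "0 \<le> (\<Prod>s\<in>reps. 1 / real (c s) * (1 / real (c (\<tau> s))) * (1 / 4 ^ e s) * sqrt (real (lcm (c s) (c (\<tau> s))) * (kappa \<delta> c e s * cell_divisor_sum \<delta> c e s)))"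
        using hs by (intro prod_nonneg) blast
      moreover have "0 \<le> 2 * sqrt (\<delta> v)" using d(1)[OF I(2)] by simp
      ultimately have "(1 / real (c v) * sqrt (real (c v) * (2 * \<delta> v * real (c v)))) *
       (\<Prod>s\<in>reps. 1 / real (c s) * (1 / real (c (\<tau> s))) * (1 / 4 ^ e s) * sqrt (real (lcm (c s) (c (\<tau> s))) * (kappa \<delta> c e s * cell_divisor_sum \<delta> c e s)))
       \<le> (2 * sqrt (\<delta> v)) *
       (\<Prod>s\<in>reps. 6 * (sqrt (\<delta> s) * sqrt (\<delta> (\<tau> s))) * sqrt (1 / (4 ^ e s * real (gcd (c s) (c (\<tau> s)))) + \<delta>m) * sqrt (?t c e s))"
        by (intro mult_mono[OF hv])
      then show ?thesis by (rule mult_left_mono) simp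
    qed
    also have "\<dots> = (1 / real (Lcm (c ` I))) * (2 * 6 ^ ?m * (sqrt (\<delta> v) * (\<Prod>s\<in>reps. sqrt (\<delta> s) * sqrt (\<delta> (\<tau> s)))) *
       (\<Prod>s\<in>reps. sqrt (1 / (4 ^ e s * real (gcd (c s) (c (\<tau> s)))) + \<delta>m)) * (\<Prod>s\<in>reps. sqrt (?t c e s)))"
      by (simp only: prod.distrib prod_constant mult_ac)
    also have "sqrt (\<delta> v) * (\<Prod>s\<in>reps. sqrt (\<delta> s) * sqrt (\<delta> (\<tau> s))) = (\<Prod>i\<in>I. sqrt (\<delta> i))" by (rule prod_split[symmetric])
    also have "(\<Prod>s\<in>reps. sqrt (1 / (4 ^ e s * real (gcd (c s) (c (\<tau> s)))) + \<delta>m)) = sqrt (\<Prod>s\<in>reps. 1 / (4 ^ e s * real (gcd (c s) (c (\<tau> s)))) + \<delta>m)"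
      by (simp add: real_sqrt_prod)
    also have "(1 / real (Lcm (c ` I))) * (2 * 6 ^ ?m * (\<Prod>i\<in>I. sqrt (\<delta> i)) * sqrt (\<Prod>s\<in>reps. 1 / (4 ^ e s * real (gcd (c s) (c (\<tau> s)))) + \<delta>m) * (\<Prod>s\<in>reps. sqrt (?t c e s)))
       \<le> (1 / real (Lcm (c ` I))) * (2 * 6 ^ ?m * (\<Prod>i\<in>I. sqrt (\<delta> i)) * sqrt (8 ^ ?m * \<delta>m) * (1 + (\<Sum>s\<in>reps. ?t c e s ^ K)))"
    proof (intro mult_left_mono mult_mono real_sqrt_le_mono prod_sqrt_le_sum finite_reps m prod_add_le d0 d(3))
      fix s assume s: "s \<in> reps"
      have "1 \<le> 4 ^ e s * gcd (c s) (c (\<tau> s))" using cpos[OF RpI(1)[OF s]] by (simp add: Suc_le_eq)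
      then have "real 1 \<le> real (4 ^ e s * gcd (c s) (c (\<tau> s)))" by (rule of_nat_mono)
      then show "0 \<le> 1 / (4 ^ e s * real (gcd (c s) (c (\<tau> s)))) \<and> 1 / (4 ^ e s * real (gcd (c s) (c (\<tau> s)))) \<le> 1" by simp
      show "0 \<le> ?t c e s" by (rule tb0[OF s])
    next
      have zb: "b0 \<in> zero_sums q I" and bc: "b0 \<in> cell \<delta> c e" using zT cellT b0 by auto
      let ?G = "\<lambda>s. 4 ^ e s * real (gcd (c s) (c (\<tau> s)))"
      have G0: "?G s > 0" if "s \<in> reps" for s using cpos RpI[OF that] by simp
      \<comment> \<open>For \<open>w = pair_part b0 s\<close>, the factor at \<open>s\<close> is
        \<open>w\<^sup>2 * gcd (c s) (c (\<tau> s))\<close>, and \<open>w < 2 * 2 ^ e s\<close>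
        loses a factor 4 for each pair.\<close>
      have "1 / \<delta>m \<le> real (\<Prod>s\<in>reps. pair_part b0 s * gcd (den q (b0 s)) (den q (b0 (\<tau> s))))" by (rule T(3)[OF b0(1)])
      also have "\<dots> \<le> (\<Prod>s\<in>reps. 4 * ?G s)"
        unfolding of_nat_prod
      proof (intro prod_mono conjI)
        fix s assume s: "s \<in> reps"
        note sI = RpI[OF s]
        have e: "den q (b0 s) = pair_part b0 s * c s" "den q (b0 (\<tau> s)) = pair_part b0 s * c (\<tau> s)"
          using den_eq[OF zb] pair_part_sym[OF zb sI(1)] bc sI by (auto simp: cell_def)
        have "pair_part b0 s < 2 ^ Suc (e s)" using bc s by (simp add: cell_def)
        then have "real (pair_part b0 s) \<le> real (2 ^ Suc (e s))" by (intro of_nat_mono) simp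
        then have w: "real (pair_part b0 s) \<le> 2 * 2 ^ e s" by simp
        have "real (pair_part b0 s) * real (pair_part b0 s) \<le> (2 * 2 ^ e s) * (2 * 2 ^ e s)" using w by (intro mult_mono) auto
        also have "\<dots> = 4 * 4 ^ e s" by (simp flip: power_mult_distrib)
        finally have "real (pair_part b0 s) * real (pair_part b0 s) * real (gcd (c s) (c (\<tau> s))) \<le> 4 * 4 ^ e s * real (gcd (c s) (c (\<tau> s)))"
          by (intro mult_right_mono) auto
        moreover have "gcd (den q (b0 s)) (den q (b0 (\<tau> s))) = pair_part b0 s * gcd (c s) (c (\<tau> s))"
          unfolding e by (simp add: gcd_mult_distrib_nat)
        ultimately show "real (pair_part b0 s * gcd (den q (b0 s)) (den q (b0 (\<tau> s)))) \<le> 4 * ?G s" by (simp add: mult_ac)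
      qed simp
      also have "\<dots> = 4 ^ ?m * (\<Prod>s\<in>reps. ?G s)" by (simp add: prod.distrib)
      finally have "1 / \<delta>m \<le> 4 ^ ?m * (\<Prod>s\<in>reps. ?G s)" .
      moreover have PG: "(\<Prod>s\<in>reps. ?G s) > 0" using G0 by (rule prod_pos)
      ultimately have "1 / (\<Prod>s\<in>reps. ?G s) \<le> 4 ^ ?m * \<delta>m" using d0 by (simp add: divide_simps mult_ac)
      then show "(\<Prod>s\<in>reps. 1 / ?G s) \<le> 4 ^ ?m * \<delta>m" by (simp add: prod_dividef)
    qed (use d d0 tb0 in \<open>auto intro!: prod_nonneg mult_nonneg_nonneg less_imp_le[OF d(1)] real_sqrt_ge_zero add_nonneg_nonneg\<close>)
    finally show ?thesis by (simp only: mult_ac)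
  qed
  let ?B = "4 ^ K * 1024 * L ^ (2 ^ (3 * Suc K) + 2 + 2 ^ K + 2 ^ K)"
  have "(\<Sum>b\<in>T. \<Prod>i\<in>I. 1 / real (den q (b i))) = (\<Sum>x\<in>Cs \<times> E. \<Sum>b | b \<in> T \<and> \<kappa> b = x. \<Prod>i\<in>I. 1 / real (den q (b i)))"
    using \<kappa> by (intro sum.group[symmetric] finT finite_cartesian_product finCs finE) blast
  also have "\<dots> \<le> (\<Sum>(c,e)\<in>Cs \<times> E. ?C * ((1 / real (Lcm (c ` I))) * (1 + (\<Sum>s\<in>reps. ?t c e s ^ K))))"
    using main by (intro sum_mono) auto
  also have "\<dots> = ?C * (\<Sum>e\<in>E. \<Sum>c\<in>Cs. (1 / real (Lcm (c ` I))) * (1 + (\<Sum>s\<in>reps. ?t c e s ^ K)))"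
    by (subst sum.swap) (simp only: sum.cartesian_product sum_distrib_left case_prod_unfold)
  also have "\<dots> \<le> ?C * (\<Sum>e\<in>E. L ^ (2 ^ card I) + real ?m * ?B)"
  proof (intro mult_left_mono sum_mono C0)
    fix e assume e: "e \<in> E"
    have "(\<Sum>c\<in>Cs. (1 / real (Lcm (c ` I))) * (1 + (\<Sum>s\<in>reps. ?t c e s ^ K))) =
       (\<Sum>c\<in>Cs. 1 / real (Lcm (c ` I))) + (\<Sum>s\<in>reps. \<Sum>c\<in>Cs. (1 / real (Lcm (c ` I))) * ?t c e s ^ K)"
      by (subst sum.swap[of _ Cs]) (simp only: distrib_left sum.distrib sum_distrib_left mult_1_right)
    also have "\<dots> \<le> L ^ (2 ^ card I) + (\<Sum>s\<in>reps. ?B)"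
    proof (intro add_mono sum_mono)
      show "(\<Sum>c\<in>Cs. 1 / real (Lcm (c ` I))) \<le> L ^ (2 ^ card I)"
        unfolding Cs_def by (rule sum_inv_Lcm_le[OF I(1) L'])
      fix s assume s: "s \<in> reps"
      note sI = RpI[OF s]
      have K1: "K \<ge> 1" using m finite_reps card_gt_0_iff[of reps] by linarith
      have "(2::nat) ^ e s \<le> 2 ^ floor_log z" using e s by (intro power_increasing) (auto simp: E_def)
      also have "\<dots> \<le> z" using floor_log_exp2_le[OF z] .
      finally have "real (2 ^ e s) \<le> real z" by (rule of_nat_mono)
      then have "2 ^ e s \<le> real z" by simp
      moreover have "s \<noteq> \<tau> s" using s by (auto simp: reps_def)
      ultimately show "(\<Sum>c\<in>Cs. (1 / real (Lcm (c ` I))) * ?t c e s ^ K) \<le> ?B"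
        unfolding Cs_def using sI d K1 m z by (intro sum_scaled_divisor_sum_le I L) (auto intro: order_trans)
    qed
    finally show "(\<Sum>c\<in>Cs. (1 / real (Lcm (c ` I))) * (1 + (\<Sum>s\<in>reps. ?t c e s ^ K))) \<le> L ^ (2 ^ card I) + real ?m * ?B" by simp
  qed
  also have "\<dots> = ?C * (real (card E) * (L ^ (2 ^ card I) + real ?m * ?B))" by simp
  also have "\<dots> \<le> ?C * ((2 * L) ^ ?m * (L ^ (2 ^ card I) + real ?m * ?B))"
    by (rule mult_left_mono[OF mult_right_mono[OF cE] C0]) (use L1 in \<open>auto intro!: add_nonneg_nonneg mult_nonneg_nonneg\<close>)
  also have "?C = 2 * 6 ^ ?m * (\<Prod>i\<in>I. sqrt (\<delta> i)) * (sqrt (8 ^ ?m) * sqrt \<delta>m)" by (simp add: real_sqrt_mult)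
  also have "\<dots> * ((2 * L) ^ ?m * (L ^ (2 ^ card I) + real ?m * ?B)) \<le> 
     (2 * 6 ^ ?m * (\<Prod>i\<in>I. sqrt (\<delta> i)) * (8 ^ ?m * sqrt \<delta>m)) * ((2 * L) ^ ?m * (L ^ (2 ^ card I) + real ?m * ?B))"
  proof (intro mult_right_mono mult_left_mono)
    have "(1::real) \<le> 8 ^ ?m" by simp
    then have "(8::real) ^ ?m \<le> (8 ^ ?m) ^ 2" by (simp add: power2_eq_square)
    then show "sqrt (8 ^ ?m) \<le> 8 ^ ?m" by (rule real_le_lsqrt[rotated -1]) auto
  qed (use L1 d d0 in \<open>auto intro!: prod_nonneg mult_nonneg_nonneg less_imp_le[OF d(1)] add_nonneg_nonneg\<close>)
  finally show ?thesis by (simp only: mult_ac)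
qed

end

section \<open>Choice of a matching with large common parts\<close>

lemma prod_nat_mono_subset:
  fixes f :: "'a \<Rightarrow> nat"
  assumes "finite A" "B \<subseteq> A" "\<And>a. a \<in> A \<Longrightarrow> f a \<ge> 1"
  shows "prod f B \<le> prod f A"
proof (rule dvd_imp_le)
  show "prod f B dvd prod f A" using assms by (intro prod_dvd_prod_subset) auto
  show "prod f A > 0" using assms(3) by (intro prod_pos) (auto simp: Suc_le_eq)
qed

lemma sum_UN_le:
  fixes f :: "'a \<Rightarrow> real"
  assumes "finite J" "\<And>j. j \<in> J \<Longrightarrow> finite (B j)" "\<And>x. f x \<ge> 0"
  shows "sum f (\<Union>j\<in>J. B j) \<le> (\<Sum>j\<in>J. sum f (B j))"
  using assms(1,2)
proof (induction J)
  case (insert j J)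
  have "sum f (\<Union>j\<in>insert j J. B j) = sum f (B j) + sum f (\<Union>j\<in>J. B j) - sum f (B j \<inter> (\<Union>j\<in>J. B j))"
    using insert by (simp add: sum_Un)
  also have "\<dots> \<le> sum f (B j) + sum f (\<Union>j\<in>J. B j)" using assms(3) by (simp add: sum_nonneg)
  also have "\<dots> \<le> sum f (B j) + (\<Sum>j\<in>J. sum f (B j))" using insert by simp
  finally show ?case using insert by simp
qed simp

lemma prod_prime_factors_squarefree:
  assumes "squarefree (n::nat)" "n > 0"
  shows "\<Prod>(prime_factors n) = n"
proof -
  have "\<Prod>(prime_factors n) = (\<Prod>p\<in>prime_factors n. p ^ multiplicity p n)"
  proof (rule prod.cong[OF refl])
    fix p assume p: "p \<in> prime_factors n"
    then have "prime p" "p dvd n" by auto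
    have "multiplicity p n \<ge> 1" using p by (simp add: prime_factors_multiplicity Suc_le_eq)
    moreover have "\<not> multiplicity p n \<ge> 2"
    proof
      assume "multiplicity p n \<ge> 2"
      then have "p ^ 2 dvd n" by (rule multiplicity_dvd')
      then have "p dvd 1" using assms(1) squarefreeD by blast
      then show False using \<open>prime p\<close> by simp
    qed
    ultimately have "multiplicity p n = 1" by linarith
    then show "p = p ^ multiplicity p n" by simp
  qed
  also have "\<dots> = n" using prod_prime_factors[of n] assms(2) by simp
  finally show ?thesis .
qed

text \<open>With denominators \<open>w * c\<close> and \<open>w * c'\<close>, where \<open>w\<close>
  is the private part, this equals \<open>w\<^sup>2 * gcd c c'\<close>, the quantity that governs
  \<open>pair_factor_le\<close>.\<close>

definition shared_part :: "nat \<Rightarrow> nat set \<Rightarrow> (nat \<Rightarrow> int) \<Rightarrow> nat \<Rightarrow> nat \<Rightarrow> nat" where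
  "shared_part q I b i l = private_part q I b i l * gcd (den q (b i)) (den q (b l))"

text \<open>A prime dividing \<open>den (b i)\<close> divides another denominator: if only one, it is counted in both
  factors of \<open>shared_part\<close>, otherwise it is counted in at least two of the gcds.\<close>

lemma den_sq_le_prod_shared_part:
  assumes q: "q > 0" "squarefree q" and I: "finite I" "i \<in> I" and b: "b \<in> zero_sums q I"
  shows "(den q (b i))\<^sup>2 \<le> (\<Prod>l\<in>I - {i}. shared_part q I b i l)"
proof -
  let ?r = "\<lambda>l. den q (b l)"
  define A where "A p l \<longleftrightarrow> p dvd ?r l \<and> (\<forall>j\<in>I - {i,l}. \<not> p dvd ?r j)" for p l
  \<comment> \<open>The contribution of the prime \<open>p\<close> to
    \<open>shared_part q I b i l\<close>.\<close>
  define x where "x p l = (if A p l then p else 1) * (if p dvd ?r l then p else (1::nat))" for p l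
  have pos: "?r l > 0" for l using den_num(4)[OF q(1)] .
  have sq: "squarefree (?r l)" for l using den_num(3)[OF q(1)] q(2) by (rule squarefree_mono)
  let ?F = "prime_factors (?r i)"
  have F: "prime p" "p dvd ?r i" if "p \<in> ?F" for p using that by auto
  have x1: "x p l \<ge> 1" if "p \<in> ?F" for p l using F(1)[OF that] prime_gt_0_nat by (auto simp: x_def Suc_le_eq)
  have px: "p\<^sup>2 \<le> (\<Prod>l\<in>I - {i}. x p l)" if p: "p \<in> ?F" for p
  proof -
    obtain j where j: "j \<in> I - {i}" "p dvd ?r j"
      using prime_dvd_den_other[OF q(1) I zero_sumsD(2)[OF b] F[OF p]] by blast
    show ?thesis
    proof (cases "A p j")
      case True
      then have "p\<^sup>2 = (\<Prod>l\<in>{j}. x p l)" using j by (simp add: x_def power2_eq_square)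
      also have "\<dots> \<le> (\<Prod>l\<in>I - {i}. x p l)" using j I x1[OF p] by (intro prod_nat_mono_subset) auto
      finally show ?thesis .
    next
      case False
      then obtain l where l: "l \<in> I - {i,j}" "p dvd ?r l" using j(2) by (auto simp: A_def)
      have "p \<le> x p m" if "p dvd ?r m" for m using that F(1)[OF p] prime_gt_0_nat[of p] by (auto simp: x_def)
      then have "p * p \<le> x p j * x p l" using j l by (intro mult_mono) auto
      also have "\<dots> = (\<Prod>m\<in>{j,l}. x p m)" using l by auto
      also have "\<dots> \<le> (\<Prod>l\<in>I - {i}. x p l)" using j l I x1[OF p] by (intro prod_nat_mono_subset) auto
      finally show ?thesis by (simp add: power2_eq_square)
    qed
  qed
  have xg: "(\<Prod>p\<in>?F. x p l) \<le> shared_part q I b i l" for l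
  proof -
    have P1: "(\<Prod>p\<in>?F. if A p l then p else 1) = private_part q I b i l"
      unfolding private_part_def A_def by (subst prod.inter_filter[symmetric]) auto
    have "(\<Prod>p\<in>?F. if p dvd ?r l then p else 1) = \<Prod>{p\<in>?F. p dvd ?r l}"
      by (subst prod.inter_filter[symmetric]) auto
    moreover have "\<Prod>{p\<in>?F. p dvd ?r l} dvd \<Prod>?F" by (intro prod_dvd_prod_subset) auto
    moreover have "\<Prod>{p\<in>?F. p dvd ?r l} dvd \<Prod>(prime_factors (?r l))"
      using pos by (intro prod_dvd_prod_subset) (auto simp: prime_factors_dvd)
    ultimately have "(\<Prod>p\<in>?F. if p dvd ?r l then p else 1) dvd gcd (?r i) (?r l)"
      using prod_prime_factors_squarefree[OF sq pos] by simp
    then have "(\<Prod>p\<in>?F. if p dvd ?r l then p else 1) \<le> gcd (?r i) (?r l)" using pos[of i] by (intro dvd_imp_le) auto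
    then show ?thesis unfolding x_def prod.distrib P1 shared_part_def by (rule mult_left_mono) simp
  qed
  have "(?r i)\<^sup>2 = (\<Prod>p\<in>?F. p\<^sup>2)"
    unfolding prod_power_distrib[symmetric] using prod_prime_factors_squarefree[OF sq pos, of i] by simp
  also have "\<dots> \<le> (\<Prod>p\<in>?F. \<Prod>l\<in>I - {i}. x p l)" using px by (intro prod_mono) auto
  also have "\<dots> = (\<Prod>l\<in>I - {i}. \<Prod>p\<in>?F. x p l)" by (rule prod.swap)
  also have "\<dots> \<le> (\<Prod>l\<in>I - {i}. shared_part q I b i l)" using xg by (intro prod_mono) auto
  finally show ?thesis .
qed

lemma shared_part_sym:
  assumes "q > 0" shows "shared_part q I b l i = shared_part q I b i l"
proof -
  have "private_part q I b l i = private_part q I b i l"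
    unfolding private_part_def using den_num(4)[OF assms]
    by (intro arg_cong[of _ _ Prod]) (auto simp: insert_commute prime_factors_dvd)
  then show ?thesis by (simp add: shared_part_def gcd.commute)
qed

text \<open>The near-perfect matchings \<open>i + l = c (mod k)\<close> of the complete graph on an odd number \<open>k\<close> of
  vertices partition its edges.\<close>

lemma odd_matchings:
  assumes I: "finite I" "card I = k" "odd k"
  obtains \<tau> :: "nat \<Rightarrow> nat \<Rightarrow> nat" and v :: "nat \<Rightarrow> nat" where
    "\<And>c. c < k \<Longrightarrow> v c \<in> I" "\<And>c i. c < k \<Longrightarrow> i \<in> I \<Longrightarrow> \<tau> c i \<in> I"
    "\<And>c i. c < k \<Longrightarrow> i \<in> I \<Longrightarrow> \<tau> c (\<tau> c i) = i" "\<And>c i. c < k \<Longrightarrow> i \<in> I \<Longrightarrow> \<tau> c i = i \<longleftrightarrow> i = v c"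
    "\<And>i. i \<in> I \<Longrightarrow> bij_betw (\<lambda>c. \<tau> c i) {..<k} I"
proof -
  obtain e where e: "bij_betw e {..<k} I" using I ex_bij_betw_nat_finite[of I] by (auto simp: atLeast0LessThan)
  define f where "f = inv_into {..<k} e"
  have f: "f i < k" "e (f i) = i" if "i \<in> I" for i
    using e that by (auto simp: f_def bij_betw_def inv_into_into f_inv_into_f)
  have fe: "f (e j) = j" if "j < k" for j using e that by (simp add: f_def bij_betw_def)
  have eI: "e j \<in> I" if "j < k" for j using e that by (auto simp: bij_betw_def)
  have k0: "k > 0" using I(3) by (auto intro: Nat.gr0I)
  \<comment> \<open>This is \<open>c - j\<close> modulo \<open>k\<close>, written with
    \<open>k - j\<close> to avoid truncated subtraction.\<close>
  define r where "r c j = (c + (k - j)) mod k" for c j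
  have rk: "r c j < k" for c j using k0 by (simp add: r_def)
  have r_int: "int (r c j) = (int c - int j) mod int k" if "j < k" for c j
  proof -
    have "int (c + (k - j)) = int c - int j + int k" using that by simp
    then show ?thesis by (simp only: r_def of_nat_mod mod_add_self2)
  qed
  have rr: "r c (r c j) = j" if "c < k" "j < k" for c j
  proof -
    have "int (r c (r c j)) = (int c - (int c - int j) mod int k) mod int k" by (simp add: r_int[OF rk] r_int[OF that(2)])
    also have "\<dots> = int j mod int k" by (simp add: mod_diff_right_eq)
    finally show ?thesis using that by simp
  qed
  have r_bij: "bij_betw (\<lambda>c. r c j) {..<k} {..<k}" if j: "j < k" for j
  proof -
    have "inj_on (\<lambda>c. r c j) {..<k}"
    proof (rule inj_onI)
      fix a b assume ab: "a \<in> {..<k}" "b \<in> {..<k}" "r a j = r b j"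
      then have "(int a - int j) mod int k = (int b - int j) mod int k" using r_int[OF j] by metis
      then have "int k dvd int a - int b" by (simp add: mod_eq_dvd_iff)
      then have "int a mod int k = int b mod int k" by (simp add: mod_eq_dvd_iff)
      then show "a = b" using ab by simp
    qed
    moreover have "(\<lambda>c. r c j) ` {..<k} \<subseteq> {..<k}" using rk by auto
    ultimately show ?thesis by (simp add: bij_betw_def endo_inj_surj)
  qed
  \<comment> \<open>The fixed point solves \<open>2 * j = c\<close> modulo \<open>k\<close>, and
    \<open>(k + 1) div 2\<close> is the inverse of 2 for odd \<open>k\<close>.\<close>
  define t where "t c = (c * ((k + 1) div 2)) mod k" for c
  have tk: "t c < k" for c using k0 by (simp add: t_def)
  have fix_iff: "r c j = j \<longleftrightarrow> j = t c" if "c < k" "j < k" for c j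
  proof -
    have h: "2 * ((k + 1) div 2) = k + 1" using I(3) by simp
    have "r c j = j \<longleftrightarrow> (int c - int j) mod int k = int j mod int k" using r_int[OF that(2), of c] that by auto
    also have "\<dots> \<longleftrightarrow> int k dvd int c - 2 * int j" by (simp add: mod_eq_dvd_iff algebra_simps)
    also have "\<dots> \<longleftrightarrow> int k dvd (int c - 2 * int j) * int ((k + 1) div 2)"
    proof -
      have "coprime (int k) (int ((k + 1) div 2))"
      proof -
        have "coprime k ((k + 1) div 2)"
        proof (rule coprimeI)
          fix d assume d: "d dvd k" "d dvd (k + 1) div 2"
          then have "d dvd 2 * ((k + 1) div 2)" by simp
          then have "d dvd k + 1" using h by simp
          then have "d dvd (k + 1) - k" using d(1) by (rule dvd_diff_nat)
          then show "is_unit d" by simp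
        qed
        then show ?thesis by simp
      qed
      then show ?thesis by (simp add: coprime_dvd_mult_left_iff)
    qed
    also have "(int c - 2 * int j) * int ((k + 1) div 2) = int (c * ((k + 1) div 2)) - int j - int k * int j"
    proof -
      have "2 * int ((k + 1) div 2) = int k + 1" using h by (metis of_nat_add of_nat_mult of_nat_numeral of_nat_1)
      then have "int j * (2 * int ((k + 1) div 2)) = int j * (int k + 1)" by simp
      then show ?thesis by (simp add: algebra_simps)
    qed
    also have "int k dvd int (c * ((k + 1) div 2)) - int j - int k * int j \<longleftrightarrow> int k dvd int (c * ((k + 1) div 2)) - int j"
      by (metis dvd_diff dvd_add_triv_right_iff dvd_triv_left diff_add_cancel dvd_add_left_iff)
    also have "\<dots> \<longleftrightarrow> int (c * ((k + 1) div 2)) mod int k = int j mod int k" by (simp only: mod_eq_dvd_iff)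
    also have "\<dots> \<longleftrightarrow> t c = j" using that unfolding t_def by (simp only: of_nat_mod[symmetric] of_nat_eq_iff) simp
    finally show ?thesis by auto
  qed
  show ?thesis
  proof (rule that[of "\<lambda>c. e (t c)" "\<lambda>c i. e (r c (f i))"])
    show "bij_betw (\<lambda>c. e (r c (f i))) {..<k} I" if "i \<in> I" for i
      using bij_betw_trans[OF r_bij[OF f(1)[OF that]] e] by (simp add: comp_def)
    show "e (r c (f i)) = i \<longleftrightarrow> i = e (t c)" if "c < k" "i \<in> I" for c i
    proof -
      have "e (r c (f i)) = i \<longleftrightarrow> r c (f i) = f i" using f[OF that(2)] fe[OF rk] by metis
      also have "\<dots> \<longleftrightarrow> f i = t c" using fix_iff that f by blast
      also have "\<dots> \<longleftrightarrow> i = e (t c)" using f[OF that(2)] fe[OF tk] by metis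
      finally show ?thesis .
    qed
  qed (use eI tk rk fe rr f in auto)
qed

lemma abs_ge_den_inv:
  assumes "q > 0" "b \<in> nz_residues q" "\<bar>real_of_int b\<bar> \<le> \<delta> * real q"
  shows "1 \<le> \<delta> * real (den q b)"
proof -
  have "int q dvd b * int (den q b)" using den_num(1)[OF assms(1), of b] by (metis dvd_triv_left)
  moreover have "b * int (den q b) \<noteq> 0" using assms den_num(4)[OF assms(1), of b] by (auto simp: nz_residues_def)
  ultimately have "int q \<le> \<bar>b * int (den q b)\<bar>" using zdvd_imp_le[of "int q" "\<bar>b * int (den q b)\<bar>"] by simp
  then have "real_of_int (int q) \<le> real_of_int \<bar>b * int (den q b)\<bar>" by (simp only: of_int_le_iff)
  then have "real q \<le> \<bar>real_of_int b\<bar> * real (den q b)" by (simp add: abs_mult)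
  also have "\<dots> \<le> (\<delta> * real q) * real (den q b)" using assms by (intro mult_right_mono) auto
  finally have "real q * 1 \<le> real q * (\<delta> * real (den q b))" by (simp add: mult_ac)
  then show ?thesis using assms(1) by (simp only: mult_le_cancel_left_pos of_nat_0_less_iff)
qed

text \<open>The constant of \<open>class_bound\<close> with \<open>card reps\<close> and
  \<open>K\<close> replaced by \<open>k\<close>; for fixed \<open>k\<close> it is a polynomial in
  \<open>L\<close>.\<close>

definition key_const :: "nat \<Rightarrow> real \<Rightarrow> real" where
  "key_const k L = 2 * 6 ^ k * 8 ^ k * (2 * L) ^ k * (L ^ (2 ^ k) + real k * (4 ^ k * 1024 * L ^ (2 ^ (3 * Suc k) + 2 + 2 ^ k + 2 ^ k)))"

text \<open>Pigeonhole over the \<open>k\<close> matchings: the values of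
  \<open>shared_part\<close>, arranged by rows, have product at least
  \<open>(1 / \<delta>m)\<^sup>2\<close> for each index, while arranged by matchings their product
  is that of the squares \<open>(?G b c)\<^sup>2\<close>. Every tuple therefore falls into a class
  \<open>TC c\<close>, to which \<open>class_bound\<close> applies.\<close>

lemma key_bound:
  assumes q: "q > 0" "squarefree q" and I: "finite I" "card I = k" "odd k" "k \<ge> 3"
    and d: "\<And>i. i \<in> I \<Longrightarrow> 0 < \<delta> i" "\<And>i. i \<in> I \<Longrightarrow> \<delta> i \<le> \<delta>m" "\<delta>m \<le> 1"
    and z: "z > 0" and L: "1 + ln (2 + 16 * real z ^ 4) \<le> L"
    and T: "T = {b \<in> zero_sums q I. (\<forall>i\<in>I. \<bar>real_of_int (b i)\<bar> \<le> \<delta> i * real q) \<and> (\<forall>i\<in>I. \<forall>j\<in>I. i \<noteq> j \<longrightarrow> b i + b j \<noteq> 0) \<and>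
       Lcm ((\<lambda>i. den q (b i)) ` I) \<le> z}"
  shows "(\<Sum>b\<in>T. \<Prod>i\<in>I. 1 / real (den q (b i))) \<le> real k * key_const k L * (\<Prod>i\<in>I. sqrt (\<delta> i)) * sqrt \<delta>m"
proof -
  have "\<exists>\<tau> v. (\<forall>c<k. v c \<in> I) \<and> (\<forall>c<k. \<forall>i\<in>I. \<tau> c i \<in> I \<and> \<tau> c (\<tau> c i) = i \<and> (\<tau> c i = i \<longleftrightarrow> i = v c)) \<and>
      (\<forall>i\<in>I. bij_betw (\<lambda>c. \<tau> c i) {..<k} I)"
    by (rule odd_matchings[OF I(1,2,3)]) blast
  then obtain \<tau> v where "(\<forall>c<k. v c \<in> I) \<and> (\<forall>c<k. \<forall>i\<in>I. \<tau> c i \<in> I \<and> \<tau> c (\<tau> c i) = i \<and> (\<tau> c i = i \<longleftrightarrow> i = v c)) \<and>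
      (\<forall>i\<in>I. bij_betw (\<lambda>c. \<tau> c i) {..<k} I)" by (elim exE)
  then have \<tau>: "\<And>c. c < k \<Longrightarrow> v c \<in> I" "\<And>c i. c < k \<Longrightarrow> i \<in> I \<Longrightarrow> \<tau> c i \<in> I"
    "\<And>c i. c < k \<Longrightarrow> i \<in> I \<Longrightarrow> \<tau> c (\<tau> c i) = i" "\<And>c i. c < k \<Longrightarrow> i \<in> I \<Longrightarrow> \<tau> c i = i \<longleftrightarrow> i = v c"
    "\<And>i. i \<in> I \<Longrightarrow> bij_betw (\<lambda>c. \<tau> c i) {..<k} I" by blast+
  have M: "matching q I (v c) (\<tau> c)" if "c < k" for c
    using q I \<tau> that by unfold_locales auto
  have I0: "\<exists>i. i \<in> I" using I by (metis card.empty not_numeral_le_zero equals0I)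
  then have d0: "\<delta>m > 0" using d(1,2) by (meson less_le_trans)
  let ?R = "\<lambda>c. matching.reps I (\<tau> c)"
  let ?G = "\<lambda>b c. \<Prod>s\<in>?R c. shared_part q I b s (\<tau> c s)"
  have L1: "L \<ge> 1" using L ln_ge_zero[of "2 + 16 * real z ^ 4"] by (smt (verit) zero_le_power of_nat_0_le_iff)
  define TC where "TC c = {b \<in> T. 1 / \<delta>m \<le> real (?G b c)}" for c
  have finT: "finite T" unfolding T using finite_zero_sums[OF I(1), of q] by simp
  have "T \<subseteq> (\<Union>c<k. TC c)"
  proof
    fix b assume bT: "b \<in> T"
    then have b: "b \<in> zero_sums q I" by (simp add: T)
    have th: "1 / \<delta>m \<le> real (den q (b i))" if i: "i \<in> I" for i
    proof -
      have "1 \<le> \<delta> i * real (den q (b i))" using abs_ge_den_inv[OF q(1) zero_sumsD(1)[OF b i], of "\<delta> i"] bT i by (simp add: T)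
      also have "\<dots> \<le> \<delta>m * real (den q (b i))" using d(2)[OF i] by (intro mult_right_mono) auto
      finally show ?thesis using d0 by (simp add: field_simps)
    qed
    \<comment> \<open>The value 1 on the diagonal makes the unmatched index of each matching
      contribute nothing.\<close>
    define g where "g i l = (if l = i then 1 else shared_part q I b i l)" for i l
    have row: "(1 / \<delta>m)\<^sup>2 \<le> real (\<Prod>c<k. g i (\<tau> c i))" if i: "i \<in> I" for i
    proof -
      have "(1 / \<delta>m)\<^sup>2 \<le> (real (den q (b i)))\<^sup>2" using th[OF i] d0 by (intro power_mono) auto
      also have "\<dots> = real ((den q (b i))\<^sup>2)" by simp
      also have "\<dots> \<le> real (\<Prod>l\<in>I - {i}. shared_part q I b i l)" using den_sq_le_prod_shared_part[OF q I(1) i b] by (rule of_nat_mono)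
      also have "(\<Prod>l\<in>I - {i}. shared_part q I b i l) = (\<Prod>l\<in>I. g i l)"
        using I(1) i by (subst prod.remove[of I i]) (auto simp: g_def intro!: prod.cong)
      also have "\<dots> = (\<Prod>c<k. g i (\<tau> c i))" by (rule prod.reindex_bij_betw[OF \<tau>(5)[OF i], symmetric])
      finally show ?thesis .
    qed
    have cls: "(\<Prod>i\<in>I. g i (\<tau> c i)) = (?G b c)\<^sup>2" if c: "c < k" for c
    proof -
      interpret matching q I "v c" "\<tau> c" by (rule M[OF c])
      have "(\<Prod>i\<in>I. g i (\<tau> c i)) = g (v c) (\<tau> c (v c)) * (\<Prod>s\<in>reps. g s (\<tau> c s) * g (\<tau> c s) (\<tau> c (\<tau> c s)))" by (rule prod_split)
      also have "g (v c) (\<tau> c (v c)) = 1" using \<tau>(1,4)[OF c] by (simp add: g_def)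
      also have "(\<Prod>s\<in>reps. g s (\<tau> c s) * g (\<tau> c s) (\<tau> c (\<tau> c s))) = (\<Prod>s\<in>reps. (shared_part q I b s (\<tau> c s))\<^sup>2)"
      proof (rule prod.cong[OF refl])
        fix s assume s: "s \<in> reps"
        then have "s \<in> I" "s \<noteq> \<tau> c s" by (auto simp: reps_def)
        then show "g s (\<tau> c s) * g (\<tau> c s) (\<tau> c (\<tau> c s)) = (shared_part q I b s (\<tau> c s))\<^sup>2"
          using \<tau>(3)[OF c] shared_part_sym[OF q(1), of I b "\<tau> c s" s] by (simp add: g_def power2_eq_square)
      qed
      finally show ?thesis by (simp add: prod_power_distrib)
    qed
    have "\<exists>c<k. 1 / \<delta>m \<le> real (?G b c)"
    proof (rule ccontr)
      assume n: "\<not> (\<exists>c<k. 1 / \<delta>m \<le> real (?G b c))"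
      have "(\<Prod>i\<in>I. (1 / \<delta>m)\<^sup>2) \<le> (\<Prod>i\<in>I. real (\<Prod>c<k. g i (\<tau> c i)))" using row by (intro prod_mono) auto
      also have "\<dots> = real (\<Prod>c<k. \<Prod>i\<in>I. g i (\<tau> c i))" by (subst prod.swap) simp
      also have "\<dots> = real (\<Prod>c<k. (?G b c)\<^sup>2)" using cls by simp
      also have "\<dots> = (\<Prod>c<k. (real (?G b c))\<^sup>2)" by simp
      also have "\<dots> < (\<Prod>c<k. (1 / \<delta>m)\<^sup>2)"
      proof -
        have lt: "(real (?G b c))\<^sup>2 < (1 / \<delta>m)\<^sup>2" if "c < k" for c
        proof -
          have "real (?G b c) < 1 / \<delta>m" using n that by (auto simp: not_le)
          then show ?thesis by (rule power_strict_mono) (rule of_nat_0_le_iff, simp)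
        qed
        show ?thesis
          by (rule prod_mono_strict[where i = 0]) (use lt I(4) d0 in \<open>auto intro: less_imp_le\<close>)
      qed
      finally show False using I by simp
    qed
    then show "b \<in> (\<Union>c<k. TC c)" using bT by (auto simp: TC_def)
  qed
  then have "(\<Sum>b\<in>T. \<Prod>i\<in>I. 1 / real (den q (b i))) \<le> (\<Sum>b\<in>(\<Union>c<k. TC c). \<Prod>i\<in>I. 1 / real (den q (b i)))"
    using finT by (intro sum_mono2) (auto simp: TC_def intro!: prod_nonneg)
  also have "\<dots> \<le> (\<Sum>c<k. \<Sum>b\<in>TC c. \<Prod>i\<in>I. 1 / real (den q (b i)))"
    using finT by (intro sum_UN_le) (auto simp: TC_def intro!: prod_nonneg)
  also have "\<dots> \<le> (\<Sum>c<k. key_const k L * (\<Prod>i\<in>I. sqrt (\<delta> i)) * sqrt \<delta>m)"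
  proof (rule sum_mono)
    fix c assume "c \<in> {..<k}"
    then have c: "c < k" by simp
    note kI = I
    interpret matching q I "v c" "\<tau> c" by (rule M[OF c])
    have cR: "card I = 1 + 2 * card reps" by (rule card_I)
    then have cR': "card reps \<le> k" "reps \<noteq> {}" using kI by auto
    have "(\<Sum>b\<in>TC c. \<Prod>i\<in>I. 1 / real (den q (b i))) \<le>
     2 * 6 ^ card reps * 8 ^ card reps * (2 * L) ^ card reps *
       (L ^ (2 ^ card I) + real (card reps) * (4 ^ k * 1024 * L ^ (2 ^ (3 * Suc k) + 2 + 2 ^ k + 2 ^ k))) *
       (\<Prod>i\<in>I. sqrt (\<delta> i)) * sqrt \<delta>m"
    proof (rule class_bound)
      show "TC c \<subseteq> box_sums \<delta>" by (auto simp: TC_def T box_sums_def)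
      show "Lcm ((\<lambda>i. den q (b i)) ` I) \<le> z" if "b \<in> TC c" for b using that by (simp add: TC_def T)
      show "1 / \<delta>m \<le> real (\<Prod>s\<in>reps. pair_part b s * gcd (den q (b s)) (den q (b (\<tau> c s))))" if "b \<in> TC c" for b
        using that by (simp add: TC_def shared_part_def pair_part_def)
    qed (use kI d z L cR' in auto)
    also have "\<dots> \<le> key_const k L * (\<Prod>i\<in>I. sqrt (\<delta> i)) * sqrt \<delta>m"
    proof (intro mult_right_mono)
      have mono: "x ^ card reps \<le> x ^ k" if "x \<ge> 1" for x :: real using that cR' by (intro power_increasing) auto
      show "2 * 6 ^ card reps * 8 ^ card reps * (2 * L) ^ card reps *
       (L ^ (2 ^ card I) + real (card reps) * (4 ^ k * 1024 * L ^ (2 ^ (3 * Suc k) + 2 + 2 ^ k + 2 ^ k))) \<le> key_const k L"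
        unfolding key_const_def kI(2) using L1 cR' by (intro mult_mono add_mono mono) (auto intro!: add_nonneg_nonneg mult_nonneg_nonneg)
    qed (use d d0 in \<open>auto intro!: prod_nonneg less_imp_le[OF d(1)]\<close>)
    finally show "(\<Sum>b\<in>TC c. \<Prod>i\<in>I. 1 / real (den q (b i))) \<le> key_const k L * (\<Prod>i\<in>I. sqrt (\<delta> i)) * sqrt \<delta>m" .
  qed
  finally show ?thesis by simp
qed

lemma sum_Un_le:
  fixes f :: "'a \<Rightarrow> real"
  assumes "finite A" "finite B" "\<And>x. f x \<ge> 0"
  shows "sum f (A \<union> B) \<le> sum f A + sum f B"
proof -
  have "0 \<le> sum f (A \<inter> B)" using assms(3) by (intro sum_nonneg) auto
  then show ?thesis using sum.union_inter[OF assms(1,2), of f] by linarith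
qed

section \<open>Moment bounds\<close>

text \<open>Restricting to \<open>L \<ge> 2\<close> lets powers of \<open>L\<close> absorb all
  constants, so exponents need not be computed in the inductions that follow.\<close>

definition polylog :: "(real \<Rightarrow> real) \<Rightarrow> bool" where
  "polylog f \<longleftrightarrow> (\<exists>A::nat. \<forall>L\<ge>2. 0 \<le> f L \<and> f L \<le> L ^ A)"

lemma polylog_const: assumes "c \<ge> 0" shows "polylog (\<lambda>_. c)"
proof -
  obtain A where A: "c < 2 ^ A" using real_arch_pow[of 2 c] by auto
  have "c \<le> L ^ A" if "L \<ge> 2" for L :: real
    using A power_mono[of 2 L A] that by linarith
  then show ?thesis using assms unfolding polylog_def by blast
qed

lemma polylog_id: "polylog (\<lambda>L. L)" unfolding polylog_def by (rule exI[of _ 1]) auto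

lemma polylog_mult: assumes "polylog f" "polylog g" shows "polylog (\<lambda>L. f L * g L)"
proof -
  obtain A B where AB: "\<forall>L\<ge>2. 0 \<le> f L \<and> f L \<le> L ^ A" "\<forall>L\<ge>2. 0 \<le> g L \<and> g L \<le> L ^ B" using assms unfolding polylog_def by blast
  have "0 \<le> f L * g L \<and> f L * g L \<le> L ^ (A + B)" if "L \<ge> 2" for L
    using AB that by (auto simp: power_add intro!: mult_mono)
  then show ?thesis unfolding polylog_def by blast
qed

lemma polylog_add: assumes "polylog f" "polylog g" shows "polylog (\<lambda>L. f L + g L)"
proof -
  obtain A B where AB: "\<forall>L\<ge>2. 0 \<le> f L \<and> f L \<le> L ^ A" "\<forall>L\<ge>2. 0 \<le> g L \<and> g L \<le> L ^ B" using assms unfolding polylog_def by blast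
  have "0 \<le> f L + g L \<and> f L + g L \<le> L ^ (Suc (A + B))" if L: "L \<ge> 2" for L
  proof -
    have "L ^ A \<le> L ^ (A + B)" "L ^ B \<le> L ^ (A + B)" using L by (auto intro!: power_increasing)
    then have "f L + g L \<le> 2 * L ^ (A + B)" using AB L by (smt (verit))
    also have "\<dots> \<le> L * L ^ (A + B)" using L by (intro mult_right_mono) auto
    finally show ?thesis using AB L by simp
  qed
  then show ?thesis unfolding polylog_def by blast
qed

lemma polylog_power: "polylog f \<Longrightarrow> polylog (\<lambda>L. f L ^ n)"
  by (induction n) (auto intro: polylog_mult polylog_const)

lemma polylog_key_const: "polylog (key_const k)"
  unfolding key_const_def by (intro polylog_mult polylog_add polylog_power polylog_const polylog_id) auto

section \<open>Dyadic decomposition of the weights\<close>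

lemma totient_ratio_le:
  assumes "squarefree q" "q > 0" "r dvd q"
  shows "1 / real (totient r) \<le> (real q / real (totient q)) / real r"
proof -
  obtain s where s: "q = r * s" using assms by blast
  then have "coprime r s" using assms squarefree_mult_imp_coprime by blast
  then have t: "totient q = totient r * totient s" using s by (simp add: totient_mult_coprime)
  have r: "r > 0" "s > 0" using assms s by auto
  have "totient s \<le> s" by (rule totient_le)
  then have "1 \<le> real s / real (totient s)" using r by simp
  then have "1 / real (totient r) * 1 \<le> 1 / real (totient r) * (real s / real (totient s))" by (intro mult_left_mono) auto
  also have "\<dots> = (real q / real (totient q)) / real r" 
  proof -
    have "real q = real r * real s" using s by simp
    then show ?thesis using r by (simp add: t)
  qed
  finally show ?thesis by simp
qed

text \<open>Take the least \<open>j\<close> with \<open>x * H \<le> 2 ^ j\<close>. As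
  \<open>x \<le> 1 / 2\<close>, a positive \<open>j\<close> satisfies \<open>2 ^ j < H\<close>, so
  no scale \<open>2 ^ j / H\<close> exceeds 1.\<close>

lemma min_le_dyadic:
  fixes x :: real
  assumes "H \<ge> 1" "0 < x" "x \<le> 1 / 2"
  shows "\<exists>j\<le>floor_log H. x \<le> 2 ^ j / real H \<and> min (real H) (1 / x) \<le> 2 / (2 ^ j / real H)"
proof -
  define y where "y = x * real H"
  have y: "y > 0" "y \<le> real H / 2" using assms by (auto simp: y_def)
  obtain n where "y < 2 ^ n" using real_arch_pow[of 2 y] by auto
  then have ex: "\<exists>j. y \<le> 2 ^ j" by (intro exI[of _ n]) simp
  define j where "j = (LEAST j. y \<le> 2 ^ j)"
  have j: "y \<le> 2 ^ j" unfolding j_def using ex by (rule LeastI_ex)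
  show ?thesis
  proof (cases j)
    case 0
    then show ?thesis using j assms by (intro exI[of _ 0]) (auto simp: y_def field_simps min_le_iff_disj)
  next
    case (Suc i)
    have "\<not> y \<le> 2 ^ i" using not_less_Least[of i "\<lambda>j. y \<le> 2 ^ j"] Suc by (simp add: j_def)
    then have i: "2 ^ i < y" by simp
    then have "2 ^ Suc i < real H" using y by simp
    then have "real (2 ^ Suc i) < real H" by simp
    then have "2 ^ j \<le> H" using Suc by (simp only: of_nat_less_iff)
    then have "floor_log (2 ^ j) \<le> floor_log H" by (rule floor_log_le_iff)
    then have jl: "j \<le> floor_log H" by simp
    have "x * 2 ^ j = 2 * (x * 2 ^ i)" using Suc by simp
    have "1 / x = real H / y" using assms by (simp add: y_def)
    also have "\<dots> \<le> real H / 2 ^ i" using i assms y by (intro divide_left_mono) auto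
    also have "\<dots> = 2 / (2 ^ j / real H)" using Suc by simp
    finally have "min (real H) (1 / x) \<le> 2 / (2 ^ j / real H)" by simp
    moreover have "x \<le> 2 ^ j / real H" using j assms by (simp add: y_def field_simps)
    ultimately show ?thesis using jl by blast
  qed
qed

lemma nz_residues_abs:
  assumes "q > 0" "b \<in> nz_residues q"
  shows "0 < \<bar>real_of_int b\<bar>" "\<bar>real_of_int b\<bar> / real q \<le> 1 / 2"
proof -
  have "2 * \<bar>b\<bar> \<le> int q" using assms by (auto simp: nz_residues_def sym_residues_def)
  then have "real_of_int (2 * \<bar>b\<bar>) \<le> real_of_int (int q)" by (simp only: of_int_le_iff)
  then show "\<bar>real_of_int b\<bar> / real q \<le> 1 / 2" using assms by (simp add: field_simps)
qed (use assms in \<open>simp add: nz_residues_def\<close>)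

lemma weight_nonneg: "weight q H b \<ge> 0" by (simp add: weight_def)

lemma weight_le_dyadic:
  assumes q: "q > 0" "squarefree q" and H: "H \<ge> 1" and b: "b \<in> nz_residues q" and P: "P = real q / real (totient q)"
  shows "weight q H b \<le> (\<Sum>j\<le>floor_log H. (if \<bar>real_of_int b\<bar> \<le> 2 ^ j / real H * real q then 2 * P / (2 ^ j / real H) * (1 / real (den q b)) else 0))"
proof -
  let ?x = "\<bar>real_of_int b\<bar> / real q"
  have P0: "P \<ge> 0" using P by simp
  obtain j where j: "j \<le> floor_log H" "?x \<le> 2 ^ j / real H" "min (real H) (1 / ?x) \<le> 2 / (2 ^ j / real H)"
    using min_le_dyadic[OF H, of ?x] nz_residues_abs[OF q(1) b] q by auto
  have t: "1 / real (totient (den q b)) \<le> P / real (den q b)" unfolding P using totient_ratio_le[OF q(2,1) den_num(3)[OF q(1)]] .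
  have "weight q H b = min (real H) (1 / ?x) * (1 / real (totient (den q b)))" by (simp add: weight_def)
  also have "\<dots> \<le> 2 / (2 ^ j / real H) * (P / real (den q b))" by (intro mult_mono j t) auto
  also have "\<dots> = (if \<bar>real_of_int b\<bar> \<le> 2 ^ j / real H * real q then 2 * P / (2 ^ j / real H) * (1 / real (den q b)) else 0)"
    using j(2) q by (simp add: field_simps)
  also have "\<dots> \<le> (\<Sum>j\<le>floor_log H. (if \<bar>real_of_int b\<bar> \<le> 2 ^ j / real H * real q then 2 * P / (2 ^ j / real H) * (1 / real (den q b)) else 0))"
    using j(1) P0 by (intro member_le_sum) (auto intro!: divide_nonneg_nonneg mult_nonneg_nonneg)
  finally show ?thesis .
qed

definition lcm_den :: "nat \<Rightarrow> nat set \<Rightarrow> (nat \<Rightarrow> int) \<Rightarrow> nat" where "lcm_den q I b = Lcm ((\<lambda>i. den q (b i)) ` I)"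

text \<open>Each weight is spread over the scales \<open>2 ^ j / H\<close>, and
  \<open>key_bound\<close> is applied to every choice of scales, of which there are at most
  \<open>L ^ k\<close>.\<close>

lemma noncancelling_bound:
  assumes q: "q > 0" "squarefree q" and I: "finite I" "card I = k" "odd k" "k \<ge> 3"
    and z: "z > 0" and L: "1 + ln (2 + 16 * real z ^ 4) \<le> L" "L \<ge> 2" and H: "H \<ge> 1" "real (floor_log H) + 1 \<le> L"
    and P: "P = real q / real (totient q)" "P \<le> L"
  shows "(\<Sum>b\<in>{b \<in> zero_sums q I. lcm_den q I b \<le> z \<and> (\<forall>i\<in>I. \<forall>j\<in>I. i \<noteq> j \<longrightarrow> b i + b j \<noteq> 0)}. \<Prod>i\<in>I. weight q H (b i))
    \<le> L ^ k * (2 * L) ^ k * real k * key_const k L * sqrt (real H) ^ (k - 1)"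
proof -
  let ?T = "{b \<in> zero_sums q I. lcm_den q I b \<le> z \<and> (\<forall>i\<in>I. \<forall>j\<in>I. i \<noteq> j \<longrightarrow> b i + b j \<noteq> 0)}"
  let ?J = "{..floor_log H}"
  define \<delta> where "\<delta> j = 2 ^ j / real H" for j :: nat
  have d0: "\<delta> j > 0" for j using H by (simp add: \<delta>_def)
  have d1: "\<delta> j \<le> 1" if "j \<in> ?J" for j
  proof -
    have "(2::nat) ^ j \<le> 2 ^ floor_log H" using that by (intro power_increasing) auto
    also have "\<dots> \<le> H" using H by (intro floor_log_exp2_le) auto
    finally have "real (2 ^ j) \<le> real H" by (rule of_nat_mono)
    then show ?thesis using H by (simp add: \<delta>_def)
  qed
  have P0: "P \<ge> 0" using P by simp
  have finT: "finite ?T" using finite_zero_sums[OF I(1), of q] by simp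
  let ?u = "\<lambda>b j. if \<bar>real_of_int b\<bar> \<le> \<delta> j * real q then 2 * P / \<delta> j * (1 / real (den q b)) else 0"
  have "(\<Sum>b\<in>?T. \<Prod>i\<in>I. weight q H (b i)) \<le> (\<Sum>b\<in>?T. \<Prod>i\<in>I. \<Sum>j\<in>?J. ?u (b i) j)"
  proof (intro sum_mono prod_mono conjI weight_nonneg)
    fix b i assume "b \<in> ?T" "i \<in> I"
    then show "weight q H (b i) \<le> (\<Sum>j\<in>?J. ?u (b i) j)"
      unfolding \<delta>_def by (intro weight_le_dyadic q H P) (auto intro: zero_sumsD)
  qed
  also have "\<dots> = (\<Sum>b\<in>?T. \<Sum>f\<in>PiE I (\<lambda>_. ?J). \<Prod>i\<in>I. ?u (b i) (f i))"
    by (intro sum.cong refl prod_sum_PiE I) auto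
  also have "\<dots> = (\<Sum>f\<in>PiE I (\<lambda>_. ?J). \<Sum>b\<in>?T. \<Prod>i\<in>I. ?u (b i) (f i))" by (rule sum.swap)
  also have "\<dots> \<le> (\<Sum>f\<in>PiE I (\<lambda>_. ?J). (2 * L) ^ k * (real k * key_const k L * sqrt (real H) ^ (k - 1)))"
  proof (rule sum_mono)
    fix f assume f: "f \<in> PiE I (\<lambda>_. ?J)"
    then have fJ: "f i \<in> ?J" if "i \<in> I" for i using that by auto
    define Tf where "Tf = {b \<in> zero_sums q I. (\<forall>i\<in>I. \<bar>real_of_int (b i)\<bar> \<le> \<delta> (f i) * real q) \<and> (\<forall>i\<in>I. \<forall>j\<in>I. i \<noteq> j \<longrightarrow> b i + b j \<noteq> 0) \<and>
       Lcm ((\<lambda>i. den q (b i)) ` I) \<le> z}"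
    have TfT: "Tf = {b \<in> ?T. \<forall>i\<in>I. \<bar>real_of_int (b i)\<bar> \<le> \<delta> (f i) * real q}" by (auto simp: Tf_def lcm_den_def)
    have "(\<Sum>b\<in>?T. \<Prod>i\<in>I. ?u (b i) (f i)) = (\<Sum>b\<in>?T. if \<forall>i\<in>I. \<bar>real_of_int (b i)\<bar> \<le> \<delta> (f i) * real q then (\<Prod>i\<in>I. 2 * P / \<delta> (f i)) * (\<Prod>i\<in>I. 1 / real (den q (b i))) else 0)"
    proof (rule sum.cong[OF refl])
      fix b
      show "(\<Prod>i\<in>I. ?u (b i) (f i)) = (if \<forall>i\<in>I. \<bar>real_of_int (b i)\<bar> \<le> \<delta> (f i) * real q then (\<Prod>i\<in>I. 2 * P / \<delta> (f i)) * (\<Prod>i\<in>I. 1 / real (den q (b i))) else 0)"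
      proof (cases "\<forall>i\<in>I. \<bar>real_of_int (b i)\<bar> \<le> \<delta> (f i) * real q")
        case True
        then have "(\<Prod>i\<in>I. ?u (b i) (f i)) = (\<Prod>i\<in>I. 2 * P / \<delta> (f i) * (1 / real (den q (b i))))" by (intro prod.cong refl) simp
        then show ?thesis unfolding if_P[OF True] prod.distrib .
      next
        case False
        then show ?thesis using I(1) by (auto intro!: prod_zero)
      qed
    qed
    also have "\<dots> = (\<Prod>i\<in>I. 2 * P / \<delta> (f i)) * (\<Sum>b\<in>Tf. \<Prod>i\<in>I. 1 / real (den q (b i)))"
      unfolding TfT sum.inter_filter[OF finT] sum_distrib_left by (intro sum.cong refl) simp
    also have "\<dots> \<le> (\<Prod>i\<in>I. 2 * L / \<delta> (f i)) * (\<Sum>b\<in>Tf. \<Prod>i\<in>I. 1 / real (den q (b i)))"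
    proof (intro mult_right_mono prod_mono conjI sum_nonneg prod_nonneg ballI)
      fix i
      show "2 * P / \<delta> (f i) \<le> 2 * L / \<delta> (f i)" using P(2) less_imp_le[OF d0[of "f i"]] by (intro divide_right_mono) auto
      show "0 \<le> 2 * P / \<delta> (f i)" using P0 less_imp_le[OF d0[of "f i"]] by (intro divide_nonneg_nonneg) auto
    qed auto
    also have "\<dots> \<le> (2 * L) ^ k * (real k * key_const k L * sqrt (real H) ^ (k - 1))"
    proof -
      have Ine: "I \<noteq> {}" using I by auto
      define \<delta>m where "\<delta>m = Max ((\<lambda>i. \<delta> (f i)) ` I)"
      have "\<delta>m \<in> (\<lambda>i. \<delta> (f i)) ` I" unfolding \<delta>m_def using I Ine by (intro Max_in) auto
      then obtain i0 where i0: "i0 \<in> I" "\<delta>m = \<delta> (f i0)" by blast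
      have dm: "\<delta> (f i) \<le> \<delta>m" if "i \<in> I" for i unfolding \<delta>m_def using that I by (intro Max_ge) auto
      have "(\<Sum>b\<in>Tf. \<Prod>i\<in>I. 1 / real (den q (b i))) \<le> real k * key_const k L * (\<Prod>i\<in>I. sqrt (\<delta> (f i))) * sqrt \<delta>m"
        using d0 dm d1[OF fJ[OF i0(1)]] i0 by (intro key_bound[OF q I _ _ _ z L(1) Tf_def]) auto
      then have "(\<Prod>i\<in>I. 2 * L / \<delta> (f i)) * (\<Sum>b\<in>Tf. \<Prod>i\<in>I. 1 / real (den q (b i))) \<le> (\<Prod>i\<in>I. 2 * L / \<delta> (f i)) * (real k * key_const k L * (\<Prod>i\<in>I. sqrt (\<delta> (f i))) * sqrt \<delta>m)"
        using L d0 by (intro mult_left_mono prod_nonneg) (auto intro!: divide_nonneg_nonneg less_imp_le[OF d0])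
      also have "\<dots> = (2 * L) ^ k * (real k * key_const k L * ((\<Prod>i\<in>I. 1 / \<delta> (f i) * sqrt (\<delta> (f i))) * sqrt \<delta>m))"
      proof -
        have "(\<Prod>i\<in>I. 2 * L / \<delta> (f i)) = (2 * L) ^ k * (\<Prod>i\<in>I. 1 / \<delta> (f i))"
          using I by (simp add: prod_dividef)
        then show ?thesis by (simp only: prod.distrib mult_ac)
      qed
      also have "\<dots> \<le> (2 * L) ^ k * (real k * key_const k L * sqrt (real H) ^ (k - 1))"
      proof (intro mult_left_mono)
        have "(\<Prod>i\<in>I. 1 / \<delta> (f i) * sqrt (\<delta> (f i))) = (\<Prod>i\<in>I. 1 / sqrt (\<delta> (f i)))"
      proof (rule prod.cong[OF refl])
        fix i
        have "\<delta> (f i) = sqrt (\<delta> (f i)) * sqrt (\<delta> (f i))" using d0[of "f i"] by simp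
        then show "1 / \<delta> (f i) * sqrt (\<delta> (f i)) = 1 / sqrt (\<delta> (f i))"
          using d0[of "f i"] by (metis divide_self_if mult.commute mult_cancel_left2 nonzero_divide_mult_cancel_left times_divide_eq_right real_sqrt_gt_zero less_irrefl div_by_1 times_divide_eq_left mult_1)
      qed
      \<comment> \<open>The factor at the index \<open>i0\<close> of the largest scale is cancelled
        exactly; each other factor is at most \<open>sqrt H\<close>, since no scale is below
        \<open>1 / H\<close>.\<close>
      then have "(\<Prod>i\<in>I. 1 / \<delta> (f i) * sqrt (\<delta> (f i))) * sqrt \<delta>m = (\<Prod>i\<in>I - {i0}. 1 / sqrt (\<delta> (f i)))"
        using prod.remove[OF I(1) i0(1), of "\<lambda>i. 1 / sqrt (\<delta> (f i))"] i0(2) d0[of "f i0"] by simp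
      also have "\<dots> \<le> (\<Prod>i\<in>I - {i0}. sqrt (real H))"
      proof (intro prod_mono conjI)
        fix i
        show "0 \<le> 1 / sqrt (\<delta> (f i))" using d0[of "f i"] by simp
        have "1 / real H \<le> \<delta> (f i)" unfolding \<delta>_def by (intro divide_right_mono) auto
        then have "sqrt (1 / real H) \<le> sqrt (\<delta> (f i))" by (rule real_sqrt_le_mono)
        then have "1 / sqrt (\<delta> (f i)) \<le> 1 / sqrt (1 / real H)" using H d0[of "f i"] by (intro divide_left_mono) auto
        then show "1 / sqrt (\<delta> (f i)) \<le> sqrt (real H)" by (simp add: real_sqrt_divide)
      qed
      also have "\<dots> = sqrt (real H) ^ (k - 1)" using I i0 by simp
        finally show "(\<Prod>i\<in>I. 1 / \<delta> (f i) * sqrt (\<delta> (f i))) * sqrt \<delta>m \<le> sqrt (real H) ^ (k - 1)" .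
      qed (use L in \<open>auto simp: key_const_def intro!: mult_nonneg_nonneg add_nonneg_nonneg\<close>)
      finally show ?thesis .
    qed
    finally show "(\<Sum>b\<in>?T. \<Prod>i\<in>I. ?u (b i) (f i)) \<le> (2 * L) ^ k * (real k * key_const k L * sqrt (real H) ^ (k - 1))" .
  qed
  also have "\<dots> = (real (floor_log H) + 1) ^ k * ((2 * L) ^ k * (real k * key_const k L * sqrt (real H) ^ (k - 1)))"
    using I by (simp add: card_PiE add.commute)
  also have "\<dots> \<le> L ^ k * ((2 * L) ^ k * (real k * key_const k L * sqrt (real H) ^ (k - 1)))"
    using H(2) L by (intro mult_right_mono power_mono) (auto simp: key_const_def intro!: mult_nonneg_nonneg add_nonneg_nonneg)
  finally show ?thesis by (simp only: mult.assoc)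
qed

text \<open>The minimum of \<open>H\<close> and \<open>r / n\<close> is at most their harmonic mean
  \<open>2 * H * r / (r + n * H)\<close>, and the squares of these means are dominated by a
  telescoping series.\<close>

lemma sum_min_sq_le:
  assumes "H > 0" "r > 0"
  shows "(\<Sum>a\<in>nz_ints (real r). (min (real H) (real r / \<bar>real_of_int a\<bar>))\<^sup>2) \<le> 8 * real H * real r"
proof -
  let ?f = "\<lambda>n::nat. (min (real H) (real r / real n))\<^sup>2"
  have step: "?f (Suc n) \<le> 4 * real H * real r ^ 2 * (1 / (real r + real n * real H) - 1 / (real r + real (Suc n) * real H))" for n
  proof -
    define m where "m = min (real H) (real r / real (Suc n))"
    define a where "a = real r + real n * real H"
    define b where "b = real r + real (Suc n) * real H"
    have ab: "0 < a" "a \<le> b" "b - a = real H" using assms by (auto simp: a_def b_def field_simps intro: add_pos_nonneg)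
    have m: "0 \<le> m" "m \<le> real H" "m \<le> real r / real (Suc n)" by (auto simp: m_def)
    have "m * real (Suc n) \<le> real r" using m(3) by (simp add: field_simps)
    then have "m * real (Suc n) * real H \<le> real r * real H" by (intro mult_right_mono) auto
    moreover have "m * real r \<le> real H * real r" using m(2) by (intro mult_right_mono) auto
    ultimately have "m * b \<le> 2 * real H * real r" unfolding b_def by (simp only: distrib_left mult_ac)
    then have "(m * b)\<^sup>2 \<le> (2 * real H * real r)\<^sup>2" using m ab by (intro power_mono) auto
    have "m\<^sup>2 * (a * b) \<le> m\<^sup>2 * (b * b)" using ab by (intro mult_left_mono mult_right_mono) auto
    also have "\<dots> = (m * b)\<^sup>2" by (simp add: power2_eq_square)
    also have "\<dots> \<le> (2 * real H * real r)\<^sup>2" by fact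
    finally have "m\<^sup>2 \<le> (2 * real H * real r)\<^sup>2 / (a * b)" using ab by (simp add: pos_le_divide_eq)
    also have "\<dots> = 4 * real H * real r ^ 2 * ((b - a) / (a * b))" unfolding ab(3) by (simp add: power2_eq_square)
    also have "(b - a) / (a * b) = 1 / a - 1 / b" using ab by (simp add: field_simps)
    finally show ?thesis by (simp add: m_def a_def b_def)
  qed
  have tel: "(\<Sum>n=1..N. ?f n) \<le> 4 * real H * real r ^ 2 * (1 / real r - 1 / (real r + real N * real H))" for N
  proof (induction N)
    case (Suc N)
    have "(\<Sum>n=1..Suc N. ?f n) = (\<Sum>n=1..N. ?f n) + ?f (Suc N)" by simp
    also have "\<dots> \<le> 4 * real H * real r ^ 2 * (1 / real r - 1 / (real r + real N * real H)) +
        4 * real H * real r ^ 2 * (1 / (real r + real N * real H) - 1 / (real r + real (Suc N) * real H))"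
      by (intro add_mono Suc.IH step)
    finally show ?case by (simp only: right_diff_distrib)
  qed simp
  have "(\<Sum>a\<in>nz_ints (real r). (min (real H) (real r / \<bar>real_of_int a\<bar>))\<^sup>2) = (\<Sum>a\<in>nz_ints (real r). ?f (nat \<bar>a\<bar>))" by simp
  also have "\<dots> \<le> 2 * (\<Sum>n=1..nat \<lfloor>real r\<rfloor>. ?f n)" by (rule sum_nz_ints_le) simp
  also have "(\<Sum>n=1..nat \<lfloor>real r\<rfloor>. ?f n) \<le> 4 * real H * real r ^ 2 * (1 / real r - 1 / (real r + real (nat \<lfloor>real r\<rfloor>) * real H))"
    by (rule tel)
  also have "\<dots> \<le> 4 * real H * real r ^ 2 * (1 / real r)" by (intro mult_left_mono) auto
  also have "\<dots> = 4 * real H * real r" using assms by (simp add: power2_eq_square)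
  finally show ?thesis by simp
qed

text \<open>The numerators of distinct fractions with denominator \<open>r\<close> are distinct
  elements of \<open>nz_ints r\<close>, and \<open>q / |t| = r / |num q t|\<close>.\<close>

lemma sum_weight_sq_den_le:
  assumes q: "q > 0" "squarefree q" and H: "H > 0" and r: "r > 0"
    and P: "real q / real (totient q) \<le> P"
  shows "(\<Sum>t\<in>{t \<in> nz_residues q. den q t = r}. (weight q H t)\<^sup>2) \<le> 8 * P ^ 2 * real H / real r"
proof -
  let ?A = "{t \<in> nz_residues q. den q t = r}"
  have P0: "P \<ge> 0" using P by (rule order_trans[rotated]) simp
  have "(\<Sum>t\<in>?A. (weight q H t)\<^sup>2) \<le> (\<Sum>a\<in>nz_ints (real r). (P / real r)\<^sup>2 * (min (real H) (real r / \<bar>real_of_int a\<bar>))\<^sup>2)"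
  proof (rule sum_le_sum_inj[where j = "num q"])
    have na: "\<bar>real_of_int t\<bar> / real q = \<bar>real_of_int (num q t)\<bar> / real r" if "t \<in> ?A" for t
    proof -
      have "real_of_int (int q * num q t) = real_of_int (t * int r)" using den_num(1)[OF q(1), of t] that by simp
      then have "\<bar>real q * real_of_int (num q t)\<bar> = \<bar>real_of_int t * real r\<bar>" by simp
      then have "real q * \<bar>real_of_int (num q t)\<bar> = \<bar>real_of_int t\<bar> * real r" by (simp add: abs_mult)
      then show ?thesis using q r by (simp add: field_simps)
    qed
    show "inj_on (num q) ?A"
    proof (rule inj_onI)
      fix s t assume st: "s \<in> ?A" "t \<in> ?A" "num q s = num q t"
      have "s * int r = t * int r" using den_num(1)[OF q(1), of s] den_num(1)[OF q(1), of t] st(3) CollectD[OF st(1)] CollectD[OF st(2)] by metis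
      then show "s = t" using r by (metis mult_cancel_right of_nat_eq_0_iff less_irrefl)
    qed
    show "num q ` ?A \<subseteq> nz_ints (real r)"
    proof (rule image_subsetI)
      fix t assume t: "t \<in> ?A"
      have b: "0 < \<bar>real_of_int t\<bar> / real q" "\<bar>real_of_int t\<bar> / real q \<le> 1 / 2" using nz_residues_abs[OF q(1), of t] t q by auto
      have "\<bar>real_of_int (num q t)\<bar> / real r \<le> 1" using b na[OF t] by linarith
      then show "num q t \<in> nz_ints (real r)" using b na[OF t] r by (auto simp: nz_ints_def divide_le_eq)
    qed
    fix t assume t: "t \<in> ?A"
    have x: "real q / \<bar>real_of_int t\<bar> = real r / \<bar>real_of_int (num q t)\<bar>"
      using arg_cong[OF na[OF t], of inverse] by (simp add: field_simps)
    have "1 / real (totient r) \<le> (real q / real (totient q)) / real r" using totient_ratio_le[OF q(2,1)] den_num(3)[OF q(1), of t] t by simp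
    also have "\<dots> \<le> P / real r" using P by (intro divide_right_mono) auto
    finally have "(1 / real (totient r))\<^sup>2 \<le> (P / real r)\<^sup>2" by (intro power_mono) auto
    then have "(1 / real (totient r))\<^sup>2 * (min (real H) (real r / \<bar>real_of_int (num q t)\<bar>))\<^sup>2 \<le> (P / real r)\<^sup>2 * (min (real H) (real r / \<bar>real_of_int (num q t)\<bar>))\<^sup>2"
      by (intro mult_right_mono) auto
    then show "(weight q H t)\<^sup>2 \<le> (P / real r)\<^sup>2 * (min (real H) (real r / \<bar>real_of_int (num q t)\<bar>))\<^sup>2"
      using t by (simp add: weight_def x power_divide)
  qed auto
  also have "\<dots> \<le> (P / real r)\<^sup>2 * (8 * real H * real r)"
    unfolding sum_distrib_left[symmetric] by (intro mult_left_mono sum_min_sq_le H r) auto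
  also have "\<dots> = 8 * P ^ 2 * real H / real r" using r by (simp add: power2_eq_square)
  finally show ?thesis .
qed

lemma sum_weight_sq_le:
  assumes q: "q > 0" "squarefree q" and H: "H > 0" and z: "z > 0" and L: "1 + ln (real z) \<le> L" 
    and P: "real q / real (totient q) \<le> L"
  shows "(\<Sum>t\<in>{t \<in> nz_residues q. den q t \<le> z}. (weight q H t)\<^sup>2) \<le> 8 * L ^ 3 * real H"
proof -
  let ?A = "{t \<in> nz_residues q. den q t \<le> z}"
  have "(\<Sum>t\<in>?A. (weight q H t)\<^sup>2) = (\<Sum>r=1..z. \<Sum>t\<in>{t \<in> ?A. den q t = r}. (weight q H t)\<^sup>2)"
  proof (rule sum.group[symmetric])
    show "den q ` ?A \<subseteq> {1..z}" using den_num(4)[OF q(1)] by (auto simp: Suc_le_eq)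
  qed (auto simp: nz_residues_def)
  also have "\<dots> \<le> (\<Sum>r=1..z. 8 * L ^ 2 * real H / real r)"
  proof (rule sum_mono)
    fix r assume r: "r \<in> {1..z}"
    have "{t \<in> ?A. den q t = r} = {t \<in> nz_residues q. den q t = r}" using r by auto
    then show "(\<Sum>t\<in>{t \<in> ?A. den q t = r}. (weight q H t)\<^sup>2) \<le> 8 * L ^ 2 * real H / real r"
      using sum_weight_sq_den_le[OF q H _ P, of r] r by simp
  qed
  also have "\<dots> = 8 * L ^ 2 * real H * harm z"
    by (simp add: harm_def inverse_eq_divide sum_distrib_left mult_ac)
  also have "\<dots> \<le> 8 * L ^ 2 * real H * L"
    using harm_le_ln[OF z] L by (intro mult_left_mono) auto
  finally show ?thesis by (simp add: power2_eq_square power3_eq_cube mult_ac)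
qed

text \<open>A cancelling pair contributes the sum of the squared weights, of order \<open>H\<close>
  up to logarithms, and leaves a zero sum with two terms fewer: the parity is kept and the exponent
  of \<open>H\<close> drops by one. The induction starts with a single fraction, which cannot be
  integral. The exponent \<open>A\<close> depends on \<open>m\<close> alone, so the same
  \<open>L\<close> serves at every stage.\<close>

lemma odd_truncated_bound:
  "\<exists>A::nat. \<forall>q H z L I. q > 0 \<and> squarefree q \<and> z > 0 \<and> 2 \<le> L \<and> 1 + ln (2 + 16 * real z ^ 4) \<le> L \<and> H \<ge> 1 \<and>
     real (floor_log H) + 1 \<le> L \<and> real q / real (totient q) \<le> L \<and> finite I \<and> card I = 2 * m + 1 \<longrightarrow>
     (\<Sum>b\<in>{b \<in> zero_sums q I. lcm_den q I b \<le> z}. \<Prod>i\<in>I. weight q H (b i)) \<le> L ^ A * real H ^ m"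
proof (induction m)
  case 0
  have "zero_sums q I = {}" if c: "q > 0" "card I = 1" for q I
  proof -
    obtain i where "I = {i}" using c(2) by (auto simp: card_1_singleton_iff)
    then show ?thesis using nz_residues_not_dvd[of _ q] by (auto simp: zero_sums_def)
  qed
  then show ?case by (intro exI[of _ 0]) auto
next
  case (Suc m)
  define k where "k = 2 * Suc m + 1"
  obtain A where A: "\<And>q H z L I. q > 0 \<Longrightarrow> squarefree q \<Longrightarrow> z > 0 \<Longrightarrow> 2 \<le> L \<Longrightarrow> 1 + ln (2 + 16 * real z ^ 4) \<le> L \<Longrightarrow> H \<ge> 1 \<Longrightarrow>
     real (floor_log H) + 1 \<le> L \<Longrightarrow> real q / real (totient q) \<le> L \<Longrightarrow> finite I \<Longrightarrow> card I = 2 * m + 1 \<Longrightarrow>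
     (\<Sum>b\<in>{b \<in> zero_sums q I. lcm_den q I b \<le> z}. \<Prod>i\<in>I. weight q H (b i)) \<le> L ^ A * real H ^ m" using Suc by blast
  have "polylog (\<lambda>L. L ^ k * (2 * L) ^ k * real k * key_const k L + real (k * k) * (8 * L ^ 3 * L ^ A))"
    by (intro polylog_mult polylog_add polylog_power polylog_const polylog_id polylog_key_const) auto
  then obtain B where B: "\<And>L. L \<ge> 2 \<Longrightarrow> L ^ k * (2 * L) ^ k * real k * key_const k L + real (k * k) * (8 * L ^ 3 * L ^ A) \<le> L ^ B"
    unfolding polylog_def by blast
  show ?case
  proof (intro exI[of _ B] allI impI, elim conjE)
    fix q H z :: nat and L :: real and I :: "nat set"
    assume q: "q > 0" "squarefree q" and z: "z > 0" and L: "2 \<le> L" "1 + ln (2 + 16 * real z ^ 4) \<le> L" and H: "H \<ge> 1"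
      "real (floor_log H) + 1 \<le> L" and P: "real q / real (totient q) \<le> L" and I: "finite I" "card I = 2 * Suc m + 1"
    let ?w = "\<lambda>J b. \<Prod>i\<in>J. weight q H (b i)"
    define T0 where "T0 = {b \<in> zero_sums q I. lcm_den q I b \<le> z \<and> (\<forall>i\<in>I. \<forall>j\<in>I. i \<noteq> j \<longrightarrow> b i + b j \<noteq> 0)}"
    define T2 where "T2 x = {b \<in> zero_sums q I. lcm_den q I b \<le> z \<and> b (fst x) + b (snd x) = 0}" for x
    define D where "D = {x \<in> I \<times> I. fst x \<noteq> snd x}"
    have finD: "finite D" unfolding D_def using I by simp
    have cD: "card D \<le> k * k"
    proof -
      have "card D \<le> card (I \<times> I)" unfolding D_def using I by (intro card_mono) auto
      then show ?thesis using I by (simp add: card_cartesian_product k_def)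
    qed
    have fz: "finite {b \<in> zero_sums q I. lcm_den q I b \<le> z \<and> Q b}" for Q using finite_zero_sums[OF I(1), of q] by simp
    have w0: "?w J b \<ge> 0" for J b by (intro prod_nonneg) (simp add: weight_nonneg)
    have L': "1 + ln (real z) \<le> L"
    proof -
      have z1: "real z \<ge> 1" using z by simp
      have "real z ^ 1 \<le> real z ^ 4" using z1 by (intro power_increasing) auto
      then have "real z \<le> 2 + 16 * real z ^ 4" unfolding power_one_right using z1 by linarith
      then have "ln (real z) \<le> ln (2 + 16 * real z ^ 4)" using z1 by (subst ln_le_cancel_iff) auto
      then show ?thesis using L by linarith
    qed
    have "(\<Sum>b\<in>{b \<in> zero_sums q I. lcm_den q I b \<le> z}. ?w I b) \<le> (\<Sum>b\<in>T0 \<union> (\<Union>x\<in>D. T2 x). ?w I b)"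
      using fz finD w0 by (intro sum_mono2) (auto simp: T0_def T2_def D_def)
    also have "\<dots> \<le> (\<Sum>b\<in>T0. ?w I b) + (\<Sum>b\<in>(\<Union>x\<in>D. T2 x). ?w I b)"
      using fz finD w0 by (intro sum_Un_le) (auto simp: T0_def T2_def)
    also have "(\<Sum>b\<in>(\<Union>x\<in>D. T2 x). ?w I b) \<le> (\<Sum>x\<in>D. \<Sum>b\<in>T2 x. ?w I b)"
      using finD fz w0 by (intro sum_UN_le) (auto simp: T2_def)
    also have "\<dots> \<le> (\<Sum>x\<in>D. (8 * L ^ 3 * real H) * (L ^ A * real H ^ m))"
    proof (rule sum_mono)
      fix x assume "x \<in> D"
      then obtain i l where x: "x = (i, l)" "i \<in> I" "l \<in> I" "i \<noteq> l" by (auto simp: D_def)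
      define J where "J = I - {i, l}"
      have J: "finite J" "card J = 2 * m + 1" "I = insert i (insert l J)" "i \<notin> J" "l \<notin> J"
      proof -
        have "card J = card I - card {i, l}" unfolding J_def using x I by (intro card_Diff_subset) auto
        then show "card J = 2 * m + 1" using x(4) I by simp
      qed (use x I in \<open>auto simp: J_def\<close>)
      let ?S = "{t \<in> nz_residues q. den q t \<le> z} \<times> {b \<in> zero_sums q J. lcm_den q J b \<le> z}"
      \<comment> \<open>Since \<open>b l = - b i\<close>, the two weights of the pair agree and the
        tuple is recovered from \<open>b i\<close> and its restriction to \<open>J\<close>.\<close>
      have "(\<Sum>b\<in>T2 x. ?w I b) \<le> (\<Sum>(t,b)\<in>?S. (weight q H t)\<^sup>2 * ?w J b)"
      proof (rule sum_le_sum_inj[where j = "\<lambda>b. (b i, restrict b J)"])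
        show "finite ?S" using finite_zero_sums[OF J(1), of q] by simp
        have bl: "b l = - b i" if "b \<in> T2 x" for b using that x by (simp add: T2_def)
        show "inj_on (\<lambda>b. (b i, restrict b J)) (T2 x)"
        proof (rule inj_onI)
          fix b c assume bc: "b \<in> T2 x" "c \<in> T2 x" "(b i, restrict b J) = (c i, restrict c J)"
          have P: "b \<in> PiE I (\<lambda>_. nz_residues q)" "c \<in> PiE I (\<lambda>_. nz_residues q)" using bc by (auto simp: T2_def zero_sums_def)
          show "b = c"
          proof (rule PiE_ext[OF P])
            fix j assume "j \<in> I"
            then consider "j = i" | "j = l" | "j \<in> J" using J by blast
            then show "b j = c j"
            proof cases
              case 3
              have "restrict b J j = restrict c J j" using bc(3) by simp
              then show ?thesis using 3 by simp
            next
              case 2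
              have "b l = - b i" "c l = - c i" "b i = c i" using bl[OF bc(1)] bl[OF bc(2)] bc(3) by auto
              then show ?thesis using 2 by simp
            qed (use bc(3) in simp)
          qed
        qed
        show "(\<lambda>b. (b i, restrict b J)) ` T2 x \<subseteq> ?S"
        proof (rule image_subsetI)
          fix b assume b: "b \<in> T2 x"
          then have z: "b \<in> zero_sums q I" "lcm_den q I b \<le> z" by (auto simp: T2_def)
          have "lcm_den q I b > 0" unfolding lcm_den_def using I den_num(4)[OF q(1)] by (auto intro!: Nat.gr0I simp: Lcm_0_iff) (metis less_numeral_extra(3))
          then have le: "n \<le> z" if "n dvd lcm_den q I b" for n using dvd_imp_le[OF that] z(2) by simp
          have "den q (b i) \<le> z" using x by (intro le) (auto simp: lcm_den_def)
          moreover have "lcm_den q J (restrict b J) \<le> z"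
            by (intro le) (auto simp: lcm_den_def J(3) intro!: Lcm_least dvd_Lcm)
          moreover have "restrict b J \<in> zero_sums q J"
          proof -
            have "(\<Sum>i\<in>I. b i) = (\<Sum>j\<in>J. b j)" using J x(4) bl[OF b] by simp
            then show ?thesis using z(1) J by (auto simp: zero_sums_def)
          qed
          ultimately show "(b i, restrict b J) \<in> ?S" using zero_sumsD(1)[OF z(1) x(2)] by simp
        qed
        fix b assume b: "b \<in> T2 x"
        have "weight q H (b l) = weight q H (b i)" using bl[OF b] by (simp add: weight_def den_uminus)
        moreover have "?w I b = weight q H (b i) * (weight q H (b l) * ?w J b)" using J x(4) by simp
        ultimately show "?w I b \<le> (case (b i, restrict b J) of (t, b) \<Rightarrow> (weight q H t)\<^sup>2 * ?w J b)"
          by (simp add: power2_eq_square)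
      qed (auto intro!: mult_nonneg_nonneg w0)
      also have "\<dots> = (\<Sum>t\<in>{t \<in> nz_residues q. den q t \<le> z}. (weight q H t)\<^sup>2) * (\<Sum>b\<in>{b \<in> zero_sums q J. lcm_den q J b \<le> z}. ?w J b)"
        by (simp only: sum.cartesian_product[symmetric] sum_product)
      also have "\<dots> \<le> (8 * L ^ 3 * real H) * (L ^ A * real H ^ m)"
        using sum_weight_sq_le[OF q _ z L' P, of H] H(1) A[OF q z L H P J(1,2)] L w0 by (intro mult_mono) (auto intro!: sum_nonneg)
      finally show "(\<Sum>b\<in>T2 x. ?w I b) \<le> (8 * L ^ 3 * real H) * (L ^ A * real H ^ m)" .
    qed
    also have "\<dots> = real (card D) * ((8 * L ^ 3 * L ^ A) * real H ^ Suc m)" by simp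
    also have "\<dots> \<le> real (k * k) * ((8 * L ^ 3 * L ^ A) * real H ^ Suc m)"
      using cD L by (intro mult_right_mono) (auto simp flip: of_nat_mult)
    also have "(\<Sum>b\<in>T0. ?w I b) \<le> L ^ k * (2 * L) ^ k * real k * key_const k L * sqrt (real H) ^ (k - 1)"
      unfolding T0_def using P by (intro noncancelling_bound q I L z H refl) (auto simp: k_def I)
    also have "sqrt (real H) ^ (k - 1) = real H ^ Suc m"
    proof -
      have "k - 1 = 2 * Suc m" by (simp add: k_def)
      then have "sqrt (real H) ^ (k - 1) = (sqrt (real H) ^ 2) ^ Suc m" by (simp only: power_mult)
      then show ?thesis by simp
    qed
    finally have "(\<Sum>b\<in>{b \<in> zero_sums q I. lcm_den q I b \<le> z}. ?w I b) \<le> (L ^ k * (2 * L) ^ k * real k * key_const k L + real (k * k) * (8 * L ^ 3 * L ^ A)) * real H ^ Suc m"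
      by (simp add: distrib_right mult.assoc)
    also have "\<dots> \<le> L ^ B * real H ^ Suc m" using B[OF L(1)] by (intro mult_right_mono) auto
    finally show "(\<Sum>b\<in>{b \<in> zero_sums q I. lcm_den q I b \<le> z}. ?w I b) \<le> L ^ B * real H ^ Suc m" .
  qed
qed

section \<open>Tuples with a large common denominator\<close>

lemma sum_subset_prod:
  fixes g :: "'a \<Rightarrow> real"
  assumes "finite S"
  shows "(\<Sum>A\<in>Pow S. \<Prod>p\<in>A. g p) = (\<Prod>p\<in>S. 1 + g p)"
  using prod_add[OF assms, of "\<lambda>_. 1" g] prod_add[OF assms, of g "\<lambda>_. 1"] by (simp add: add.commute)

lemma divs_le_two_power:
  assumes "squarefree n" "n > 0"
  shows "divs n \<le> 2 ^ card (prime_factors n)"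
proof -
  have "card {d. d dvd n} \<le> card (Pow (prime_factors n))"
  proof (rule card_inj_on_le[where f = prime_factors])
    have p: "\<Prod>(prime_factors d) = d" if "d dvd n" for d
      using that assms by (intro prod_prime_factors_squarefree) (auto intro: squarefree_mono Nat.gr0I)
    show "inj_on prime_factors {d. d dvd n}" by (rule inj_onI) (metis p mem_Collect_eq)
    show "prime_factors ` {d. d dvd n} \<subseteq> Pow (prime_factors n)" using assms by (auto simp: prime_factors_dvd)
  qed simp
  then show ?thesis by (simp add: divs_def card_Pow)
qed

lemma totient_ratio_prod:
  assumes "q > 0"
  shows "real q / real (totient q) = (\<Prod>p\<in>prime_factors q. 1 / (1 - 1 / real p))"
proof -
  have "real (totient q) = real q * (\<Prod>p\<in>prime_factors q. 1 - 1 / real p)"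
    using totient_formula2[of q] by (simp add: )
  moreover have pp: "1 - 1 / real p > 0" if "p \<in> prime_factors q" for p
    using prime_gt_1_nat[OF in_prime_factors_imp_prime[OF that]] by simp
  ultimately show ?thesis
    using assms by (simp add: prod_dividef)
qed

lemma prod_one_plus_inverse_le:
  assumes "squarefree q" "q > 0"
  shows "(\<Prod>p\<in>prime_factors q. 1 + 1 / real p) \<le> real q / real (totient q)"
proof -
  have pp: "1 - 1 / real p > 0" if "p \<in> prime_factors q" for p
    using prime_gt_1_nat[OF in_prime_factors_imp_prime[OF that]] by simp
  have "real q / real (totient q) = (\<Prod>p\<in>prime_factors q. 1 / (1 - 1 / real p))"
    using assms by (intro totient_ratio_prod)
  moreover have "(\<Prod>p\<in>prime_factors q. 1 + 1 / real p) \<le> (\<Prod>p\<in>prime_factors q. 1 / (1 - 1 / real p))"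
  proof (rule prod_mono, intro conjI)
    fix p assume "p \<in> prime_factors q"
    from pp[OF this] show "1 + 1 / real p \<le> 1 / (1 - 1 / real p)"
      by (simp add: pos_le_divide_eq algebra_simps)
  qed simp
  ultimately show ?thesis by simp
qed

text \<open>Rankin's trick: since \<open>p powr (1 / ln y) \<le> 3\<close> for \<open>p \<le> y\<close>, the weight \<open>(D / z) powr (1 / ln y)\<close>
  costs only a bounded factor at each prime.\<close>

lemma rankin_bound:
  assumes q: "squarefree q" "q > 0" and y: "y > 1" "\<And>p. p \<in> prime_factors q \<Longrightarrow> real p \<le> y" and z: "z > 0"
    and P: "real q / real (totient q) \<le> P"
  shows "(\<Sum>D\<in>{D. D dvd q \<and> real D > z}. real (divs D) ^ k / real D) \<le> z powr (- 1 / ln y) * P ^ (3 * 2 ^ k)"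
proof -
  let ?e = "1 / ln y"
  \<comment> \<open>At each prime, 3 is the cost of the Rankin weight and \<open>2 ^ k\<close> that
    of \<open>divs D ^ k\<close>.\<close>
  let ?g = "\<lambda>p. 3 * 2 ^ k / real p"
  have fin: "finite {D. D dvd q}" using q by (intro finite_divs) auto
  have prm: "1 < p" if "p \<in> prime_factors q" for p using prime_gt_1_nat[of p] that by auto
  have P1: "P \<ge> 1"
  proof -
    have "1 \<le> real q / real (totient q)" using q totient_le[of q] by (simp add: le_divide_eq)
    then show ?thesis using P by linarith
  qed
  have "(\<Sum>D\<in>{D. D dvd q \<and> real D > z}. real (divs D) ^ k / real D) \<le> (\<Sum>A\<in>Pow (prime_factors q). z powr (- ?e) * (\<Prod>p\<in>A. ?g p))"
  proof (rule sum_le_sum_inj[where j = prime_factors])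
    have sf: "squarefree D" "D > 0" if "D dvd q" for D
      using that q by (auto intro: squarefree_mono Nat.gr0I)
    have p: "\<Prod>(prime_factors D) = D" if "D dvd q" for D
      using sf[OF that] by (intro prod_prime_factors_squarefree)
    show "inj_on prime_factors {D. D dvd q \<and> real D > z}" by (rule inj_onI) (metis (no_types, lifting) p mem_Collect_eq)
    show "prime_factors ` {D. D dvd q \<and> real D > z} \<subseteq> Pow (prime_factors q)" using q by (auto simp: prime_factors_dvd)
    fix D assume D: "D \<in> {D. D dvd q \<and> real D > z}"
    then have Dq: "D dvd q" "z < real D" by auto
    have sub: "prime_factors D \<subseteq> prime_factors q" using Dq q by (auto simp: prime_factors_dvd)
    have rp: "real D = (\<Prod>p\<in>prime_factors D. real p)" using of_nat_prod[of "\<lambda>p. p" "prime_factors D", where 'a = real] unfolding p[OF Dq(1)] .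
    have "real D powr ?e = (\<Prod>p\<in>prime_factors D. real p powr ?e)"
      unfolding rp by (rule prod_powr_distrib) 
    also have "\<dots> \<le> (\<Prod>p\<in>prime_factors D. 3)"
    proof (rule prod_mono, intro conjI)
      fix p assume "p \<in> prime_factors D"
      then have p: "p \<in> prime_factors q" using sub by auto
      have "ln (real p) \<le> ln y" using y(2)[OF p] prm[OF p] by (subst ln_le_cancel_iff) (use y in auto)
      then have "?e * ln (real p) \<le> 1" using y by (simp add: divide_le_eq)
      then have "real p powr ?e \<le> exp 1" using prm[OF p] by (simp add: powr_def)
      also have "\<dots> \<le> 3" by (rule exp_le)
      finally show "real p powr ?e \<le> 3" .
    qed simp
    finally have De: "real D powr ?e \<le> 3 ^ card (prime_factors D)" by simp
    have "1 = z powr (- ?e) * z powr ?e" using z by (simp flip: powr_add)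
    also have "\<dots> \<le> z powr (- ?e) * real D powr ?e"
      using Dq y z by (intro mult_left_mono powr_mono2) auto
    also have "\<dots> \<le> z powr (- ?e) * 3 ^ card (prime_factors D)" using De by (intro mult_left_mono) auto
    finally have one: "1 \<le> z powr (- ?e) * 3 ^ card (prime_factors D)" .
    have "real (divs D) \<le> real (2 ^ card (prime_factors D))" using divs_le_two_power[OF sf[OF Dq(1)]] by (rule of_nat_mono)
    then have "real (divs D) ^ k \<le> (2 ^ card (prime_factors D)) ^ k" by (intro power_mono) auto
    also have "\<dots> = (2 ^ k) ^ card (prime_factors D)" by (simp flip: power_mult add: mult.commute)
    finally have "real (divs D) ^ k / real D \<le> (2 ^ k) ^ card (prime_factors D) / real D" by (intro divide_right_mono) auto
    also have "\<dots> \<le> ((2 ^ k) ^ card (prime_factors D) / real D) * (z powr (- ?e) * 3 ^ card (prime_factors D))"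
      using mult_left_mono[OF one, of "(2 ^ k) ^ card (prime_factors D) / real D"] by simp
    also have "\<dots> = z powr (- ?e) * (\<Prod>p\<in>prime_factors D. ?g p)"
    proof -
      have "(\<Prod>p\<in>prime_factors D. ?g p) = (3 * 2 ^ k) ^ card (prime_factors D) / real D"
        unfolding prod_dividef rp by simp
      then show ?thesis by (simp add: power_mult_distrib)
    qed
    finally show "real (divs D) ^ k / real D \<le> z powr (- ?e) * (\<Prod>p\<in>prime_factors D. ?g p)" .
  qed (auto intro!: mult_nonneg_nonneg prod_nonneg)
  also have "\<dots> = z powr (- ?e) * (\<Prod>p\<in>prime_factors q. 1 + ?g p)"
    by (simp add: sum_distrib_left[symmetric] sum_subset_prod)
  also have "\<dots> \<le> z powr (- ?e) * P ^ (3 * 2 ^ k)"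
  proof (rule mult_left_mono)
    \<comment> \<open>Bernoulli's inequality bounds the factors \<open>1 + 3 * 2 ^ k / p\<close> by
      powers of \<open>1 + 1 / p\<close>, whose product is at most
      \<open>q / totient q\<close>.\<close>
    have "(\<Prod>p\<in>prime_factors q. 1 + ?g p) \<le> (\<Prod>p\<in>prime_factors q. (1 + 1 / real p) ^ (3 * 2 ^ k))"
    proof (rule prod_mono, intro conjI)
      fix p :: nat
      show "0 \<le> 1 + ?g p" by simp
      show "1 + ?g p \<le> (1 + 1 / real p) ^ (3 * 2 ^ k)"
        using Bernoulli_inequality[of "1 / real p" "3 * 2 ^ k"] by (simp add: divide_nonneg_nonneg order_trans[of "-1" 0])
    qed
    also have "\<dots> = (\<Prod>p\<in>prime_factors q. 1 + 1 / real p) ^ (3 * 2 ^ k)" by (rule prod_power_distrib[symmetric])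
    also have "\<dots> \<le> P ^ (3 * 2 ^ k)" using prod_one_plus_inverse_le[OF q] P by (intro power_mono prod_nonneg) auto
    finally show "(\<Prod>p\<in>prime_factors q. 1 + ?g p) \<le> P ^ (3 * 2 ^ k)" .
  qed simp
  finally show ?thesis by simp
qed

text \<open>Fix the least common multiple \<open>D\<close> and the denominators \<open>r i\<close>.
  The squared weights with denominator \<open>r i\<close> sum to order \<open>H / r i\<close>, so
  the factors \<open>d s = r s\<close> in \<open>montgomery_vaughan\<close> cancel and only
  \<open>1 / D\<close> remains; there are at most \<open>divs D ^ k\<close> choices of
  \<open>r\<close>.\<close>

lemma sum_zero_sums_le:
  assumes q: "q > 0" "squarefree q" and H: "H > 0" and I: "finite I" "card I = k"
    and P: "real q / real (totient q) \<le> P"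
  shows "(\<Sum>b\<in>{b \<in> zero_sums q I. real (lcm_den q I b) > z}. \<Prod>i\<in>I. weight q H (b i))
     \<le> sqrt (8 * P\<^sup>2 * real H) ^ k * (\<Sum>D\<in>{D. D dvd q \<and> real D > z}. real (divs D) ^ k / real D)"
proof -
  let ?T = "{b \<in> zero_sums q I. real (lcm_den q I b) > z}"
  let ?M = "{D. D dvd q \<and> real D > z}"
  let ?w = "\<lambda>b. \<Prod>i\<in>I. weight q H (b i)"
  let ?c = "\<lambda>b. restrict (\<lambda>i. den q (b i)) I"
  let ?RR = "\<lambda>D. PiE I (\<lambda>_. {r. r dvd D})"
  have finT: "finite ?T" using finite_zero_sums[OF I(1), of q] by simp
  have finM: "finite ?M" using q by (intro finite_subset[OF _ finite_divs[of q]]) auto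
  have lq: "lcm_den q I b dvd q" for b unfolding lcm_den_def using den_num(3)[OF q(1)] by (auto intro!: Lcm_least)
  have main: "(\<Sum>b\<in>{b \<in> zero_sums q I. lcm_den q I b = D \<and> ?c b = r}. ?w b) \<le> sqrt (8 * P\<^sup>2 * real H) ^ k / real D"
    if D: "D dvd q" and r: "r \<in> ?RR D" for D r
  proof (cases "{b \<in> zero_sums q I. lcm_den q I b = D \<and> ?c b = r} = {}")
    case True
    show ?thesis unfolding True by simp
  next
    case False
    then obtain b0 where b0: "b0 \<in> zero_sums q I" "lcm_den q I b0 = D" "?c b0 = r" by blast
    have rd: "den q (b0 i) = r i" if "i \<in> I" for i using b0(3) that by auto
    define X where "X i = {t \<in> nz_residues q. den q t = r i}" for i
    have "{b \<in> zero_sums q I. lcm_den q I b = D \<and> ?c b = r} \<subseteq> {b \<in> PiE I X. int q dvd (\<Sum>i\<in>I. b i)}"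
      by (auto simp: zero_sums_def X_def PiE_def Pi_def)
    then have "(\<Sum>b\<in>{b \<in> zero_sums q I. lcm_den q I b = D \<and> ?c b = r}. ?w b) \<le> (\<Sum>b\<in>{b \<in> PiE I X. int q dvd (\<Sum>i\<in>I. b i)}. ?w b)"
    proof (intro sum_mono2)
      have "finite (PiE I X)" using I by (intro finite_PiE) (auto simp: X_def nz_residues_def)
      then show "finite {b \<in> PiE I X. int q dvd (\<Sum>i\<in>I. b i)}" by simp
    qed (auto intro!: prod_nonneg weight_nonneg)
    also have "\<dots> \<le> (1 / real D) * (\<Prod>i\<in>I. sqrt (real (r i) * (\<Sum>t\<in>X i. (weight q H t)\<^sup>2)))"
    proof (rule montgomery_vaughan[OF q(1) D _ I(1)])
      show "squarefree D" using D q by (rule_tac squarefree_mono)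
      show "\<And>s. s \<in> I \<Longrightarrow> r s dvd D" using r by auto
      show "int q dvd b * int (r s)" if "s \<in> I" "b \<in> X s" for s b
        using den_num(1)[OF q(1), of b] that by (auto simp: X_def) (metis dvd_triv_left)
      show "finite (X s)" for s by (simp add: X_def nz_residues_def)
      show "inj_on (\<lambda>b. b mod int q) (X s)" for s using inj_on_nz_residues by (rule inj_on_subset) (auto simp: X_def)
      show "weight q H b \<ge> 0" for b by (rule weight_nonneg)
      fix p :: nat assume p: "prime p" "p dvd D"
      have "p dvd Lcm ((\<lambda>i. den q (b0 i)) ` I)" using p b0 by (simp add: lcm_den_def)
      also have "\<dots> dvd (\<Prod>i\<in>I. den q (b0 i))" using I by (auto intro!: Lcm_least dvd_prodI)
      finally obtain i where i: "i \<in> I" "p dvd den q (b0 i)" using p(1) I by (auto simp: prime_dvd_prod_iff)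
      then obtain j where j: "j \<in> I - {i}" "p dvd den q (b0 j)"
        using prime_dvd_den_other[OF q(1) I(1) i(1) zero_sumsD(2)[OF b0(1)] p(1)] by blast
      have "card {i, j} \<le> card {s \<in> I. p dvd r s}" using i j rd I by (intro card_mono) auto
      then show "card {s \<in> I. p dvd r s} \<ge> 2" using j by (cases "i = j") auto
    qed
    also have "\<dots> \<le> (1 / real D) * (\<Prod>i\<in>I. sqrt (8 * P\<^sup>2 * real H))"
    proof (intro mult_left_mono prod_mono conjI real_sqrt_le_mono)
      fix i assume i: "i \<in> I"
      have ri: "r i > 0" using rd[OF i] den_num(4)[OF q(1), of "b0 i"] by simp
      have "(\<Sum>t\<in>X i. (weight q H t)\<^sup>2) \<le> 8 * P\<^sup>2 * real H / real (r i)" unfolding X_def by (rule sum_weight_sq_den_le[OF q H ri P])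
      then show "real (r i) * (\<Sum>t\<in>X i. (weight q H t)\<^sup>2) \<le> 8 * P\<^sup>2 * real H" using ri by (simp add: field_simps)
      show "0 \<le> sqrt (real (r i) * (\<Sum>t\<in>X i. (weight q H t)\<^sup>2))" by (auto intro!: mult_nonneg_nonneg sum_nonneg)
    qed auto
    also have "\<dots> = sqrt (8 * P\<^sup>2 * real H) ^ k / real D" using I by simp
    finally show ?thesis .
  qed
  have "(\<Sum>b\<in>?T. ?w b) = (\<Sum>D\<in>?M. \<Sum>b\<in>{b \<in> ?T. lcm_den q I b = D}. ?w b)"
    using lq by (intro sum.group[symmetric] finT finM) auto
  also have "\<dots> \<le> (\<Sum>D\<in>?M. sqrt (8 * P\<^sup>2 * real H) ^ k * (real (divs D) ^ k / real D))"
  proof (rule sum_mono)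
    fix D assume D: "D \<in> ?M"
    then have D0: "D > 0" using q by (auto intro: Nat.gr0I)
    have finR: "finite (?RR D)" using finite_divs[OF D0] I by (intro finite_PiE) auto
    have "(\<Sum>b\<in>{b \<in> ?T. lcm_den q I b = D}. ?w b) = (\<Sum>b\<in>{b \<in> zero_sums q I. lcm_den q I b = D}. ?w b)" using D by (intro sum.cong) auto
    also have "\<dots> = (\<Sum>r\<in>?RR D. \<Sum>b\<in>{b \<in> {b \<in> zero_sums q I. lcm_den q I b = D}. ?c b = r}. ?w b)"
    proof (rule sum.group[symmetric])
      show "?c ` {b \<in> zero_sums q I. lcm_den q I b = D} \<subseteq> ?RR D" by (auto simp: lcm_den_def)
      show "finite {b \<in> zero_sums q I. lcm_den q I b = D}" using finite_zero_sums[OF I(1), of q] by simp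
    qed (rule finR)
    also have "\<dots> \<le> (\<Sum>r\<in>?RR D. sqrt (8 * P\<^sup>2 * real H) ^ k / real D)"
    proof (rule sum_mono)
      fix r assume "r \<in> ?RR D"
      with main[of D r] D show "(\<Sum>b\<in>{b \<in> {b \<in> zero_sums q I. lcm_den q I b = D}. ?c b = r}. ?w b) \<le> sqrt (8 * P\<^sup>2 * real H) ^ k / real D"
        by (simp add: conj_assoc)
    qed
    also have "\<dots> = sqrt (8 * P\<^sup>2 * real H) ^ k * (real (divs D) ^ k / real D)"
      using I by (simp add: card_PiE divs_def)
    finally show "(\<Sum>b\<in>{b \<in> ?T. lcm_den q I b = D}. ?w b) \<le> sqrt (8 * P\<^sup>2 * real H) ^ k * (real (divs D) ^ k / real D)" .
  qed
  finally show ?thesis by (simp add: sum_distrib_left)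
qed

text \<open>For even \<open>m\<close> the Montgomery-Vaughan bound gives
  \<open>H ^ (m div 2)\<close> for all tuples at once. For odd \<open>m\<close> it is too large by
  \<open>sqrt H\<close>, which Rankin's trick recovers for least common multiples above a threshold
  \<open>z\<close>; the other tuples are those of \<open>odd_truncated_bound\<close>.\<close>

lemma moment_bound:
  "\<exists>A::nat. \<forall>q H y L. q > 0 \<and> squarefree q \<and> (\<forall>p\<in>prime_factors q. real p \<le> y) \<and> 3 \<le> y \<and> 3 \<le> H \<and> 2 \<le> L \<and>
     ln y \<le> L \<and> 1 + 2 * ln (real H) \<le> L \<and> real q / real (totient q) \<le> L \<longrightarrow>
     \<bar>(\<Sum>n<q. window_sum q H n ^ m) / real q\<bar> \<le> L ^ A * real H ^ (m div 2)"
proof -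
  let ?w = "\<lambda>q H b. \<Prod>i<m. weight q H (b i)"
  have tail: "(\<Sum>b\<in>{b \<in> zero_sums q {..<m}. real (lcm_den q {..<m} b) > z}. ?w q H b)
      \<le> sqrt (8 * L\<^sup>2 * real H) ^ m * (z powr (- 1 / ln y) * L ^ (3 * 2 ^ m))"
    if "q > 0" "squarefree q" "\<And>p. p \<in> prime_factors q \<Longrightarrow> real p \<le> y" "3 \<le> y" "3 \<le> H" "real q / real (totient q) \<le> L" "z > 0" for q H y L z
  proof (rule order_trans[OF sum_zero_sums_le[where P = L and k = m]])
    show "sqrt (8 * L\<^sup>2 * real H) ^ m * (\<Sum>D\<in>{D. D dvd q \<and> real D > z}. real (divs D) ^ m / real D)
      \<le> sqrt (8 * L\<^sup>2 * real H) ^ m * (z powr (- 1 / ln y) * L ^ (3 * 2 ^ m))"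
      using that by (intro mult_left_mono rankin_bound) auto
  qed (use that in auto)
  obtain A where A: "\<And>q H z L I. q > 0 \<Longrightarrow> squarefree q \<Longrightarrow> z > 0 \<Longrightarrow> 2 \<le> L \<Longrightarrow> 1 + ln (2 + 16 * real z ^ 4) \<le> L \<Longrightarrow> H \<ge> 1 \<Longrightarrow>
     real (floor_log H) + 1 \<le> L \<Longrightarrow> real q / real (totient q) \<le> L \<Longrightarrow> finite I \<Longrightarrow> card I = 2 * (m div 2) + 1 \<Longrightarrow>
     (\<Sum>b\<in>{b \<in> zero_sums q I. lcm_den q I b \<le> z}. \<Prod>i\<in>I. weight q H (b i)) \<le> L ^ A * real H ^ (m div 2)"
    using odd_truncated_bound[of "m div 2"] by blast
  have "polylog (\<lambda>L. (4 * L ^ 2) ^ A + (8 * L ^ 2) ^ Suc (m div 2) * (2 * L ^ (3 * 2 ^ m)))"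
    by (intro polylog_mult polylog_add polylog_power polylog_const polylog_id) auto
  then obtain B where B: "\<And>L::real. L \<ge> 2 \<Longrightarrow> (4 * L ^ 2) ^ A + (8 * L ^ 2) ^ Suc (m div 2) * (2 * L ^ (3 * 2 ^ m)) \<le> L ^ B"
    unfolding polylog_def by blast
  show ?thesis
  proof (intro exI[of _ B] allI impI, elim conjE)
    fix q H :: nat and y L :: real
    assume q: "q > 0" "squarefree q" and pf: "\<forall>p\<in>prime_factors q. real p \<le> y" and y: "3 \<le> y" and H: "3 \<le> H" and
      L: "2 \<le> L" "ln y \<le> L" "1 + 2 * ln (real H) \<le> L" and P: "real q / real (totient q) \<le> L"
    have ln3: "1 < ln (3::real)" using e_less_272 ln_less_cancel_iff[of "exp 1" 3] by simp
    have lny: "1 < ln y" using ln3 y ln_le_cancel_iff[of 3 y] by linarith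
    have h8: "sqrt (8 * L\<^sup>2 * real H) ^ (2 * n) = (8 * L\<^sup>2) ^ n * real H ^ n" for n
    proof -
      have "sqrt (8 * L\<^sup>2 * real H) ^ (2 * n) = (8 * L\<^sup>2 * real H) ^ n" unfolding power_mult by (subst real_sqrt_pow2) auto
      then show ?thesis by (simp add: power_mult_distrib)
    qed
    have fz: "finite (zero_sums q {..<m})" by (rule finite_zero_sums) simp
    have "(\<Sum>b\<in>zero_sums q {..<m}. ?w q H b) \<le> ((4 * L ^ 2) ^ A + (8 * L ^ 2) ^ Suc (m div 2) * (2 * L ^ (3 * 2 ^ m))) * real H ^ (m div 2)"
    proof (cases "even m")
      case True
      then obtain n where n: "m = 2 * n" by blast
      have "lcm_den q {..<m} b > 0" for b unfolding lcm_den_def using den_num(4)[OF q(1)] by (auto intro!: Nat.gr0I simp: Lcm_0_iff) (metis less_numeral_extra(3))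
      then have "1 \<le> lcm_den q {..<m} b" for b by (simp add: Suc_le_eq)
      then have "(1::real) \<le> real (lcm_den q {..<m} b)" for b by simp
      \<comment> \<open>The threshold \<open>1 / 2\<close> lies below every least common multiple,
        so that \<open>tail\<close> covers all tuples.\<close>
      then have l: "1 / 2 < real (lcm_den q {..<m} b)" for b by (rule less_le_trans[rotated]) simp
      have "(\<Sum>b\<in>zero_sums q {..<m}. ?w q H b) = (\<Sum>b\<in>{b \<in> zero_sums q {..<m}. real (lcm_den q {..<m} b) > 1 / 2}. ?w q H b)"
        using l by simp
      also have "\<dots> \<le> sqrt (8 * L\<^sup>2 * real H) ^ m * ((1 / 2) powr (- 1 / ln y) * L ^ (3 * 2 ^ m))"
        using q pf y H P by (intro tail) auto
      also have "\<dots> \<le> sqrt (8 * L\<^sup>2 * real H) ^ m * (2 * L ^ (3 * 2 ^ m))"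
      proof (intro mult_left_mono mult_right_mono)
        have "(1 / 2) powr (- 1 / ln y) = 2 powr (1 / ln y)" by (simp add: powr_def ln_div)
        also have "\<dots> \<le> 2 powr 1" using lny by (intro powr_mono) auto
        finally show "(1 / 2) powr (- 1 / ln y) \<le> 2" by simp
      qed (use L in auto)
      also have "\<dots> = (8 * L ^ 2) ^ n * (2 * L ^ (3 * 2 ^ m)) * real H ^ n" unfolding n h8 by simp
      also have "\<dots> \<le> ((4 * L ^ 2) ^ A + (8 * L ^ 2) ^ Suc n * (2 * L ^ (3 * 2 ^ m))) * real H ^ n"
      proof (intro mult_right_mono)
        have "1 \<le> 8 * L ^ 2" using one_le_power[of L 2] L by linarith
        then have "(8 * L ^ 2) ^ n \<le> (8 * L ^ 2) ^ Suc n" by (intro power_increasing) auto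
        then have "(8 * L ^ 2) ^ n * (2 * L ^ (3 * 2 ^ m)) \<le> (8 * L ^ 2) ^ Suc n * (2 * L ^ (3 * 2 ^ m))"
          using L by (intro mult_right_mono) auto
        moreover have "0 \<le> (4 * L ^ 2) ^ A" by simp
        ultimately show "(8 * L ^ 2) ^ n * (2 * L ^ (3 * 2 ^ m)) \<le> (4 * L ^ 2) ^ A + (8 * L ^ 2) ^ Suc n * (2 * L ^ (3 * 2 ^ m))"
          by linarith
      qed auto
      finally show ?thesis using n by simp
    next
      case False
      define n where "n = m div 2"
      have n: "m = 2 * n + 1" using False by (simp add: n_def)
      \<comment> \<open>Chosen so that \<open>exp w powr (- 1 / ln y) = 1 / sqrt H\<close>.\<close>
      define w where "w = ln y * ln (real H) / 2"
      define z where "z = nat \<lceil>exp w\<rceil>"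
      have lnH: "1 < ln (real H)" using ln3 H ln_le_cancel_iff[of 3 "real H"] by linarith
      have w0: "w \<ge> 0" using lny lnH by (simp add: w_def)
      have w: "w \<le> L ^ 2 / 2"
      proof -
        have "ln y * ln (real H) \<le> L * L" using lny lnH L by (intro mult_mono) auto
        then show ?thesis by (simp add: w_def power2_eq_square)
      qed
      have zl: "exp w \<le> real z" unfolding z_def by linarith
      have zu: "real z \<le> 2 * exp w" using one_le_exp_iff[of w] w0 unfolding z_def by linarith
      have z1: "1 \<le> real z" using one_le_exp_iff[of w] w0 zl by linarith
      then have z0: "z > 0" by (intro Nat.gr0I) auto
      \<comment> \<open>The logarithm of \<open>z\<close> may be of order \<open>L\<^sup>2\<close>,
        so the truncated bound is used with \<open>4 * L ^ 2\<close> in the role of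
        \<open>L\<close>.\<close>
      have lz: "1 + ln (2 + 16 * real z ^ 4) \<le> 4 * L ^ 2"
      proof -
        have "1 \<le> real z ^ 4" using z1 by (rule one_le_power)
        then have "2 + 16 * real z ^ 4 \<le> 32 * real z ^ 4" by linarith
        then have "ln (2 + 16 * real z ^ 4) \<le> ln (32 * real z ^ 4)" using z1 by (subst ln_le_cancel_iff) (auto intro!: add_pos_nonneg)
        also have "\<dots> = ln (2 ^ 5) + 4 * ln (real z)" using z1 by (simp add: ln_mult ln_realpow)
        also have "\<dots> = 5 * ln 2 + 4 * ln (real z)" by (subst ln_realpow) auto
        also have "ln (real z) \<le> ln (2 * exp w)" using zu z1 by (subst ln_le_cancel_iff) auto
        also have "ln (2 * exp w) = ln 2 + w" by (simp add: ln_mult)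
        finally have "ln (2 + 16 * real z ^ 4) \<le> 9 * ln 2 + 4 * w" by simp
        moreover have "ln 2 \<le> (25 / 36 :: real)" by (rule ln2_le_25_over_36)
        moreover have "2 ^ 2 \<le> L ^ 2" using L by (intro power_mono) auto
        ultimately show ?thesis using w by simp
      qed
      have LL: "L \<le> 4 * L ^ 2" using L self_le_power[of L 2] by simp
      have "(\<Sum>b\<in>zero_sums q {..<m}. ?w q H b) = (\<Sum>b\<in>{b \<in> zero_sums q {..<m}. lcm_den q {..<m} b \<le> z} \<union> {b \<in> zero_sums q {..<m}. real (lcm_den q {..<m} b) > real z}. ?w q H b)"
        by (intro sum.cong) auto
      also have "\<dots> = (\<Sum>b\<in>{b \<in> zero_sums q {..<m}. lcm_den q {..<m} b \<le> z}. ?w q H b) + (\<Sum>b\<in>{b \<in> zero_sums q {..<m}. real (lcm_den q {..<m} b) > real z}. ?w q H b)"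
        using fz by (intro sum.union_disjoint) auto
      also have "\<dots> \<le> (4 * L ^ 2) ^ A * real H ^ n + sqrt (8 * L\<^sup>2 * real H) ^ m * (real z powr (- 1 / ln y) * L ^ (3 * 2 ^ m))"
      proof (rule add_mono)
        have "real (floor_log H) \<le> 2 * ln (real H)" using H by (intro floor_log_le_ln) auto
        then show "(\<Sum>b\<in>{b \<in> zero_sums q {..<m}. lcm_den q {..<m} b \<le> z}. ?w q H b) \<le> (4 * L ^ 2) ^ A * real H ^ n"
          unfolding n_def using L LL P H z0 n_def n by (intro A q lz) auto
        show "(\<Sum>b\<in>{b \<in> zero_sums q {..<m}. real (lcm_den q {..<m} b) > real z}. ?w q H b) \<le> sqrt (8 * L\<^sup>2 * real H) ^ m * (real z powr (- 1 / ln y) * L ^ (3 * 2 ^ m))"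
          using q pf y H P z0 by (intro tail) auto
      qed
      also have "sqrt (8 * L\<^sup>2 * real H) ^ m * (real z powr (- 1 / ln y) * L ^ (3 * 2 ^ m)) \<le> ((8 * L ^ 2) ^ Suc n * (2 * L ^ (3 * 2 ^ m))) * real H ^ n"
      proof -
        have "real z powr (- 1 / ln y) \<le> exp w powr (- 1 / ln y)" using zl lny by (intro powr_mono2') auto
        also have "\<dots> = exp (- (ln (real H) / 2))" using lny by (simp add: powr_def w_def)
        also have "\<dots> = 1 / sqrt (real H)"
        proof -
          have "sqrt (real H) = exp (ln (sqrt (real H)))" using H by (subst exp_ln) auto
          also have "ln (sqrt (real H)) = ln (real H) / 2" using H by (intro ln_sqrt) auto
          finally have "sqrt (real H) = exp (ln (real H) / 2)" .
          then show ?thesis by (simp add: exp_minus inverse_eq_divide)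
        qed
        finally have zz: "real z powr (- 1 / ln y) \<le> 1 / sqrt (real H)" .
        have sH: "sqrt (real H) > 0" using H by simp
        have m8: "sqrt (8 * L\<^sup>2 * real H) ^ m = (8 * L\<^sup>2) ^ n * real H ^ n * (sqrt (8 * L\<^sup>2) * sqrt (real H))"
          unfolding n power_add h8 by (simp add: real_sqrt_mult)
        have "sqrt (8 * L\<^sup>2 * real H) ^ m * (real z powr (- 1 / ln y) * L ^ (3 * 2 ^ m)) \<le> sqrt (8 * L\<^sup>2 * real H) ^ m * (1 / sqrt (real H) * L ^ (3 * 2 ^ m))"
          using zz L by (intro mult_left_mono mult_right_mono) auto
        also have "\<dots> = (8 * L\<^sup>2) ^ n * sqrt (8 * L\<^sup>2) * L ^ (3 * 2 ^ m) * real H ^ n"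
          unfolding m8 using sH by simp
        also have "\<dots> \<le> (8 * L\<^sup>2) ^ n * (8 * L\<^sup>2) * (2 * L ^ (3 * 2 ^ m)) * real H ^ n"
        proof (intro mult_right_mono mult_mono)
          have "1 \<le> 8 * L ^ 2" using one_le_power[of L 2] L by linarith
          then have "sqrt (8 * L ^ 2) * 1 \<le> sqrt (8 * L ^ 2) * sqrt (8 * L ^ 2)" by (intro mult_left_mono) auto
          then show "sqrt (8 * L ^ 2) \<le> 8 * L ^ 2" by simp
        qed (use L in auto)
        finally show ?thesis by (simp add: mult_ac)
      qed
      finally show ?thesis unfolding n_def by (simp add: distrib_right)
    qed
    also have "\<dots> \<le> L ^ B * real H ^ (m div 2)" using B[OF L(1)] by (intro mult_right_mono) auto
    finally show "\<bar>(\<Sum>n<q. window_sum q H n ^ m) / real q\<bar> \<le> L ^ B * real H ^ (m div 2)"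
      using moment_le[OF q, of H m] by linarith
  qed
qed

section \<open>Products over primes\<close>

lemma prod_primes_dvd:
  fixes n :: nat
  assumes "finite A" "\<And>p. p \<in> A \<Longrightarrow> prime p" "\<And>p. p \<in> A \<Longrightarrow> p dvd n"
  shows "\<Prod>A dvd n"
  using assms
proof (induction A rule: finite_induct)
  case (insert p A)
  have "coprime p (\<Prod>A)" using insert by (intro prod_coprime_right primes_coprime) auto
  then have "p * \<Prod>A dvd n" using insert by (intro divides_mult) auto
  then show ?case using insert by simp
qed simp

text \<open>Chebyshev's argument with \<open>n = 2 ^ j\<close>: the primes above \<open>n\<close>
  and up to \<open>2 * n\<close> divide the central binomial coefficient, which is at most
  \<open>2 ^ (2 * n)\<close>, and each of them exceeds \<open>n\<close>.\<close>

lemma card_primes_dyadic_le: "j * card {p::nat. prime p \<and> 2 ^ j < p \<and> p \<le> 2 * 2 ^ j} \<le> 2 * 2 ^ j"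
proof -
  define n :: nat where "n = 2 ^ j"
  let ?A = "{p::nat. prime p \<and> n < p \<and> p \<le> 2 * n}"
  have fin: "finite ?A" by (rule finite_subset[of _ "{..2 * n}"]) auto
  have "\<Prod>?A dvd (2 * n choose n)"
  proof (rule prod_primes_dvd[OF fin])
    fix p assume p: "p \<in> ?A"
    have "(2 * n choose n) * (fact n * fact n) = (fact (2 * n) :: nat)"
      using binomial_fact_lemma[of n "2 * n"] by (simp add: mult_2 mult_ac)
    moreover have "p dvd fact (2 * n)" using p by (simp add: prime_dvd_fact_iff)
    moreover have "\<not> p dvd fact n" using p by (simp add: prime_dvd_fact_iff)
    ultimately show "p dvd (2 * n choose n)" using p by (metis (no_types, lifting) mem_Collect_eq prime_dvd_mult_iff)
  qed auto
  moreover have "(2 * n choose n) > 0" by simp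
  ultimately have "\<Prod>?A \<le> (2 * n choose n)" by (intro dvd_imp_le)
  also have "\<dots> \<le> (\<Sum>i\<le>2 * n. 2 * n choose i)" by (rule member_le_sum) auto
  also have "\<dots> = 2 ^ (2 * n)" by (rule choose_row_sum)
  finally have "\<Prod>?A \<le> 2 ^ (2 * n)" .
  moreover have "n ^ card ?A \<le> \<Prod>?A"
    using prod_mono[of ?A "\<lambda>_. n" "\<lambda>p. p"] fin by simp
  ultimately have "(2::nat) ^ (j * card ?A) \<le> 2 ^ (2 * n)" by (simp add: n_def power_mult)
  then have "j * card ?A \<le> 2 * n" by (rule power_le_imp_le_exp[rotated]) simp
  then show ?thesis by (simp add: n_def)
qed

text \<open>A weak substitute for Mertens' theorem: by the Chebyshev bound the \<open>j\<close>-th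
  dyadic block contributes at most \<open>exp (4 / j)\<close>. As \<open>harm J\<close> grows like
  \<open>ln J\<close>, the product is at most a power of the logarithm of the largest prime.\<close>

lemma prod_primes_le_exp_harm:
  "(\<Prod>p\<in>{p::nat. prime p \<and> p \<le> 2 * 2 ^ J}. 1 + 2 / real p) \<le> exp (1 + 4 * harm J)"
proof (induction J)
  case 0
  have "{p::nat. prime p \<and> p \<le> 2} = {2}" using prime_ge_2_nat by (auto intro: le_antisym)
  then show ?case using exp_ge_add_one_self[of 1] by (simp add: harm_def)
next
  case (Suc J)
  define j where "j = Suc J"
  let ?A = "{p::nat. prime p \<and> p \<le> 2 * 2 ^ J}" and ?B = "{p::nat. prime p \<and> 2 ^ j < p \<and> p \<le> 2 * 2 ^ j}"
  have fin: "finite ?A" "finite ?B" by (rule finite_subset[of _ "{..2 * 2 ^ j}"]; auto simp: j_def)+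
  have "{p::nat. prime p \<and> p \<le> 2 * 2 ^ Suc J} = ?A \<union> ?B" by (auto simp: j_def)
  moreover have "?A \<inter> ?B = {}" by (auto simp: j_def)
  ultimately have "(\<Prod>p\<in>{p::nat. prime p \<and> p \<le> 2 * 2 ^ Suc J}. 1 + 2 / real p) = (\<Prod>p\<in>?A. 1 + 2 / real p) * (\<Prod>p\<in>?B. 1 + 2 / real p)"
    using fin by (simp only: prod.union_disjoint)
  also have "\<dots> \<le> exp (1 + 4 * harm J) * exp (4 / real j)"
  proof (intro mult_mono Suc.IH)
    have "(\<Prod>p\<in>?B. 1 + 2 / real p) \<le> (\<Prod>p\<in>?B. exp (2 / 2 ^ j))"
    proof (intro prod_mono conjI)
      fix p assume "p \<in> ?B"
      then have "2 ^ j \<le> p" by simp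
      then have "real (2 ^ j) \<le> real p" by (rule of_nat_mono)
      then have "2 / real p \<le> 2 / 2 ^ j" by (intro divide_left_mono) (auto intro!: mult_pos_pos intro: less_le_trans[of 0 "2 ^ j"])
      then show "1 + 2 / real p \<le> exp (2 / 2 ^ j)" using exp_ge_add_one_self[of "2 / 2 ^ j :: real"] by linarith
    qed simp
    also have "\<dots> = exp (real (card ?B) * (2 / 2 ^ j))" by (simp only: prod_constant exp_of_nat_mult)
    also have "\<dots> \<le> exp (4 / real j)"
    proof -
      have "real (j * card ?B) \<le> real (2 * 2 ^ j)" by (rule of_nat_mono[OF card_primes_dyadic_le])
      then have "real j * real (card ?B) \<le> 2 * 2 ^ j" by simp
      then have "real (card ?B) * (2 / 2 ^ j) \<le> 4 / real j" by (simp add: j_def field_simps)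
      then show ?thesis by simp
    qed
    finally show "(\<Prod>p\<in>?B. 1 + 2 / real p) \<le> exp (4 / real j)" .
  qed (auto intro!: prod_nonneg)
  also have "\<dots> = exp (1 + 4 * harm (Suc J))" by (simp add: j_def harm_Suc exp_add[symmetric] inverse_eq_divide)
  finally show ?case .
qed

definition primorial :: "nat \<Rightarrow> nat" where "primorial y = \<Prod>{p. prime p \<and> p \<le> y}"

lemma finite_primes_le [simp]: "finite {p::nat. prime p \<and> p \<le> y}"
  by (rule finite_subset[of _ "{..y}"]) auto

lemma primorial_pos: "primorial y > 0"
  unfolding primorial_def by (intro prod_pos) (auto simp: prime_gt_0_nat)

lemma prime_factors_primorial: "prime_factors (primorial y) = {p. prime p \<and> p \<le> y}"
  using primorial_pos[of y] by (auto simp: prime_factors_dvd primorial_def prime_dvd_prod_iff dest: primes_dvd_imp_eq)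

lemma squarefree_primorial: "squarefree (primorial y)"
  unfolding primorial_def by (rule squarefree_prod_coprime) (auto intro: primes_coprime squarefree_prime)

text \<open>Each factor satisfies \<open>1 / (1 - 1 / p) \<le> 1 + 2 / p\<close>. The exponent 4 is
  that of \<open>exp (4 * harm J)\<close> with \<open>J \<le> 2 * ln y\<close>; any fixed power of
  the logarithm would do.\<close>

lemma primorial_ratio_le:
  assumes "y \<ge> 2"
  shows "real (primorial y) / real (totient (primorial y)) \<le> exp 5 * (2 * ln (real y)) ^ 4"
proof -
  define J where "J = floor_log y"
  have J1: "J \<ge> 1" using floor_log_le_iff[of "2 ^ 1" y] assms unfolding floor_log_power by (simp add: J_def)
  have yJ: "y < 2 * 2 ^ J" using floor_log_exp2_gt[of y] by (simp add: J_def)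
  have "real (primorial y) / real (totient (primorial y)) = (\<Prod>p\<in>{p. prime p \<and> p \<le> y}. 1 / (1 - 1 / real p))"
    using totient_ratio_prod[OF primorial_pos] by (simp add: prime_factors_primorial)
  also have "\<dots> \<le> (\<Prod>p\<in>{p. prime p \<and> p \<le> y}. 1 + 2 / real p)"
  proof (intro prod_mono conjI)
    fix p assume "p \<in> {p. prime p \<and> p \<le> y}"
    then have "p \<ge> 2" by (auto simp: prime_ge_2_nat)
    then have p: "real p \<ge> 2" by simp
    then show "1 / (1 - 1 / real p) \<le> 1 + 2 / real p" "0 \<le> 1 / (1 - 1 / real p)"
      by (simp_all add: field_simps)
  qed
  also have "\<dots> \<le> (\<Prod>p\<in>{p. prime p \<and> p \<le> 2 * 2 ^ J}. 1 + 2 / real p)"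
    using yJ by (intro prod_mono2) auto
  also have "\<dots> \<le> exp (1 + 4 * harm J)" by (rule prod_primes_le_exp_harm)
  also have "\<dots> \<le> exp (5 + 4 * ln (real J))" using harm_le_ln[of J] J1 by simp
  also have "\<dots> = exp 5 * real J ^ 4" using J1 exp_of_nat_mult[of 4 "ln (real J)"] by (simp add: exp_add)
  also have "\<dots> \<le> exp 5 * (2 * ln (real y)) ^ 4"
    using floor_log_le_ln[of y] assms by (intro mult_left_mono power_mono) (auto simp: J_def)
  finally show ?thesis .
qed

section \<open>Elementary symmetric functions of the centred indicators\<close>

definition esym :: "('a \<Rightarrow> real) \<Rightarrow> 'a set \<Rightarrow> nat \<Rightarrow> real" where
  "esym x V k = (\<Sum>A\<in>{A. A \<subseteq> V \<and> card A = k}. \<Prod>d\<in>A. x d)"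

lemma esym_0 [simp]: "finite V \<Longrightarrow> esym x V 0 = 1"
proof -
  assume "finite V"
  then have "{A. A \<subseteq> V \<and> card A = 0} = {{}}" by (auto simp: card_eq_0_iff dest: finite_subset)
  then show ?thesis by (simp add: esym_def)
qed

lemma esym_empty_Suc [simp]: "esym x {} (Suc k) = 0"
  unfolding esym_def by (rule sum.neutral) auto

lemma esym_insert:
  assumes "finite V" "v \<notin> V"
  shows "esym x (insert v V) (Suc k) = esym x V (Suc k) + x v * esym x V k"
proof -
  let ?K = "\<lambda>k. {A. A \<subseteq> V \<and> card A = k}"
  have fin: "finite (?K k)" for k using assms(1) by simp
  have "{A. A \<subseteq> insert v V \<and> card A = Suc k} = ?K (Suc k) \<union> insert v ` ?K k"
  proof (intro equalityI subsetI)
    fix A assume A: "A \<in> {A. A \<subseteq> insert v V \<and> card A = Suc k}"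
    show "A \<in> ?K (Suc k) \<union> insert v ` ?K k"
    proof (cases "v \<in> A")
      case True
      then have "card (A - {v}) = k" using A by simp
      then have "A - {v} \<in> ?K k" using A by auto
      moreover have "A = insert v (A - {v})" using True by auto
      ultimately show ?thesis by blast
    qed (use A in auto)
  next
    fix A assume "A \<in> ?K (Suc k) \<union> insert v ` ?K k"
    then show "A \<in> {A. A \<subseteq> insert v V \<and> card A = Suc k}"
    proof
      assume "A \<in> insert v ` ?K k"
      then obtain B where B: "B \<subseteq> V" "card B = k" "A = insert v B" by auto
      then have "finite B" "v \<notin> B" using assms by (auto dest: finite_subset)
      then show ?thesis using B by auto
    qed auto
  qed
  moreover have "?K (Suc k) \<inter> insert v ` ?K k = {}" using assms(2) by auto
  ultimately have "esym x (insert v V) (Suc k) = esym x V (Suc k) + (\<Sum>A\<in>insert v ` ?K k. \<Prod>d\<in>A. x d)"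
    unfolding esym_def using fin by (simp add: sum.union_disjoint)
  also have "(\<Sum>A\<in>insert v ` ?K k. \<Prod>d\<in>A. x d) = (\<Sum>A\<in>?K k. \<Prod>d\<in>insert v A. x d)"
  proof (subst sum.reindex)
    show "inj_on (insert v) (?K k)" using assms(2) by (intro inj_onI) (metis (no_types, lifting) insert_ident mem_Collect_eq subsetD)
  qed simp
  also have "\<dots> = (\<Sum>A\<in>?K k. x v * (\<Prod>d\<in>A. x d))"
  proof (rule sum.cong[OF refl])
    fix A assume "A \<in> ?K k"
    then have "finite A" "v \<notin> A" using assms by (auto dest: finite_subset)
    then show "(\<Prod>d\<in>insert v A. x d) = x v * (\<Prod>d\<in>A. x d)" by simp
  qed
  finally show ?thesis by (simp add: esym_def sum_distrib_left)
qed

lemma esym_1: "finite V \<Longrightarrow> esym x V (Suc 0) = sum x V"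
  by (induction V rule: finite_induct) (auto simp: esym_insert)

text \<open>Multiply a product over a set of size \<open>k + 1\<close> by \<open>x d\<close>. If
  \<open>d\<close> is new, a set of size \<open>k + 2\<close> arises, each in \<open>k + 2\<close>
  ways. If \<open>d\<close> is in the set, the quadratic equation replaces the square: the term with
  \<open>a\<close> keeps the set, each in \<open>k + 1\<close> ways, and the term with
  \<open>b\<close> removes \<open>d\<close>, each set of size \<open>k\<close> arising from
  \<open>card V - k\<close> elements \<open>d\<close>.\<close>

lemma sum_mult_esym:
  assumes "finite V" "\<And>d. d \<in> V \<Longrightarrow> (x d)\<^sup>2 = a * x d + b"
  shows "sum x V * esym x V (Suc k) = (real k + 2) * esym x V (Suc (Suc k)) + a * (real k + 1) * esym x V (Suc k)
    + b * (real (card V) - real k) * esym x V k"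
  using assms
proof (induction V arbitrary: k rule: finite_induct)
  case empty
  then show ?case by (cases k) auto
next
  case (insert v V)
  have IH: "sum x V * esym x V (Suc k) = (real k + 2) * esym x V (Suc (Suc k)) + a * (real k + 1) * esym x V (Suc k)
    + b * (real (card V) - real k) * esym x V k" for k using insert by auto
  have sq: "x v * x v = a * x v + b" using insert.prems[of v] by (simp add: power2_eq_square)
  have sq': "x v * (x v * t) = a * (x v * t) + b * t" for t
    using sq by (metis distrib_right mult.assoc)
  show ?case
  \<comment> \<open>For positive \<open>k\<close> inserting \<open>v\<close> also changes
    \<open>esym x V k\<close>, through its predecessor; \<open>esym x V 0\<close> stays 1.\<close>
  proof (cases k)
    case 0
    have s: "sum x V * esym x V (Suc 0) = 2 * esym x V (Suc (Suc 0)) + a * esym x V (Suc 0) + b * real (card V)"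
      using IH[of 0] insert.hyps by simp
    have e: "esym x V (Suc 0) = sum x V" using insert.hyps by (simp add: esym_1)
    have "sum x (insert v V) * esym x (insert v V) (Suc 0) = (x v + sum x V) * (esym x V (Suc 0) + x v)"
      using insert.hyps by (simp add: esym_insert)
    also have "\<dots> = sum x V * esym x V (Suc 0) + 2 * (x v * esym x V (Suc 0)) + x v * x v"
      by (simp add: e algebra_simps)
    also have "\<dots> = 2 * (esym x V (Suc (Suc 0)) + x v * esym x V (Suc 0)) + a * (esym x V (Suc 0) + x v) + b * (real (card V) + 1)"
      unfolding s sq by (simp add: algebra_simps)
    finally show ?thesis using 0 insert.hyps by (simp add: esym_insert)
  next
    case (Suc j)
    have "sum x (insert v V) * esym x (insert v V) (Suc k) = (x v + sum x V) * (esym x V (Suc k) + x v * esym x V k)"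
      using insert.hyps by (simp add: esym_insert)
    also have "\<dots> = sum x V * esym x V (Suc k) + x v * (sum x V * esym x V (Suc j)) + x v * esym x V (Suc k) + x v * (x v * esym x V k)"
      by (simp add: Suc algebra_simps)
    also have "\<dots> = (real k + 2) * (esym x V (Suc (Suc k)) + x v * esym x V (Suc k)) + a * (real k + 1) * (esym x V (Suc k) + x v * esym x V k)
        + b * (real (card V) + 1 - real k) * (esym x V k + x v * esym x V j)"
      unfolding IH sq' by (simp add: Suc algebra_simps)
    finally show ?thesis using Suc insert.hyps by (simp add: esym_insert)
  qed
qed

definition admissible :: "nat \<Rightarrow> nat \<Rightarrow> real \<Rightarrow> real \<Rightarrow> bool" where
  "admissible q H y L \<longleftrightarrow> q > 0 \<and> squarefree q \<and> (\<forall>p\<in>prime_factors q. real p \<le> y) \<and> 3 \<le> y \<and> 3 \<le> H \<and> 2 \<le> L \<and>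
     ln y \<le> L \<and> 1 + 2 * ln (real H) \<le> L \<and> real q / real (totient q) \<le> L"

lemma centred_square: "(centred q m)\<^sup>2 = (real q / real (totient q) - 2) * centred q m + (real q / real (totient q) - 1)"
proof -
  have "(P * (if c then 1 else 0) - 1)\<^sup>2 = (P - 2) * (P * (if c then 1 else 0) - 1) + (P - 1)" for P :: real and c
    by (cases c) (auto simp: power2_eq_square algebra_simps)
  then show ?thesis unfolding centred_def by blast
qed

text \<open>The recursion \<open>sum_mult_esym\<close> lowers \<open>k\<close> at the price of one
  more factor \<open>window_sum\<close>, so \<open>m\<close> has to vary in the induction. The term
  with index \<open>k\<close> has a coefficient of order \<open>H\<close> up to logarithms, which
  matches the drop of \<open>m + k\<close> by two.\<close>

lemma esym_moment_bound:
  "\<exists>A::nat. \<forall>q H y L. admissible q H y L \<longrightarrow>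
     \<bar>(\<Sum>n<q. window_sum q H n ^ m * esym (\<lambda>d. centred q (n + d)) {1..H} k) / real q\<bar> \<le> L ^ A * real H ^ ((m + k) div 2)"
proof (induction k arbitrary: m rule: induct_nat_012)
  case 0
  show ?case using moment_bound[of m] by (simp add: admissible_def)
next
  case 1
  have "window_sum q H n ^ m * esym (\<lambda>d. centred q (n + d)) {1..H} (Suc 0) = window_sum q H n ^ Suc m" for q H n
    by (simp add: esym_1 window_sum_def)
  then show ?case using moment_bound[of "Suc m"] unfolding admissible_def by (simp only: add_Suc_right add_0_right)
next
  case (ge2 k)
  let ?E = "\<lambda>q H m k. (\<Sum>n<q. window_sum q H n ^ m * esym (\<lambda>d. centred q (n + d)) {1..H} k) / real q"
  obtain A1 A2 A3 where
    A1: "\<And>q H y L. admissible q H y L \<Longrightarrow> \<bar>?E q H (Suc m) (Suc k)\<bar> \<le> L ^ A1 * real H ^ ((Suc m + Suc k) div 2)" and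
    A2: "\<And>q H y L. admissible q H y L \<Longrightarrow> \<bar>?E q H m (Suc k)\<bar> \<le> L ^ A2 * real H ^ ((m + Suc k) div 2)" and
    A3: "\<And>q H y L. admissible q H y L \<Longrightarrow> \<bar>?E q H m k\<bar> \<le> L ^ A3 * real H ^ ((m + k) div 2)"
    using ge2(2)[of "Suc m"] ge2(2)[of m] ge2(1)[of m] by blast
  have "polylog (\<lambda>L. L ^ A1 + L * (real k + 1) * L ^ A2 + L * (real k + 1) * L ^ A3)"
    by (intro polylog_mult polylog_add polylog_power polylog_const polylog_id) auto
  then obtain B where B: "\<And>L::real. L \<ge> 2 \<Longrightarrow> L ^ A1 + L * (real k + 1) * L ^ A2 + L * (real k + 1) * L ^ A3 \<le> L ^ B"
    unfolding polylog_def by blast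
  show ?case
  proof (intro exI[of _ B] allI impI)
    fix q H y L assume adm: "admissible q H y L"
    then have L: "2 \<le> L" and H: "3 \<le> H" and PL: "real q / real (totient q) \<le> L" by (auto simp: admissible_def)
    define P where "P = real q / real (totient q)"
    have P: "0 \<le> P" "P \<le> L" using PL by (auto simp: P_def)
    have rec: "(real k + 2) * esym (\<lambda>d. centred q (n + d)) {1..H} (Suc (Suc k)) = window_sum q H n * esym (\<lambda>d. centred q (n + d)) {1..H} (Suc k)
      - (P - 2) * (real k + 1) * esym (\<lambda>d. centred q (n + d)) {1..H} (Suc k) - (P - 1) * (real H - real k) * esym (\<lambda>d. centred q (n + d)) {1..H} k" for n
      using sum_mult_esym[of "{1..H}" "\<lambda>d. centred q (n + d)" "P - 2" "P - 1" k] by (simp add: centred_square P_def window_sum_def)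
    have "(real k + 2) * ?E q H m (Suc (Suc k)) = (\<Sum>n<q. window_sum q H n ^ m * ((real k + 2) * esym (\<lambda>d. centred q (n + d)) {1..H} (Suc (Suc k)))) / real q"
      by (simp add: sum_distrib_left mult_ac)
    also have "\<dots> = ?E q H (Suc m) (Suc k) - (P - 2) * (real k + 1) * ?E q H m (Suc k) - (P - 1) * (real H - real k) * ?E q H m k"
      unfolding rec right_diff_distrib sum_subtractf diff_divide_distrib by (simp add: sum_distrib_left mult_ac)
    finally have eq: "(real k + 2) * ?E q H m (Suc (Suc k)) =
      ?E q H (Suc m) (Suc k) - (P - 2) * (real k + 1) * ?E q H m (Suc k) - (P - 1) * (real H - real k) * ?E q H m k" .
    let ?X = "real H ^ ((m + Suc (Suc k)) div 2)"
    have H1: "real H \<ge> 1" using H by simp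
    have "\<bar>?E q H m (Suc (Suc k))\<bar> \<le> \<bar>(real k + 2) * ?E q H m (Suc (Suc k))\<bar>"
      using mult_right_mono[of 1 "real k + 2" "\<bar>?E q H m (Suc (Suc k))\<bar>"] by (simp add: abs_mult)
    also have "\<dots> \<le> \<bar>?E q H (Suc m) (Suc k)\<bar> + \<bar>(P - 2) * (real k + 1) * ?E q H m (Suc k)\<bar> + \<bar>(P - 1) * (real H - real k) * ?E q H m k\<bar>"
    proof -
      have "\<bar>a - b - c\<bar> \<le> \<bar>a\<bar> + \<bar>b\<bar> + \<bar>c\<bar>" for a b c :: real by linarith
      then show ?thesis unfolding eq by blast
    qed
    also have "\<dots> \<le> L ^ A1 * ?X + L * (real k + 1) * L ^ A2 * ?X + L * (real k + 1) * L ^ A3 * ?X"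
    proof (intro add_mono)
      show "\<bar>?E q H (Suc m) (Suc k)\<bar> \<le> L ^ A1 * ?X" using A1[OF adm] by simp
      have "\<bar>(P - 2) * (real k + 1) * ?E q H m (Suc k)\<bar> \<le> L * (real k + 1) * (L ^ A2 * ?X)"
        unfolding abs_mult
      proof (intro mult_mono)
        show "\<bar>P - 2\<bar> \<le> L" using P L by linarith
        have "\<bar>?E q H m (Suc k)\<bar> \<le> L ^ A2 * real H ^ ((m + Suc k) div 2)" by (rule A2[OF adm])
        also have "\<dots> \<le> L ^ A2 * ?X" using L H1 by (intro mult_left_mono power_increasing div_le_mono) auto
        finally show "\<bar>?E q H m (Suc k)\<bar> \<le> L ^ A2 * ?X" .
      qed (use L in auto)
      then show "\<bar>(P - 2) * (real k + 1) * ?E q H m (Suc k)\<bar> \<le> L * (real k + 1) * L ^ A2 * ?X" by (simp add: mult.assoc)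
      have "\<bar>(P - 1) * (real H - real k) * ?E q H m k\<bar> \<le> L * ((real k + 1) * real H) * (L ^ A3 * real H ^ ((m + k) div 2))"
        unfolding abs_mult
      proof (intro mult_mono)
        show "\<bar>P - 1\<bar> \<le> L" using P L by linarith
        have "real k * 1 \<le> real k * real H" using H1 by (intro mult_left_mono) auto
        then show "\<bar>real H - real k\<bar> \<le> (real k + 1) * real H" by (simp add: algebra_simps)
        show "\<bar>?E q H m k\<bar> \<le> L ^ A3 * real H ^ ((m + k) div 2)" by (rule A3[OF adm])
      qed (use L in auto)
      then show "\<bar>(P - 1) * (real H - real k) * ?E q H m k\<bar> \<le> L * (real k + 1) * L ^ A3 * ?X" by (simp add: mult_ac)
    qed
    also have "\<dots> = (L ^ A1 + L * (real k + 1) * L ^ A2 + L * (real k + 1) * L ^ A3) * ?X" by (simp add: distrib_right)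
    also have "\<dots> \<le> L ^ B * ?X" using B[OF L] by (intro mult_right_mono) auto
    finally show "\<bar>?E q H m (Suc (Suc k))\<bar> \<le> L ^ B * ?X" .
  qed
qed

lemma sum_distinct_lists:
  fixes f :: "'a set \<Rightarrow> real"
  assumes "finite V"
  shows "(\<Sum>D\<in>{D. length D = k \<and> distinct D \<and> set D \<subseteq> V}. f (set D)) = fact k * (\<Sum>A\<in>{A. A \<subseteq> V \<and> card A = k}. f A)"
proof -
  let ?T = "{D. length D = k \<and> distinct D \<and> set D \<subseteq> V}" and ?K = "{A. A \<subseteq> V \<and> card A = k}"
  have fin: "finite ?T" by (rule finite_subset[OF _ finite_lists_length_eq[OF assms, of k]]) auto
  have "(\<Sum>D\<in>?T. f (set D)) = (\<Sum>A\<in>?K. \<Sum>D\<in>{D \<in> ?T. set D = A}. f (set D))"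
    using assms by (intro sum.group[symmetric] fin) (auto simp: distinct_card)
  also have "\<dots> = (\<Sum>A\<in>?K. fact k * f A)"
  proof (rule sum.cong[OF refl])
    fix A assume A: "A \<in> ?K"
    then have "{D \<in> ?T. set D = A} = permutations_of_set A" by (auto simp: permutations_of_set_def distinct_card)
    moreover have "finite A" using A assms by (auto dest: finite_subset)
    moreover have "(\<Sum>D\<in>permutations_of_set A. f (set D)) = (\<Sum>D\<in>permutations_of_set A. f A)"
      by (intro sum.cong) (auto simp: permutations_of_set_def)
    ultimately show "(\<Sum>D\<in>{D \<in> ?T. set D = A}. f (set D)) = fact k * f A" using A by simp
  qed
  finally show ?thesis by (simp add: sum_distrib_left)
qed

section \<open>Truncation of the singular series\<close>

lemma sum_shift_periodic:
  fixes g :: "nat \<Rightarrow> 'a::comm_monoid_add"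
  assumes "\<And>n. g (n + p) = g n"
  shows "(\<Sum>j<p. g (n + j)) = (\<Sum>j<p. g j)"
proof (induction n)
  case (Suc n)
  have "(\<Sum>j<p. g (Suc n + j)) = (\<Sum>j<p. g (n + j))"
  proof (cases p)
    case (Suc r)
    have "(\<Sum>j<p. g (n + j)) = g n + (\<Sum>j<r. g (n + Suc j))" using Suc by (simp add: sum.lessThan_Suc_shift del: sum.lessThan_Suc)
    moreover have "(\<Sum>j<p. g (Suc n + j)) = (\<Sum>j<r. g (n + Suc j)) + g (n + p)" using Suc by simp
    ultimately show ?thesis using assms[of n] by (simp add: add.commute)
  qed simp
  then show ?case using Suc by simp
qed simp

lemma sum_mult_coprime:
  fixes f g :: "nat \<Rightarrow> real"
  assumes c: "coprime p d" and p: "p > 0" and f: "\<And>n. f (n + p) = f n" and g: "\<And>n. g (n + d) = g n"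
  shows "(\<Sum>n<p*d. f n * g n) = (\<Sum>n<p. f n) * (\<Sum>n<d. g n)"
proof -
  have "(\<Sum>n<p*d. f n * g n) = (\<Sum>n<d. \<Sum>j<p. f (n + j * d) * g (n + j * d))" by (rule sum_mult_group)
  also have "\<dots> = (\<Sum>n<d. (\<Sum>j<p. f (n + j * d)) * g n)"
    using periodic_mult[of g d, OF g] by (simp add: sum_distrib_left mult.commute)
  also have "\<dots> = (\<Sum>n<d. (\<Sum>j<p. f j) * g n)"
  proof (rule sum.cong[OF refl])
    fix n
    have "(\<Sum>j<p. f (n + j * (d * 1))) = (\<Sum>j<p. f (n + j * 1))"
      using f c p by (intro sum_periodic_coprime_step) auto
    then show "(\<Sum>j<p. f (n + j * d)) * g n = (\<Sum>j<p. f j) * g n" using sum_shift_periodic[of f p n, OF f] by simp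
  qed
  finally show ?thesis by (simp add: sum_distrib_left)
qed

text \<open>The map from \<open>n\<close> to \<open>(p - n) mod p\<close> carries the excluded
  \<open>n\<close> bijectively onto the residues \<open>c i mod p\<close>.\<close>

lemma sum_prime_indicator:
  fixes c :: "'i \<Rightarrow> nat"
  assumes p: "prime p" and X: "finite X"
  shows "(\<Sum>n<p. if \<forall>i\<in>X. coprime (n + c i) p then 1 else 0 :: real) = real p - real (card ((\<lambda>i. c i mod p) ` X))"
proof -
  have p0: "p > 0" using p by (rule prime_gt_0_nat)
  have cop: "coprime m p \<longleftrightarrow> \<not> p dvd m" for m
    using p by (metis coprime_commute prime_imp_coprime coprime_absorb_left not_prime_unit)
  let ?B = "{n \<in> {..<p}. \<exists>i\<in>X. p dvd n + c i}"
  have iff: "p dvd n + t \<longleftrightarrow> t mod p = (p - n) mod p" if "n < p" for n t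
  proof -
    have "t mod p = (p - n) mod p \<longleftrightarrow> [t + n = (p - n) + n] (mod p)"
      unfolding cong_add_rcancel_nat by (simp add: cong_def)
    also have "\<dots> \<longleftrightarrow> p dvd n + t" using that by (simp add: cong_def add.commute dvd_eq_mod_eq_0)
    finally show ?thesis by simp
  qed
  have "(\<lambda>n. (p - n) mod p) ` ?B = (\<lambda>i. c i mod p) ` X"
  proof (intro equalityI subsetI)
    fix r assume "r \<in> (\<lambda>n. (p - n) mod p) ` ?B"
    then obtain n i where n: "n < p" "i \<in> X" "p dvd n + c i" "r = (p - n) mod p" by auto
    then have "r = c i mod p" using iff[of n "c i"] by simp
    then show "r \<in> (\<lambda>i. c i mod p) ` X" using n(2) by (rule image_eqI)
  next
    fix r assume "r \<in> (\<lambda>i. c i mod p) ` X"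
    then obtain i where i: "i \<in> X" "r = c i mod p" by auto
    define n where "n = (p - c i mod p) mod p"
    have np: "n < p" using p0 by (simp add: n_def)
    have "(n + c i) mod p = ((p - c i mod p) + c i mod p) mod p" unfolding n_def by (simp add: mod_simps)
    also have "(p - c i mod p) + c i mod p = p" using p0 by (simp add: less_imp_le)
    finally have d: "p dvd n + c i" by (simp add: dvd_eq_mod_eq_0)
    then have "r = (p - n) mod p" using iff[OF np, of "c i"] i by simp
    then show "r \<in> (\<lambda>n. (p - n) mod p) ` ?B" using np d i by auto
  qed
  moreover have "inj_on (\<lambda>n. (p - n) mod p) ?B"
  proof (rule inj_onI)
    fix n m assume nm: "n \<in> ?B" "m \<in> ?B" "(p - n) mod p = (p - m) mod p"
    then have "p dvd n + (p - m)" using iff[of n "p - m"] by simp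
    then obtain t where t: "n + (p - m) = p * t" by blast
    have "p * t < p * 2" "p * t > 0" using nm(1,2) t[symmetric] by auto
    then have "t = 1" using p0 by (cases t) auto
    then have "n + (p - m) = p" "m < p" using t nm(2) by auto
    then show "n = m" by arith
  qed
  ultimately have card: "card ?B = card ((\<lambda>i. c i mod p) ` X)" using card_image[of "\<lambda>n. (p - n) mod p" ?B] by simp
  have "(\<Sum>n<p. if \<forall>i\<in>X. coprime (n + c i) p then 1 else 0 :: real) = (\<Sum>n\<in>{..<p} - ?B. 1)"
    unfolding cop by (simp add: sum.If_cases Int_def) (intro arg_cong[of _ _ card], auto)
  also have "\<dots> = real (card ({..<p} - ?B))" by simp
  also have "card ({..<p} - ?B) = p - card ?B" by (subst card_Diff_subset) auto
  also have "real (p - card ?B) = real p - real (card ?B)"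
  proof -
    have "card ?B \<le> card {..<p}" by (intro card_mono) auto
    then show ?thesis by (simp add: of_nat_diff)
  qed
  finally show ?thesis using card by simp
qed

lemma sum_coprime_indicator:
  fixes c :: "'i \<Rightarrow> nat"
  assumes "finite Q" "\<And>p. p \<in> Q \<Longrightarrow> prime p" "finite X"
  shows "(\<Sum>n<\<Prod>Q. if \<forall>i\<in>X. coprime (n + c i) (\<Prod>Q) then 1 else 0 :: real)
    = (\<Prod>p\<in>Q. real p - real (card ((\<lambda>i. c i mod p) ` X)))"
  using assms
proof (induction Q rule: finite_induct)
  case (insert p Q)
  let ?g = "\<lambda>d n. if \<forall>i\<in>X. coprime (n + c i) d then 1 else 0 :: real"
  have per: "?g d (n + d) = ?g d n" for d n
  proof -
    have "coprime (n + d + t) d \<longleftrightarrow> coprime (n + t) d" for t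
    proof -
      have "n + d + t = (n + t) + d" by simp
      then show ?thesis by (simp only: coprime_iff_gcd_eq_1 gcd_add1)
    qed
    then show ?thesis by simp
  qed
  have "(\<Sum>n<p * \<Prod>Q. ?g (p * \<Prod>Q) n) = (\<Sum>n<p * \<Prod>Q. ?g p n * ?g (\<Prod>Q) n)"
    by (intro sum.cong refl) auto
  also have "\<dots> = (\<Sum>n<p. ?g p n) * (\<Sum>n<\<Prod>Q. ?g (\<Prod>Q) n)"
  proof (rule sum_mult_coprime)
    show "coprime p (\<Prod>Q)" using insert by (intro prod_coprime_right primes_coprime) auto
    show "p > 0" using insert by (simp add: prime_gt_0_nat)
  qed (rule per)+
  also have "(\<Sum>n<p. ?g p n) = real p - real (card ((\<lambda>i. c i mod p) ` X))" using insert by (intro sum_prime_indicator) auto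
  finally show ?case using insert by simp
qed (simp add: coprime_1_right)

definition local_factor :: "int list \<Rightarrow> nat \<Rightarrow> real" where
  "local_factor D p = (1 - 1 / real p) powi (- int (length D)) * (1 - real (residue_count p D) / real p)"

definition truncated_series :: "nat \<Rightarrow> int list \<Rightarrow> real" where
  "truncated_series y D = (\<Prod>p\<in>{p. prime p \<and> p \<le> y}. local_factor D p)"

lemma residue_count_nths:
  assumes "\<forall>d\<in>set D. d \<ge> 0" "X \<subseteq> {..<length D}"
  shows "residue_count p (nths D X) = card ((\<lambda>i. nat (D ! i) mod p) ` X)"
proof -
  have "(\<lambda>d. d mod int p) ` set (nths D X) = int ` ((\<lambda>i. nat (D ! i) mod p) ` X)"
  proof -
    have "set (nths D X) = (\<lambda>i. D ! i) ` X" using assms(2) by (auto simp: set_nths)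
    moreover have "(\<lambda>i. D ! i mod int p) ` X = (\<lambda>i. int (nat (D ! i) mod p)) ` X"
    proof (rule image_cong[OF refl])
      fix i assume "i \<in> X"
      then have "D ! i \<ge> 0" using assms by auto
      then show "D ! i mod int p = int (nat (D ! i) mod p)" by (simp add: zmod_int)
    qed
    ultimately show ?thesis by (simp only: image_image)
  qed
  then show ?thesis by (simp add: residue_count_def card_image)
qed

text \<open>By the Chinese remainder theorem the proportion of \<open>n\<close> modulo
  \<open>q\<close> with all shifts coprime to \<open>q\<close> is the product of the local densities
  \<open>1 - residue_count / p\<close>; the power \<open>P ^ card X\<close> supplies the rest of the
  local factors.\<close>

lemma truncated_series_nths:
  fixes y :: nat
  defines "q \<equiv> primorial y"
  defines "P \<equiv> real q / real (totient q)"
  assumes "\<forall>d\<in>set D. d \<ge> 0" "X \<subseteq> {..<length D}"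
  shows "truncated_series y (nths D X) = (\<Sum>n<q. \<Prod>i\<in>X. P * (if coprime (n + nat (D ! i)) q then 1 else 0)) / real q"
proof -
  let ?Q = "{p. prime p \<and> p \<le> y}"
  let ?r = "\<lambda>p. card ((\<lambda>i. nat (D ! i) mod p) ` X)"
  have X: "finite X" using assms(4) by (rule finite_subset) simp
  have q: "q = \<Prod>?Q" by (simp add: q_def primorial_def)
  have q0: "q > 0" unfolding q_def by (rule primorial_pos)
  have P: "P = (\<Prod>p\<in>?Q. 1 / (1 - 1 / real p))"
    unfolding P_def q_def using totient_ratio_prod[OF primorial_pos[of y]] by (simp add: prime_factors_primorial)
  have len: "length (nths D X) = card X"
  proof -
    have "{i. i < length D \<and> i \<in> X} = X" using assms(4) by auto
    then show ?thesis by (simp add: length_nths)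
  qed
  have "(\<Sum>n<q. \<Prod>i\<in>X. P * (if coprime (n + nat (D ! i)) q then 1 else 0)) = (\<Sum>n<q. P ^ card X * (if \<forall>i\<in>X. coprime (n + nat (D ! i)) q then 1 else 0))"
  proof (rule sum.cong[OF refl])
    fix n
    show "(\<Prod>i\<in>X. P * (if coprime (n + nat (D ! i)) q then 1 else 0)) = P ^ card X * (if \<forall>i\<in>X. coprime (n + nat (D ! i)) q then 1 else 0)"
      using X by (auto simp: prod.distrib prod_zero_iff)
  qed
  also have "\<dots> = P ^ card X * (\<Prod>p\<in>?Q. real p - real (?r p))"
  proof -
    have "(\<Sum>n<q. if \<forall>i\<in>X. coprime (n + nat (D ! i)) q then 1 else 0 :: real) = (\<Prod>p\<in>?Q. real p - real (?r p))"
      unfolding q by (rule sum_coprime_indicator) (use X in auto)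
    then show ?thesis unfolding sum_distrib_left[symmetric] by (rule arg_cong)
  qed
  finally have "(\<Sum>n<q. \<Prod>i\<in>X. P * (if coprime (n + nat (D ! i)) q then 1 else 0)) / real q
      = P ^ card X * ((\<Prod>p\<in>?Q. real p - real (?r p)) / real q)" by simp
  also have "(\<Prod>p\<in>?Q. real p - real (?r p)) / real q = (\<Prod>p\<in>?Q. 1 - real (?r p) / real p)"
    unfolding q of_nat_prod prod_dividef[symmetric] by (intro prod.cong refl) (auto simp: diff_divide_distrib prime_gt_0_nat)
  also have "P ^ card X = (\<Prod>p\<in>?Q. (1 - 1 / real p) powi (- int (card X)))"
    unfolding P prod_power_distrib by (intro prod.cong refl) (simp add: power_int_minus power_one_over inverse_eq_divide)
  finally show ?thesis
    unfolding truncated_series_def local_factor_def len residue_count_nths[OF assms(3,4)] prod.distrib by (rule sym)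
qed

text \<open>The entries are distinct modulo \<open>p > y\<close>, so with \<open>x = 1 / p\<close>
  the factor is \<open>(1 - k * x) / (1 - x) ^ k\<close>. Bernoulli's inequality for
  \<open>(1 - x) ^ k\<close> shows that it is at most 1; together with
  \<open>1 / (1 - x) ^ k \<ge> (1 + x) ^ k \<ge> 1 + k * x\<close> it gives the lower bound
  \<open>1 - k\<^sup>2 * x\<^sup>2\<close>.\<close>

lemma local_factor_large_prime:
  assumes D: "length D = k" "distinct D" "\<And>d. d \<in> set D \<Longrightarrow> 1 \<le> d \<and> d \<le> int y" and k: "k \<le> y" and y: "y > 0" and p: "p > y"
  shows "0 \<le> 1 - local_factor D p" "1 - local_factor D p \<le> real k ^ 2 / real p ^ 2" "1 - local_factor D p \<le> 1"
proof -
  have "inj_on (\<lambda>d. d mod int p) (set D)"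
  proof (rule inj_onI)
    fix a b assume ab: "a \<in> set D" "b \<in> set D" "a mod int p = b mod int p"
    have "a mod int p = a" "b mod int p = b" using D(3)[OF ab(1)] D(3)[OF ab(2)] p by (auto intro!: mod_pos_pos_trivial)
    then show "a = b" using ab(3) by metis
  qed
  then have "residue_count p D = k" using D by (simp add: residue_count_def card_image distinct_card)
  then have t: "local_factor D p = 1 / (1 - 1 / real p) ^ k * (1 - real k / real p)"
    using D by (simp add: local_factor_def power_int_minus inverse_eq_divide)
  define x where "x = 1 / real p"
  have x: "0 \<le> x" "x < 1" using p y by (auto simp: x_def)
  have kx: "real k * x \<le> 1" using k p by (simp add: x_def)
  have lf: "local_factor D p = 1 / (1 - x) ^ k * (1 - real k * x)" unfolding t x_def by simp
  have pos: "(1 - x) ^ k > 0" using x by simp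
  have lo: "1 - real k * x \<le> (1 - x) ^ k" using Bernoulli_inequality[of "- x" k] x by simp
  show "1 - local_factor D p \<le> 1" unfolding lf using kx pos by simp
  show "0 \<le> 1 - local_factor D p" unfolding lf using lo pos by simp
  have "(1 + x) ^ k * (1 - x) ^ k \<le> 1"
  proof -
    have "((1 + x) * (1 - x)) ^ k \<le> 1" using x by (intro power_le_one) (auto simp: algebra_simps mult_le_one)
    then show ?thesis by (simp add: power_mult_distrib)
  qed
  then have "(1 + x) ^ k \<le> 1 / (1 - x) ^ k" using pos by (simp add: pos_le_divide_eq)
  moreover have "1 + real k * x \<le> (1 + x) ^ k" using Bernoulli_inequality[of x k] x by simp
  ultimately have "1 + real k * x \<le> 1 / (1 - x) ^ k" by linarith
  then have "(1 + real k * x) * (1 - real k * x) \<le> local_factor D p" unfolding lf using kx by (intro mult_right_mono) auto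
  then show "1 - local_factor D p \<le> real k ^ 2 / real p ^ 2" by (simp add: x_def power2_eq_square algebra_simps)
qed

lemma sum_inverse_squares_le:
  assumes "y > 0" "y \<le> N"
  shows "(\<Sum>n\<in>{y<..N}. 1 / real n ^ 2) \<le> 1 / real y - 1 / real N"
  using assms(2)
proof (induction N rule: dec_induct)
  case (step N)
  have "{y<..Suc N} = insert (Suc N) {y<..N}" using step by auto
  then have "(\<Sum>n\<in>{y<..Suc N}. 1 / real n ^ 2) = 1 / real (Suc N) ^ 2 + (\<Sum>n\<in>{y<..N}. 1 / real n ^ 2)" by simp
  also have "\<dots> \<le> 1 / real (Suc N) ^ 2 + (1 / real y - 1 / real N)" using step by simp
  also have "1 / real (Suc N) ^ 2 \<le> 1 / real N - 1 / real (Suc N)"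
  proof -
    have "1 / real (Suc N) ^ 2 \<le> 1 / (real N * real (Suc N))"
      using step assms(1) by (intro divide_left_mono) (auto simp: power2_eq_square intro!: mult_right_mono)
    also have "\<dots> = 1 / real N - 1 / real (Suc N)" using step assms(1) by (simp add: field_simps)
    finally show ?thesis .
  qed
  finally show ?case by simp
qed simp

text \<open>The factors beyond \<open>y\<close> lie between 0 and 1 and differ from 1 by at most
  \<open>k\<^sup>2 / p\<^sup>2\<close>, so by the Weierstrass product inequality every partial tail
  product lies between \<open>1 - k\<^sup>2 / y\<close> and 1.\<close>

lemma singular_series_truncation:
  assumes D: "length D = k" "distinct D" "\<And>d. d \<in> set D \<Longrightarrow> 1 \<le> d \<and> d \<le> int y" and k: "k \<le> y" and y: "y > 0"
    and T: "truncated_series y D \<ge> 0"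
  shows "\<bar>singular_series D - truncated_series y D\<bar> \<le> truncated_series y D * (real k ^ 2 / real y)"
proof -
  define f where "f = (\<lambda>p. if prime p then local_factor D p else 1)"
  have ss: "singular_series D = prodinf f" unfolding singular_series_def f_def local_factor_def by (rule refl)
  have f: "0 \<le> 1 - f p" "1 - f p \<le> real k ^ 2 / real p ^ 2" "1 - f p \<le> 1" if "p > y" for p
    using local_factor_large_prime[OF D k y that] by (auto simp: f_def)
  have "summable (\<lambda>p. norm (f p - 1))"
  proof (rule summable_comparison_test_ev)
    show "summable (\<lambda>p. real k ^ 2 * inverse (real p ^ 2))" by (intro summable_mult inverse_power_summable) auto
    show "\<forall>\<^sub>F p in sequentially. norm (norm (f p - 1)) \<le> real k ^ 2 * inverse (real p ^ 2)"
      using eventually_gt_at_top[of y]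
    proof eventually_elim
      case (elim p)
      from f(1,2)[OF elim] show ?case by (simp add: divide_inverse)
    qed
  qed
  then have "convergent_prod f" by (intro abs_convergent_prod_imp_convergent_prod summable_imp_abs_convergent_prod)
  then have lim: "(\<lambda>N. \<Prod>p\<le>N. f p) \<longlonglongrightarrow> singular_series D" unfolding ss by (rule convergent_prod_LIMSEQ)
  have bounds: "truncated_series y D * (1 - real k ^ 2 / real y) \<le> (\<Prod>p\<le>N. f p) \<and> (\<Prod>p\<le>N. f p) \<le> truncated_series y D" if N: "N \<ge> y" for N
  proof -
    have "{..N} = {..y} \<union> {y<..N}" using N by auto
    then have "(\<Prod>p\<le>N. f p) = (\<Prod>p\<le>y. f p) * (\<Prod>p\<in>{y<..N}. f p)" by (simp only:) (rule prod.union_disjoint; auto)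
    also have "(\<Prod>p\<le>y. f p) = truncated_series y D"
    proof -
      have "{p. prime p \<and> p \<le> y} = {p \<in> {..y}. prime p}" by auto
      then show ?thesis unfolding truncated_series_def f_def by (simp only: prod.inter_filter finite_atMost)
    qed
    finally have e: "(\<Prod>p\<le>N. f p) = truncated_series y D * (\<Prod>p\<in>{y<..N}. 1 - (1 - f p))" by simp
    have "(\<Prod>p\<in>{y<..N}. 1 - (1 - f p)) \<le> 1" using f by (intro prod_le_1) auto
    moreover have "1 - real k ^ 2 / real y \<le> (\<Prod>p\<in>{y<..N}. 1 - (1 - f p))"
    proof -
      have "(\<Sum>p\<in>{y<..N}. 1 - f p) \<le> (\<Sum>p\<in>{y<..N}. real k ^ 2 * (1 / real p ^ 2))"
        using f(2) by (intro sum_mono) simp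
      also have "\<dots> = real k ^ 2 * (\<Sum>p\<in>{y<..N}. 1 / real p ^ 2)" by (simp add: sum_distrib_left)
      also have "\<dots> \<le> real k ^ 2 * (1 / real y)"
        using sum_inverse_squares_le[OF y N] by (intro mult_left_mono) (auto intro: order_trans)
      finally have "1 - real k ^ 2 / real y \<le> 1 - (\<Sum>p\<in>{y<..N}. 1 - f p)" by simp
      also have "\<dots> \<le> (\<Prod>p\<in>{y<..N}. 1 - (1 - f p))" using f by (intro Weierstrass_prod_ineq) auto
      finally show ?thesis .
    qed
    ultimately show ?thesis unfolding e using T mult_left_mono[of _ 1 "truncated_series y D"] by (auto intro!: mult_left_mono)
  qed
  have "singular_series D \<le> truncated_series y D"
    using bounds by (intro tendsto_upperbound[OF lim]) (auto simp: eventually_at_top_linorder)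
  moreover have "truncated_series y D * (1 - real k ^ 2 / real y) \<le> singular_series D"
    using bounds by (intro tendsto_lowerbound[OF lim]) (auto simp: eventually_at_top_linorder)
  moreover have "truncated_series y D * (1 - real k ^ 2 / real y) = truncated_series y D - truncated_series y D * (real k ^ 2 / real y)"
    by (simp add: right_diff_distrib)
  moreover have "0 \<le> truncated_series y D * (real k ^ 2 / real y)" using T by simp
  ultimately show ?thesis by linarith
qed

lemma truncated_series_nths_bounds:
  fixes y :: nat
  assumes "\<forall>d\<in>set D. d \<ge> 0" "X \<subseteq> {..<length D}"
    and P: "real (primorial y) / real (totient (primorial y)) \<le> L" "1 \<le> L"
  shows "0 \<le> truncated_series y (nths D X)" "truncated_series y (nths D X) \<le> L ^ length D"
proof -
  let ?q = "primorial y"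
  let ?P = "real ?q / real (totient ?q)"
  let ?g = "\<lambda>n. \<Prod>i\<in>X. ?P * (if coprime (n + nat (D ! i)) ?q then 1 else 0)"
  have q0: "?q > 0" by (rule primorial_pos)
  have "?g n \<le> L ^ length D" for n
  proof -
    have "?g n \<le> (\<Prod>i\<in>X. L)" using P by (intro prod_mono) auto
    also have "\<dots> = L ^ card X" by simp
    also have "\<dots> \<le> L ^ length D" using P(2) card_mono[OF _ assms(2)] by (intro power_increasing) auto
    finally show ?thesis .
  qed
  then have "(\<Sum>n<?q. ?g n) \<le> real ?q * L ^ length D" using sum_bounded_above[of "{..<?q}" ?g] by simp
  then have "(\<Sum>n<?q. ?g n) / real ?q \<le> L ^ length D"
    using q0 by (simp only: pos_divide_le_eq of_nat_0_less_iff mult.commute)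
  then show "truncated_series y (nths D X) \<le> L ^ length D"
    unfolding truncated_series_nths[OF assms(1,2)] .
  show "0 \<le> truncated_series y (nths D X)"
    unfolding truncated_series_nths[OF assms(1,2)] by (auto intro!: divide_nonneg_nonneg sum_nonneg prod_nonneg)
qed

text \<open>Expanding the product of the \<open>?g n i - 1\<close> over subsets of the indices gives
  the alternating sum that defines \<open>refined_singular_series\<close>, with each singular series
  truncated at \<open>y\<close>. The truncation error is counted once for each of the
  \<open>2 ^ k\<close> subsets.\<close>

lemma refined_singular_series_approx:
  assumes D: "length D = k" "distinct D" "\<And>d. d \<in> set D \<Longrightarrow> 1 \<le> d \<and> d \<le> int y" and k: "k \<le> y" and y: "y > 0"
    and P: "real (primorial y) / real (totient (primorial y)) \<le> L" "1 \<le> L"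
  shows "\<bar>refined_singular_series D - (\<Sum>n<primorial y. \<Prod>d\<in>set D. centred (primorial y) (n + nat d)) / real (primorial y)\<bar>
    \<le> 2 ^ k * (L ^ k * (real k ^ 2 / real y))"
proof -
  let ?q = "primorial y"
  let ?g = "\<lambda>n i. real ?q / real (totient ?q) * (if coprime (n + nat (D ! i)) ?q then 1 else 0)"
  have D0: "\<forall>d\<in>set D. d \<ge> 0" using D(3) by force
  have img: "set D = (\<lambda>i. D ! i) ` {..<k}" using D(1) by (auto simp: set_conv_nth)
  have injD: "inj_on (\<lambda>i. D ! i) {..<k}" using D(1,2) by (auto simp: inj_on_def nth_eq_iff_index_eq)
  have "(\<Sum>n<?q. \<Prod>d\<in>set D. centred ?q (n + nat d)) = (\<Sum>n<?q. \<Prod>i<k. ?g n i + (- 1))"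
    unfolding img prod.reindex[OF injD] by (simp add: centred_def)
  also have "\<dots> = (\<Sum>n<?q. \<Sum>X\<in>Pow {..<k}. (\<Prod>i\<in>X. ?g n i) * (- 1) ^ (k - card X))"
  proof (rule sum.cong[OF refl])
    fix n
    have "(\<Prod>i<k. ?g n i + (- 1)) = (\<Sum>X\<in>Pow {..<k}. (\<Prod>i\<in>X. ?g n i) * (\<Prod>i\<in>{..<k} - X. - 1))"
      by (rule prod_add) simp
    also have "\<dots> = (\<Sum>X\<in>Pow {..<k}. (\<Prod>i\<in>X. ?g n i) * (- 1) ^ (k - card X))"
      by (intro sum.cong refl) (auto simp: card_Diff_subset finite_subset)
    finally show "(\<Prod>i<k. ?g n i + (- 1)) = (\<Sum>X\<in>Pow {..<k}. (\<Prod>i\<in>X. ?g n i) * (- 1) ^ (k - card X))" .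
  qed
  also have "\<dots> = (\<Sum>X\<in>Pow {..<k}. (- 1) ^ (k - card X) * (\<Sum>n<?q. \<Prod>i\<in>X. ?g n i))"
    by (subst sum.swap) (simp add: sum_distrib_left mult.commute)
  finally have "(\<Sum>n<?q. \<Prod>d\<in>set D. centred ?q (n + nat d)) / real ?q = (\<Sum>X\<in>Pow {..<k}. (- 1) ^ (k - card X) * ((\<Sum>n<?q. \<Prod>i\<in>X. ?g n i) / real ?q))"
    by (simp only: times_divide_eq_right sum_divide_distrib[symmetric])
  also have "\<dots> = (\<Sum>X\<in>Pow {..<k}. (- 1) ^ (k - card X) * truncated_series y (nths D X))"
    using truncated_series_nths[OF D0, of _ y] D(1) by (intro sum.cong refl) auto
  finally have "refined_singular_series D - (\<Sum>n<?q. \<Prod>d\<in>set D. centred ?q (n + nat d)) / real ?q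
    = (\<Sum>X\<in>Pow {..<k}. (- 1) ^ (k - card X) * (singular_series (nths D X) - truncated_series y (nths D X)))"
    by (simp add: refined_singular_series_def D(1) right_diff_distrib sum_subtractf)
  also have "\<bar>\<dots>\<bar> \<le> (\<Sum>X\<in>Pow {..<k}. L ^ k * (real k ^ 2 / real y))"
  proof (rule order_trans[OF sum_abs], rule sum_mono)
    fix X assume "X \<in> Pow {..<k}"
    then have X: "X \<subseteq> {..<length D}" using D(1) by simp
    define m where "m = length (nths D X)"
    have m: "m \<le> k"
    proof -
      have "m = card (set (nths D X))" using D(2) by (simp add: m_def distinct_card)
      also have "\<dots> \<le> card (set D)" by (intro card_mono) (auto dest: in_set_nthsD)
      finally show ?thesis using D by (simp add: distinct_card)
    qed
    note scaled_divisor_sum = truncated_series_nths_bounds[OF D0 X P]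
    have "\<bar>singular_series (nths D X) - truncated_series y (nths D X)\<bar> \<le> truncated_series y (nths D X) * (real m ^ 2 / real y)"
      using D m k y scaled_divisor_sum(1) by (intro singular_series_truncation) (auto simp: m_def dest: in_set_nthsD)
    also have "\<dots> \<le> L ^ k * (real k ^ 2 / real y)"
      using scaled_divisor_sum D(1) m P(2) by (intro mult_mono divide_right_mono power_mono) auto
    finally show "\<bar>(- 1) ^ (k - card X) * (singular_series (nths D X) - truncated_series y (nths D X))\<bar> \<le> L ^ k * (real k ^ 2 / real y)"
      by (simp add: abs_mult power_abs)
  qed
  also have "\<dots> = 2 ^ k * (L ^ k * (real k ^ 2 / real y))" by (simp add: card_Pow)
  finally show ?thesis .
qed

section \<open>From symmetric functions to \<open>R k h\<close>\<close>

lemma distinct_tuples_conv: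
  assumes "h \<ge> 0"
  shows "distinct_tuples k h = map int ` {D. length D = k \<and> distinct D \<and> set D \<subseteq> {1..nat \<lfloor>h\<rfloor>}}"
proof (intro equalityI subsetI)
  fix D assume "D \<in> distinct_tuples k h"
  then have D: "length D = k" "distinct D" "\<And>d. d \<in> set D \<Longrightarrow> 1 \<le> d \<and> d \<le> \<lfloor>h\<rfloor>" by (auto simp: distinct_tuples_def le_floor_iff)
  define E where "E = map nat D"
  have DE: "D = map int E" unfolding E_def using D(3) by (simp add: map_idI order_trans[of 0 1] o_def)
  moreover have "length E = k" "distinct E" using D(1,2) unfolding DE by (auto simp: distinct_map)
  moreover have "set E \<subseteq> {1..nat \<lfloor>h\<rfloor>}"
  proof
    fix e assume "e \<in> set E"
    then have "int e \<in> set D" unfolding DE by simp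
    from D(3)[OF this] show "e \<in> {1..nat \<lfloor>h\<rfloor>}" by auto
  qed
  ultimately show "D \<in> map int ` {D. length D = k \<and> distinct D \<and> set D \<subseteq> {1..nat \<lfloor>h\<rfloor>}}" by blast
next
  fix D assume "D \<in> map int ` {D. length D = k \<and> distinct D \<and> set D \<subseteq> {1..nat \<lfloor>h\<rfloor>}}"
  then obtain E where E: "D = map int E" "length E = k" "distinct E" "set E \<subseteq> {1..nat \<lfloor>h\<rfloor>}" by blast
  have "real e \<le> h" if "e \<in> set E" for e
  proof -
    have "e \<le> nat \<lfloor>h\<rfloor>" using that E(4) by auto
    then show ?thesis using assms by (simp add: le_nat_floor le_nat_iff le_floor_iff)
  qed
  then show "D \<in> distinct_tuples k h" using E by (auto simp: distinct_tuples_def distinct_map)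
qed

text \<open>Here \<open>L\<close> has to dominate \<open>q / totient q\<close> and the logarithms of
  \<open>y\<close> and \<open>h\<close>, where \<open>y \<le> h ^ (k + 1)\<close>; its choice as a
  power of \<open>ln h\<close> is left to the end.\<close>

lemma R_bound:
  fixes k :: nat
  assumes "k \<ge> 3"
  shows "\<exists>A::nat. \<forall>h L. h \<ge> 3 \<and> L \<ge> 2 \<and> 1 + (real k + 1) * ln h \<le> L \<and> exp 5 * (2 * ((real k + 1) * ln h)) ^ 4 \<le> L \<longrightarrow>
    \<bar>R k h\<bar> \<le> L ^ A * h ^ (k div 2)"
proof -
  obtain A where A: "\<And>q H y L. admissible q H y L \<Longrightarrow>
     \<bar>(\<Sum>n<q. window_sum q H n ^ 0 * esym (\<lambda>d. centred q (n + d)) {1..H} k) / real q\<bar> \<le> L ^ A * real H ^ ((0 + k) div 2)"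
    using esym_moment_bound[of 0 k] by blast
  have "polylog (\<lambda>L. 2 ^ k * (L ^ k * real k ^ 2) + fact k * L ^ A)"
    by (intro polylog_mult polylog_add polylog_power polylog_const polylog_id) auto
  then obtain B where B: "\<And>L::real. L \<ge> 2 \<Longrightarrow> 2 ^ k * (L ^ k * real k ^ 2) + fact k * L ^ A \<le> L ^ B"
    unfolding polylog_def by blast
  show ?thesis
  proof (intro exI[of _ B] allI impI, elim conjE)
    fix h L :: real
    assume h: "3 \<le> h" and L: "2 \<le> L" "1 + (real k + 1) * ln h \<le> L" "exp 5 * (2 * ((real k + 1) * ln h)) ^ 4 \<le> L"
    define H where "H = nat \<lfloor>h\<rfloor>"
    \<comment> \<open>There are at most \<open>H ^ k \<le> y\<close> tuples, each with a truncation
      error of order \<open>1 / y\<close> up to logarithms, so the total error is polylogarithmic,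
      while \<open>ln y\<close> stays of order \<open>ln h\<close>.\<close>
    define y where "y = H ^ (k + 1)"
    define q where "q = primorial y"
    have H3: "3 \<le> H" using h by (simp add: H_def le_nat_floor)
    have Hh: "real H \<le> h" using h by (simp add: H_def)
    have Hy: "H \<le> y" using H3 by (simp add: y_def)
    have ky: "k \<le> y"
    proof -
      have "k < 2 ^ k" by (rule less_exp)
      also have "(2::nat) ^ k \<le> H ^ k" using H3 by (intro power_mono) auto
      also have "\<dots> \<le> y" unfolding y_def using H3 by (intro power_increasing) auto
      finally show ?thesis by simp
    qed
    have q0: "q > 0" unfolding q_def by (rule primorial_pos)
    have lnH: "0 \<le> ln (real H)" "ln (real H) \<le> ln h" using H3 Hh by (auto simp: ln_le_cancel_iff)
    have lny: "ln (real y) = (real k + 1) * ln (real H)" using H3 by (simp add: y_def ln_realpow flip: power_Suc)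
    have lnyh: "ln (real y) \<le> (real k + 1) * ln h" unfolding lny using lnH by (intro mult_left_mono) auto
    have lny0: "0 \<le> ln (real y)" unfolding lny using lnH by simp
    have P: "real q / real (totient q) \<le> L"
    proof -
      have "real q / real (totient q) \<le> exp 5 * (2 * ln (real y)) ^ 4"
        unfolding q_def using Hy H3 by (intro primorial_ratio_le) auto
      also have "\<dots> \<le> exp 5 * (2 * ((real k + 1) * ln h)) ^ 4"
        using lnyh lny0 by (intro mult_left_mono power_mono) auto
      finally show ?thesis using L by linarith
    qed
    have adm: "admissible q H (real y) L"
      unfolding admissible_def
    proof (intro conjI)
      show "squarefree q" unfolding q_def by (rule squarefree_primorial)
      show "\<forall>p\<in>prime_factors q. real p \<le> real y" unfolding q_def prime_factors_primorial by simp
      show "3 \<le> real y" using H3 Hy by simp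
      show "ln (real y) \<le> L" using lnyh L by linarith
      have "2 * ln (real H) \<le> (real k + 1) * ln h" using lnH assms by (intro mult_mono) auto
      then show "1 + 2 * ln (real H) \<le> L" using L by linarith
    qed (use q0 H3 L P in auto)
    let ?T = "{D. length D = k \<and> distinct D \<and> set D \<subseteq> {1..H}}"
    let ?M = "\<lambda>A. (\<Sum>n<q. \<Prod>d\<in>A. centred q (n + d)) / real q"
    have Rk: "R k h = (\<Sum>D\<in>?T. refined_singular_series (map int D))"
      unfolding R_def using h distinct_tuples_conv[of h k] by (simp add: H_def sum.reindex inj_on_def o_def)
    have "\<bar>R k h - (\<Sum>D\<in>?T. ?M (set D))\<bar> \<le> (\<Sum>D\<in>?T. 2 ^ k * (L ^ k * (real k ^ 2 / real y)))"
      unfolding Rk sum_subtractf[symmetric]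
    proof (rule order_trans[OF sum_abs], rule sum_mono)
      fix D assume D: "D \<in> ?T"
      have "\<bar>refined_singular_series (map int D) - (\<Sum>n<primorial y. \<Prod>d\<in>set (map int D). centred (primorial y) (n + nat d)) / real (primorial y)\<bar>
        \<le> 2 ^ k * (L ^ k * (real k ^ 2 / real y))"
      proof (rule refined_singular_series_approx)
        show "1 \<le> d \<and> d \<le> int y" if "d \<in> set (map int D)" for d using that D Hy by auto
        show "0 < y" using H3 Hy by simp
      qed (use D ky P L in \<open>auto simp: q_def distinct_map\<close>)
      moreover have "(\<Prod>d\<in>set (map int D). centred q (n + nat d)) = (\<Prod>d\<in>set D. centred q (n + d))" for n
        by (simp add: prod.reindex)
      ultimately show "\<bar>refined_singular_series (map int D) - ?M (set D)\<bar> \<le> 2 ^ k * (L ^ k * (real k ^ 2 / real y))"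
        by (simp add: q_def)
    qed
    also have "\<dots> = real (card ?T) * (2 ^ k * (L ^ k * (real k ^ 2 / real y)))" by simp
    also have "\<dots> \<le> real y * (2 ^ k * (L ^ k * (real k ^ 2 / real y)))"
    proof (rule mult_right_mono)
      have "card ?T \<le> card {D. set D \<subseteq> {1..H} \<and> length D = k}" by (intro card_mono finite_lists_length_eq) auto
      also have "\<dots> = H ^ k" by (subst card_lists_length_eq) auto
      also have "\<dots> \<le> y" unfolding y_def using H3 by (intro power_increasing) auto
      finally show "real (card ?T) \<le> real y" by (rule of_nat_mono)
    qed (use L in auto)
    also have "\<dots> = 2 ^ k * (L ^ k * real k ^ 2)" using Hy H3 by simp
    finally have a: "\<bar>R k h - (\<Sum>D\<in>?T. ?M (set D))\<bar> \<le> 2 ^ k * (L ^ k * real k ^ 2)" .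
    have "(\<Sum>D\<in>?T. ?M (set D)) = fact k * (\<Sum>A\<in>{A. A \<subseteq> {1..H} \<and> card A = k}. ?M A)"
      by (rule sum_distinct_lists) simp
    also have "(\<Sum>A\<in>{A. A \<subseteq> {1..H} \<and> card A = k}. ?M A) = (\<Sum>n<q. window_sum q H n ^ 0 * esym (\<lambda>d. centred q (n + d)) {1..H} k) / real q"
      unfolding sum_divide_distrib[symmetric] esym_def by (subst sum.swap) simp
    finally have "\<bar>\<Sum>D\<in>?T. ?M (set D)\<bar> \<le> fact k * (L ^ A * real H ^ (k div 2))"
      using mult_left_mono[OF A[OF adm], of "fact k"] by (simp add: abs_mult)
    also have "\<dots> \<le> fact k * (L ^ A * h ^ (k div 2))" using Hh L by (intro mult_left_mono power_mono) auto
    finally have b: "\<bar>\<Sum>D\<in>?T. ?M (set D)\<bar> \<le> fact k * (L ^ A * h ^ (k div 2))" .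
    have "1 \<le> h ^ (k div 2)" using h by (intro one_le_power) auto
    then have "2 ^ k * (L ^ k * real k ^ 2) * 1 \<le> 2 ^ k * (L ^ k * real k ^ 2) * h ^ (k div 2)" using L by (intro mult_left_mono) auto
    then have "\<bar>R k h\<bar> \<le> 2 ^ k * (L ^ k * real k ^ 2) * h ^ (k div 2) + fact k * (L ^ A * h ^ (k div 2))" using a b by linarith
    also have "\<dots> = (2 ^ k * (L ^ k * real k ^ 2) + fact k * L ^ A) * h ^ (k div 2)" by (simp only: distrib_right mult.assoc)
    also have "\<dots> \<le> L ^ B * h ^ (k div 2)" using B[OF L(1)] h by (intro mult_right_mono) auto
    finally show "\<bar>R k h\<bar> \<le> L ^ B * h ^ (k div 2)" .
  qed
qed

text \<open>The constant can be 1 for all \<open>k\<close>: for \<open>h < 3\<close> there are no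
  \<open>k \<ge> 3\<close> distinct integers in the range and \<open>R k h = 0\<close>, while
  \<open>ln h > 1\<close> for \<open>h \<ge> 3\<close>, so that constants depending on
  \<open>k\<close> go into the exponent of \<open>ln h\<close>.\<close>

theorem theorem1p2:
  "\<exists>C::real. \<forall>k::nat. odd k \<and> 3 \<le> k \<longrightarrow>
     (\<exists>A::real. \<forall>h::real. 1 < h \<longrightarrow>
        \<bar>R k h\<bar> \<le> C * (ln h) powr A * h powr ((real k - 1) / 2))"
proof (rule exI[of _ 1], intro allI impI, elim conjE)
  fix k :: nat assume k: "odd k" "3 \<le> k"
  obtain B where B: "\<And>h L. h \<ge> 3 \<Longrightarrow> L \<ge> 2 \<Longrightarrow> 1 + (real k + 1) * ln h \<le> L \<Longrightarrow> exp 5 * (2 * ((real k + 1) * ln h)) ^ 4 \<le> L \<Longrightarrow>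
    \<bar>R k h\<bar> \<le> L ^ B * h ^ (k div 2)"
    using R_bound[OF k(2)] by blast
  define c where "c = exp 5 * (2 * (real k + 1)) ^ 4"
  have k1: "1 \<le> real k + 1" by simp
  have c1: "1 \<le> c" unfolding c_def using one_le_exp_iff[of 5] by (intro mult_ge1_I one_le_power) auto
  have ln3: "1 < ln (3::real)" using e_less_272 ln_less_cancel_iff[of "exp 1" 3] by simp
  \<comment> \<open>As \<open>ln 3 > 1\<close>, the constant \<open>c\<close> is below a power of
    \<open>ln 3\<close>, hence below the same power of \<open>ln h\<close>.\<close>
  obtain E where E: "c < ln (3::real) ^ E" using real_arch_pow[OF ln3, of c] by blast
  have kd: "(real k - 1) / 2 = real (k div 2)" using k(1) by (auto elim!: oddE)
  show "\<exists>A::real. \<forall>h::real. 1 < h \<longrightarrow> \<bar>R k h\<bar> \<le> 1 * (ln h) powr A * h powr ((real k - 1) / 2)"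
  proof (intro exI[of _ "real ((E + 4) * B)"] allI impI)
    fix h :: real assume h1: "1 < h"
    show "\<bar>R k h\<bar> \<le> 1 * (ln h) powr real ((E + 4) * B) * h powr ((real k - 1) / 2)"
    proof (cases "h < 3")
      case True
      have "distinct_tuples k h = {}"
      proof (rule ccontr)
        assume "distinct_tuples k h \<noteq> {}"
        then obtain D where D: "length D = k" "distinct D" "\<forall>d\<in>set D. 1 \<le> d \<and> real_of_int d \<le> h" by (auto simp: distinct_tuples_def)
        have "set D \<subseteq> {1, 2}"
        proof
          fix d assume "d \<in> set D"
          then have "1 \<le> d" "real_of_int d < 3" using D(3) True by force+
          then show "d \<in> {1, 2}" by auto
        qed
        then have "card (set D) \<le> card {1, 2 :: int}" by (intro card_mono) auto
        then show False using D k by (simp add: distinct_card)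
      qed
      then show ?thesis by (simp add: R_def)
    next
      case False
      then have h: "3 \<le> h" by simp
      define l where "l = ln h"
      have l3: "ln 3 \<le> l" unfolding l_def using h by (subst ln_le_cancel_iff) auto
      then have l: "ln 3 \<le> l" "1 < l" using ln3 by linarith+
      have "ln (3::real) ^ E \<le> l ^ E" using l ln3 by (intro power_mono) auto
      then have cE: "c \<le> l ^ E" using E by linarith
      \<comment> \<open>Large enough for both lower bounds on \<open>L\<close> in
        \<open>R_bound\<close>: it dominates \<open>c * l ^ 4\<close>, which in turn dominates
        \<open>1 + (k + 1) * l\<close>.\<close>
      define L where "L = l ^ (E + 4)"
      have cL: "c * l ^ 4 \<le> L" unfolding L_def power_add using cE l by (intro mult_right_mono) auto
      have e: "exp 5 * (2 * ((real k + 1) * ln h)) ^ 4 = c * l ^ 4" by (simp add: c_def l_def power_mult_distrib mult_ac)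
      have big: "1 + (real k + 1) * l \<le> c * l ^ 4"
      proof -
        have "1 + (real k + 1) * l \<le> l + (real k + 1) * l" using l by simp
        also have "\<dots> \<le> (2 * (real k + 1)) * l" using l by (simp add: algebra_simps)
        also have "\<dots> \<le> c * l ^ 4"
        proof (intro mult_mono)
          have "2 * (real k + 1) \<le> (2 * (real k + 1)) ^ 4" by (intro self_le_power) auto
          also have "\<dots> \<le> c" unfolding c_def using mult_right_mono[of 1 "exp 5" "(2 * (real k + 1)) ^ 4"] by simp
          finally show "2 * (real k + 1) \<le> c" .
          show "l \<le> l ^ 4" using l by (intro self_le_power) auto
        qed (use l c1 in auto)
        finally show ?thesis .
      qed
      have "1 * 1 \<le> (real k + 1) * l" using l by (intro mult_mono) auto
      then have "\<bar>R k h\<bar> \<le> L ^ B * h ^ (k div 2)" using cL big e h by (intro B) (auto simp: l_def)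
      also have "L ^ B = l powr real ((E + 4) * B)" using l unfolding L_def by (subst powr_realpow) (auto simp: power_mult)
      also have "h ^ (k div 2) = h powr ((real k - 1) / 2)" using h unfolding kd by (subst powr_realpow) auto
      finally show ?thesis by (simp add: l_def)
    qed
  qed
qed

end
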